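(* Let $c\in(0,\infty)$, $a,b>-1/2$ and $\sigma>0$. For each $N$, let $0\le\lambda_1(t)\le\cdots\le\lambda_N(t)\le1$ be the beta Jacobi process with parameters $a,b$ and $\beta=2c/N$ and given deterministic initial condition. Let $$x_i(t)=\gamma_N\lambda_i\left(\tfrac{t}{\tau_N}\right),\quad i=1,\dots,N,$$ where $\gamma_N,\tau_N>0$ are non-random. Let $\mu_t^{(N)}=\frac1N\sum_{i=1}^N\delta_{x_i(t)}$ and $S_n^{(N)}(t)=\frac1N\sum_{i=1}^Nx_i(t)^n$. Assume that as $N\to\infty$ $$\tau_N\to\infty,\quad\frac{\gamma_N}{\tau_N}\to\sigma.$$ (1) Assume that for each $n$, $S_n^{(N)}(0)\to a_n$ as $N\to\infty$ for some real $a_n$. Then for every $n$ and every $T>0$, $S_n^{(N)}(t)\to m_n(t)$ as $N\to\infty$ in probability as random elements in $C([0,T])$, where $m_0(t)=1$ and, for $n\ge1$, with $\alpha=a+1$, $$m_n(t)=a_n+\sigma n(n+\alpha-1)\int_0^tm_{n-1}(u)\,du+\sigma cn\sum_{j=0}^{n-1}\int_0^tm_j(u)m_{n-1-j}(u)\,du.$$ (2) If, in addition, there is a constant $\Lambda>0$ with $a_n\le(\Lambda n)^{2n}$ for all $n\ge0$ (with $0^0=1$), then for any $t\ge0$, $\{m_n(t)\}_{n\ge0}$ are the moments of a unique probability measure $\mu_t$ on $[0,\infty)$. Moreover, the probability measure-valued process $\mu_t$ is continuous and, for every $T>0$, the empirical measure process $(\mu_t^{(N)})_{0\le t\le T}$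 converges to $(\mu_t)_{0\le t\le T}$ in probability under the topology of uniform convergence.
   Context: Beta Jacobi process with parameters $a,b>-1/2$, $\beta>0$: the continuous ordered process $0\le\lambda_1(t)\le\cdots\le\lambda_N(t)\le1$ solving (strong solution, integral form) $$d\lambda_i=\sqrt{2\lambda_i(1-\lambda_i)}\,db_i+\left(a+1-(a+b+2)\lambda_i+\frac\beta2\sum_{j\ne i}\frac{2\lambda_i(1-\lambda_i)}{\lambda_i-\lambda_j}\right)dt,\quad i=1,\dots,N,$$ with $b_1,\dots,b_N$ independent standard Brownian motions. $C([0,T])$ carries the supremum norm; random elements $X^{(N)}$ of $C([0,T])$ converge in probability to a non-random $x$ if $\mathbb P(\|X^{(N)}-x\|_\infty\ge\varepsilon)\to0$ for all $\varepsilon>0$. The space of probability measures carries the weak topology (metrized by some metric $d$); continuity of $\mu_t$ is with respect to it, and convergence in probability under the topology of uniform convergence means $\sup_{0\le t\le T}d(\mu_t^{(N)},\mu_t)\to0$ in probability. The numbers $a_n$ are unrelated to the parameter $a$. *)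

theory Defs
  imports "HOL-Probability.Probability"
begin

section \<open>Brownian motions and their filtration\<close>

text \<open>Processes are indexed by real times; only times \<open>t \<ge> 0\<close> are ever constrained.\<close>

definition generated_sets ::
    "'w measure \<Rightarrow> 'i set \<Rightarrow> ('i \<Rightarrow> real \<Rightarrow> 'w \<Rightarrow> real) \<Rightarrow> real \<Rightarrow> 'w set set" where
  "generated_sets M I W t =
     {W i u -` A \<inter> space M | i u A. i \<in> I \<and> 0 \<le> u \<and> u \<le> t \<and> A \<in> sets borel}"

definition standard_brownian_motion :: "'w measure \<Rightarrow> (real \<Rightarrow> 'w \<Rightarrow> real) \<Rightarrow> bool" where
  "standard_brownian_motion M B \<longleftrightarrow>
     prob_space M \<and>
     (\<forall>t\<ge>0. B t \<in> borel_measurable M) \<and>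
     (\<forall>\<omega>\<in>space M. B 0 \<omega> = 0 \<and> continuous_on {0..} (\<lambda>t. B t \<omega>)) \<and>
     (\<forall>s t. 0 \<le> s \<and> s < t \<longrightarrow>
        distributed M lborel (\<lambda>\<omega>. B t \<omega> - B s \<omega>) (normal_density 0 (sqrt (t - s))) \<and>
        prob_space.indep_set M
          {(\<lambda>\<omega>. B t \<omega> - B s \<omega>) -` A \<inter> space M | A. A \<in> sets borel}
          (sigma_sets (space M) (generated_sets M {()} (\<lambda>_. B) s)))"

text \<open>Independence is that of the whole paths, as random elements of \<open>\<real>\<^bsup>[0,\<infinity>)\<^esup>\<close>.\<close>

definition independent_brownian_motions ::
    "'w measure \<Rightarrow> 'i set \<Rightarrow> ('i \<Rightarrow> real \<Rightarrow> 'w \<Rightarrow> real) \<Rightarrow> bool" where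
  "independent_brownian_motions M I W \<longleftrightarrow>
     (\<forall>i\<in>I. standard_brownian_motion M (W i)) \<and>
     prob_space.indep_vars M (\<lambda>_. \<Pi>\<^sub>M t\<in>{0..}. borel) (\<lambda>i \<omega>. \<lambda>t\<in>{0..}. W i t \<omega>) I"

definition augmented_filtration ::
    "'w measure \<Rightarrow> 'i set \<Rightarrow> ('i \<Rightarrow> real \<Rightarrow> 'w \<Rightarrow> real) \<Rightarrow> real \<Rightarrow> 'w measure" where
  "augmented_filtration M I W t = sigma (space M) (generated_sets M I W t \<union> null_sets M)"

section \<open>The Ito integral\<close>

text \<open>
  A simple integrand is \<open>\<Sum>j<k. e j * 1\<^bsub>(p j, p (j+1)]\<^esub>\<close> with \<open>e j\<close> bounded and measurable
  with respect to the past of \<open>p j\<close>.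
\<close>

definition simple_integrand ::
    "'w measure \<Rightarrow> (real \<Rightarrow> 'w measure) \<Rightarrow> nat \<Rightarrow> (nat \<Rightarrow> real) \<Rightarrow> (nat \<Rightarrow> 'w \<Rightarrow> real) \<Rightarrow> bool" where
  "simple_integrand M F k p e \<longleftrightarrow>
     0 \<le> p 0 \<and>
     (\<forall>j<k. p j < p (Suc j) \<and> e j \<in> borel_measurable (F (p j)) \<and>
            (\<exists>C. \<forall>\<omega>\<in>space M. \<bar>e j \<omega>\<bar> \<le> C))"

definition simple_value ::
    "nat \<Rightarrow> (nat \<Rightarrow> real) \<Rightarrow> (nat \<Rightarrow> 'w \<Rightarrow> real) \<Rightarrow> real \<Rightarrow> 'w \<Rightarrow> real" where
  "simple_value k p e t \<omega> = (\<Sum>j<k. e j \<omega> * indicator {p j<..p (Suc j)} t)"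

definition simple_integral ::
    "nat \<Rightarrow> (nat \<Rightarrow> real) \<Rightarrow> (nat \<Rightarrow> 'w \<Rightarrow> real) \<Rightarrow> (real \<Rightarrow> 'w \<Rightarrow> real) \<Rightarrow> real \<Rightarrow> 'w \<Rightarrow> real" where
  "simple_integral k p e B t \<omega> =
     (\<Sum>j<k. e j \<omega> * (B (min t (p (Suc j))) \<omega> - B (min t (p j)) \<omega>))"

text \<open>
  The process \<open>J\<close> is a continuous version of \<open>t \<mapsto> \<integral>\<^sub>0\<^sup>t H dB\<close>, for progressively measurable \<open>H\<close> with
  \<open>E \<integral>\<^sub>0\<^sup>T H\<^sup>2 dt < \<infinity>\<close> for all \<open>T\<close>: the \<open>L\<^sup>2\<close> limit of the integrals of simple integrands
  approximating \<open>H\<close> in \<open>L\<^sup>2\<close>. (By the Ito isometry the limit does not depend on the approximation.)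
\<close>

definition has_ito_integral ::
    "'w measure \<Rightarrow> (real \<Rightarrow> 'w measure) \<Rightarrow> (real \<Rightarrow> 'w \<Rightarrow> real) \<Rightarrow> (real \<Rightarrow> 'w \<Rightarrow> real) \<Rightarrow>
     (real \<Rightarrow> 'w \<Rightarrow> real) \<Rightarrow> bool" where
  "has_ito_integral M F B H J \<longleftrightarrow>
     (\<forall>T\<ge>0. (\<lambda>(t, \<omega>). H t \<omega>) \<in> borel_measurable (restrict_space borel {0..T} \<Otimes>\<^sub>M F T)) \<and>
     (\<forall>t\<ge>0. J t \<in> borel_measurable (F t)) \<and>
     (\<forall>\<omega>\<in>space M. continuous_on {0..} (\<lambda>t. J t \<omega>)) \<and>
     (\<exists>k p e.
        (\<forall>n. simple_integrand M F (k n) (p n) (e n)) \<and>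
        (\<forall>T\<ge>0.
           (\<lambda>n. \<integral>\<^sup>+\<omega>. (\<integral>\<^sup>+t\<in>{0..T}. ennreal ((simple_value (k n) (p n) (e n) t \<omega> - H t \<omega>)\<^sup>2) \<partial>lborel) \<partial>M)
             \<longlonglongrightarrow> 0 \<and>
           (\<lambda>n. \<integral>\<^sup>+\<omega>. ennreal ((simple_integral (k n) (p n) (e n) B T \<omega> - J T \<omega>)\<^sup>2) \<partial>M)
             \<longlonglongrightarrow> 0))"

section \<open>The beta Jacobi process\<close>

definition jacobi_drift ::
    "nat \<Rightarrow> real \<Rightarrow> real \<Rightarrow> real \<Rightarrow> (nat \<Rightarrow> real) \<Rightarrow> nat \<Rightarrow> real" where
  "jacobi_drift N a b \<beta> x i =
     a + 1 - (a + b + 2) * x i +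
     \<beta> / 2 * (\<Sum>j\<in>{1..N} - {i}. 2 * x i * (1 - x i) / (x i - x j))"

text \<open>
  Strong solution, in integral form, driven by the Brownian motions \<open>W\<close> and started from the
  deterministic point \<open>x0\<close>. Particles may collide (when \<open>\<beta>\<close> is small) or start at the same point.
  For the drift integral to make sense its integrand has to be defined at almost every time; since
  division is total in HOL, this is the explicit requirement that the particles be distinct at
  almost every time.
\<close>

definition beta_jacobi_process ::
    "'w measure \<Rightarrow> nat \<Rightarrow> real \<Rightarrow> real \<Rightarrow> real \<Rightarrow> (nat \<Rightarrow> real) \<Rightarrow>
     (nat \<Rightarrow> real \<Rightarrow> 'w \<Rightarrow> real) \<Rightarrow> (nat \<Rightarrow> real \<Rightarrow> 'w \<Rightarrow> real) \<Rightarrow> bool" where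
  "beta_jacobi_process M N a b \<beta> x0 W lam \<longleftrightarrow>
     prob_space M \<and>
     independent_brownian_motions M {1..N} W \<and>
     (\<forall>i\<in>{1..N}. \<forall>t\<ge>0. lam i t \<in> borel_measurable (augmented_filtration M {1..N} W t)) \<and>
     (\<forall>\<omega>\<in>space M.
        (\<forall>i\<in>{1..N}. lam i 0 \<omega> = x0 i \<and> continuous_on {0..} (\<lambda>t. lam i t \<omega>)) \<and>
        (\<forall>t\<ge>0. (\<forall>i\<in>{1..N}. 0 \<le> lam i t \<omega> \<and> lam i t \<omega> \<le> 1) \<and>
               mono_on {1..N} (\<lambda>i. lam i t \<omega>))) \<and>
     (AE \<omega> in M. AE t in lborel. 0 \<le> t \<longrightarrow> inj_on (\<lambda>i. lam i t \<omega>) {1..N}) \<and>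
     (\<forall>i\<in>{1..N}. \<exists>J.
        has_ito_integral M (augmented_filtration M {1..N} W) (W i)
          (\<lambda>t \<omega>. sqrt (2 * lam i t \<omega> * (1 - lam i t \<omega>))) J \<and>
        (AE \<omega> in M. \<forall>t\<ge>0.
           set_integrable lborel {0..t} (\<lambda>s. jacobi_drift N a b \<beta> (\<lambda>j. lam j s \<omega>) i) \<and>
           lam i t \<omega> = x0 i + J t \<omega> +
             (LINT s:{0..t}|lborel. jacobi_drift N a b \<beta> (\<lambda>j. lam j s \<omega>) i)))"

section \<open>Convergence in probability\<close>

text \<open>
  Probability spaces may vary with the index. Measurability is required explicitly because
  the measure of a non-measurable set is 0 by convention.
\<close>

definition tendsto_in_prob ::
    "(nat \<Rightarrow> 'w measure) \<Rightarrow> (nat \<Rightarrow> 'w \<Rightarrow> real) \<Rightarrow> real \<Rightarrow> bool" where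
  "tendsto_in_prob M X x \<longleftrightarrow>
     (\<forall>\<^sub>F N in sequentially. X N \<in> borel_measurable (M N)) \<and>
     (\<forall>\<epsilon>>0. (\<lambda>N. measure (M N) {\<omega> \<in> space (M N). \<epsilon> \<le> \<bar>X N \<omega> - x\<bar>}) \<longlonglongrightarrow> 0)"

text \<open>
  Convergence in probability of random elements of \<open>C([0,T])\<close>; on this space the Borel
  \<open>\<sigma>\<close>-algebra is generated by the evaluations.
\<close>

definition tendsto_in_prob_C ::
    "(nat \<Rightarrow> 'w measure) \<Rightarrow> real \<Rightarrow> (nat \<Rightarrow> real \<Rightarrow> 'w \<Rightarrow> real) \<Rightarrow> (real \<Rightarrow> real) \<Rightarrow> bool" where
  "tendsto_in_prob_C M T X x \<longleftrightarrow>
     (\<forall>\<^sub>F N in sequentially.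
        (\<forall>t\<in>{0..T}. X N t \<in> borel_measurable (M N)) \<and>
        (\<forall>\<omega>\<in>space (M N). continuous_on {0..T} (\<lambda>t. X N t \<omega>))) \<and>
     continuous_on {0..T} x \<and>
     tendsto_in_prob M (\<lambda>N \<omega>. SUP t\<in>{0..T}. \<bar>X N t \<omega> - x t\<bar>) 0"

section \<open>Probability measures with the weak topology\<close>

definition weak_topology :: "real measure topology" where
  "weak_topology = topology_generated_by
     {{\<mu>. real_distribution \<mu> \<and> (\<integral>x. f x \<partial>\<mu>) \<in> U} | f U.
        continuous_on UNIV f \<and> bounded (range f) \<and> open (U :: real set)}"

lemma topspace_weak_topology: "topspace weak_topology = Collect real_distribution"
proof -
  have "Collect real_distribution \<in>
      {{\<mu>. real_distribution \<mu> \<and> (\<integral>x. f x \<partial>\<mu>) \<in> U} | f U.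
        continuous_on UNIV f \<and> bounded (range f) \<and> open (U :: real set)}"
    by (intro CollectI exI[of _ "\<lambda>_. 0"] exI[of _ UNIV]) auto
  then show ?thesis
    unfolding weak_topology_def topology_generated_by_topspace by blast
qed

definition metrizes_weak_topology :: "(real measure \<Rightarrow> real measure \<Rightarrow> real) \<Rightarrow> bool" where
  "metrizes_weak_topology d \<longleftrightarrow>
     Metric_space (Collect real_distribution) d \<and>
     Metric_space.mtopology (Collect real_distribution) d = weak_topology"

text \<open>
  Convergence in probability of random continuous paths of probability measures, with respect to
  uniform convergence on \<open>[0,T]\<close>.
\<close>

definition tendsto_in_prob_C_weak ::
    "(real measure \<Rightarrow> real measure \<Rightarrow> real) \<Rightarrow> (nat \<Rightarrow> 'w measure) \<Rightarrow> real \<Rightarrow>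
     (nat \<Rightarrow> real \<Rightarrow> 'w \<Rightarrow> real measure) \<Rightarrow> (real \<Rightarrow> real measure) \<Rightarrow> bool" where
  "tendsto_in_prob_C_weak d M T X x \<longleftrightarrow>
     (\<forall>\<^sub>F N in sequentially. \<forall>\<omega>\<in>space (M N).
        continuous_map (top_of_set {0..T}) weak_topology (\<lambda>t. X N t \<omega>)) \<and>
     continuous_map (top_of_set {0..T}) weak_topology x \<and>
     tendsto_in_prob M (\<lambda>N \<omega>. SUP t\<in>{0..T}. d (X N t \<omega>) (x t)) 0"

text \<open>\<open>\<mu>\<close> is a probability measure on \<open>[0,\<infinity>)\<close> whose moment sequence is \<open>m\<close>.\<close>

definition nonneg_distribution_with_moments :: "real measure \<Rightarrow> (nat \<Rightarrow> real) \<Rightarrow> bool" where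
  "nonneg_distribution_with_moments \<mu> m \<longleftrightarrow>
     real_distribution \<mu> \<and> (AE x in \<mu>. 0 \<le> x) \<and>
     (\<forall>n. integrable \<mu> (\<lambda>x. x ^ n) \<and> (\<integral>x. x ^ n \<partial>\<mu>) = m n)"

section \<open>Empirical measures, empirical moments and their limits\<close>

definition empirical_moment :: "nat \<Rightarrow> nat \<Rightarrow> (nat \<Rightarrow> real) \<Rightarrow> real" where
  "empirical_moment n N x = 1 / real N * (\<Sum>i=1..N. x i ^ n)"

definition empirical_measure :: "nat \<Rightarrow> (nat \<Rightarrow> real) \<Rightarrow> real measure" where
  "empirical_measure N x = distr (uniform_count_measure {1..N}) borel x"

lemma emeasure_empirical_measure:
  assumes "A \<in> sets borel" and "N \<ge> 1"
  shows "emeasure (empirical_measure N x) A =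
    ennreal (1 / real N) * (\<Sum>i=1..N. emeasure (return borel (x i)) A)"
proof -
  have "emeasure (empirical_measure N x) A =
      emeasure (uniform_count_measure {1..N}) (x -` A \<inter> {1..N})"
    unfolding empirical_measure_def using assms
    by (subst emeasure_distr) (auto simp: space_uniform_count_measure measurable_def sets_uniform_count_measure)
  also have "\<dots> = ennreal (real (card (x -` A \<inter> {1..N})) / real N)"
    by (subst emeasure_uniform_count_measure) auto
  also have "\<dots> = ennreal (1 / real N) * ennreal (real (card (x -` A \<inter> {1..N})))"
    by (subst ennreal_mult[symmetric]) auto
  also have "ennreal (real (card (x -` A \<inter> {1..N}))) = (\<Sum>i=1..N. indicator A (x i))"
  proof -
    have "(\<Sum>i=1..N. indicator A (x i) :: ennreal) = (\<Sum>i=1..N. indicator (x -` A) i)"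
      by (intro sum.cong) (auto simp: indicator_def)
    also have "\<dots> = of_nat (card ({1..N} \<inter> x -` A))"
      by (simp add: indicator_def of_bool_def sum.If_cases vimage_def)
    finally show ?thesis by (simp add: Int_commute ennreal_of_nat_eq_real_of_nat)
  qed
  finally show ?thesis using assms by simp
qed

text \<open>The limits \<open>m\<^sub>n(t)\<close>, where \<open>an\<close> is the sequence of initial limiting moments.\<close>

function limit_moment :: "real \<Rightarrow> real \<Rightarrow> real \<Rightarrow> (nat \<Rightarrow> real) \<Rightarrow> nat \<Rightarrow> real \<Rightarrow> real" where
  "limit_moment \<sigma> c \<alpha> an n t =
     (if n = 0 then 1
      else an n
        + \<sigma> * real n * (real n + \<alpha> - 1) * integral {0..t} (\<lambda>u. limit_moment \<sigma> c \<alpha> an (n - 1) u)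
        + \<sigma> * c * real n *
            (\<Sum>j\<in>{0..<n}. integral {0..t}
               (\<lambda>u. limit_moment \<sigma> c \<alpha> an j u * limit_moment \<sigma> c \<alpha> an (n - 1 - j) u)))"
  by pat_completeness auto
termination
  by (relation "Wellfounded.measure (\<lambda>(\<sigma>, c, \<alpha>, an, n, t). n)") auto

declare limit_moment.simps [simp del]

end

theory Submission imports Defs begin

text \<open>
 Since the particles live in \<open>[0,1]\<close> and have bounded diffusion coefficients, the Ito formula for their powers
 follows from a third-order Taylor expansion along uniform partitions and the Ito isometry. Symmetrizing the
 singular interaction shows that the drift of a power sum is a polynomial in power sums. After rescaling,
 \<open>S\<^sub>n\<close> therefore satisfies the recursion of \<open>m\<^sub>n\<close> up to a drift of order \<open>1/N + 1/\<tau>\<^sub>N\<close> in mean and a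
 martingale with second moment of order \<open>1/N\<close>, which is uniformly small by a maximal inequality;
 induction on \<open>n\<close> gives (1).

 For (2), the recursion gives \<open>m\<^sub>n(t) \<le> L\<^sup>n (n!)\<^sup>2 \<le> L\<^sup>n (2n)!\<close>. Hence \<open>\<plusminus>\<surd>x\<close> has exponential moments, its characteristic
 function is analytic in a strip, and the moment problem is determinate. By tightness, convergence of moments then
 implies weak convergence, uniformly in \<open>t \<in> [0,T]\<close> by compactness.
\<close>

text \<open>The process is described only weakly: its Ito integrals are \<open>L^2\<close> limits of
  simple ones, and the drift of a single particle is singular at collisions and merely integrable in
  time along almost every path. Limits of expectations along partitions need more, namely square
  integrable total variation of each drift. It comes from the equations themselves: a constant plus
  a positive combination of all drifts dominates each of them, and its time integral is a bounded
  quantity minus martingales.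

  The shape of the limit is a matter of degrees. In the drift of \<open>S_m\<close> the terms of
  degree \<open>m - 1\<close> carry the factor \<open>\<gamma> / \<tau>\<close>, those of degree
  \<open>m\<close> only \<open>1 / \<tau>\<close>, so the boundary at 1 disappears. The choice
  \<open>\<beta> = 2c / N\<close> makes the sum over pairs of order one and its diagonal of order
  \<open>1 / N\<close>. The bracket of the martingale is bounded by the moment of order
  \<open>2m - 1\<close>, so bounds on expected moments suffice.

  The probability spaces vary with \<open>N\<close>, so no almost sure limit is at hand from which
  to build \<open>\<mu>_t\<close>; single outcomes from different spaces are used instead.\<close>

text \<open>The unqualified names denote Henstock-Kurzweil integrals.\<close>

lemmas lint_integrable_sum = Bochner_Integration.integrable_sum
 and lint_sum = Bochner_Integration.integral_sum
 and lint_cong = Bochner_Integration.integral_cong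
 and lint_nonneg = Bochner_Integration.integral_nonneg
 and lint_add = Bochner_Integration.integral_add
 and lint_diff = Bochner_Integration.integral_diff
 and integrable_dominated = Bochner_Integration.integrable_bound
 and lint_integrable_diff = Bochner_Integration.integrable_diff
 and lint_integrable_add = Bochner_Integration.integrable_add

section \<open>Square integrable functions\<close>

text \<open>Measurability is a separate clause because integrability of the square does not
  determine the sign of \<open>f\<close> measurably.\<close>

definition sq_int :: "'a measure \<Rightarrow> ('a \<Rightarrow> real) \<Rightarrow> bool" where
 "sq_int M f \<longleftrightarrow> f \<in> borel_measurable M \<and> integrable M (\<lambda>x. (f x)^2)"

lemma sq_int_measurable [measurable_dest]: "sq_int M f \<Longrightarrow> f \<in> borel_measurable M"
 by (simp add: sq_int_def)

lemma sq_int_integrable_square: "sq_int M f \<Longrightarrow> integrable M (\<lambda>x. (f x)^2)"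
 by (simp add: sq_int_def)

lemma abs_mult_le_squares: "\<bar>x * y\<bar> \<le> x^2 + (y::real)^2"
proof -
 let ?A = "\<bar>x\<bar> - \<bar>y\<bar>"
 have "0 \<le> ?A^2" "0 \<le> x^2" "0 \<le> y^2" by auto
 moreover have "?A^2 = x^2 + y^2 - 2 * \<bar>x * y\<bar>"
  by (simp add: power2_eq_square algebra_simps abs_mult)
 ultimately show ?thesis by linarith
qed

lemma power2_add_le: "(x + y)^2 \<le> 2 * x^2 + 2 * (y::real)^2"
 using zero_le_power2[of "x - y"] unfolding power2_sum power2_diff by linarith

lemma sq_int_mult:
 assumes "sq_int M f" "sq_int M g"
 shows "integrable M (\<lambda>x. f x * g x)"
proof (rule integrable_dominated)
 show "integrable M (\<lambda>x. (f x)^2 + (g x)^2)" using assms by (auto simp: sq_int_def)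
 show "AE x in M. norm (f x * g x) \<le> norm ((f x)^2 + (g x)^2)"
  using abs_mult_le_squares by (auto intro!: AE_I2)
qed (use assms in \<open>auto simp: sq_int_def\<close>)

lemma sq_int_bound:
 assumes "sq_int M g" "f \<in> borel_measurable M" "AE x in M. \<bar>f x\<bar> \<le> \<bar>g x\<bar>"
 shows "sq_int M f"
 unfolding sq_int_def
proof (intro conjI assms(2))
 show "integrable M (\<lambda>x. (f x)^2)"
 proof (rule integrable_dominated)
  show "integrable M (\<lambda>x. (g x)^2)" using assms(1) by (auto simp: sq_int_def)
  show "AE x in M. norm ((f x)^2) \<le> norm ((g x)^2)"
   using assms(3) by (auto simp: power2_le_iff_abs_le abs_le_square_iff)
 qed (use assms(2) in auto)
qed

lemma sq_int_add:
 assumes "sq_int M f" "sq_int M g"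
 shows "sq_int M (\<lambda>x. f x + g x)"
 unfolding sq_int_def
proof
 show "integrable M (\<lambda>x. (f x + g x)^2)"
 proof (rule integrable_dominated)
  show "integrable M (\<lambda>x. 2 * (f x)^2 + 2 * (g x)^2)" using assms by (auto simp: sq_int_def)
  show "AE x in M. norm ((f x + g x)^2) \<le> norm (2 * (f x)^2 + 2 * (g x)^2)"
   using power2_add_le by (auto intro!: AE_I2)
 qed (use assms in \<open>auto simp: sq_int_def\<close>)
qed (use assms in \<open>auto simp: sq_int_def\<close>)

lemma sq_int_cmult: "sq_int M f \<Longrightarrow> sq_int M (\<lambda>x. c * f x)"
 by (auto simp: sq_int_def power_mult_distrib)

lemma sq_int_minus: "sq_int M f \<Longrightarrow> sq_int M (\<lambda>x. - f x)"
 by (auto simp: sq_int_def)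

lemma sq_int_diff:
 assumes "sq_int M f" "sq_int M g"
 shows "sq_int M (\<lambda>x. f x - g x)"
 using sq_int_add[OF assms(1) sq_int_minus[OF assms(2)]] by simp

lemma sq_int_zero [simp]: "sq_int M (\<lambda>x. 0)"
 by (simp add: sq_int_def)

lemma sq_int_sum:
 assumes "\<And>i. i \<in> I \<Longrightarrow> sq_int M (f i)"
 shows "sq_int M (\<lambda>x. \<Sum>i\<in>I. f i x)"
 using assms by (induction I rule: infinite_finite_induct) (auto intro: sq_int_add)

lemma sq_int_abs: "sq_int M f \<Longrightarrow> sq_int M (\<lambda>x. \<bar>f x\<bar>)"
 by (auto simp: sq_int_def)

lemma sq_int_bounded_mult:
 assumes "sq_int M f" "g \<in> borel_measurable M" "\<And>x. x \<in> space M \<Longrightarrow> \<bar>g x\<bar> \<le> C"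
 shows "sq_int M (\<lambda>x. g x * f x)"
proof (rule sq_int_bound)
 show "sq_int M (\<lambda>x. C * f x)" using assms(1) by (rule sq_int_cmult)
 show "AE x in M. \<bar>g x * f x\<bar> \<le> \<bar>C * f x\<bar>"
 proof (rule AE_I2)
  fix x assume "x \<in> space M"
  then have "\<bar>g x\<bar> \<le> \<bar>C\<bar>" using assms(3) by fastforce
  then show "\<bar>g x * f x\<bar> \<le> \<bar>C * f x\<bar>" by (simp add: abs_mult mult_right_mono)
 qed
qed (use assms in auto)

lemma (in finite_measure) sq_int_bounded:
 assumes "g \<in> borel_measurable M" "\<And>x. x \<in> space M \<Longrightarrow> \<bar>g x\<bar> \<le> C"
 shows "sq_int M g"
 using sq_int_bounded_mult[OF _ assms, of "\<lambda>_. 1"] by (simp add: sq_int_def)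

lemma (in finite_measure) sq_int_imp_integrable: "sq_int M f \<Longrightarrow> integrable M f"
 using sq_int_mult[of M f "\<lambda>_. 1"] by (simp add: sq_int_def)

text \<open>Cauchy-Schwarz, transferred from the version for extended nonnegative integrals; square
  integrability makes all three integrals finite.\<close>

lemma integral_abs_mult_le:
 assumes "sq_int M f" "sq_int M g"
 shows "(\<integral>x. \<bar>f x * g x\<bar> \<partial>M) \<le> sqrt (\<integral>x. (f x)^2 \<partial>M) * sqrt (\<integral>x. (g x)^2 \<partial>M)"
proof -
 let ?A = "\<integral>x. \<bar>f x * g x\<bar> \<partial>M"
 let ?B = "\<integral>x. (f x)^2 \<partial>M"
 let ?C = "\<integral>x. (g x)^2 \<partial>M"
 have [measurable]: "f \<in> borel_measurable M" "g \<in> borel_measurable M" using assms by (auto simp: sq_int_def)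
 have i: "integrable M (\<lambda>x. \<bar>f x * g x\<bar>)" using sq_int_mult[OF assms] by auto
 have eq: "(\<integral>\<^sup>+x. ennreal \<bar>f x * g x\<bar> \<partial>M) = ennreal ?A"
  "(\<integral>\<^sup>+x. ennreal ((f x)^2) \<partial>M) = ennreal ?B"
  "(\<integral>\<^sup>+x. ennreal ((g x)^2) \<partial>M) = ennreal ?C"
  using i assms by (auto intro!: nn_integral_eq_integral simp: sq_int_def)
 have "(\<integral>\<^sup>+x. ennreal \<bar>f x\<bar> * ennreal \<bar>g x\<bar> \<partial>M)^2 \<le> (\<integral>\<^sup>+x. (ennreal \<bar>f x\<bar>)^2 \<partial>M) * (\<integral>\<^sup>+x. (ennreal \<bar>g x\<bar>)^2 \<partial>M)"
  by (rule Cauchy_Schwarz_nn_integral) auto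
 then have "?A^2 \<le> ?B * ?C"
  by (simp add: ennreal_power ennreal_mult[symmetric] abs_mult[symmetric] eq)
 then have "sqrt (?A^2) \<le> sqrt (?B * ?C)"
  by (rule real_sqrt_le_mono)
 then show ?thesis by (simp add: real_sqrt_mult)
qed

text \<open>Products of \<open>L^2\<close> convergent sequences converge in \<open>L^1\<close>, also
  against a bounded weight. This carries the martingale, orthogonality and isometry identities from
  simple integrands to Ito integrals, with \<open>Z\<close> a bounded variable known at the earlier
  time.\<close>

lemma sq_int_tendsto_mult:
 fixes X Y :: "nat \<Rightarrow> 'a \<Rightarrow> real"
 assumes X: "\<And>n. sq_int M (X n)" "sq_int M x" "(\<lambda>n. \<integral>w. (X n w - x w)^2 \<partial>M) \<longlonglongrightarrow> 0"
  and Y: "\<And>n. sq_int M (Y n)" "sq_int M y" "(\<lambda>n. \<integral>w. (Y n w - y w)^2 \<partial>M) \<longlonglongrightarrow> 0"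
  and Z: "Z \<in> borel_measurable M" "\<And>w. w \<in> space M \<Longrightarrow> \<bar>Z w\<bar> \<le> C"
 shows "(\<lambda>n. \<integral>w. Z w * (X n w * Y n w) \<partial>M) \<longlonglongrightarrow> (\<integral>w. Z w * (x w * y w) \<partial>M)"
proof -
 let ?A = "\<lambda>a n b. a n * b n + a n * sqrt (\<integral>w. (y w)^2 \<partial>M) + sqrt (\<integral>w. (x w)^2 \<partial>M) * b n"
 let ?B = "\<lambda>X n w Y. \<bar>(X n w - x w) * (Y n w - y w)\<bar> + \<bar>(X n w - x w) * y w\<bar> + \<bar>x w * (Y n w - y w)\<bar>"
 let ?C = "\<integral>w. Z w * (x w * y w) \<partial>M"
 let ?D = "\<lambda>w X n Y. Z w * (X n w * Y n w) - Z w * (x w * y w)"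
 let ?E = "\<lambda>X n Y. \<integral>w. Z w * (X n w * Y n w) \<partial>M"
 define a where "a n = sqrt (\<integral>w. (X n w - x w)^2 \<partial>M)" for n
 define b where "b n = sqrt (\<integral>w. (Y n w - y w)^2 \<partial>M)" for n
 have a0: "a \<longlonglongrightarrow> 0" and b0: "b \<longlonglongrightarrow> 0"
  unfolding a_def b_def using tendsto_real_sqrt[OF X(3)] tendsto_real_sqrt[OF Y(3)] by auto
 have dX: "sq_int M (\<lambda>w. X n w - x w)" and dY: "sq_int M (\<lambda>w. Y n w - y w)" for n
  using X Y by (auto intro: sq_int_diff)
 have I: "integrable M (\<lambda>w. Z w * (f w * g w))" if "sq_int M f" "sq_int M g" for f g
  using sq_int_mult[OF sq_int_bounded_mult[OF that(1) Z] that(2)] by (simp add: mult.assoc)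
 have [measurable]: "Z \<in> borel_measurable M" by fact
 have bd: "norm ((?E X n Y) - ?C) \<le>
   \<bar>C\<bar> * (?A a n b)" for n
 proof -
  have "norm ((?E X n Y) - ?C)
   = norm (\<integral>w. Z w * (X n w * Y n w) - Z w * (x w * y w) \<partial>M)"
   by (subst lint_diff) (use X Y I in auto)
  also have "\<dots> \<le> (\<integral>w. norm (?D w X n Y) \<partial>M)"
   by (rule integral_norm_bound)
  also have "\<dots> \<le> (\<integral>w. \<bar>C\<bar> * (?B X n w Y) \<partial>M)"
  proof (rule integral_mono)
   show "integrable M (\<lambda>w. norm (?D w X n Y))"
    using X Y I by auto
   show "integrable M (\<lambda>w. \<bar>C\<bar> * (?B X n w Y))"
    using sq_int_mult[OF dX dY] sq_int_mult[OF dX Y(2)] sq_int_mult[OF X(2) dY] by auto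
   fix w assume w: "w \<in> space M"
   \<comment> \<open>One product of two small factors and two products with one small factor; each
     is then handled by Cauchy-Schwarz.\<close>
   have "Z w * (X n w * Y n w) - Z w * (x w * y w) =
     Z w * ((X n w - x w) * (Y n w - y w) + (X n w - x w) * y w + x w * (Y n w - y w))"
    by (simp add: algebra_simps)
   then have "norm (?D w X n Y) =
     \<bar>Z w\<bar> * \<bar>(X n w - x w) * (Y n w - y w) + (X n w - x w) * y w + x w * (Y n w - y w)\<bar>"
    by (simp only: real_norm_def abs_mult)
   also have "\<dots> \<le> \<bar>C\<bar> * (?B X n w Y)"
   proof (rule mult_mono)
    show "\<bar>Z w\<bar> \<le> \<bar>C\<bar>" using Z(2)[OF w] by linarith
   qed auto
   finally show "norm (?D w X n Y) \<le> \<dots>" .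
  qed
  also have "\<dots> = \<bar>C\<bar> * ((\<integral>w. \<bar>(X n w - x w) * (Y n w - y w)\<bar> \<partial>M) + (\<integral>w. \<bar>(X n w - x w) * y w\<bar> \<partial>M) + (\<integral>w. \<bar>x w * (Y n w - y w)\<bar> \<partial>M))"
   using sq_int_mult[OF dX dY] sq_int_mult[OF dX Y(2)] sq_int_mult[OF X(2) dY]
   by (subst integral_mult_right_zero) (simp add: lint_add)
  also have "\<dots> \<le> \<bar>C\<bar> * (?A a n b)"
   unfolding a_def b_def
   by (intro mult_left_mono add_mono integral_abs_mult_le dX dY X Y) auto
  finally show ?thesis .
 qed
 have "(\<lambda>n. \<bar>C\<bar> * (?A a n b)) \<longlonglongrightarrow>
   \<bar>C\<bar> * (0 * 0 + 0 * sqrt (\<integral>w. (y w)^2 \<partial>M) + sqrt (\<integral>w. (x w)^2 \<partial>M) * 0)"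
  by (intro tendsto_intros a0 b0)
 then have "(\<lambda>n. (?E X n Y) - ?C) \<longlonglongrightarrow> 0"
  by (intro Lim_null_comparison[OF always_eventually[OF allI[OF bd]]]) simp
 then show ?thesis by (simp add: LIM_zero_iff)
qed

section \<open>Increments of independent Brownian motions\<close>

abbreviation (in prob_space) "\<E> \<equiv> expectation"

text \<open>Nonemptiness of the index set keeps the intersections over \<open>I\<close> below inside
  \<open>space M\<close>.\<close>

locale brownian_family = prob_space M for M :: "'w measure" +
 fixes I :: "'i set" and W :: "'i \<Rightarrow> real \<Rightarrow> 'w \<Rightarrow> real"
 assumes finite_I: "finite I" and I_nonempty: "I \<noteq> {}"
  and independent: "independent_brownian_motions M I W"
begin

abbreviation \<F> :: "real \<Rightarrow> 'w measure" where "\<F> \<equiv> augmented_filtration M I W"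

lemma W_measurable: "i \<in> I \<Longrightarrow> 0 \<le> t \<Longrightarrow> W i t \<in> borel_measurable M"
 using independent by (auto simp: independent_brownian_motions_def standard_brownian_motion_def)

lemma generated_sets_subset: "J \<subseteq> I \<Longrightarrow> generated_sets M J W t \<subseteq> sets M"
 using W_measurable by (auto simp: generated_sets_def measurable_sets)

lemma generators_Pow: "generated_sets M I W t \<union> null_sets M \<subseteq> Pow (space M)"
 using generated_sets_subset[of I t] sets.space_closed[of M] by (auto simp: null_sets_def)

lemma space_filtration [simp]: "space (\<F> t) = space M"
 unfolding augmented_filtration_def by (rule space_measure_of) (rule generators_Pow)

lemma sets_filtration: "sets (\<F> t) = sigma_sets (space M) (generated_sets M I W t \<union> null_sets M)"
 unfolding augmented_filtration_def by (rule sets_measure_of) (rule generators_Pow)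

lemma sets_filtration_subset: "sets (\<F> t) \<subseteq> sets M"
 unfolding sets_filtration
 by (rule sets.sigma_sets_subset) (use generated_sets_subset[of I t] in \<open>auto simp: null_sets_def\<close>)

lemma sets_filtration_mono: "s \<le> t \<Longrightarrow> sets (\<F> s) \<subseteq> sets (\<F> t)"
 unfolding sets_filtration by (rule sigma_sets_mono') (fastforce simp: generated_sets_def)

lemma filtration_measurable_mono:
 "s \<le> t \<Longrightarrow> f \<in> measurable (\<F> s) N \<Longrightarrow> f \<in> measurable (\<F> t) N"
 using sets_filtration_mono[of s t] by (auto simp: measurable_def)

lemma filtration_measurable: "f \<in> measurable (\<F> s) N \<Longrightarrow> f \<in> measurable M N"
 using sets_filtration_subset[of s] by (auto simp: measurable_def)

lemma W_filtration_measurable: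
 assumes "i \<in> I" "0 \<le> u" "u \<le> t"
 shows "W i u \<in> borel_measurable (\<F> t)"
proof (rule measurableI)
 fix A :: "real set" assume "A \<in> sets borel"
 then have "W i u -` A \<inter> space M \<in> generated_sets M I W t"
  using assms by (auto simp: generated_sets_def)
 then show "W i u -` A \<inter> space (\<F> t) \<in> sets (\<F> t)"
  unfolding sets_filtration by auto
qed auto

text \<open>Increments of the whole family, and in \<open>past_events\<close> its past, are
  described by intersections over \<open>i\<close>: such families are stable under intersection, and
  their product form lets independence be checked motion by motion.\<close>

definition increment_events :: "real \<Rightarrow> real \<Rightarrow> 'w set set" where
 "increment_events u v =
   {(\<Inter>i\<in>I. (\<lambda>w. W i v w - W i u w) -` C i \<inter> space M) | C. \<forall>i\<in>I. C i \<in> sets borel}"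

definition past_events :: "real \<Rightarrow> 'w set set" where
 "past_events u =
   {(\<Inter>i\<in>I. A i) | A. \<forall>i\<in>I. A i \<in> sigma_sets (space M) (generated_sets M {()} (\<lambda>_. W i) u)}"

text \<open>Independence of the motions is assumed for preimages of product-measurable sets under
  the path map. Coordinate events are such preimages, and preimages under one map form a
  \<sigma>-algebra.\<close>

lemma path_event:
 assumes i: "i \<in> I" and A: "A \<in> sigma_sets (space M) {W i r -` B \<inter> space M | r B. 0 \<le> r \<and> B \<in> sets borel}"
 shows "A \<in> {(\<lambda>w. \<lambda>t\<in>{0..}. W i t w) -` S \<inter> space M | S. S \<in> sets (\<Pi>\<^sub>M t\<in>{0::real..}. (borel :: real measure))}"
  (is "_ \<in> ?R")
proof -
 let ?f = "\<lambda>w. \<lambda>t\<in>{0..}. W i t w"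
 let ?P = "\<Pi>\<^sub>M t\<in>{0::real..}. (borel :: real measure)"
 have f: "?f \<in> space M \<rightarrow> space ?P" by (auto simp: space_PiM)
 have R: "?R = sets (vimage_algebra (space M) ?f ?P)"
  using sets_vimage_algebra2[OF f] by simp
 have "{W i r -` B \<inter> space M | r B. 0 \<le> r \<and> B \<in> sets borel} \<subseteq> ?R"
 proof safe
  fix r :: real and B :: "real set" assume r: "0 \<le> r" and B: "B \<in> sets borel"
  have "(\<lambda>x. x r) -` B \<inter> space ?P \<in> sets ?P"
   using r B by (intro measurable_sets[OF measurable_component_singleton]) auto
  moreover have "W i r -` B \<inter> space M = ?f -` ((\<lambda>x. x r) -` B \<inter> space ?P) \<inter> space M"
   using r f by auto
  ultimately show "\<exists>S. W i r -` B \<inter> space M = ?f -` S \<inter> space M \<and> S \<in> sets ?P"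
   by blast
 qed
 then have "sigma_sets (space M) {W i r -` B \<inter> space M | r B. 0 \<le> r \<and> B \<in> sets borel} \<subseteq> ?R"
  unfolding R using sets.sigma_sets_subset[of _ "vimage_algebra (space M) ?f ?P"] by simp
 then show ?thesis using A by auto
qed

lemma path_sigma_increment:
 assumes i: "i \<in> I" "0 \<le> u" "0 \<le> v" "C \<in> sets borel"
 shows "(\<lambda>w. W i v w - W i u w) -` C \<inter> space M
  \<in> sigma_sets (space M) {W i r -` B \<inter> space M | r B. 0 \<le> r \<and> B \<in> sets borel}"
proof -
 let ?G = "{W i r -` B \<inter> space M | r B. 0 \<le> r \<and> B \<in> sets borel}"
 let ?N = "sigma (space M) ?G"
 have P: "?G \<subseteq> Pow (space M)" by auto
 have m: "W i r \<in> borel_measurable ?N" if "0 \<le> r" for r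
  by (rule measurableI) (use that P in \<open>auto simp: sets_measure_of\<close>)
 have "(\<lambda>w. W i v w - W i u w) \<in> borel_measurable ?N" using m i by auto
 from measurable_sets[OF this i(4)] show ?thesis using P by (simp add: sets_measure_of space_measure_of)
qed

text \<open>Two independences are combined: different motions have independent paths, and within one
  motion the increment is independent of its own past. Both events are split into one factor per
  motion.\<close>

lemma past_increment_indep:
 assumes u: "0 \<le> u" "u < v" and A: "A \<in> past_events u" and D: "D \<in> increment_events u v"
 shows "prob (A \<inter> D) = prob A * prob D"
proof -
 let ?A = "\<lambda>i w. W i v w - W i u w"
 let ?B = "\<lambda>i w. \<lambda>t\<in>{0..}. W i t w"
 obtain A' where A': "A = (\<Inter>i\<in>I. A' i)" "\<And>i. i \<in> I \<Longrightarrow> A' i \<in> sigma_sets (space M) (generated_sets M {()} (\<lambda>_. W i) u)"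
  using A by (auto simp: past_events_def)
 obtain C where C: "D = (\<Inter>i\<in>I. (?A i) -` C i \<inter> space M)" "\<And>i. i \<in> I \<Longrightarrow> C i \<in> sets borel"
  using D by (auto simp: increment_events_def)
 define D' where "D' i = (?A i) -` C i \<inter> space M" for i
 let ?G = "\<lambda>i. {W i r -` B \<inter> space M | r B. 0 \<le> r \<and> B \<in> sets borel}"
 have A2: "A' i \<in> sigma_sets (space M) (?G i)" if "i \<in> I" for i
  using A'(2)[OF that] by (rule rev_subsetD) (auto intro!: sigma_sets_mono' simp: generated_sets_def)
 have D2: "D' i \<in> sigma_sets (space M) (?G i)" if "i \<in> I" for i
  unfolding D'_def using path_sigma_increment[OF that, of u v "C i"] u C(2)[OF that] by auto
 have sp: "space M \<in> sigma_sets (space M) (?G i)" for i by (rule sigma_sets_top)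
 have int: "X \<inter> Y \<in> sigma_sets (space M) (?G i)" if "X \<in> sigma_sets (space M) (?G i)" "Y \<in> sigma_sets (space M) (?G i)" for X Y i
 proof -
  interpret S: sigma_algebra "space M" "sigma_sets (space M) (?G i)"
   by (rule sigma_algebra_sigma_sets) auto
  show ?thesis by (rule S.Int[OF that])
 qed
 \<comment> \<open>Across motions: events of the individual paths multiply.\<close>
 have prd: "prob (\<Inter>i\<in>I. E i) = (\<Prod>i\<in>I. prob (E i))" if E: "\<And>i. i \<in> I \<Longrightarrow> E i \<in> sigma_sets (space M) (?G i)" for E
 proof -
  have iv: "indep_vars (\<lambda>_. \<Pi>\<^sub>M t\<in>{0..}. borel) (\<lambda>i w. \<lambda>t\<in>{0..}. W i t w) I"
   using independent by (simp add: independent_brownian_motions_def)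
  have "\<forall>i\<in>I. \<exists>S. E i = (?B i) -` S \<inter> space M \<and> S \<in> sets (\<Pi>\<^sub>M t\<in>{0::real..}. (borel :: real measure))"
   using path_event E by blast
  then obtain S where S: "\<And>i. i \<in> I \<Longrightarrow> E i = (?B i) -` S i \<inter> space M"
   "\<And>i. i \<in> I \<Longrightarrow> S i \<in> sets (\<Pi>\<^sub>M t\<in>{0::real..}. (borel :: real measure))"
   by metis
  from indep_varsD[OF iv I_nonempty finite_I subset_refl, of S] S show ?thesis
   by simp
 qed
 \<comment> \<open>Within one motion: the increment is independent of the past of that
   motion.\<close>
 have one: "prob (A' i \<inter> D' i) = prob (A' i) * prob (D' i)" if i: "i \<in> I" for i
 proof -
  have "indep_set {(?A i) -` A \<inter> space M | A. A \<in> sets borel}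
    (sigma_sets (space M) (generated_sets M {()} (\<lambda>_. W i) u))"
   using independent i u by (auto simp: independent_brownian_motions_def standard_brownian_motion_def)
  from indep_setD[OF this, of "D' i" "A' i"] A'(2)[OF i] C(2)[OF i] show ?thesis
   unfolding D'_def by (auto simp: Int_commute mult.commute)
 qed
 have "A \<inter> D = (\<Inter>i\<in>I. A' i \<inter> D' i)"
  unfolding A'(1) C(1) D'_def using I_nonempty by auto
 then have "prob (A \<inter> D) = (\<Prod>i\<in>I. prob (A' i \<inter> D' i))"
  using prd[of "\<lambda>i. A' i \<inter> D' i"] A2 D2 int by auto
 also have "\<dots> = (\<Prod>i\<in>I. prob (A' i)) * (\<Prod>i\<in>I. prob (D' i))"
  using one by (simp add: prod.distrib)
 also have "\<dots> = prob A * prob D"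
  using prd[of A'] prd[of D'] A2 D2 unfolding A'(1) C(1) D'_def by auto
 finally show ?thesis .
qed

lemma generated_sigma_subset_events:
 "i \<in> I \<Longrightarrow> sigma_sets (space M) (generated_sets M {()} (\<lambda>_. W i) u) \<subseteq> sets M"
 by (rule sets.sigma_sets_subset) (use W_measurable in \<open>auto simp: generated_sets_def measurable_sets\<close>)

lemma past_events_subset: "past_events u \<subseteq> sets M"
 unfolding past_events_def using finite_I I_nonempty generated_sigma_subset_events
 by (fastforce intro!: sets.finite_INT)

lemma increment_events_subset: "0 \<le> u \<Longrightarrow> 0 \<le> v \<Longrightarrow> increment_events u v \<subseteq> sets M"
 unfolding increment_events_def using finite_I I_nonempty W_measurable
 by (auto intro!: sets.finite_INT measurable_sets[where A=borel])

lemma Int_stable_past: "Int_stable (past_events u)"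
proof (rule Int_stableI)
 let ?A = "\<lambda>i. generated_sets M {()} (\<lambda>_. W i) u"
 fix a b assume "a \<in> past_events u" "b \<in> past_events u"
 then obtain A B where *: "a = (\<Inter>i\<in>I. A i)" "b = (\<Inter>i\<in>I. B i)"
  "\<And>i. i \<in> I \<Longrightarrow> A i \<in> sigma_sets (space M) (?A i)"
  "\<And>i. i \<in> I \<Longrightarrow> B i \<in> sigma_sets (space M) (?A i)"
  by (auto simp: past_events_def)
 have "A i \<inter> B i \<in> sigma_sets (space M) (?A i)" if "i \<in> I" for i
 proof -
  interpret S: sigma_algebra "space M" "sigma_sets (space M) (?A i)"
   by (rule sigma_algebra_sigma_sets) (auto simp: generated_sets_def)
  show ?thesis using *(3,4)[OF that] by auto
 qed
 moreover have "a \<inter> b = (\<Inter>i\<in>I. A i \<inter> B i)" using * by auto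
 ultimately show "a \<inter> b \<in> past_events u" unfolding past_events_def by blast
qed

lemma Int_stable_increment: "Int_stable (increment_events u v)"
proof (rule Int_stableI)
 let ?A = "\<lambda>i w. W i v w - W i u w"
 fix a b assume "a \<in> increment_events u v" "b \<in> increment_events u v"
 then obtain A B where *: "a = (\<Inter>i\<in>I. (?A i) -` A i \<inter> space M)"
   "b = (\<Inter>i\<in>I. (?A i) -` B i \<inter> space M)"
  "\<And>i. i \<in> I \<Longrightarrow> A i \<in> sets borel" "\<And>i. i \<in> I \<Longrightarrow> B i \<in> sets borel"
  by (auto simp: increment_events_def)
 have "a \<inter> b = (\<Inter>i\<in>I. (?A i) -` (A i \<inter> B i) \<inter> space M)" using * by auto
 moreover have "\<forall>i\<in>I. A i \<inter> B i \<in> sets borel" using * by auto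
 ultimately show "a \<inter> b \<in> increment_events u v" unfolding increment_events_def by (intro CollectI exI[of _ "\<lambda>i. A i \<inter> B i"]) simp
qed

text \<open>The filtration contains all null sets, which the intersections in
  \<open>past_events\<close> do not generate. Up to almost sure equality they change nothing, and
  probabilities do not see the difference.\<close>

lemma filtration_modulo_null:
 assumes "A \<in> sets (\<F> u)"
 shows "\<exists>A'\<in>sigma_sets (space M) (past_events u). AE w in M. w \<in> A \<longleftrightarrow> w \<in> A'"
 using assms unfolding sets_filtration
proof (induction rule: sigma_sets.induct)
 case (Basic a)
 then show ?case
 proof
  assume "a \<in> generated_sets M I W u"
  then obtain i r B where *: "a = W i r -` B \<inter> space M" "i \<in> I" "0 \<le> r" "r \<le> u" "B \<in> sets borel"
   by (auto simp: generated_sets_def)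
  \<comment> \<open>An event of a single motion is padded by \<open>space M\<close> in the other
    coordinates.\<close>
  define A where "A j = (if j = i then a else space M)" for j
  have "A j \<in> sigma_sets (space M) (generated_sets M {()} (\<lambda>_. W j) u)" for j
  proof (cases "j = i")
   case True
   then show ?thesis unfolding A_def using * by (auto simp: generated_sets_def intro!: sigma_sets.Basic)
  qed (auto simp: A_def sigma_sets_top)
  moreover have "(\<Inter>j\<in>I. A j) = a" using * by (auto simp: A_def split: if_splits)
  ultimately have "a \<in> past_events u" unfolding past_events_def by blast
  then show ?thesis by (intro bexI[of _ a]) auto
 next
  assume "a \<in> null_sets M"
  then have "AE w in M. w \<notin> a" by (rule AE_not_in)
  then show ?thesis by (intro bexI[of _ "{}"]) (auto intro: sigma_sets.Empty)
 qed
next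
 case Empty
 then show ?case by (intro bexI[of _ "{}"]) (auto intro: sigma_sets.Empty)
next
 case (Compl a)
 then obtain A' where "A'\<in>sigma_sets (space M) (past_events u)" "AE w in M. w \<in> a \<longleftrightarrow> w \<in> A'" by auto
 then show ?case by (intro bexI[of _ "space M - A'"]) (auto intro: sigma_sets.Compl)
next
 case (Union a)
 then have "\<forall>i. \<exists>A'. A' \<in> sigma_sets (space M) (past_events u) \<and> (AE w in M. w \<in> a i \<longleftrightarrow> w \<in> A')" by auto
 then obtain A' where *: "\<And>i. A' i \<in> sigma_sets (space M) (past_events u)" "\<And>i::nat. AE w in M. w \<in> a i \<longleftrightarrow> w \<in> A' i"
  by metis
 have "AE w in M. \<forall>i. w \<in> a i \<longleftrightarrow> w \<in> A' i" using *(2) by (simp add: AE_all_countable)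
 then have "AE w in M. w \<in> (\<Union>i. a i) \<longleftrightarrow> w \<in> (\<Union>i. A' i)" by eventually_elim auto
 then show ?case using *(1) by (intro bexI[of _ "\<Union>i. A' i"]) (auto intro: sigma_sets.Union)
qed

text \<open>Independence extends from the two intersection-stable families to the \<sigma>-algebras
  they generate; an event of the augmented filtration is then replaced by an almost surely equal
  one.\<close>

lemma filtration_increment_indep:
 assumes u: "0 \<le> u" "u < v" and A: "A \<in> sets (\<F> u)" and D: "D \<in> sigma_sets (space M) (increment_events u v)"
 shows "prob (A \<inter> D) = prob A * prob D"
proof -
 have "indep_set (past_events u) (increment_events u v)"
  using past_events_subset increment_events_subset past_increment_indep[OF u] u by (intro indep_setI) auto
 then have ind: "indep_set (sigma_sets (space M) (past_events u)) (sigma_sets (space M) (increment_events u v))"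
  by (rule indep_set_sigma_sets) (auto intro: Int_stable_past Int_stable_increment)
 obtain A' where A': "A' \<in> sigma_sets (space M) (past_events u)" "AE w in M. w \<in> A \<longleftrightarrow> w \<in> A'"
  using filtration_modulo_null[OF A] by auto
 have Am: "A \<in> events" "A' \<in> events" "D \<in> events"
  using A sets_filtration_subset indep_setD_ev1[OF ind] indep_setD_ev2[OF ind] A'(1) D by auto
 have "prob A = prob A'" by (rule finite_measure_eq_AE) (use A'(2) Am in auto)
 moreover have "prob (A \<inter> D) = prob (A' \<inter> D)"
  by (rule finite_measure_eq_AE) (use A'(2) Am in auto)
 moreover have "prob (A' \<inter> D) = prob A' * prob D"
  by (rule indep_setD[OF ind A'(1) D])
 ultimately show ?thesis by simp
qed

lemma increment_measurable:
 assumes "i \<in> I"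
 shows "(\<lambda>w. W i v w - W i u w) \<in> borel_measurable (sigma (space M) (increment_events u v))"
proof (rule measurableI)
 let ?A = "\<lambda>w. W i v w - W i u w"
 let ?B = "sigma (space M) (increment_events u v)"
 have P: "increment_events u v \<subseteq> Pow (space M)" using I_nonempty by (auto simp: increment_events_def)
 fix A :: "real set" assume A: "A \<in> sets borel"
 define C where "C j = (if j = i then A else UNIV)" for j
 have "?A -` A \<inter> space M = (\<Inter>j\<in>I. (\<lambda>w. W j v w - W j u w) -` C j \<inter> space M)"
  using assms by (auto simp: C_def split: if_splits)
 moreover have "\<forall>j\<in>I. C j \<in> sets borel" using A by (auto simp: C_def)
 ultimately have "?A -` A \<inter> space M \<in> increment_events u v"
  unfolding increment_events_def by blast
 then show "?A -` A \<inter> space ?B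
   \<in> sets ?B"
  using P by (simp add: sets_measure_of space_measure_of)
qed auto

lemma indep_var_past_increments:
 assumes u: "0 \<le> u" "u < v" and Y: "Y \<in> borel_measurable (\<F> u)"
  and Q: "Q \<in> borel_measurable (sigma (space M) (increment_events u v))"
 shows "indep_var borel Y borel Q"
proof -
 have P: "increment_events u v \<subseteq> Pow (space M)" using I_nonempty by (auto simp: increment_events_def)
 have Qs: "Q -` B \<inter> space M \<in> sigma_sets (space M) (increment_events u v)" if "B \<in> sets borel" for B
  using measurable_sets[OF Q that] P by (simp add: sets_measure_of space_measure_of)
 have Ys: "Y -` B \<inter> space M \<in> sets (\<F> u)" if "B \<in> sets borel" for B
  using measurable_sets[OF Y that] by simp
 have sub: "sigma_sets (space M) (increment_events u v) \<subseteq> sets M"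
  using increment_events_subset[of u v] u by (intro sets.sigma_sets_subset) auto
 have rv: "random_variable borel Y" "random_variable borel Q"
  using filtration_measurable[OF Y] Qs sub by (auto intro!: measurableI)
 have "indep_set {Y -` A \<inter> space M | A. A \<in> sets borel} {Q -` A \<inter> space M | A. A \<in> sets borel}"
  by (rule indep_setI) (use Qs Ys sub sets_filtration_subset[of u] filtration_increment_indep[OF u] in auto)
 then have "indep_set (sigma_sets (space M) {Y -` A \<inter> space M | A. A \<in> sets borel}) (sigma_sets (space M) {Q -` A \<inter> space M | A. A \<in> sets borel})"
  by (rule indep_set_sigma_sets) (auto intro!: Int_stableI intro: exI[of _ "_ \<inter> _"])
 then show ?thesis using rv by (simp add: indep_var_eq)
qed

end

section \<open>Lebesgue measure of intervals, integral bounds and double sums\<close>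

lemma emeasure_lborel_Ioc_finite: "emeasure lborel {a<..b::real} < \<infinity>"
 by (cases "a \<le> b") (auto simp: emeasure_lborel_Ioc)

lemma measure_lborel_Ioc_max: "measure lborel {a<..b::real} = max 0 (b - a)"
 by (cases "a \<le> b") (auto simp: measure_def emeasure_lborel_Ioc)

lemma norm_integral_le:
 fixes f g :: "'a \<Rightarrow> real"
 assumes "integrable N f" "integrable N g" "\<And>x. x \<in> space N \<Longrightarrow> norm (f x) \<le> g x"
 shows "norm (\<integral>x. f x \<partial>N) \<le> (\<integral>x. g x \<partial>N)"
 by (rule order_trans[OF integral_norm_bound integral_mono]) (use assms in auto)

lemma integral_double_sum:
 fixes f :: "'i \<Rightarrow> 'j \<Rightarrow> 'a \<Rightarrow> real"
 assumes "\<And>m l. m \<in> A \<Longrightarrow> l \<in> B \<Longrightarrow> integrable N (f m l)"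
 shows "(\<integral>x. (\<Sum>m\<in>A. \<Sum>l\<in>B. f m l x) \<partial>N) = (\<Sum>m\<in>A. \<Sum>l\<in>B. \<integral>x. f m l x \<partial>N)"
proof -
 have "(\<integral>x. (\<Sum>m\<in>A. \<Sum>l\<in>B. f m l x) \<partial>N) = (\<Sum>m\<in>A. \<integral>x. (\<Sum>l\<in>B. f m l x) \<partial>N)"
  by (rule lint_sum) (intro lint_integrable_sum assms)
 also have "\<dots> = (\<Sum>m\<in>A. \<Sum>l\<in>B. \<integral>x. f m l x \<partial>N)"
  by (intro sum.cong refl lint_sum assms)
 finally show ?thesis .
qed

section \<open>Second moments of weighted Brownian increments\<close>

context brownian_family
begin

lemma increment_moments:
 assumes i: "i \<in> I" and u: "0 \<le> u" "u \<le> v"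
 shows "sq_int M (\<lambda>w. W i v w - W i u w)"
  and "\<E> (\<lambda>w. W i v w - W i u w) = 0"
  and "\<E> (\<lambda>w. (W i v w - W i u w)^2) = v - u"
proof -
 let ?D = "\<lambda>w. W i v w - W i u w"
 have m: "?D \<in> borel_measurable M" using W_measurable i u by auto
 have "sq_int M ?D \<and> \<E> ?D = 0 \<and> \<E> (\<lambda>w. (?D w)^2) = v - u"
 proof (cases "u = v")
  case False
  then have uv: "u < v" using u by auto
  let ?s = "sqrt (v - u)"
  have s: "0 < ?s" using uv by simp
  have d: "distributed M lborel ?D (normal_density 0 ?s)"
   using independent i u uv by (auto simp: independent_brownian_motions_def standard_brownian_motion_def)
  have e: "\<E> ?D = 0" by (rule normal_distributed_expectation[OF s d])
  moreover have "variance ?D = ?s^2" by (rule normal_distributed_variance[OF s d])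
  moreover have "integrable lborel (\<lambda>x. normal_density 0 ?s x * x^2)"
   using integrable_normal_moment[OF s, of 0 2] by simp
  then have "integrable M (\<lambda>w. (?D w)^2)"
   using distributed_integrable[OF d, of "\<lambda>x. x^2"] s by simp
  ultimately show ?thesis using m uv by (auto simp: sq_int_def)
 qed auto
 then show "sq_int M ?D" "\<E> ?D = 0" "\<E> (\<lambda>w. (?D w)^2) = v - u" by auto
qed

lemma distinct_increments_uncorrelated:
 assumes ij: "i \<in> I" "j \<in> I" "i \<noteq> j" and u: "0 \<le> u" "u \<le> v"
 shows "\<E> (\<lambda>w. (W i v w - W i u w) * (W j v w - W j u w)) = 0"
proof -
 let ?A = "\<lambda>i w. W i v w - W i u w"
 have iv: "indep_vars (\<lambda>_. \<Pi>\<^sub>M t\<in>{0..}. borel) (\<lambda>i w. \<lambda>t\<in>{0..}. W i t w) I"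
  using independent by (simp add: independent_brownian_motions_def)
 have "indep_vars (\<lambda>_. borel) (\<lambda>i w. (\<lambda>x. x v - x u) (\<lambda>t\<in>{0..}. W i t w)) I"
  by (rule indep_vars_compose2[OF iv])
   (use u in \<open>auto intro!: borel_measurable_diff measurable_component_singleton\<close>)
 then have "indep_vars (\<lambda>_. borel) ?A I"
  using u by simp
 then have *: "indep_vars (\<lambda>_. borel) ?A {i, j}"
  by (rule indep_vars_subset) (use ij in auto)
 have "\<E> (\<lambda>w. \<Prod>k\<in>{i,j}. W k v w - W k u w) = (\<Prod>k\<in>{i,j}. \<E> (\<lambda>w. W k v w - W k u w))"
  by (rule indep_vars_lebesgue_integral[OF _ *])
   (use ij increment_moments(1)[OF _ u] in \<open>auto intro!: sq_int_imp_integrable\<close>)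
 then show ?thesis using ij increment_moments(2)[OF _ u] by simp
qed

lemma past_increment_expectation:
 assumes i: "i \<in> I" and u: "0 \<le> u" "u \<le> v" and Y: "Y \<in> borel_measurable (\<F> u)" "sq_int M Y"
 shows "\<E> (\<lambda>w. Y w * (W i v w - W i u w)) = 0"
proof (cases "u = v")
 case False
 then have uv: "u < v" using u by simp
 have "indep_var borel Y borel (\<lambda>w. W i v w - W i u w)"
  by (rule indep_var_past_increments[OF u(1) uv Y(1) increment_measurable[OF i]])
 then show ?thesis
  using increment_moments[OF i u] Y
  by (subst indep_var_lebesgue_integral) (auto intro: sq_int_imp_integrable)
qed auto

lemma past_increment_product_expectation:
 assumes i: "i \<in> I" "j \<in> I" and u: "0 \<le> u" "u \<le> v" and Y: "Y \<in> borel_measurable (\<F> u)" "integrable M Y"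
 shows "\<E> (\<lambda>w. Y w * ((W i v w - W i u w) * (W j v w - W j u w))) =
  (if i = j then (v - u) * \<E> Y else 0)"
proof (cases "u = v")
 case False
 then have uv: "u < v" using u by simp
 have "indep_var borel Y borel (\<lambda>w. (W i v w - W i u w) * (W j v w - W j u w))"
  by (rule indep_var_past_increments[OF u(1) uv Y(1)])
   (intro borel_measurable_times increment_measurable i)
 then show ?thesis
  using increment_moments[OF i(1) u] increment_moments[OF i(2) u] Y
   distinct_increments_uncorrelated[OF i _ u]
  by (subst indep_var_lebesgue_integral) (auto intro: sq_int_mult simp: power2_eq_square)
qed auto

lemma sq_int_bounded_past_mult:
 assumes "Y \<in> borel_measurable (\<F> u)" "\<And>w. w \<in> space M \<Longrightarrow> \<bar>Y w\<bar> \<le> C" "sq_int M f"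
 shows "sq_int M (\<lambda>w. Y w * f w)"
 by (rule sq_int_bounded_mult[OF assms(3) filtration_measurable[OF assms(1)] assms(2)])

text \<open>The longer increment is cut where the shorter one ends. Its later part is orthogonal to
  everything known at the cut, so only the product over the common interval contributes.\<close>

lemma past_increments_common_start:
 assumes ij: "i \<in> I" "j \<in> I" and v: "0 \<le> v" "v \<le> r" "v \<le> r'"
  and Y: "Y \<in> borel_measurable (\<F> v)" "\<And>w. w \<in> space M \<Longrightarrow> \<bar>Y w\<bar> \<le> C"
 shows "\<E> (\<lambda>w. Y w * ((W i r w - W i v w) * (W j r' w - W j v w))) =
  (if i = j then (min r r' - v) * \<E> Y else 0)"
proof -
 let ?A = "\<lambda>i r j w. Y w * ((W i r w - W i v w) * (W j r w - W j v w))"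
 let ?B = "\<lambda>i r j r' w. Y w * ((W i r w - W i v w) * (W j r' w - W j v w))"
 let ?C = "\<lambda>i r j r' w. (Y w * (W i r w - W i v w)) * (W j r' w - W j r w)"
 have *: "\<E> (?B i r j r') =
  (if i = j then (r - v) * \<E> Y else 0)"
  if ij: "i \<in> I" "j \<in> I" and v: "v \<le> r" "r \<le> r'" for i j r r'
 proof -
  have r: "0 \<le> r" "v \<le> r'" using v \<open>0 \<le> v\<close> by auto
  note mI = increment_moments(1)[OF ij(1) \<open>0 \<le> v\<close> v(1)] and mJ = increment_moments(1)[OF ij(2) \<open>0 \<le> v\<close> v(1)]
   and mJ' = increment_moments(1)[OF ij(2) r(1) v(2)]
  have YI: "sq_int M (\<lambda>w. Y w * (W i r w - W i v w))"
   by (rule sq_int_bounded_past_mult[OF Y mI])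
  have "\<E> (?B i r j r')
    = \<E> (\<lambda>w. Y w * ((W i r w - W i v w) * (W j r w - W j v w)) +
      (Y w * (W i r w - W i v w)) * (W j r' w - W j r w))"
   by (intro lint_cong) (auto simp: algebra_simps)
  also have "\<dots> = \<E> (?A i r j) +
    \<E> (?C i r j r')"
   using sq_int_mult[OF YI mJ] sq_int_mult[OF YI mJ']
   by (intro lint_add) (auto simp: mult.assoc)
  also have "\<E> (?C i r j r') = 0"
  proof (rule past_increment_expectation[OF ij(2) r(1) v(2) _ YI])
   show "(\<lambda>w. Y w * (W i r w - W i v w)) \<in> borel_measurable (\<F> r)"
    using filtration_measurable_mono[OF v(1) Y(1)] W_filtration_measurable[OF ij(1), of _ r] v \<open>0 \<le> v\<close>
    by auto
  qed
  also have "\<E> (?A i r j) =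
   (if i = j then (r - v) * \<E> Y else 0)"
   by (rule past_increment_product_expectation[OF ij \<open>0 \<le> v\<close> v(1) Y(1)])
    (use sq_int_bounded[OF filtration_measurable[OF Y(1)] Y(2)] in \<open>auto intro: sq_int_imp_integrable\<close>)
  finally show ?thesis by simp
 qed
 show ?thesis
 proof (cases "r \<le> r'")
  case True
  then show ?thesis using *[OF ij v(2) True] by (simp add: min_def)
 next
  case False
  then have "r' \<le> r" by simp
  from *[OF ij(2,1) v(3) this] show ?thesis using False
   by (auto simp: min_def mult.commute mult.left_commute)
 qed
qed

text \<open>Only the overlap of the two time intervals contributes. Say the first starts earlier:
  its part before \<open>v1\<close> is known at \<open>v1\<close> and hence orthogonal to the second
  increment; the rest starts together with the second one.\<close>

lemma weighted_increments_expectation: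
 assumes ij: "i \<in> I" "j \<in> I" and u: "0 \<le> u1" "u1 \<le> u2" and v: "0 \<le> v1" "v1 \<le> v2"
  and Y1: "Y1 \<in> borel_measurable (\<F> u1)" "\<And>w. w \<in> space M \<Longrightarrow> \<bar>Y1 w\<bar> \<le> C1"
  and Y2: "Y2 \<in> borel_measurable (\<F> v1)" "\<And>w. w \<in> space M \<Longrightarrow> \<bar>Y2 w\<bar> \<le> C2"
 shows "\<E> (\<lambda>w. (Y1 w * (W i u2 w - W i u1 w)) * (Y2 w * (W j v2 w - W j v1 w))) =
  (if i = j then max 0 (min u2 v2 - max u1 v1) * \<E> (\<lambda>w. Y1 w * Y2 w) else 0)"
proof -
 have *: "\<E> (\<lambda>w. (Y1 w * (W i u2 w - W i u1 w)) * (Y2 w * (W j v2 w - W j v1 w))) =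
  (if i = j then max 0 (min u2 v2 - v1) * \<E> (\<lambda>w. Y1 w * Y2 w) else 0)"
  if ij: "i \<in> I" "j \<in> I" and u: "0 \<le> u1" "u1 \<le> u2" and v: "u1 \<le> v1" "v1 \<le> v2"
   and Y1: "Y1 \<in> borel_measurable (\<F> u1)" "\<And>w. w \<in> space M \<Longrightarrow> \<bar>Y1 w\<bar> \<le> C1"
   and Y2: "Y2 \<in> borel_measurable (\<F> v1)" "\<And>w. w \<in> space M \<Longrightarrow> \<bar>Y2 w\<bar> \<le> C2"
  for i j u1 u2 v1 v2 Y1 Y2 C1 C2
 proof -
  \<comment> \<open>If the intervals are disjoint, \<open>p = u2\<close> and \<open>r = v1\<close>,
    so the second piece of the splitting vanishes; otherwise \<open>p = v1\<close> and
    \<open>r = u2\<close>.\<close>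
  define p where "p = min u2 v1"
  define r where "r = max u2 v1"
  have v0: "0 \<le> v1" "u1 \<le> p" "v1 \<le> r" using u v by (auto simp: p_def r_def)
  have split: "W i u2 w - W i u1 w = (W i p w - W i u1 w) + (W i r w - W i v1 w)" for w
   by (auto simp: p_def r_def min_def max_def)
  have Y1v: "Y1 \<in> borel_measurable (\<F> v1)" by (rule filtration_measurable_mono[OF v(1) Y1(1)])
  have YYb: "\<bar>Y1 w * Y2 w\<bar> \<le> \<bar>C1\<bar> * \<bar>C2\<bar>" if "w \<in> space M" for w
  proof -
   have "\<bar>Y1 w\<bar> \<le> \<bar>C1\<bar>" "\<bar>Y2 w\<bar> \<le> \<bar>C2\<bar>" using Y1(2)[OF that] Y2(2)[OF that] by linarith+
   then show ?thesis unfolding abs_mult by (intro mult_mono) auto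
  qed
  have YYm: "(\<lambda>w. Y1 w * Y2 w) \<in> borel_measurable (\<F> v1)" using Y1v Y2(1) by auto
  note m1 = increment_moments(1)[OF ij(1) u(1) v0(2)]
   and m2 = increment_moments(1)[OF ij(1) v0(1,3)]
   and m3 = increment_moments(1)[OF ij(2) v0(1) v(2)]
  note s1 = sq_int_bounded_past_mult[OF YYm YYb m1] and s2 = sq_int_bounded_past_mult[OF YYm YYb m2]
  have "\<E> (\<lambda>w. (Y1 w * (W i u2 w - W i u1 w)) * (Y2 w * (W j v2 w - W j v1 w))) =
    \<E> (\<lambda>w. ((Y1 w * Y2 w) * (W i p w - W i u1 w)) * (W j v2 w - W j v1 w) +
     ((Y1 w * Y2 w) * (W i r w - W i v1 w)) * (W j v2 w - W j v1 w))"
   unfolding split by (intro lint_cong) (auto simp: algebra_simps)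
  also have "\<dots> = \<E> (\<lambda>w. ((Y1 w * Y2 w) * (W i p w - W i u1 w)) * (W j v2 w - W j v1 w)) +
     \<E> (\<lambda>w. ((Y1 w * Y2 w) * (W i r w - W i v1 w)) * (W j v2 w - W j v1 w))"
   using sq_int_mult[OF s1 m3] sq_int_mult[OF s2 m3] by (rule lint_add)
  also have "\<E> (\<lambda>w. ((Y1 w * Y2 w) * (W i p w - W i u1 w)) * (W j v2 w - W j v1 w)) = 0"
  proof (rule past_increment_expectation[OF ij(2) v0(1) v(2) _ s1])
   show "(\<lambda>w. Y1 w * Y2 w * (W i p w - W i u1 w)) \<in> borel_measurable (\<F> v1)"
    using YYm W_filtration_measurable[OF ij(1), of _ v1] u v v0 by (auto simp: p_def)
  qed
  also have "\<E> (\<lambda>w. ((Y1 w * Y2 w) * (W i r w - W i v1 w)) * (W j v2 w - W j v1 w)) =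
   (if i = j then (min r v2 - v1) * \<E> (\<lambda>w. Y1 w * Y2 w) else 0)"
   using past_increments_common_start[OF ij v0(1,3) v(2) YYm YYb] by (simp add: mult.assoc)
  also have "min r v2 - v1 = max 0 (min u2 v2 - v1)"
   using v by (auto simp: r_def)
  finally show ?thesis by simp
 qed
 show ?thesis
 proof (cases "u1 \<le> v1")
  case True
  show ?thesis using *[OF ij u True v(2) Y1 Y2] True by (simp add: max_absorb2)
 next
  case False
  then have "v1 \<le> u1" by simp
  from *[OF ij(2,1) v this u(2) Y2 Y1] False show ?thesis
   by (simp add: mult.commute min.commute max_absorb1)
 qed
qed

section \<open>Moments of Ito integrals\<close>

text \<open>One clipped partition of \<open>[s,t]\<close> represents both the increment of the
  simple integral and the integrand on \<open>(s,t]\<close>, with the same coefficients; using both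
  together yields the isometry. Cells may be degenerate, and \<open>C\<close> bounds all
  coefficients at once.\<close>

definition increment_representation ::
  "real \<Rightarrow> real \<Rightarrow> nat \<Rightarrow> (nat \<Rightarrow> real) \<Rightarrow> (nat \<Rightarrow> 'w \<Rightarrow> real) \<Rightarrow> (nat \<Rightarrow> real) \<Rightarrow> (nat \<Rightarrow> 'w \<Rightarrow> real) \<Rightarrow> real \<Rightarrow> bool" where
 "increment_representation s t k p e q e' C \<longleftrightarrow>
  (\<forall>j<k. s \<le> q j \<and> q j \<le> q (Suc j) \<and> q (Suc j) \<le> t) \<and>
  (\<forall>j<k. e' j \<in> borel_measurable (\<F> (q j))) \<and>
  (\<forall>j<k. \<forall>w\<in>space M. \<bar>e' j w\<bar> \<le> C) \<and>
  (\<forall>B w. simple_integral k p e B t w - simple_integral k p e B s w =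
    (\<Sum>j<k. e' j w * (B (q (Suc j)) w - B (q j) w))) \<and>
  (\<forall>r w. indicator {s<..t} r * simple_value k p e r w =
    (\<Sum>j<k. e' j w * indicator {q j<..q (Suc j)} r))"

lemma increment_representationD:
 assumes "increment_representation s t k p e q e' C"
 shows "j < k \<Longrightarrow> s \<le> q j \<and> q j \<le> q (Suc j) \<and> q (Suc j) \<le> t" "j < k \<Longrightarrow> e' j \<in> borel_measurable (\<F> (q j))"
  "j < k \<Longrightarrow> w \<in> space M \<Longrightarrow> \<bar>e' j w\<bar> \<le> C"
  "simple_integral k p e B t w - simple_integral k p e B s w = (\<Sum>j<k. e' j w * (B (q (Suc j)) w - B (q j) w))"
  "indicator {s<..t} r * simple_value k p e r w = (\<Sum>j<k. e' j w * indicator {q j<..q (Suc j)} r)"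
 using assms unfolding increment_representation_def by blast+

lemma simple_increment_representation:
 assumes S: "simple_integrand M \<F> k p e" and st: "0 \<le> s" "s \<le> t"
 shows "\<exists>q e' C. increment_representation s t k p e q e' C"
proof -
 define q where "q j = max s (min t (p j))" for j
 \<comment> \<open>On a degenerate cell the coefficient is replaced by 0: there \<open>p j\<close>
   may lie beyond \<open>t\<close>, and \<open>e j\<close> need not be measurable at time
   \<open>q j\<close>.\<close>
 define e' where "e' j = (if q j < q (Suc j) then e j else (\<lambda>_. 0))" for j
 have p: "p j < p (Suc j)" and em: "e j \<in> borel_measurable (\<F> (p j))"
  and eb: "\<exists>C. \<forall>w\<in>space M. \<bar>e j w\<bar> \<le> C" if "j < k" for j
  using S that by (auto simp: simple_integrand_def)
 obtain C where C: "\<And>j w. j < k \<Longrightarrow> w \<in> space M \<Longrightarrow> \<bar>e j w\<bar> \<le> C j" using eb by metis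
 show ?thesis
  unfolding increment_representation_def
 proof (intro exI[of _ q] exI[of _ e'] exI[of _ "Max (insert 0 (C ` {..<k}))"] conjI allI impI ballI)
  fix j assume j: "j < k"
  show "s \<le> q j" "q j \<le> q (Suc j)" "q (Suc j) \<le> t"
   using st p[OF j] by (auto simp: q_def)
  show "e' j \<in> borel_measurable (\<F> (q j))"
  proof (cases "q j < q (Suc j)")
   case True
   then have "p j \<le> q j" using p[OF j] st by (auto simp: q_def min_def max_def split: if_splits)
   then show ?thesis using filtration_measurable_mono[OF _ em[OF j]] True by (simp add: e'_def)
  qed (simp add: e'_def)
  fix w assume w: "w \<in> space M"
  have "C j \<le> Max (insert 0 (C ` {..<k}))" "0 \<le> Max (insert 0 (C ` {..<k}))"
   using j by (auto intro!: Max_ge)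
  then show "\<bar>e' j w\<bar> \<le> Max (insert 0 (C ` {..<k}))"
   using C[OF j w] by (auto simp: e'_def)
 next
  fix B :: "real \<Rightarrow> 'w \<Rightarrow> real" and w
  have "e j w * (B (min t (p (Suc j))) w - B (min t (p j)) w) - e j w * (B (min s (p (Suc j))) w - B (min s (p j)) w)
    = e' j w * (B (q (Suc j)) w - B (q j) w)" if "j < k" for j
  proof -
   \<comment> \<open>Up to \<open>B s w\<close>, which cancels between consecutive partition points,
     a difference of stopped values is the value at the clipped point.\<close>
   have *: "B (min t x) w - B (min s x) w = B (max s (min t x)) w - B s w" for x
    using st by (auto simp: min_def max_def)
   have "e j w * (B (min t (p (Suc j))) w - B (min t (p j)) w) - e j w * (B (min s (p (Suc j))) w - B (min s (p j)) w)
    = e j w * ((B (min t (p (Suc j))) w - B (min s (p (Suc j))) w) - (B (min t (p j)) w - B (min s (p j)) w))"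
    by (simp add: algebra_simps)
   also have "\<dots> = e j w * (B (q (Suc j)) w - B (q j) w)"
    unfolding * by (simp add: q_def)
   also have "\<dots> = e' j w * (B (q (Suc j)) w - B (q j) w)"
   proof (cases "q j < q (Suc j)")
    case False
    then have "q j = q (Suc j)" using st p[OF that] by (auto simp: q_def)
    then show ?thesis by simp
   qed (simp add: e'_def)
   finally show ?thesis .
  qed
  then show "simple_integral k p e B t w - simple_integral k p e B s w =
    (\<Sum>j<k. e' j w * (B (q (Suc j)) w - B (q j) w))"
   unfolding simple_integral_def sum_subtractf[symmetric] by (intro sum.cong) auto
  fix r :: real
  show "indicator {s<..t} r * simple_value k p e r w = (\<Sum>j<k. e' j w * indicator {q j<..q (Suc j)} r)"
   unfolding simple_value_def sum_distrib_left
   by (intro sum.cong refl) (use st p in \<open>auto simp: e'_def q_def indicator_def split: if_splits\<close>)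
 qed
qed

lemma sq_int_simple_integral:
 assumes S: "simple_integrand M \<F> k p e" and t: "0 \<le> t" and i: "i \<in> I"
 shows "sq_int M (\<lambda>w. simple_integral k p e (W i) t w)"
 unfolding simple_integral_def
proof (rule sq_int_sum)
 fix j assume j: "j \<in> {..<k}"
 have p0: "0 \<le> p 0" and p: "\<And>j. j < k \<Longrightarrow> p j < p (Suc j)" and em: "e j \<in> borel_measurable (\<F> (p j))"
  using S j by (auto simp: simple_integrand_def)
 have "\<exists>C. \<forall>w\<in>space M. \<bar>e j w\<bar> \<le> C" using S j by (auto simp: simple_integrand_def)
 then obtain C where C: "\<And>w. w \<in> space M \<Longrightarrow> \<bar>e j w\<bar> \<le> C" by blast
 have "l \<le> k \<Longrightarrow> 0 \<le> p l" for l
 proof (induction l)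
  case (Suc l) then show ?case using p[of l] by simp
 qed (use p0 in simp)
 then have "0 \<le> min t (p j)" "min t (p j) \<le> min t (p (Suc j))" using j t p[of j] by auto
 from sq_int_bounded_past_mult[OF em C increment_moments(1)[OF i this]]
 show "sq_int M (\<lambda>w. e j w * (W i (min t (p (Suc j))) w - W i (min t (p j)) w))" by simp
qed

text \<open>Every cell of the clipped partition starts at or after \<open>s\<close>, so
  \<open>Z\<close> times the coefficient is known when the cell begins.\<close>

lemma simple_integral_martingale:
 assumes S: "simple_integrand M \<F> k p e" and st: "0 \<le> s" "s \<le> t" and i: "i \<in> I"
  and Z: "Z \<in> borel_measurable (\<F> s)" "\<And>w. w \<in> space M \<Longrightarrow> \<bar>Z w\<bar> \<le> D"
 shows "\<E> (\<lambda>w. Z w * (simple_integral k p e (W i) t w - simple_integral k p e (W i) s w)) = 0"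
proof -
 let ?A = "\<lambda>e' j w. Z w * e' j w"
 obtain q e' C where "increment_representation s t k p e q e' C"
  using simple_increment_representation[OF S st] by blast
 note q = increment_representationD[OF this]
 have Zm: "Z \<in> borel_measurable M" by (rule filtration_measurable[OF Z(1)])
 have sq: "sq_int M (?A e' j)" and Zem: "(?A e' j) \<in> borel_measurable (\<F> (q j))"
  and qj: "0 \<le> q j" "q j \<le> q (Suc j)"
  if j: "j < k" for j
 proof -
  have "sq_int M (e' j)" by (rule sq_int_bounded[OF filtration_measurable[OF q(2)[OF j]] q(3)[OF j]])
  then show "sq_int M (?A e' j)" by (rule sq_int_bounded_mult[OF _ Zm Z(2)])
  show "(?A e' j) \<in> borel_measurable (\<F> (q j))"
   using filtration_measurable_mono[OF _ Z(1), of "q j"] q(1)[OF j] q(2)[OF j] by auto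
  show "0 \<le> q j" "q j \<le> q (Suc j)" using q(1)[OF j] st by auto
 qed
 have "\<E> (\<lambda>w. Z w * (simple_integral k p e (W i) t w - simple_integral k p e (W i) s w)) =
  \<E> (\<lambda>w. \<Sum>j<k. (Z w * e' j w) * (W i (q (Suc j)) w - W i (q j) w))"
  unfolding q(4) by (simp add: sum_distrib_left mult.assoc)
 also have "\<dots> = (\<Sum>j<k. \<E> (\<lambda>w. (Z w * e' j w) * (W i (q (Suc j)) w - W i (q j) w)))"
  using sq qj increment_moments(1)[OF i] by (intro lint_sum sq_int_mult) auto
 also have "\<dots> = 0"
  by (intro sum.neutral ballI past_increment_expectation[OF i]) (use sq Zem qj in auto)
 finally show ?thesis .
qed

text \<open>The isometry in polarized form. Expanding both integrals gives a double sum over cells;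
  the covariance of two weighted increments contains the length of the overlap of their cells, which
  is also the time integral of the product of their indicators.\<close>

lemma simple_integral_product:
 assumes S: "simple_integrand M \<F> k p e" "simple_integrand M \<F> k' p' e'"
  and st: "0 \<le> s" "s \<le> t" and ij: "i \<in> I" "j \<in> I"
  and Z: "Z \<in> borel_measurable (\<F> s)" "\<And>w. w \<in> space M \<Longrightarrow> \<bar>Z w\<bar> \<le> D"
 shows "\<E> (\<lambda>w. Z w * ((simple_integral k p e (W i) t w - simple_integral k p e (W i) s w)
      * (simple_integral k' p' e' (W j) t w - simple_integral k' p' e' (W j) s w))) =
   (if i = j then \<E> (\<lambda>w. Z w * (LINT r:{s<..t}|lborel. simple_value k p e r w * simple_value k' p' e' r w)) else 0)"
proof -
 let ?A = "\<lambda>w. LINT r:{s<..t}|lborel. simple_value k p e r w * simple_value k' p' e' r w"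
 let ?B = "\<lambda>g m w q. g m w * (W i (q (Suc m)) w - W i (q m) w)"
 let ?C = "\<lambda>f' l w q'. f' l w * (W j (q' (Suc l)) w - W j (q' l) w)"
 obtain q f C where "increment_representation s t k p e q f C"
  using simple_increment_representation[OF S(1) st] by blast
 note q = increment_representationD[OF this]
 obtain q' f' C' where "increment_representation s t k' p' e' q' f' C'"
  using simple_increment_representation[OF S(2) st] by blast
 note q' = increment_representationD[OF this]
 have Zm: "Z \<in> borel_measurable M" by (rule filtration_measurable[OF Z(1)])
 define g where "g m w = Z w * f m w" for m w
 have gm: "g m \<in> borel_measurable (\<F> (q m))" and gb: "\<And>w. w \<in> space M \<Longrightarrow> \<bar>g m w\<bar> \<le> \<bar>D\<bar> * \<bar>C\<bar>"
   and qm: "0 \<le> q m" "q m \<le> q (Suc m)" "q (Suc m) \<le> t" if m: "m < k" for m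
 proof -
  show "g m \<in> borel_measurable (\<F> (q m))"
   unfolding g_def[abs_def] using filtration_measurable_mono[OF _ Z(1), of "q m"] q(1)[OF m] q(2)[OF m] by auto
  show "0 \<le> q m" "q m \<le> q (Suc m)" "q (Suc m) \<le> t" using q(1)[OF m] st by auto
  fix w assume w: "w \<in> space M"
  show "\<bar>g m w\<bar> \<le> \<bar>D\<bar> * \<bar>C\<bar>" unfolding g_def abs_mult
   using Z(2)[OF w] q(3)[OF m w] by (intro mult_mono) auto
 qed
 have qm': "0 \<le> q' m" "q' m \<le> q' (Suc m)" "q' (Suc m) \<le> t" if m: "m < k'" for m
  using q'(1)[OF m] st by auto
 have gI: "integrable M (\<lambda>w. g m w * f' l w)" if "m < k" "l < k'" for m l
  using sq_int_bounded[OF filtration_measurable[OF gm[OF that(1)]] gb[OF that(1)]]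
   sq_int_bounded[OF filtration_measurable[OF q'(2)[OF that(2)]] q'(3)[OF that(2)]]
  by (auto intro: sq_int_mult)
 define ov where "ov m l = max 0 (min (q (Suc m)) (q' (Suc l)) - max (q m) (q' l))" for m l
 have "\<E> (\<lambda>w. Z w * ((simple_integral k p e (W i) t w - simple_integral k p e (W i) s w)
      * (simple_integral k' p' e' (W j) t w - simple_integral k' p' e' (W j) s w))) =
  \<E> (\<lambda>w. \<Sum>m<k. \<Sum>l<k'. (?B g m w q) * (?C f' l w q'))"
  unfolding q(4) q'(4) sum_product
  by (simp add: sum_distrib_left mult.assoc g_def)
 also have "\<dots> = (\<Sum>m<k. \<Sum>l<k'. \<E> (\<lambda>w. (?B g m w q) * (?C f' l w q')))"
 proof -
  have "integrable M (\<lambda>w. (?B g m w q) * (?C f' l w q'))"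
   if "m < k" "l < k'" for m l
   by (intro sq_int_mult sq_int_bounded_past_mult[OF gm gb] sq_int_bounded_past_mult[OF q'(2,3)] that
     increment_moments(1) ij qm qm')
  then show ?thesis by (intro integral_double_sum) auto
 qed
 also have "\<dots> = (\<Sum>m<k. \<Sum>l<k'. if i = j then ov m l * \<E> (\<lambda>w. g m w * f' l w) else 0)"
  unfolding ov_def
  by (intro sum.cong refl weighted_increments_expectation[OF ij _ _ _ _ gm gb q'(2,3)] qm qm') auto
 also have "\<dots> = (if i = j then \<E> (\<lambda>w. Z w * (?A w)) else 0)"
 proof (cases "i = j")
  case True
  have ind: "indicator {q m<..q (Suc m)} r * indicator {q' l<..q' (Suc l)} r
     = (indicator {max (q m) (q' l)<..min (q (Suc m)) (q' (Suc l))} r :: real)" for m l r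
   by (auto simp: indicator_def)
  have len: "(LINT r|lborel. indicator {max (q m) (q' l)<..min (q (Suc m)) (q' (Suc l))} r) = ov m l"
   for m l using measure_lborel_Ioc_max by (simp add: ov_def)
  have e1: "(?A w) =
   (LINT r|lborel. (\<Sum>m<k. \<Sum>l<k'. (f m w * f' l w) * indicator {max (q m) (q' l)<..min (q (Suc m)) (q' (Suc l))} r))" for w
   unfolding set_lebesgue_integral_def
  proof (rule lint_cong[OF refl])
   fix r :: real
   have "indicator {s<..t} r *\<^sub>R (simple_value k p e r w * simple_value k' p' e' r w) =
    (indicator {s<..t} r * simple_value k p e r w) * (indicator {s<..t} r * simple_value k' p' e' r w)"
    by (auto simp: indicator_def)
   also have "\<dots> = (\<Sum>m<k. \<Sum>l<k'. (f m w * f' l w) * (indicator {q m<..q (Suc m)} r * indicator {q' l<..q' (Suc l)} r))"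
    unfolding q(5) q'(5) sum_product by (intro sum.cong refl) (simp add: mult.assoc mult.left_commute)
   finally show "indicator {s<..t} r *\<^sub>R (simple_value k p e r w * simple_value k' p' e' r w) =
     (\<Sum>m<k. \<Sum>l<k'. (f m w * f' l w) * indicator {max (q m) (q' l)<..min (q (Suc m)) (q' (Suc l))} r)"
    unfolding ind .
  qed
  have e2: "(LINT r|lborel. (\<Sum>m<k. \<Sum>l<k'. (f m w * f' l w) * indicator {max (q m) (q' l)<..min (q (Suc m)) (q' (Suc l))} r)) =
    (\<Sum>m<k. \<Sum>l<k'. (f m w * f' l w) * ov m l)" for w
  proof -
   have "integrable lborel (\<lambda>r. f m w * f' l w * indicat_real {max (q m) (q' l)<..min (q (Suc m)) (q' (Suc l))} r)" for m l
    by (intro integrable_mult_right integrable_real_indicator emeasure_lborel_Ioc_finite) auto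
   then show ?thesis
    by (subst integral_double_sum) (auto simp only: integral_mult_right_zero len)
  qed
  have "\<E> (\<lambda>w. Z w * (?A w))
    = \<E> (\<lambda>w. \<Sum>m<k. \<Sum>l<k'. ov m l * (g m w * f' l w))"
   unfolding e1 e2 by (simp add: g_def sum_distrib_left mult.assoc mult.left_commute mult.commute)
  also have "\<dots> = (\<Sum>m<k. \<Sum>l<k'. ov m l * \<E> (\<lambda>w. g m w * f' l w))"
   using gI by (subst integral_double_sum) auto
  finally show ?thesis using True by simp
 qed simp
 finally show ?thesis .
qed

lemma simple_value_measurable:
 assumes S: "simple_integrand M \<F> k p e"
 shows "(\<lambda>(r, w). simple_value k p e r w) \<in> borel_measurable (borel \<Otimes>\<^sub>M M)"
proof -
 have [measurable]: "e j \<in> borel_measurable M" if "j < k" for j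
  using S that filtration_measurable by (auto simp: simple_integrand_def)
 show ?thesis unfolding simple_value_def split_beta'
  by (intro borel_measurable_sum borel_measurable_times borel_measurable_indicator')
    (auto intro!: measurable_compose[OF measurable_snd])
qed

lemma simple_value_bounded:
 assumes S: "simple_integrand M \<F> k p e"
 shows "\<exists>C. \<forall>w\<in>space M. \<forall>r. \<bar>simple_value k p e r w\<bar> \<le> C"
proof -
 have "\<forall>j. \<exists>C. j < k \<longrightarrow> (\<forall>w\<in>space M. \<bar>e j w\<bar> \<le> C)" using S by (auto simp: simple_integrand_def)
 then obtain C where C: "\<And>j w. j < k \<Longrightarrow> w \<in> space M \<Longrightarrow> \<bar>e j w\<bar> \<le> C j" by metis
 have "\<bar>simple_value k p e r w\<bar> \<le> (\<Sum>j<k. C j)" if "w \<in> space M" for w r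
  unfolding simple_value_def
 proof (rule order_trans[OF sum_abs], rule sum_mono)
  fix j assume "j \<in> {..<k}"
  then show "\<bar>e j w * indicator {p j<..p (Suc j)} r\<bar> \<le> C j"
   using C[of j w] that by (auto simp: indicator_def abs_mult)
 qed
 then show ?thesis by blast
qed

end

text \<open>The definition of the Ito integral speaks of extended nonnegative integrals and does not
  assert that the limit is square integrable. A single finite error shows this, and then all errors
  are ordinary integrals.\<close>

lemma (in prob_space) L2_error_tendsto_0:
 assumes X: "\<And>n. sq_int M (X n)" and Y: "Y \<in> borel_measurable M"
  and lim: "(\<lambda>n. \<integral>\<^sup>+w. ennreal ((X n w - Y w)^2) \<partial>M) \<longlonglongrightarrow> 0"
 shows "sq_int M Y" and "(\<lambda>n. \<integral>w. (X n w - Y w)^2 \<partial>M) \<longlonglongrightarrow> 0"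
proof -
 let ?A = "\<lambda>n. \<integral>\<^sup>+w. ennreal ((X n w - Y w)^2) \<partial>M"
 have "\<forall>\<^sub>F n in sequentially. (?A n) < 1"
  using lim by (rule order_tendstoD) simp
 then obtain n where n: "(?A n) < 1"
  using eventually_happens'[OF sequentially_bot] by blast
 have "sq_int M (\<lambda>w. X n w - Y w)" unfolding sq_int_def
 proof
  show "integrable M (\<lambda>w. (X n w - Y w)^2)"
   using X[of n] Y order_less_trans[OF n, of \<infinity>] by (intro integrableI_bounded) (auto simp: sq_int_def)
 qed (use X[of n] Y in \<open>auto simp: sq_int_def\<close>)
 from sq_int_diff[OF X[of n] this] show Y2: "sq_int M Y" by simp
 have "(?A n) = ennreal (\<integral>w. (X n w - Y w)^2 \<partial>M)" for n
  using sq_int_diff[OF X[of n] Y2] by (intro nn_integral_eq_integral) (auto simp: sq_int_def)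
 then have "(\<lambda>n. ennreal (\<integral>w. (X n w - Y w)^2 \<partial>M)) \<longlonglongrightarrow> ennreal 0" using lim by simp
 then show "(\<lambda>n. \<integral>w. (X n w - Y w)^2 \<partial>M) \<longlonglongrightarrow> 0"
  by (subst (asm) tendsto_ennreal_iff) auto
qed

section \<open>From simple integrands to Ito integrals\<close>

context brownian_family
begin

abbreviation sint where "sint k p e i n \<equiv> simple_integral (k n) (p n) (e n) (W i)"

text \<open>The part of the defining property that does not mention the integrand. It is enough for
  the martingale and orthogonality properties; only the isometry needs the approximation of the
  integrand itself.\<close>

definition ito_approximation :: "(nat \<Rightarrow> nat) \<Rightarrow> (nat \<Rightarrow> nat \<Rightarrow> real) \<Rightarrow> (nat \<Rightarrow> nat \<Rightarrow> 'w \<Rightarrow> real) \<Rightarrow> 'i \<Rightarrow> (real \<Rightarrow> 'w \<Rightarrow> real) \<Rightarrow> bool" where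
 "ito_approximation k p e i J \<longleftrightarrow> (\<forall>n. simple_integrand M \<F> (k n) (p n) (e n)) \<and>
  (\<forall>t\<ge>0. J t \<in> borel_measurable (\<F> t) \<and> (\<lambda>n. \<integral>\<^sup>+w. ennreal ((sint k p e i n t w - J t w)^2) \<partial>M) \<longlonglongrightarrow> 0)"

lemma ito_approximationD:
 assumes "ito_approximation k p e i J"
 shows "simple_integrand M \<F> (k n) (p n) (e n)" "0 \<le> t \<Longrightarrow> J t \<in> borel_measurable (\<F> t)"
  "0 \<le> t \<Longrightarrow> (\<lambda>n. \<integral>\<^sup>+w. ennreal ((sint k p e i n t w - J t w)^2) \<partial>M) \<longlonglongrightarrow> 0"
 using assms by (auto simp: ito_approximation_def)

lemma ito_approximation_exists:
 assumes "has_ito_integral M \<F> (W i) H J"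
 obtains k p e where "ito_approximation k p e i J"
  "\<And>t. 0 \<le> t \<Longrightarrow> (\<lambda>n. \<integral>\<^sup>+w. (\<integral>\<^sup>+r\<in>{0..t}. ennreal ((simple_value (k n) (p n) (e n) r w - H r w)^2) \<partial>lborel) \<partial>M) \<longlonglongrightarrow> 0"
 using assms unfolding has_ito_integral_def ito_approximation_def by blast

lemma ito_integral_sq_int:
 assumes "has_ito_integral M \<F> (W i) H J" "i \<in> I" "0 \<le> t"
 shows "sq_int M (J t)"
proof -
 obtain k p e where "ito_approximation k p e i J" by (rule ito_approximation_exists[OF assms(1)])
 note A = ito_approximationD[OF this]
 show ?thesis
  by (rule L2_error_tendsto_0(1)[OF sq_int_simple_integral[OF A(1) assms(3,2)] filtration_measurable[OF A(2)[OF assms(3)]] A(3)[OF assms(3)]])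
qed

text \<open>The definition approximates \<open>J\<close> at single times; for increments the two
  errors are added with \<open>(x + y)^2 \<le> 2 x^2 + 2 y^2\<close>.\<close>

lemma ito_increment_approximation:
 assumes A: "ito_approximation k p e i J" and i: "i \<in> I"
  and st: "0 \<le> s" "s \<le> t"
 shows "\<And>n. sq_int M (\<lambda>w. sint k p e i n t w - sint k p e i n s w)"
  and "sq_int M (\<lambda>w. J t w - J s w)"
  and "(\<lambda>n. \<integral>w. ((sint k p e i n t w - sint k p e i n s w) - (J t w - J s w))^2 \<partial>M) \<longlonglongrightarrow> 0"
proof -
 let ?X = "\<lambda>n t w. sint k p e i n t w"
 note S = ito_approximationD(1)[OF A] and J = ito_approximationD(2,3)[OF A]
 have t: "0 \<le> t" using st by simp
 have X: "sq_int M (?X n r)" if "0 \<le> r" for n r by (rule sq_int_simple_integral[OF S that i])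
 have Jm: "J r \<in> borel_measurable M" if "0 \<le> r" for r using filtration_measurable[OF J(1)[OF that]] .
 note L = L2_error_tendsto_0[OF X Jm J(2)]
 show "sq_int M (\<lambda>w. ?X n t w - ?X n s w)" for n using X st t by (auto intro: sq_int_diff)
 show Jd: "sq_int M (\<lambda>w. J t w - J s w)" using L(1) st t by (auto intro: sq_int_diff)
 have Xd: "sq_int M (\<lambda>w. ?X n r w - J r w)" if "0 \<le> r" for n r by (intro sq_int_diff X L(1) that)
 have bd: "(\<integral>w. ((?X n t w - ?X n s w) - (J t w - J s w))^2 \<partial>M) \<le> 2 * (\<integral>w. (?X n t w - J t w)^2 \<partial>M) + 2 * (\<integral>w. (?X n s w - J s w)^2 \<partial>M)" for n
 proof -
  have "(\<integral>w. ((?X n t w - ?X n s w) - (J t w - J s w))^2 \<partial>M) \<le> (\<integral>w. 2 * (?X n t w - J t w)^2 + 2 * (?X n s w - J s w)^2 \<partial>M)"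
  proof (rule integral_mono)
   have "sq_int M (\<lambda>w. (?X n t w - ?X n s w) - (J t w - J s w))"
    using X st t Jd by (auto intro!: sq_int_diff)
   then show "integrable M (\<lambda>w. ((?X n t w - ?X n s w) - (J t w - J s w))^2)" by (simp add: sq_int_def)
   show "integrable M (\<lambda>w. 2 * (?X n t w - J t w)^2 + 2 * (?X n s w - J s w)^2)"
    using Xd[OF t, of n] Xd[OF st(1), of n] by (auto simp: sq_int_def)
   fix w
   show "((?X n t w - ?X n s w) - (J t w - J s w))^2 \<le> 2 * (?X n t w - J t w)^2 + 2 * (?X n s w - J s w)^2"
    using power2_add_le[of "?X n t w - J t w" "- (?X n s w - J s w)"]
    by (simp add: algebra_simps power2_commute)
  qed
  also have "\<dots> = 2 * (\<integral>w. (?X n t w - J t w)^2 \<partial>M) + 2 * (\<integral>w. (?X n s w - J s w)^2 \<partial>M)"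
   using Xd[OF t, of n] Xd[OF st(1), of n] by (simp add: sq_int_def)
  finally show ?thesis .
 qed
 have "(\<lambda>n. 2 * (\<integral>w. (?X n t w - J t w)^2 \<partial>M) + 2 * (\<integral>w. (?X n s w - J s w)^2 \<partial>M)) \<longlonglongrightarrow> 2 * 0 + 2 * 0"
  by (intro tendsto_intros L(2) t st)
 then show "(\<lambda>n. \<integral>w. ((?X n t w - ?X n s w) - (J t w - J s w))^2 \<partial>M) \<longlonglongrightarrow> 0"
  by (intro tendsto_sandwich[OF _ always_eventually[OF allI[OF bd]] tendsto_const]) auto
qed

lemma ito_integral_martingale:
 assumes "has_ito_integral M \<F> (W i) H J" and i: "i \<in> I" and st: "0 \<le> s" "s \<le> t"
  and Z: "Z \<in> borel_measurable (\<F> s)" "\<And>w. w \<in> space M \<Longrightarrow> \<bar>Z w\<bar> \<le> D"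
 shows "\<E> (\<lambda>w. Z w * (J t w - J s w)) = 0"
proof -
 obtain k p e where A: "ito_approximation k p e i J" by (rule ito_approximation_exists[OF assms(1)])
 \<comment> \<open>Convergence of products with the constant 1 as second factor.\<close>
 have "(\<lambda>n. \<integral>w. Z w * ((sint k p e i n t w - sint k p e i n s w) * 1) \<partial>M)
   \<longlonglongrightarrow> (\<integral>w. Z w * ((J t w - J s w) * 1) \<partial>M)"
  by (rule sq_int_tendsto_mult[OF ito_increment_approximation[OF A i st] _ _ _ filtration_measurable[OF Z(1)] Z(2)])
    (auto simp: sq_int_def)
 then have "(\<lambda>n. 0) \<longlonglongrightarrow> (\<integral>w. Z w * (J t w - J s w) \<partial>M)"
  using simple_integral_martingale[OF ito_approximationD(1)[OF A] st i Z] by simp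
 then show ?thesis by (simp add: LIMSEQ_const_iff)
qed

lemma ito_integral_orthogonal:
 assumes Hi: "has_ito_integral M \<F> (W i) H J" and Hj: "has_ito_integral M \<F> (W j) H' J'"
  and ij: "i \<in> I" "j \<in> I" "i \<noteq> j" and st: "0 \<le> s" "s \<le> t"
  and Z: "Z \<in> borel_measurable (\<F> s)" "\<And>w. w \<in> space M \<Longrightarrow> \<bar>Z w\<bar> \<le> D"
 shows "\<E> (\<lambda>w. Z w * ((J t w - J s w) * (J' t w - J' s w))) = 0"
proof -
 let ?A = "\<integral>w. Z w * ((J t w - J s w) * (J' t w - J' s w)) \<partial>M"
 obtain k p e where A: "ito_approximation k p e i J" by (rule ito_approximation_exists[OF Hi])
 obtain k' p' e' where A': "ito_approximation k' p' e' j J'" by (rule ito_approximation_exists[OF Hj])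
 have "(\<lambda>n. \<integral>w. Z w * ((sint k p e i n t w - sint k p e i n s w) *
   (sint k' p' e' j n t w - sint k' p' e' j n s w)) \<partial>M)
   \<longlonglongrightarrow> ?A"
  by (rule sq_int_tendsto_mult[OF ito_increment_approximation[OF A ij(1) st]
    ito_increment_approximation[OF A' ij(2) st] filtration_measurable[OF Z(1)] Z(2)])
 then have "(\<lambda>n. 0) \<longlonglongrightarrow> ?A"
  using simple_integral_product[OF ito_approximationD(1)[OF A] ito_approximationD(1)[OF A'] st ij(1,2) Z] ij(3) by simp
 then show ?thesis by (simp add: LIMSEQ_const_iff)
qed

text \<open>Young's inequality with a free parameter. For fixed \<open>\<eta>\<close> the first term
  is a multiple of the approximation error and tends to 0; the second can be chosen small
  afterwards.\<close>

lemma square_diff_le: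
 fixes v h \<eta> :: real
 assumes "\<bar>h\<bar> \<le> 1" "0 < \<eta>"
 shows "\<bar>v^2 - h^2\<bar> \<le> (1 + 1 / \<eta>) * (v - h)^2 + \<eta>"
proof -
 let ?d = "\<bar>v - h\<bar>"
 have "v^2 - h^2 = (v - h)^2 + 2 * h * (v - h)" by (simp add: power2_eq_square algebra_simps)
 then have "\<bar>v^2 - h^2\<bar> \<le> (v - h)^2 + 2 * (\<bar>h\<bar> * ?d)"
  by (metis abs_mult abs_numeral abs_power2 abs_triangle_ineq mult.assoc)
 moreover have "\<bar>h\<bar> * ?d \<le> ?d" using assms by (simp add: mult_left_le_one_le)
 moreover have "2 * ?d \<le> ?d^2 / \<eta> + \<eta>"
 proof -
  have "0 \<le> (?d - \<eta>)^2 / \<eta>" using assms by simp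
  also have "\<dots> = ?d^2 / \<eta> + \<eta> - 2 * ?d" using assms by (simp add: power2_diff field_simps power2_eq_square)
  finally show ?thesis by simp
 qed
 ultimately show ?thesis by (simp add: algebra_simps)
qed

text \<open>Both sides of the isometry for simple integrands pass to the limit: the left by
  \<open>L^2\<close> convergence of the integrals, the right because the squared integrands converge
  in \<open>L^1\<close>. \<open>G\<close> is a bounded version of \<open>H\<close> measurable
  jointly on all of the time axis, whereas \<open>H\<close> is only known to be measurable on each
  \<open>[0,T]\<close>.\<close>

lemma ito_isometry:
 assumes Hi: "has_ito_integral M \<F> (W i) H J"
  and ij: "i \<in> I" and st: "0 \<le> s" "s \<le> t"
  and Z: "Z \<in> borel_measurable (\<F> s)" "\<And>w. w \<in> space M \<Longrightarrow> \<bar>Z w\<bar> \<le> D"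
  and G: "(\<lambda>(r, w). G r w) \<in> borel_measurable (borel \<Otimes>\<^sub>M M)"
  and GH: "\<And>r w. 0 \<le> r \<Longrightarrow> w \<in> space M \<Longrightarrow> G r w = H r w" and Gb: "\<And>r w. w \<in> space M \<Longrightarrow> \<bar>G r w\<bar> \<le> 1"
 shows "\<E> (\<lambda>w. Z w * (J t w - J s w)^2) = \<E> (\<lambda>w. Z w * (LINT r:{s<..t}|lborel. (G r w)^2))"
proof -
 let ?A = "\<lambda>Q n q w. \<bar>Q n w - q w\<bar>"
 let ?B = "\<lambda>E n. \<integral>\<^sup>+w. E n w \<partial>M"
 let ?C = "\<lambda>k p e t n. \<integral>w. Z w * ((sint k p e i n t w - sint k p e i n s w) * (sint k p e i n t w - sint k p e i n s w)) \<partial>M"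
 let ?D = "M \<Otimes>\<^sub>M lborel"
 let ?E = "\<lambda>E n w. enn2real (E n w)"
 let ?F = "lborel \<Otimes>\<^sub>M M"
 let ?H = "borel \<Otimes>\<^sub>M M"
 let ?K = "\<lambda>E n. \<integral>\<^sup>+w. ennreal (norm (enn2real (E n w))) \<partial>M"
 let ?P = "\<lambda>t w r. indicator {s<..t} r *\<^sub>R (G r w)^2"
 obtain k p e where A: "ito_approximation k p e i J"
  and D: "\<And>t. 0 \<le> t \<Longrightarrow> (\<lambda>n. \<integral>\<^sup>+w. (\<integral>\<^sup>+r\<in>{0..t}. ennreal ((simple_value (k n) (p n) (e n) r w - H r w)^2) \<partial>lborel) \<partial>M) \<longlonglongrightarrow> 0"
  using ito_approximation_exists[OF Hi] by blast
 note S = ito_approximationD(1)[OF A]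
 have t: "0 \<le> t" using st by simp
 have Zm[measurable]: "Z \<in> borel_measurable M" by (rule filtration_measurable[OF Z(1)])
 let ?v = "\<lambda>n r w. simple_value (k n) (p n) (e n) r w"
 have vm: "(\<lambda>x. ?v n (fst x) (snd x)) \<in> borel_measurable ?H" for n
  using simple_value_measurable[OF S, of n] by (simp add: split_beta')
 have Gm: "(\<lambda>x. G (fst x) (snd x)) \<in> borel_measurable ?H"
  using G by (simp add: split_beta')
 have lb: "sets ?H = sets ?F" by (intro sets_pair_measure_cong) auto
 have vm': "(\<lambda>x. ?v n (fst x) (snd x)) \<in> borel_measurable ?F"
  and Gm': "(\<lambda>x. G (fst x) (snd x)) \<in> borel_measurable ?F" for n
  using vm[of n] Gm measurable_cong_sets[OF lb refl, of "borel :: real measure"] by simp_all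
 have vm2: "(\<lambda>x. ?v n (snd x) (fst x)) \<in> borel_measurable ?D"
  and Gm2: "(\<lambda>x. G (snd x) (fst x)) \<in> borel_measurable ?D" for n
  using measurable_compose[OF measurable_pair_swap'[of M lborel], OF vm'[of n]]
   measurable_compose[OF measurable_pair_swap'[of M lborel], OF Gm']
  by (simp_all add: split_beta')
 have vs: "(\<lambda>r. ?v n r w) \<in> borel_measurable lborel" "(\<lambda>r. G r w) \<in> borel_measurable lborel" if "w \<in> space M" for n w
  using measurable_compose[OF measurable_Pair1'[OF that, of lborel] vm2[of n]]
   measurable_compose[OF measurable_Pair1'[OF that, of lborel] Gm2] by simp_all
 \<comment> \<open>Along a fixed path: the energy of the approximation, the energy \<open>q\<close>
   of the integrand, and the squared distance \<open>E\<close> between the two.\<close>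
 define Q where "Q n w = (LINT r:{s<..t}|lborel. (?v n r w)^2)" for n w
 define q where "q w = (LINT r:{s<..t}|lborel. (G r w)^2)" for w
 define E where "E n w = (\<integral>\<^sup>+r\<in>{0..t}. ennreal ((?v n r w - G r w)^2) \<partial>lborel)" for n w
 have Qm[measurable]: "Q n \<in> borel_measurable M" and qm[measurable]: "q \<in> borel_measurable M"
  and Em[measurable]: "E n \<in> borel_measurable M" for n
 proof -
  have ind: "(\<lambda>x. indicator {s<..t} (snd x) :: real) \<in> borel_measurable ?D"
   "(\<lambda>x. indicator {0..t} (snd x) :: ennreal) \<in> borel_measurable ?D"
   by (rule measurable_compose[OF measurable_snd], simp)+
  show "Q n \<in> borel_measurable M" "q \<in> borel_measurable M"
   unfolding Q_def[abs_def] q_def[abs_def] set_lebesgue_integral_def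
   by (rule lborel.borel_measurable_lebesgue_integral, unfold split_beta',
     intro borel_measurable_scaleR ind borel_measurable_power vm2 Gm2)+
  show "E n \<in> borel_measurable M"
   unfolding E_def[abs_def]
   by (rule lborel.borel_measurable_nn_integral, unfold split_beta',
     intro borel_measurable_times_ennreal measurable_compose[OF _ measurable_ennreal] borel_measurable_power borel_measurable_diff ind vm2 Gm2)
 qed
 have Elim: "(\<lambda>n. \<integral>\<^sup>+w. E n w \<partial>M) \<longlonglongrightarrow> 0"
 proof -
  have "(?B E n) = (\<integral>\<^sup>+w. (\<integral>\<^sup>+r\<in>{0..t}. ennreal ((?v n r w - H r w)^2) \<partial>lborel) \<partial>M)" for n
   unfolding E_def by (intro nn_integral_cong) (auto simp: GH indicator_def)
  then show ?thesis using D[OF t] by simp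
 qed
 have Qb: "\<exists>C. \<forall>w\<in>space M. \<bar>Q n w\<bar> \<le> C" for n
 proof -
  obtain C where C: "\<And>w r. w \<in> space M \<Longrightarrow> \<bar>?v n r w\<bar> \<le> C" using simple_value_bounded[OF S] by blast
  have "\<bar>Q n w\<bar> \<le> C^2 * (t - s)" if w: "w \<in> space M" for w
  proof -
   have "\<bar>Q n w\<bar> \<le> (\<integral>r. indicator {s<..t} r * C^2 \<partial>lborel)"
    unfolding Q_def set_lebesgue_integral_def real_norm_def[symmetric]
   proof (rule norm_integral_le)
    have i: "integrable lborel (\<lambda>r. indicator {s<..t} r * C^2)"
     by (intro integrable_mult_left integrable_real_indicator emeasure_lborel_Ioc_finite) auto
    have b: "norm (indicator {s<..t} r *\<^sub>R (?v n r w)^2) \<le> indicator {s<..t} r * C^2" for r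
     using power_mono[OF C[OF w, of r], of 2] by (auto simp: indicator_def)
    then show "norm (indicator {s<..t} r *\<^sub>R (?v n r w)^2) \<le> indicator {s<..t} r * C^2" for r .
    show "integrable lborel (\<lambda>r. indicator {s<..t} r * C^2)" by fact
    show "integrable lborel (\<lambda>r. indicator {s<..t} r *\<^sub>R (?v n r w)^2)"
    proof (rule integrable_dominated[OF i])
     show "AE r in lborel. norm (indicator {s<..t} r *\<^sub>R (?v n r w)^2) \<le> norm (indicator {s<..t} r * C^2)"
      using b by (intro AE_I2) (auto intro: order_trans)
    qed (use vs[OF w] in auto)
   qed
   also have "\<dots> = C^2 * (t - s)" using st measure_lborel_Ioc_max[of s t] by simp
   finally show ?thesis .
  qed
  then show ?thesis by blast
 qed
 \<comment> \<open>Pathwise comparison where the distance is finite, which is almost everywhere as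
   soon as its mean is finite.\<close>
 have diff: "\<bar>Q n w - q w\<bar> \<le> (1 + 1 / \<eta>) * enn2real (E n w) + \<eta> * (t - s)"
  if w: "w \<in> space M" and fin: "E n w < \<infinity>" and \<eta>: "0 < \<eta>" for n w \<eta>
 proof -
  obtain C where C: "\<And>w r. w \<in> space M \<Longrightarrow> \<bar>?v n r w\<bar> \<le> C" using simple_value_bounded[OF S] by blast
  have bi: "integrable lborel (\<lambda>r. indicator {s<..t} r *\<^sub>R f r)"
   if "f \<in> borel_measurable lborel" "\<And>r. \<bar>f r\<bar> \<le> K" for f :: "real \<Rightarrow> real" and K
   by (rule integrableI_bounded_set_indicator[where B=K]) (use that emeasure_lborel_Ioc_finite in auto)
  have i1: "integrable lborel (\<lambda>r. indicator {s<..t} r *\<^sub>R (?v n r w)^2)"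
  proof (intro bi[of _ "C^2"])
   show "\<bar>(?v n r w)^2\<bar> \<le> C^2" for r using power_mono[OF C[OF w, of r], of 2] by simp
  qed (use vs[OF w] in simp)
  have i2: "integrable lborel (?P t w)"
  proof (intro bi[of _ 1])
   show "\<bar>(G r w)^2\<bar> \<le> 1" for r using power_mono[OF Gb[OF w, of r], of 2] by simp
  qed (use vs[OF w] in simp)
  have i3: "integrable lborel (\<lambda>r. indicator {0..t} r * (?v n r w - G r w)^2)"
  proof (rule integrableI_bounded)
   have "(\<integral>\<^sup>+r. ennreal (norm (indicator {0..t} r * (?v n r w - G r w)^2)) \<partial>lborel) = E n w"
    unfolding E_def by (intro nn_integral_cong) (auto simp: indicator_def)
   then show "(\<integral>\<^sup>+r. ennreal (norm (indicator {0..t} r * (?v n r w - G r w)^2)) \<partial>lborel) < \<infinity>" using fin by simp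
  qed (use vs[OF w] in auto)
  have e3: "(\<integral>r. indicator {0..t} r * (?v n r w - G r w)^2 \<partial>lborel) = enn2real (E n w)"
   unfolding E_def using vs(1)[OF w, of n] vs(2)[OF w]
   by (subst integral_eq_nn_integral) (auto intro!: arg_cong[where f=enn2real] nn_integral_cong simp: indicator_def)
  have i4: "integrable lborel (\<lambda>r. indicator {s<..t} r * \<eta>)"
   by (intro integrable_mult_left integrable_real_indicator emeasure_lborel_Ioc_finite) auto
  have "\<bar>Q n w - q w\<bar> = norm (\<integral>r. indicator {s<..t} r *\<^sub>R (?v n r w)^2 - indicator {s<..t} r *\<^sub>R (G r w)^2 \<partial>lborel)"
   unfolding Q_def q_def set_lebesgue_integral_def using i1 i2 by simp
  also have "\<dots> \<le> (\<integral>r. (1 + 1 / \<eta>) * (indicator {0..t} r * (?v n r w - G r w)^2) + indicator {s<..t} r * \<eta> \<partial>lborel)"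
  proof (rule norm_integral_le)
   fix r :: real
   show "norm (indicator {s<..t} r *\<^sub>R (?v n r w)^2 - indicator {s<..t} r *\<^sub>R (G r w)^2) \<le>
     (1 + 1 / \<eta>) * (indicator {0..t} r * (?v n r w - G r w)^2) + indicator {s<..t} r * \<eta>"
    using square_diff_le[OF Gb[OF w, of r] \<eta>, of "?v n r w"] \<eta> st by (auto simp: indicator_def)
  qed (use i1 i2 i3 i4 in auto)
  also have "\<dots> = (1 + 1 / \<eta>) * enn2real (E n w) + \<eta> * (t - s)"
   using i3 i4 e3 st measure_lborel_Ioc_max[of s t] by simp
  finally show ?thesis .
 qed
 have qb: "\<bar>q w\<bar> \<le> t - s" if w: "w \<in> space M" for w
 proof -
  have "\<bar>q w\<bar> \<le> (\<integral>r. indicator {s<..t} r \<partial>lborel)"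
   unfolding q_def set_lebesgue_integral_def real_norm_def[symmetric]
  proof (rule norm_integral_le)
   show i: "integrable lborel (indicator {s<..t} :: real \<Rightarrow> real)"
    by (intro integrable_real_indicator emeasure_lborel_Ioc_finite) auto
   show b: "norm (indicator {s<..t} r *\<^sub>R (G r w)^2) \<le> indicator {s<..t} r" for r
    using power_mono[OF Gb[OF w, of r], of 2] by (auto simp: indicator_def)
   show "integrable lborel (?P t w)"
    by (rule integrable_dominated[OF i]) (use b vs[OF w] in \<open>auto intro!: AE_I2 intro: order_trans\<close>)
  qed
  then show ?thesis using st measure_lborel_Ioc_max[of s t] by simp
 qed
 have lim: "(\<lambda>n. \<E> (?A Q n q)) \<longlonglongrightarrow> 0"
 proof (rule LIMSEQ_I)
  fix \<epsilon> :: real assume \<epsilon>: "0 < \<epsilon>"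
  \<comment> \<open>Chosen so that \<open>\<eta> * (t - s) \<le> \<epsilon> / 4\<close>, the summand
    1 excluding division by 0. Then \<open>\<delta>\<close> is the mean error for which the other
    term is \<open>\<epsilon> / 2\<close>.\<close>
  define \<eta> where "\<eta> = \<epsilon> / (4 * (t - s + 1))"
  have \<eta>: "0 < \<eta>" using st \<epsilon> by (simp add: \<eta>_def)
  have \<eta>2: "\<eta> * (t - s) < \<epsilon> / 2"
  proof -
   have "\<eta> * (t - s) \<le> \<eta> * (t - s + 1)" using \<eta> by simp
   also have "\<dots> = \<epsilon> / 4" using st by (simp add: \<eta>_def field_simps)
   finally show ?thesis using \<epsilon> by simp
  qed
  define \<delta> where "\<delta> = \<epsilon> / (2 * (1 + 1 / \<eta>))"
  have pos: "0 < 1 + 1 / \<eta>" using \<eta> by (simp add: add_pos_pos)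
  have \<delta>: "0 < \<delta>" using pos \<epsilon> by (simp add: \<delta>_def)
  have "\<forall>\<^sub>F n in sequentially. (?B E n) < ennreal \<delta>"
   using Elim by (rule order_tendstoD) (use \<delta> in simp)
  then obtain n0 where n0: "\<And>n. n \<ge> n0 \<Longrightarrow> (?B E n) < ennreal \<delta>"
   by (auto simp: eventually_sequentially)
  show "\<exists>n0. \<forall>n\<ge>n0. norm (\<E> (?A Q n q) - 0) < \<epsilon>"
  proof (intro exI allI impI)
   fix n assume n: "n0 \<le> n"
   have Efin: "(?B E n) < \<infinity>" using n0[OF n] by (rule order_less_trans) simp
   then have EAE: "AE w in M. E n w < \<infinity>" using nn_integral_PInf_AE[of "E n" M] Em by (auto simp: less_top)
   have Ei: "integrable M (?E E n)"
   proof (rule integrableI_bounded)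
    have "(?K E n) = (?B E n)"
     using EAE by (intro nn_integral_cong_AE) (auto elim!: eventually_mono simp: ennreal_enn2real)
    then show "(?K E n) < \<infinity>" using Efin by simp
   qed auto
   have Ee: "\<E> (?E E n) < \<delta>"
   proof -
    have "ennreal (\<E> (?E E n)) = (\<integral>\<^sup>+w. ennreal (enn2real (E n w)) \<partial>M)"
     by (rule nn_integral_eq_integral[symmetric, OF Ei]) auto
    also have "\<dots> = (?B E n)"
     using EAE by (intro nn_integral_cong_AE) (auto elim!: eventually_mono simp: ennreal_enn2real)
    also have "\<dots> < ennreal \<delta>" by (rule n0[OF n])
    finally show ?thesis using \<delta> by (simp add: ennreal_less_iff)
   qed
   have "\<E> (?A Q n q) \<le> \<E> (\<lambda>w. (1 + 1 / \<eta>) * enn2real (E n w) + \<eta> * (t - s))"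
   proof (rule integral_mono_AE)
    obtain C where "\<And>w. w \<in> space M \<Longrightarrow> \<bar>Q n w\<bar> \<le> C" using Qb by blast
    then show "integrable M (?A Q n q)"
     using qb by (intro integrable_const_bound[where B="C + (t - s)"] AE_I2) fastforce+
    show "AE w in M. \<bar>Q n w - q w\<bar> \<le> (1 + 1 / \<eta>) * enn2real (E n w) + \<eta> * (t - s)"
     using EAE AE_space by eventually_elim (rule diff[OF _ _ \<eta>], auto)
   qed (use Ei in auto)
   also have "\<dots> = (1 + 1 / \<eta>) * \<E> (?E E n) + \<eta> * (t - s)"
    using Ei by (simp add: prob_space)
   also have "\<dots> < (1 + 1 / \<eta>) * \<delta> + \<epsilon> / 2"
    using mult_strict_left_mono[OF Ee pos] \<eta>2 by linarith
   also have "\<dots> = \<epsilon>"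
   proof -
    have "x * (\<epsilon> / (2 * x)) = \<epsilon> / 2" if "0 < x" for x using that by simp
    from this[OF pos] show ?thesis unfolding \<delta>_def by linarith
   qed
   finally show "norm (\<E> (?A Q n q) - 0) < \<epsilon>" by simp
  qed
 qed
 have ZQi: "integrable M (\<lambda>w. Z w * f w)" if "f \<in> borel_measurable M" "\<And>w. w \<in> space M \<Longrightarrow> \<bar>f w\<bar> \<le> C" for f C
  by (rule sq_int_imp_integrable[OF sq_int_bounded_mult[OF sq_int_bounded[OF that] Zm Z(2)]])
 have l1: "(\<lambda>n. \<E> (\<lambda>w. Z w * Q n w)) \<longlonglongrightarrow> \<E> (\<lambda>w. Z w * q w)"
 proof -
  have bd: "norm (\<E> (\<lambda>w. Z w * Q n w) - \<E> (\<lambda>w. Z w * q w)) \<le> \<bar>D\<bar> * \<E> (?A Q n q)" for n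
  proof -
   obtain C where C: "\<And>w. w \<in> space M \<Longrightarrow> \<bar>Q n w\<bar> \<le> C" using Qb by blast
   note i1 = ZQi[OF Qm[of n] C] and i2 = ZQi[OF qm qb]
   have "norm (\<E> (\<lambda>w. Z w * Q n w) - \<E> (\<lambda>w. Z w * q w)) = norm (\<E> (\<lambda>w. Z w * Q n w - Z w * q w))"
    using i1 i2 by simp
   also have "\<dots> \<le> \<E> (\<lambda>w. \<bar>D\<bar> * \<bar>Q n w - q w\<bar>)"
   proof (rule norm_integral_le)
    show "integrable M (\<lambda>w. Z w * Q n w - Z w * q w)" using i1 i2 by simp
    show "integrable M (\<lambda>w. \<bar>D\<bar> * \<bar>Q n w - q w\<bar>)"
     by (intro integrable_mult_right integrable_abs lint_integrable_diff
       sq_int_imp_integrable[OF sq_int_bounded[OF Qm C]] sq_int_imp_integrable[OF sq_int_bounded[OF qm qb]])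
    fix w assume w: "w \<in> space M"
    have "norm (Z w * Q n w - Z w * q w) = \<bar>Z w\<bar> * \<bar>Q n w - q w\<bar>"
     by (simp add: right_diff_distrib[symmetric] abs_mult)
    also have "\<dots> \<le> \<bar>D\<bar> * \<bar>Q n w - q w\<bar>"
     using Z(2)[OF w] by (intro mult_right_mono) auto
    finally show "norm (Z w * Q n w - Z w * q w) \<le> \<bar>D\<bar> * \<bar>Q n w - q w\<bar>" .
   qed
   finally show ?thesis by simp
  qed
  have "(\<lambda>n. \<bar>D\<bar> * \<E> (?A Q n q)) \<longlonglongrightarrow> \<bar>D\<bar> * 0"
   by (intro tendsto_mult tendsto_const lim)
  then have lim0: "(\<lambda>n. \<bar>D\<bar> * \<E> (?A Q n q)) \<longlonglongrightarrow> 0"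
   by (simp only: mult_zero_right)
  have "(\<lambda>n. \<E> (\<lambda>w. Z w * Q n w) - \<E> (\<lambda>w. Z w * q w)) \<longlonglongrightarrow> 0"
   by (rule Lim_null_comparison[OF always_eventually[OF allI[OF bd]] lim0])
  then show ?thesis by (simp only: LIM_zero_iff)
 qed
 have l2: "(?C k p e t)
   \<longlonglongrightarrow> (\<integral>w. Z w * ((J t w - J s w) * (J t w - J s w)) \<partial>M)"
  by (rule sq_int_tendsto_mult[OF ito_increment_approximation[OF A ij st] ito_increment_approximation[OF A ij st]
    Zm Z(2)])
 have "\<E> (\<lambda>w. Z w * ((J t w - J s w) * (J t w - J s w))) = \<E> (\<lambda>w. Z w * q w)"
 proof (rule LIMSEQ_unique[OF l2])
  show "(?C k p e t) \<longlonglongrightarrow> \<E> (\<lambda>w. Z w * q w)"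
   using l1 simple_integral_product[OF S S st ij ij Z] by (simp add: Q_def power2_eq_square)
 qed
 then show ?thesis by (simp add: q_def power2_eq_square)
qed

end

section \<open>Uniform partitions\<close>

text \<open>The index \<open>n\<close> stands for \<open>n + 1\<close> cells, so every index gives a
  genuine partition.\<close>

definition grid :: "real \<Rightarrow> real \<Rightarrow> nat \<Rightarrow> nat \<Rightarrow> real" where
 "grid s t n k = s + (t - s) * real k / real (Suc n)"

lemma grid_0 [simp]: "grid s t n 0 = s"
 by (simp add: grid_def)

lemma grid_last [simp]: "grid s t n (Suc n) = t"
 by (simp add: grid_def)

lemma grid_step: "grid s t n (Suc k) - grid s t n k = (t - s) / real (Suc n)"
 by (simp add: grid_def distrib_left add_divide_distrib)

lemma grid_mono: "s \<le> t \<Longrightarrow> k \<le> l \<Longrightarrow> grid s t n k \<le> grid s t n l"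
 unfolding grid_def by (intro add_left_mono divide_right_mono mult_left_mono) auto

lemma grid_ge: "s \<le> t \<Longrightarrow> s \<le> grid s t n k"
 using grid_mono[of s t 0 k n] by simp

lemma grid_le: "s \<le> t \<Longrightarrow> k \<le> Suc n \<Longrightarrow> grid s t n k \<le> t"
 using grid_mono[of s t k "Suc n" n] by simp

lemma telescope_grid:
 fixes f :: "real \<Rightarrow> real"
 shows "(\<Sum>k<Suc n. f (grid s t n (Suc k)) - f (grid s t n k)) = f t - f s"
 using sum_lessThan_telescope[of "\<lambda>k. f (grid s t n k)" "Suc n"] by simp

lemma set_integrable_subset_real:
 fixes f :: "real \<Rightarrow> real"
 assumes "set_integrable lborel A f" "B \<in> sets borel" "B \<subseteq> A"
 shows "set_integrable lborel B f"
 by (rule set_integrable_subset[OF assms(1)]) (use assms in auto)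

lemma sum_grid_integral:
 fixes f :: "real \<Rightarrow> real"
 assumes f: "set_integrable lborel {s<..t} f" and st: "s \<le> t"
 shows "(\<Sum>k<Suc n. LINT r:{grid s t n k<..grid s t n (Suc k)}|lborel. f r) = (LINT r:{s<..t}|lborel. f r)"
proof -
 have "K \<le> Suc n \<Longrightarrow> (\<Sum>k<K. LINT r:{grid s t n k<..grid s t n (Suc k)}|lborel. f r) = (LINT r:{s<..grid s t n K}|lborel. f r)" for K
 proof (induction K)
  case 0
  then show ?case by (simp add: set_lebesgue_integral_def)
 next
  case (Suc K)
  have g: "s \<le> grid s t n K" "grid s t n K \<le> grid s t n (Suc K)" "grid s t n (Suc K) \<le> t"
   using Suc.prems st by (auto intro: grid_ge grid_mono grid_le)
  have "{s<..grid s t n (Suc K)} = {s<..grid s t n K} \<union> {grid s t n K<..grid s t n (Suc K)}" using g by auto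
  then have "(LINT r:{s<..grid s t n (Suc K)}|lborel. f r) =
   (LINT r:{s<..grid s t n K}|lborel. f r) + (LINT r:{grid s t n K<..grid s t n (Suc K)}|lborel. f r)"
   using g by (simp only:) (intro set_integral_Un set_integrable_subset_real[OF f]; auto)
  then show ?case using Suc by simp
 qed
 from this[of "Suc n"] show ?thesis by simp
qed

lemma set_integral_abs_le:
 fixes f :: "real \<Rightarrow> real"
 assumes "set_integrable lborel A f"
 shows "\<bar>LINT r:A|lborel. f r\<bar> \<le> (LINT r:A|lborel. \<bar>f r\<bar>)"
proof -
 have "\<bar>LINT r:A|lborel. f r\<bar> \<le> (LINT r|lborel. \<bar>indicator A r *\<^sub>R f r\<bar>)"
  unfolding set_lebesgue_integral_def by (rule integral_abs_bound)
 also have "\<dots> = (LINT r:A|lborel. \<bar>f r\<bar>)"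
  unfolding set_lebesgue_integral_def by (intro lint_cong) (auto simp: abs_mult)
 finally show ?thesis .
qed

lemma set_integrable_abs_real:
 fixes f :: "real \<Rightarrow> real"
 shows "set_integrable lborel A f \<Longrightarrow> set_integrable lborel A (\<lambda>r. \<bar>f r\<bar>)"
 by (rule set_integrable_abs)

lemma set_integral_mono_set:
 fixes f :: "real \<Rightarrow> real"
 assumes "set_integrable lborel B f" "A \<in> sets borel" "A \<subseteq> B" "\<And>r. 0 \<le> f r"
 shows "(LINT r:A|lborel. f r) \<le> (LINT r:B|lborel. f r)"
 unfolding set_lebesgue_integral_def
proof (rule integral_mono)
 show "integrable lborel (\<lambda>r. indicator A r *\<^sub>R f r)"
  using set_integrable_subset_real[OF assms(1-3)] by (simp add: set_integrable_def)
 show "integrable lborel (\<lambda>r. indicator B r *\<^sub>R f r)" using assms(1) by (simp add: set_integrable_def)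
 show "indicator A r *\<^sub>R f r \<le> indicator B r *\<^sub>R f r" for r using assms(3,4) by (auto simp: indicator_def)
qed

lemma set_integrable_bounded_mult:
 fixes f g :: "real \<Rightarrow> real"
 assumes f: "set_integrable lborel A f" and g: "g \<in> borel_measurable borel" "\<And>r. r \<in> A \<Longrightarrow> \<bar>g r\<bar> \<le> C"
  and A: "A \<in> sets borel"
 shows "set_integrable lborel A (\<lambda>r. g r * f r)"
proof -
 let ?A = "\<lambda>r. indicator A r *\<^sub>R f r"
 have "integrable lborel (\<lambda>r. \<bar>C\<bar> * (?A r))"
  using f by (intro integrable_mult_right) (simp add: set_integrable_def)
 then have "integrable lborel (\<lambda>r. (indicator A r * g r) * (?A r))"
 proof (rule integrable_dominated)
  show "(\<lambda>r. (indicator A r * g r) * (?A r)) \<in> borel_measurable lborel"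
   using f g A by (intro borel_measurable_times) (auto simp: set_integrable_def dest: borel_measurable_integrable)
  show "AE r in lborel. norm ((indicator A r * g r) * (?A r)) \<le> norm (\<bar>C\<bar> * (?A r))"
  proof (rule AE_I2)
   fix r
   have "\<bar>g r\<bar> * \<bar>f r\<bar> \<le> \<bar>C\<bar> * \<bar>f r\<bar>" if "r \<in> A"
    using g(2)[OF that] by (intro mult_right_mono) auto
   then show "norm ((indicator A r * g r) * (?A r)) \<le> norm (\<bar>C\<bar> * (?A r))"
    by (auto simp: indicator_def abs_mult)
  qed
 qed
 then show ?thesis unfolding set_integrable_def by (rule back_subst[of "integrable lborel"]) (auto simp: indicator_def)
qed

lemma set_integrable_const_Ioc: "set_integrable lborel {a<..b::real} (\<lambda>_. c::real)"
 unfolding set_integrable_def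
 by (rule integrableI_bounded_set_indicator[where B="\<bar>c\<bar>"]) (use emeasure_lborel_Ioc_finite in auto)

lemma set_integrable_bounded_Ioc:
 fixes g :: "real \<Rightarrow> real"
 assumes "g \<in> borel_measurable borel" "\<And>r. r \<in> {a<..b} \<Longrightarrow> \<bar>g r\<bar> \<le> C"
 shows "set_integrable lborel {a<..b} g"
 using set_integrable_bounded_mult[OF set_integrable_const_Ioc[of a b 1] assms] by simp

lemma set_integral_const_Ioc: "a \<le> b \<Longrightarrow> (LINT r:{a<..b}|lborel. c) = (b - a) * (c::real)"
 by (simp add: set_lebesgue_integral_def measure_lborel_Ioc_max)

text \<open>The integrator is the signed measure \<open>f dr\<close>, for which \<open>f\<close>
  need only be integrable. Uniform continuity of \<open>g\<close> bounds the error by a small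
  multiple of the integral of \<open>\<bar>f\<bar>\<close>.\<close>

lemma riemann_stieltjes_tendsto:
 fixes f g :: "real \<Rightarrow> real"
 assumes f: "set_integrable lborel {s<..t} f" and st: "s \<le> t"
  and g: "continuous_on {s..t} g" "g \<in> borel_measurable borel"
 shows "(\<lambda>n. \<Sum>k<Suc n. g (grid s t n k) * (LINT r:{grid s t n k<..grid s t n (Suc k)}|lborel. f r))
   \<longlonglongrightarrow> (LINT r:{s<..t}|lborel. g r * f r)"
proof (rule LIMSEQ_I)
 let ?A = "\<lambda>s. LINT r:{s<..t}|lborel. g r * f r"
 fix e :: real assume e: "0 < e"
 define v where "v = (LINT r:{s<..t}|lborel. \<bar>f r\<bar>)"
 have v: "0 \<le> v" unfolding v_def set_lebesgue_integral_def by (intro lint_nonneg) auto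
 \<comment> \<open>The summand 1 keeps the quotient meaningful when \<open>f\<close> has total
   variation 0.\<close>
 define \<eta> where "\<eta> = e / (2 * (v + 1))"
 have \<eta>: "0 < \<eta>" using e v by (simp add: \<eta>_def)
 have \<eta>v: "\<eta> * v < e"
 proof -
  have "\<eta> * v \<le> \<eta> * (v + 1)" using \<eta> by simp
  also have "\<dots> = e / 2" using v by (simp add: \<eta>_def field_simps)
  finally show ?thesis using e by simp
 qed
 have "uniformly_continuous_on {s..t} g" by (rule compact_uniformly_continuous[OF g(1)]) simp
 then obtain \<delta> where \<delta>: "0 < \<delta>" "\<And>x y. x \<in> {s..t} \<Longrightarrow> y \<in> {s..t} \<Longrightarrow> dist y x < \<delta> \<Longrightarrow> dist (g y) (g x) < \<eta>"
  using \<eta> unfolding uniformly_continuous_on_def by blast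
 obtain n0 :: nat where n0: "(t - s) / \<delta> < real n0" using reals_Archimedean2 by blast
 have "bounded (g ` {s..t})" by (intro compact_imp_bounded compact_continuous_image g) simp
 then obtain C where "\<forall>x\<in>g ` {s..t}. norm x \<le> C" unfolding bounded_iff by blast
 then have C: "\<And>r. r \<in> {s..t} \<Longrightarrow> \<bar>g r\<bar> \<le> C" by simp
 have gf: "set_integrable lborel {s<..t} (\<lambda>r. g r * f r)"
  by (rule set_integrable_bounded_mult[OF f g(2), of C]) (use C in auto)
 show "\<exists>n0. \<forall>n\<ge>n0. norm ((\<Sum>k<Suc n. g (grid s t n k) * (LINT r:{grid s t n k<..grid s t n (Suc k)}|lborel. f r))
   - (?A s)) < e"
 proof (intro exI allI impI)
  fix n assume "n0 \<le> n"
  then have "(t - s) / \<delta> < real (Suc n)" using n0 by linarith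
  then have step: "(t - s) / real (Suc n) < \<delta>" using \<delta>(1) by (simp add: field_simps)
  let ?I = "\<lambda>k. {grid s t n k<..grid s t n (Suc k)}"
  have sub: "?I k \<subseteq> {s<..t}" if "k < Suc n" for k
   using grid_ge[OF st, of n k] grid_le[OF st, of "Suc k" n] that by auto
  have one: "\<bar>g (grid s t n k) * (LINT r:?I k|lborel. f r) - (LINT r:?I k|lborel. g r * f r)\<bar> \<le> \<eta> * (LINT r:?I k|lborel. \<bar>f r\<bar>)"
   if k: "k < Suc n" for k
  proof -
   have fk: "set_integrable lborel (?I k) f" and gfk: "set_integrable lborel (?I k) (\<lambda>r. g r * f r)"
    using sub[OF k] by (auto intro: set_integrable_subset_real[OF f] set_integrable_subset_real[OF gf])
   have "\<bar>g (grid s t n k) * (LINT r:?I k|lborel. f r) - (LINT r:?I k|lborel. g r * f r)\<bar>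
    = norm (LINT r|lborel. indicator (?I k) r *\<^sub>R (g (grid s t n k) * f r - g r * f r))"
    using fk gfk by (subst scaleR_diff_right, subst lint_diff)
     (auto simp: set_lebesgue_integral_def set_integrable_def mult.left_commute)
   also have "\<dots> \<le> (LINT r|lborel. \<eta> * (indicator (?I k) r *\<^sub>R \<bar>f r\<bar>))"
   proof (rule norm_integral_le)
    have "set_integrable lborel (?I k) (\<lambda>r. g (grid s t n k) * f r - g r * f r)"
     by (intro set_integral_diff(1) gfk set_integrable_mult_right fk)
    then show "integrable lborel (\<lambda>r. indicator (?I k) r *\<^sub>R (g (grid s t n k) * f r - g r * f r))"
     by (simp add: set_integrable_def)
    show "integrable lborel (\<lambda>r. \<eta> * (indicator (?I k) r *\<^sub>R \<bar>f r\<bar>))"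
     using set_integrable_abs_real[OF fk] by (intro integrable_mult_right) (simp add: set_integrable_def)
    fix r
    show "norm (indicator (?I k) r *\<^sub>R (g (grid s t n k) * f r - g r * f r)) \<le> \<eta> * (indicator (?I k) r *\<^sub>R \<bar>f r\<bar>)"
    proof (cases "r \<in> ?I k")
     case True
     then have "r \<in> {s..t}" "grid s t n k \<in> {s..t}"
      using sub[OF k] grid_ge[OF st, of n k] grid_le[OF st, of k n] k by auto
     moreover have "dist (grid s t n k) r < \<delta>"
      using True step grid_step[of s t n k] by (auto simp: dist_real_def)
     ultimately have "\<bar>g (grid s t n k) - g r\<bar> \<le> \<eta>" using \<delta>(2) by (force simp: dist_real_def)
     then have "\<bar>g (grid s t n k) - g r\<bar> * \<bar>f r\<bar> \<le> \<eta> * \<bar>f r\<bar>" by (rule mult_right_mono) simp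
     then show ?thesis using True by (simp add: left_diff_distrib[symmetric] abs_mult)
    qed simp
   qed
   also have "\<dots> = \<eta> * (LINT r:?I k|lborel. \<bar>f r\<bar>)" by (simp add: set_lebesgue_integral_def)
   finally show ?thesis .
  qed
  have "\<bar>(\<Sum>k<Suc n. g (grid s t n k) * (LINT r:?I k|lborel. f r)) - (?A s)\<bar>
   = \<bar>\<Sum>k<Suc n. g (grid s t n k) * (LINT r:?I k|lborel. f r) - (LINT r:?I k|lborel. g r * f r)\<bar>"
   by (simp only: sum_subtractf sum_grid_integral[OF gf st])
  also have "\<dots> \<le> (\<Sum>k<Suc n. \<eta> * (LINT r:?I k|lborel. \<bar>f r\<bar>))"
   by (rule order_trans[OF sum_abs]) (intro sum_mono one, simp)
  also have "\<dots> = \<eta> * v"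
   unfolding v_def by (simp only: sum_distrib_left[symmetric] sum_grid_integral[OF set_integrable_abs_real[OF f] st])
  finally show "norm ((\<Sum>k<Suc n. g (grid s t n k) * (LINT r:?I k|lborel. f r)) - (?A s)) < e"
   using \<eta>v by simp
 qed
qed

text \<open>The modulus of continuity restricted to neighbouring grid points: a maximum of finitely
  many terms, hence measurable when \<open>h\<close> is random.\<close>

definition oscillation :: "real \<Rightarrow> real \<Rightarrow> (real \<Rightarrow> real) \<Rightarrow> nat \<Rightarrow> real" where
 "oscillation s t h n = Max ((\<lambda>k. \<bar>h (grid s t n (Suc k)) - h (grid s t n k)\<bar>) ` {..<Suc n})"

lemma oscillation_ge: "k < Suc n \<Longrightarrow> \<bar>h (grid s t n (Suc k)) - h (grid s t n k)\<bar> \<le> oscillation s t h n"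
 unfolding oscillation_def by (intro Max_ge) auto

lemma oscillation_le:
 "(\<And>k. k < Suc n \<Longrightarrow> \<bar>h (grid s t n (Suc k)) - h (grid s t n k)\<bar> \<le> C) \<Longrightarrow> oscillation s t h n \<le> C"
 unfolding oscillation_def by (intro Max.boundedI) auto

lemma oscillation_nonneg: "0 \<le> oscillation s t h n"
 using order_trans[OF abs_ge_zero oscillation_ge[of 0 n h s t]] by simp

lemma oscillation_tendsto_0:
 assumes st: "s \<le> t" and h: "continuous_on {s..t} h"
 shows "(\<lambda>n. oscillation s t h n) \<longlonglongrightarrow> 0"
proof (rule LIMSEQ_I)
 fix e :: real assume e: "0 < e"
 have "uniformly_continuous_on {s..t} h" by (rule compact_uniformly_continuous[OF h]) simp
 then obtain \<delta> where \<delta>: "0 < \<delta>" "\<And>x y. x \<in> {s..t} \<Longrightarrow> y \<in> {s..t} \<Longrightarrow> dist y x < \<delta> \<Longrightarrow> dist (h y) (h x) < e / 2"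
  using e half_gt_zero[OF e] unfolding uniformly_continuous_on_def by metis
 obtain n0 :: nat where n0: "(t - s) / \<delta> < real n0" using reals_Archimedean2 by blast
 have "oscillation s t h n < e" if "n0 \<le> n" for n
 proof -
  have "(t - s) / \<delta> < real (Suc n)" using n0 that by linarith
  then have step: "(t - s) / real (Suc n) < \<delta>" using \<delta>(1) by (simp add: field_simps)
  have "oscillation s t h n \<le> e / 2"
  proof (rule oscillation_le)
   fix k assume k: "k < Suc n"
   have "dist (grid s t n (Suc k)) (grid s t n k) < \<delta>"
    using step grid_step[of s t n k] st by (simp add: dist_real_def)
   then have "dist (h (grid s t n (Suc k))) (h (grid s t n k)) < e / 2"
    using \<delta>(2)[of "grid s t n k" "grid s t n (Suc k)"] grid_ge[OF st, of n] grid_le[OF st, of _ n] k by auto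
   then show "\<bar>h (grid s t n (Suc k)) - h (grid s t n k)\<bar> \<le> e / 2" by (simp add: dist_real_def)
  qed
  then show ?thesis using e by simp
 qed
 then show "\<exists>n0. \<forall>n\<ge>n0. norm (oscillation s t h n - 0) < e" using oscillation_nonneg by auto
qed

section \<open>Joint measurability of processes\<close>

lemma set_integral_process_measurable:
 fixes H :: "real \<Rightarrow> 'w \<Rightarrow> real"
 assumes H: "(\<lambda>(r, w). H r w) \<in> borel_measurable (borel \<Otimes>\<^sub>M M)" and A: "A \<in> sets borel"
 shows "(\<lambda>w. LINT r:A|lborel. H r w) \<in> borel_measurable M"
proof -
 have lb: "sets (borel \<Otimes>\<^sub>M M) = sets (lborel \<Otimes>\<^sub>M M)" by (intro sets_pair_measure_cong) auto
 have H': "(\<lambda>x. H (fst x) (snd x)) \<in> borel_measurable (lborel \<Otimes>\<^sub>M M)"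
  using H measurable_cong_sets[OF lb refl, of "borel :: real measure"] by (simp add: split_beta')
 have H2: "(\<lambda>x. H (snd x) (fst x)) \<in> borel_measurable (M \<Otimes>\<^sub>M lborel)"
  using measurable_compose[OF measurable_pair_swap'[of M lborel], OF H'] by (simp add: split_beta')
 have ind: "(\<lambda>x. indicator A (snd x) :: real) \<in> borel_measurable (M \<Otimes>\<^sub>M lborel)"
  by (rule measurable_compose[OF measurable_snd]) (use A in simp)
 show ?thesis unfolding set_lebesgue_integral_def
  by (rule lborel.borel_measurable_lebesgue_integral, unfold split_beta', intro borel_measurable_scaleR ind H2)
qed

lemma process_section_measurable:
 fixes H :: "real \<Rightarrow> 'w \<Rightarrow> real"
 assumes H: "(\<lambda>(r, w). H r w) \<in> borel_measurable (borel \<Otimes>\<^sub>M M)"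
 shows "w \<in> space M \<Longrightarrow> (\<lambda>r. H r w) \<in> borel_measurable borel" and "(\<lambda>w. H r w) \<in> borel_measurable M"
 using measurable_compose[OF measurable_Pair2' H, of w] measurable_compose[OF measurable_Pair1' H, of r]
 by simp_all

text \<open>The time is rounded down to multiples of \<open>1 / (n + 1)\<close>. The rounded process
  takes its times from a countable set and is therefore jointly measurable; continuity of the paths
  gives the limit. Negative times are sent to 0, where the process is still constrained.\<close>

lemma continuous_process_measurable:
 fixes X :: "real \<Rightarrow> 'w \<Rightarrow> real"
 assumes m: "\<And>t. 0 \<le> t \<Longrightarrow> X t \<in> borel_measurable M"
  and c: "\<And>w. w \<in> space M \<Longrightarrow> continuous_on {0..} (\<lambda>t. X t w)"
 shows "(\<lambda>(r, w). X (max 0 r) w) \<in> borel_measurable (borel \<Otimes>\<^sub>M M)"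
 unfolding split_beta'
proof (rule borel_measurable_LIMSEQ_real)
 let ?A = "\<lambda>n r. nat \<lfloor>real (Suc n) * r\<rfloor>"
 let ?B = "borel \<Otimes>\<^sub>M M"
 let ?f = "\<lambda>n x. X (real (nat \<lfloor>real (Suc n) * max 0 (fst x)\<rfloor>) / real (Suc n)) (snd x)"
 show "?f n \<in> borel_measurable ?B" for n
 proof (rule measurable_compose_countable[where f="\<lambda>k x. X (real (k::nat) / real (Suc n)) (snd x)" and g="\<lambda>x. nat \<lfloor>real (Suc n) * max 0 (fst x)\<rfloor>"])
  show "(\<lambda>x. X (real k / real (Suc n)) (snd x)) \<in> borel_measurable ?B" for k
   by (rule measurable_compose[OF measurable_snd m]) simp
  show "(\<lambda>x. nat \<lfloor>real (Suc n) * max 0 (fst x)\<rfloor>) \<in> measurable ?B (count_space UNIV)"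
   by (intro measurable_compose[OF measurable_fst]) measurable
 qed
 fix x :: "real \<times> 'w" assume "x \<in> space ?B"
 then have w: "snd x \<in> space M" by (auto simp: space_pair_measure)
 define r where "r = max 0 (fst x)"
 have r: "0 \<le> r" by (simp add: r_def)
 let ?a = "\<lambda>n. real (?A n r) / real (Suc n)"
 have "?a \<longlonglongrightarrow> r"
 proof (rule tendsto_sandwich[of "\<lambda>n. r - 1 / real (Suc n)" _ _ "\<lambda>_. r"])
  have e: "real (?A n r) = of_int \<lfloor>real (Suc n) * r\<rfloor>" for n using r by simp
  show "\<forall>\<^sub>F n in sequentially. r - 1 / real (Suc n) \<le> ?a n"
  proof (rule always_eventually, rule allI)
   fix n
   have "real (Suc n) * r - 1 \<le> real (?A n r)" unfolding e by linarith
   then have "(real (Suc n) * r - 1) / real (Suc n) \<le> ?a n" by (intro divide_right_mono) auto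
   then show "r - 1 / real (Suc n) \<le> ?a n" by (simp add: diff_divide_distrib)
  qed
  show "\<forall>\<^sub>F n in sequentially. ?a n \<le> r"
  proof (rule always_eventually, rule allI)
   fix n
   have "real (?A n r) \<le> real (Suc n) * r" unfolding e by linarith
   then show "?a n \<le> r" by (simp add: divide_le_eq mult.commute)
  qed
  have "(\<lambda>n. r - 1 / real (Suc n)) \<longlonglongrightarrow> r - 0"
   by (intro tendsto_diff tendsto_const LIMSEQ_Suc[OF lim_1_over_n])
  then show "(\<lambda>n. r - 1 / real (Suc n)) \<longlonglongrightarrow> r" by simp
 qed auto
 then show "(\<lambda>n. ?f n x) \<longlonglongrightarrow> X (max 0 (fst x)) (snd x)"
  using continuous_on_tendsto_compose[OF c[OF w], of ?a r sequentially] r by (simp add: r_def)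
qed

section \<open>Semimartingales with values in the unit interval\<close>

text \<open>From here on the Brownian motions enter only through these consequences: orthogonal
  square integrable martingales \<open>J\<close> with bracket \<open>2 X (1 - X) dt\<close>, tested
  against bounded variables of the past. The substantial requirement is \<open>drift_sq_int\<close>,
  because the Jacobi drift is singular at collisions.\<close>

locale ito_system = prob_space M for M :: "'w measure" +
 fixes F :: "real \<Rightarrow> 'w measure" and I :: "'i set" and X \<alpha> J :: "'i \<Rightarrow> real \<Rightarrow> 'w \<Rightarrow> real"
 assumes finite_I: "finite I"
  and space_F: "\<And>t. space (F t) = space M" and sets_F: "\<And>t. sets (F t) \<subseteq> sets M"
  and mono_F: "\<And>s t. s \<le> t \<Longrightarrow> sets (F s) \<subseteq> sets (F t)"
  and X_adapted: "\<And>i t. i \<in> I \<Longrightarrow> 0 \<le> t \<Longrightarrow> X i t \<in> borel_measurable (F t)"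
  and X_joint: "\<And>i. i \<in> I \<Longrightarrow> (\<lambda>(r, w). X i r w) \<in> borel_measurable (borel \<Otimes>\<^sub>M M)"
  and X_cont: "\<And>i w. i \<in> I \<Longrightarrow> w \<in> space M \<Longrightarrow> continuous_on {0..} (\<lambda>t. X i t w)"
  and X_nonneg: "\<And>i t w. i \<in> I \<Longrightarrow> w \<in> space M \<Longrightarrow> 0 \<le> X i t w"
  and X_le_1: "\<And>i t w. i \<in> I \<Longrightarrow> w \<in> space M \<Longrightarrow> X i t w \<le> 1"
  and drift_joint: "\<And>i. i \<in> I \<Longrightarrow> (\<lambda>(r, w). \<alpha> i r w) \<in> borel_measurable (borel \<Otimes>\<^sub>M M)"
  and J_adapted: "\<And>i t. i \<in> I \<Longrightarrow> 0 \<le> t \<Longrightarrow> J i t \<in> borel_measurable (F t)"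
  and J_cont: "\<And>i w. i \<in> I \<Longrightarrow> w \<in> space M \<Longrightarrow> continuous_on {0..} (\<lambda>t. J i t w)"
  and J_sq_int: "\<And>i t. i \<in> I \<Longrightarrow> 0 \<le> t \<Longrightarrow> sq_int M (J i t)"
  and J_martingale: "\<And>i s t Z D. i \<in> I \<Longrightarrow> 0 \<le> s \<Longrightarrow> s \<le> t \<Longrightarrow> Z \<in> borel_measurable (F s) \<Longrightarrow>
    (\<And>w. w \<in> space M \<Longrightarrow> \<bar>Z w\<bar> \<le> D) \<Longrightarrow> \<E> (\<lambda>w. Z w * (J i t w - J i s w)) = 0"
  and J_orthogonal: "\<And>i j s t Z D. i \<in> I \<Longrightarrow> j \<in> I \<Longrightarrow> i \<noteq> j \<Longrightarrow> 0 \<le> s \<Longrightarrow> s \<le> t \<Longrightarrow> Z \<in> borel_measurable (F s) \<Longrightarrow>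
    (\<And>w. w \<in> space M \<Longrightarrow> \<bar>Z w\<bar> \<le> D) \<Longrightarrow>
    \<E> (\<lambda>w. Z w * ((J i t w - J i s w) * (J j t w - J j s w))) = 0"
  and J_isometry: "\<And>i s t Z D. i \<in> I \<Longrightarrow> 0 \<le> s \<Longrightarrow> s \<le> t \<Longrightarrow> Z \<in> borel_measurable (F s) \<Longrightarrow>
    (\<And>w. w \<in> space M \<Longrightarrow> \<bar>Z w\<bar> \<le> D) \<Longrightarrow>
    \<E> (\<lambda>w. Z w * (J i t w - J i s w)^2) =
    \<E> (\<lambda>w. Z w * (LINT r:{s<..t}|lborel. 2 * X i r w * (1 - X i r w)))"
  and decomposition: "\<And>i. i \<in> I \<Longrightarrow> AE w in M. \<forall>t\<ge>0. set_integrable lborel {0..t} (\<lambda>r. \<alpha> i r w) \<and>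
    X i t w = X i 0 w + J i t w + (LINT r:{0..t}|lborel. \<alpha> i r w)"
  and drift_sq_int: "\<And>i t. i \<in> I \<Longrightarrow> 0 \<le> t \<Longrightarrow> sq_int M (\<lambda>w. LINT r:{0..t}|lborel. \<bar>\<alpha> i r w\<bar>)"
begin

lemma F_measurable_mono: "s \<le> t \<Longrightarrow> f \<in> measurable (F s) N \<Longrightarrow> f \<in> measurable (F t) N"
 using mono_F[of s t] by (auto simp: measurable_def space_F)

lemma F_measurable: "f \<in> measurable (F s) N \<Longrightarrow> f \<in> measurable M N"
 using sets_F[of s] by (auto simp: measurable_def space_F)

lemma X_measurable: "i \<in> I \<Longrightarrow> X i t \<in> borel_measurable M"
 using process_section_measurable(2)[OF X_joint] .

definition quadratic :: "'i \<Rightarrow> real \<Rightarrow> 'w \<Rightarrow> real" where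
 "quadratic i r w = 2 * X i r w * (1 - X i r w)"

lemma quadratic_joint: "i \<in> I \<Longrightarrow> (\<lambda>(r, w). quadratic i r w) \<in> borel_measurable (borel \<Otimes>\<^sub>M M)"
 using X_joint[of i] unfolding quadratic_def split_beta' by measurable

lemma quadratic_bounds:
 assumes "i \<in> I" "w \<in> space M"
 shows "0 \<le> quadratic i r w" "quadratic i r w \<le> 1"
proof -
 show "0 \<le> quadratic i r w" using X_nonneg[OF assms, of r] X_le_1[OF assms, of r] by (simp add: quadratic_def)
 have "0 \<le> (2 * X i r w - 1)^2" by simp
 then show "quadratic i r w \<le> 1" unfolding quadratic_def power2_eq_square by (simp add: algebra_simps)
qed

definition variation :: "'i \<Rightarrow> real \<Rightarrow> 'w \<Rightarrow> real" where
 "variation i t w = (LINT r:{0..t}|lborel. \<bar>\<alpha> i r w\<bar>)"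

lemma variation_nonneg: "0 \<le> variation i t w"
 unfolding variation_def set_lebesgue_integral_def by (intro lint_nonneg) auto

lemma variation_sq_int: "i \<in> I \<Longrightarrow> 0 \<le> t \<Longrightarrow> sq_int M (variation i t)"
 using drift_sq_int[of i t] by (simp add: variation_def[abs_def])

abbreviation inc :: "('i \<Rightarrow> real \<Rightarrow> 'w \<Rightarrow> real) \<Rightarrow> 'i \<Rightarrow> real \<Rightarrow> real \<Rightarrow> nat \<Rightarrow> nat \<Rightarrow> 'w \<Rightarrow> real" where
 "inc Y i s t n k w \<equiv> Y i (grid s t n (Suc k)) w - Y i (grid s t n k) w"

text \<open>The initial value plus the finite variation part. As a difference it is defined and
  continuous on every path, while its integral representation holds only almost surely.\<close>

definition A :: "'i \<Rightarrow> real \<Rightarrow> 'w \<Rightarrow> real" where "A i t w = X i t w - J i t w"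

lemma A_cont: "i \<in> I \<Longrightarrow> w \<in> space M \<Longrightarrow> continuous_on {0..} (\<lambda>t. A i t w)"
 unfolding A_def by (intro continuous_on_diff X_cont J_cont)

lemma A_measurable: "i \<in> I \<Longrightarrow> 0 \<le> t \<Longrightarrow> A i t \<in> borel_measurable M"
 unfolding A_def[abs_def] using X_measurable J_sq_int by (auto dest: sq_int_measurable)

text \<open>The exceptional null set does not depend on the times, so the representation holds along
  all partitions simultaneously.\<close>

lemma drift_increment:
 assumes i: "i \<in> I"
 shows "AE w in M. \<forall>s t. 0 \<le> s \<longrightarrow> s \<le> t \<longrightarrow> set_integrable lborel {s<..t} (\<lambda>r. \<alpha> i r w) \<and>
   A i t w - A i s w = (LINT r:{s<..t}|lborel. \<alpha> i r w) \<and>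
   (LINT r:{s<..t}|lborel. \<bar>\<alpha> i r w\<bar>) \<le> variation i t w"
 using decomposition[OF i]
proof eventually_elim
 case (elim w)
 show ?case
 proof (intro allI impI)
  fix s t :: real assume st: "0 \<le> s" "s \<le> t"
  then have t: "0 \<le> t" by simp
  have it: "set_integrable lborel {0..t} (\<lambda>r. \<alpha> i r w)" using elim t by blast
  have i1: "set_integrable lborel {s<..t} (\<lambda>r. \<alpha> i r w)" "set_integrable lborel {0..s} (\<lambda>r. \<alpha> i r w)"
   using st by (auto intro!: set_integrable_subset_real[OF it])
  have "{0..t} = {0..s} \<union> {s<..t}" using st by auto
  then have "(LINT r:{0..t}|lborel. \<alpha> i r w) = (LINT r:{0..s}|lborel. \<alpha> i r w) + (LINT r:{s<..t}|lborel. \<alpha> i r w)"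
   by (simp only:) (intro set_integral_Un i1; auto)
  moreover have "X i t w = X i 0 w + J i t w + (LINT r:{0..t}|lborel. \<alpha> i r w)"
   "X i s w = X i 0 w + J i s w + (LINT r:{0..s}|lborel. \<alpha> i r w)"
   using elim st t by blast+
  ultimately have "A i t w - A i s w = (LINT r:{s<..t}|lborel. \<alpha> i r w)" by (simp add: A_def)
  moreover have "(LINT r:{s<..t}|lborel. \<bar>\<alpha> i r w\<bar>) \<le> variation i t w"
   unfolding variation_def
   by (rule set_integral_mono_set[OF set_integrable_abs_real[OF it]]) (use st in auto)
  ultimately show "set_integrable lborel {s<..t} (\<lambda>r. \<alpha> i r w) \<and>
   A i t w - A i s w = (LINT r:{s<..t}|lborel. \<alpha> i r w) \<and>
   (LINT r:{s<..t}|lborel. \<bar>\<alpha> i r w\<bar>) \<le> variation i t w" using i1 by auto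
 qed
qed

text \<open>Truncation of \<open>Z\<close> at level \<open>n\<close> and dominated convergence.
  Partial sums of stochastic integrals are used as test variables, and these are square integrable
  but not bounded.\<close>

lemma J_martingale_sq_int:
 assumes i: "i \<in> I" and st: "0 \<le> s" "s \<le> t" and Z: "Z \<in> borel_measurable (F s)" "sq_int M Z"
 shows "\<E> (\<lambda>w. Z w * (J i t w - J i s w)) = 0"
proof -
 let ?A = "\<lambda>n w. max (- real n) (min (real n) (Z w)) * (J i t w - J i s w)"
 let ?B = "\<lambda>w n. max (- real n) (min (real n) (Z w)) * (J i t w - J i s w)"
 let ?C = "\<lambda>w. J i t w - J i s w"
 have Jd: "sq_int M ?C" using J_sq_int[OF i] st by (intro sq_int_diff) auto
 have [measurable]: "Z \<in> borel_measurable M" "?C \<in> borel_measurable M"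
  using Z(2) Jd by (auto dest: sq_int_measurable)
 have "(\<lambda>n. \<E> (?A n)) \<longlonglongrightarrow> \<E> (\<lambda>w. Z w * (J i t w - J i s w))"
 proof (rule integral_dominated_convergence[where w="\<lambda>w. \<bar>Z w * (J i t w - J i s w)\<bar>"])
  show "integrable M (\<lambda>w. \<bar>Z w * (J i t w - J i s w)\<bar>)" using sq_int_mult[OF Z(2) Jd] by simp
  show "AE w in M. (?B w) \<longlonglongrightarrow> Z w * (J i t w - J i s w)"
  proof (rule AE_I2)
   fix w
   obtain n0 :: nat where n0: "\<bar>Z w\<bar> \<le> real n0" using real_arch_simple by blast
   have "\<forall>\<^sub>F n in sequentially. max (- real n) (min (real n) (Z w)) * (J i t w - J i s w) = Z w * (J i t w - J i s w)"
    using eventually_ge_at_top[of n0]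
   proof eventually_elim
    case (elim n)
    then have "real n0 \<le> real n" by simp
    then have "- real n \<le> Z w" "Z w \<le> real n" using n0 by linarith+
    then show ?case by simp
   qed
   then show "(?B w) \<longlonglongrightarrow> Z w * (J i t w - J i s w)"
    by (rule tendsto_eventually)
  qed
  show "AE w in M. norm (max (- real n) (min (real n) (Z w)) * (J i t w - J i s w)) \<le> \<bar>Z w * (J i t w - J i s w)\<bar>" for n
   by (intro AE_I2) (auto simp: abs_mult intro!: mult_right_mono)
 qed measurable
 moreover have "\<E> (?A n) = 0" for n
  by (rule J_martingale[OF i st, of _ "real n"]) (use Z(1) in auto)
 ultimately show ?thesis by (simp add: LIMSEQ_const_iff)
qed

text \<open>Coefficients allowed in the left-point sums: adaptedness removes the martingale
  increments, continuity makes the sums converge, and the bound provides domination.\<close>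

definition weight :: "real \<Rightarrow> real \<Rightarrow> (real \<Rightarrow> 'w \<Rightarrow> real) \<Rightarrow> real \<Rightarrow> bool" where
 "weight s t G C \<longleftrightarrow> (\<forall>r\<in>{s..t}. G r \<in> borel_measurable (F r)) \<and>
   (\<lambda>(r, w). G r w) \<in> borel_measurable (borel \<Otimes>\<^sub>M M) \<and>
   (\<forall>w\<in>space M. continuous_on {s..t} (\<lambda>r. G r w)) \<and>
   (\<forall>w\<in>space M. \<forall>r\<in>{s..t}. \<bar>G r w\<bar> \<le> C)"

lemma weightD:
 assumes "weight s t G C"
 shows "\<And>r. r \<in> {s..t} \<Longrightarrow> G r \<in> borel_measurable (F r)"
  "(\<lambda>(r, w). G r w) \<in> borel_measurable (borel \<Otimes>\<^sub>M M)"
  "\<And>w. w \<in> space M \<Longrightarrow> continuous_on {s..t} (\<lambda>r. G r w)"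
  "\<And>w r. w \<in> space M \<Longrightarrow> r \<in> {s..t} \<Longrightarrow> \<bar>G r w\<bar> \<le> C"
  "\<And>r. G r \<in> borel_measurable M"
  "\<And>w. w \<in> space M \<Longrightarrow> (\<lambda>r. G r w) \<in> borel_measurable borel"
 using assms process_section_measurable[of G M] by (auto simp: weight_def)

section \<open>Left-point sums along uniform partitions\<close>

context
 fixes s t :: real assumes st: "0 \<le> s" "s \<le> t"
begin

lemma grid_range:
 assumes "k \<le> Suc n"
 shows "grid s t n k \<in> {s..t}" "0 \<le> grid s t n k"
 using grid_ge[OF st(2), of n k] grid_le[OF st(2) assms] st by auto

lemma grid_increasing: "grid s t n k \<le> grid s t n (Suc k)"
 using grid_mono[OF st(2)] by simp

lemma inc_X_measurable: "i \<in> I \<Longrightarrow> inc X i s t n k \<in> borel_measurable M"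
 using X_measurable by simp

lemma inc_X_bounded: "i \<in> I \<Longrightarrow> w \<in> space M \<Longrightarrow> \<bar>inc X i s t n k w\<bar> \<le> 1"
 using X_nonneg X_le_1 by (smt (verit))

lemma inc_J_sq_int: "i \<in> I \<Longrightarrow> k \<le> n \<Longrightarrow> sq_int M (inc J i s t n k)"
 using J_sq_int grid_range by (intro sq_int_diff) auto

lemma inc_A_measurable: "i \<in> I \<Longrightarrow> k \<le> n \<Longrightarrow> inc A i s t n k \<in> borel_measurable M"
 using A_measurable grid_range by (intro borel_measurable_diff) auto

lemma inc_split: "inc X i s t n k w = inc J i s t n k w + inc A i s t n k w"
 by (simp add: A_def)

lemma sum_abs_inc_A:
 assumes i: "i \<in> I"
 shows "AE w in M. \<forall>n. (\<Sum>k<Suc n. \<bar>inc A i s t n k w\<bar>) \<le> variation i t w"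
 using drift_increment[OF i]
proof eventually_elim
 case (elim w)
 have f: "set_integrable lborel {s<..t} (\<lambda>r. \<alpha> i r w)" using elim st by blast
 show ?case
 proof
  fix n
  have "(\<Sum>k<Suc n. \<bar>inc A i s t n k w\<bar>) \<le> (\<Sum>k<Suc n. LINT r:{grid s t n k<..grid s t n (Suc k)}|lborel. \<bar>\<alpha> i r w\<bar>)"
  proof (rule sum_mono)
   fix k assume k: "k \<in> {..<Suc n}"
   have "0 \<le> grid s t n k" "grid s t n k \<le> grid s t n (Suc k)" using grid_range[of k n] k grid_increasing by auto
   with elim have "set_integrable lborel {grid s t n k<..grid s t n (Suc k)} (\<lambda>r. \<alpha> i r w)"
    "inc A i s t n k w = (LINT r:{grid s t n k<..grid s t n (Suc k)}|lborel. \<alpha> i r w)" by blast+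
   then show "\<bar>inc A i s t n k w\<bar> \<le> (LINT r:{grid s t n k<..grid s t n (Suc k)}|lborel. \<bar>\<alpha> i r w\<bar>)"
    using set_integral_abs_le by metis
  qed
  also have "\<dots> = (LINT r:{s<..t}|lborel. \<bar>\<alpha> i r w\<bar>)"
   by (rule sum_grid_integral[OF set_integrable_abs_real[OF f] st(2)])
  also have "\<dots> \<le> variation i t w" using elim st by blast
  finally show "(\<Sum>k<Suc n. \<bar>inc A i s t n k w\<bar>) \<le> variation i t w" .
 qed
qed

lemma weighted_sum_abs_le:
 assumes G: "weight s t G C" and w: "w \<in> space M" and f: "(\<Sum>k<Suc n. \<bar>f k\<bar>) \<le> B"
 shows "\<bar>\<Sum>k<Suc n. G (grid s t n k) w * f k\<bar> \<le> \<bar>C\<bar> * B"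
proof -
 have "\<bar>\<Sum>k<Suc n. G (grid s t n k) w * f k\<bar> \<le> (\<Sum>k<Suc n. \<bar>C\<bar> * \<bar>f k\<bar>)"
 proof (rule order_trans[OF sum_abs], rule sum_mono)
  fix k assume "k \<in> {..<Suc n}"
  then have "\<bar>G (grid s t n k) w\<bar> \<le> \<bar>C\<bar>" using weightD(4)[OF G w] grid_range[of k n] by fastforce
  then show "\<bar>G (grid s t n k) w * f k\<bar> \<le> \<bar>C\<bar> * \<bar>f k\<bar>" unfolding abs_mult by (rule mult_right_mono) simp
 qed
 also have "\<dots> = \<bar>C\<bar> * (\<Sum>k<Suc n. \<bar>f k\<bar>)" by (rule sum_distrib_left[symmetric])
 also have "\<dots> \<le> \<bar>C\<bar> * B" using f by (rule mult_left_mono) simp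
 finally show ?thesis .
qed

text \<open>The weight is known at the left end of each cell, so the increments of \<open>J\<close>
  have mean zero against it. What remains is a Stieltjes sum for \<open>A\<close>, convergent on
  almost every path and dominated by the total variation.\<close>

lemma weighted_first_order:
 assumes G: "weight s t G C" and i: "i \<in> I"
 shows "(\<lambda>n. \<E> (\<lambda>w. \<Sum>k<Suc n. G (grid s t n k) w * inc X i s t n k w))
  \<longlonglongrightarrow> \<E> (\<lambda>w. LINT r:{s<..t}|lborel. G r w * \<alpha> i r w)"
proof -
 let ?A = "\<lambda>n w. \<Sum>k<Suc n. G (grid s t n k) w * inc A i s t n k w"
 let ?B = "\<lambda>n k w. G (grid s t n k) w * inc X i s t n k w"
 let ?C = "\<lambda>w. LINT r:{s<..t}|lborel. G r w * \<alpha> i r w"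
 let ?D = "\<lambda>n k w. G (grid s t n k) w * inc J i s t n k w"
 let ?E = "\<lambda>n k w. G (grid s t n k) w * inc A i s t n k w"
 let ?F = "\<lambda>n k w. LINT r:{grid s t n k<..grid s t n (Suc k)}|lborel. \<alpha> i r w"
 note Gm = weightD(5)[OF G]
 have t: "0 \<le> t" using st by simp
 have Gb: "\<bar>G (grid s t n k) w\<bar> \<le> C" if "k \<le> n" "w \<in> space M" for n k w
  using weightD(4)[OF G that(2)] grid_range[of k n] that by auto
 have iJ: "integrable M (?D n k)" if "k \<le> n" for n k
  by (rule sq_int_imp_integrable[OF sq_int_bounded_mult[OF inc_J_sq_int[OF i that] Gm Gb[OF that]]])
 have iX: "integrable M (?B n k)" if "k \<le> n" for n k
  by (rule sq_int_imp_integrable[OF sq_int_bounded_mult[OF sq_int_bounded[OF inc_X_measurable[OF i] inc_X_bounded[OF i]] Gm Gb[OF that]]])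
 have iA: "integrable M (?E n k)" if "k \<le> n" for n k
  using lint_integrable_diff[OF iX[OF that] iJ[OF that]]
  by (simp add: A_def algebra_simps)
 have eq: "\<E> (\<lambda>w. \<Sum>k<Suc n. G (grid s t n k) w * inc X i s t n k w) =
   \<E> (?A n)" for n
 proof -
  have "\<E> (?B n k) = \<E> (?E n k)"
   if k: "k \<le> n" for k
  proof -
   have "\<E> (?D n k) = 0"
    by (rule J_martingale[OF i _ grid_increasing weightD(1)[OF G] Gb[OF k]]) (use grid_range[of k n] k in auto)
   moreover have "\<E> (?B n k) =
    \<E> (\<lambda>w. G (grid s t n k) w * inc J i s t n k w + G (grid s t n k) w * inc A i s t n k w)"
    by (simp only: inc_split distrib_left)
   ultimately show ?thesis using iJ[OF k] iA[OF k] by simp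
  qed
  then show ?thesis
   using iX iA by (subst (1 2) lint_sum) (auto intro!: sum.cong)
 qed
 have "(\<lambda>n. \<E> (?A n))
  \<longlonglongrightarrow> \<E> ?C"
 proof (rule integral_dominated_convergence[where w="\<lambda>w. \<bar>C\<bar> * variation i t w"])
  show "?C \<in> borel_measurable M"
   using weightD(2)[OF G] drift_joint[OF i]
   by (intro set_integral_process_measurable) (auto simp: split_beta')
  show "(?A n) \<in> borel_measurable M" for n
   using Gm inc_A_measurable[OF i] by (intro borel_measurable_sum borel_measurable_times) auto
  show "integrable M (\<lambda>w. \<bar>C\<bar> * variation i t w)"
   using sq_int_imp_integrable[OF variation_sq_int[OF i t]] by simp
  show "AE w in M. (\<lambda>n. \<Sum>k<Suc n. G (grid s t n k) w * inc A i s t n k w) \<longlonglongrightarrow> (LINT r:{s<..t}|lborel. G r w * \<alpha> i r w)"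
   using drift_increment[OF i] AE_space
  proof eventually_elim
   case (elim w)
   have f: "set_integrable lborel {s<..t} (\<lambda>r. \<alpha> i r w)" using elim st by blast
   have "inc A i s t n k w = (?F n k w)" if "k < Suc n" for n k
    using elim(1) grid_range[of k n] grid_increasing[of n k] that by auto
   then have "(\<Sum>k<Suc n. G (grid s t n k) w * inc A i s t n k w) =
    (\<Sum>k<Suc n. G (grid s t n k) w * (?F n k w))" for n
    by (intro sum.cong) auto
   then show ?case
    using riemann_stieltjes_tendsto[OF f st(2) weightD(3)[OF G elim(2)] weightD(6)[OF G elim(2)]] by simp
  qed
  show "AE w in M. norm (\<Sum>k<Suc n. G (grid s t n k) w * inc A i s t n k w) \<le> \<bar>C\<bar> * variation i t w" for n
   using sum_abs_inc_A[OF i] AE_space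
  proof eventually_elim
   case (elim w)
   show ?case unfolding real_norm_def
    by (rule weighted_sum_abs_le[OF G elim(2) elim(1)[rule_format]])
  qed
 qed
 then show ?thesis unfolding eq .
qed

lemma osc_X_measurable: "i \<in> I \<Longrightarrow> (\<lambda>w. oscillation s t (\<lambda>r. X i r w) n) \<in> borel_measurable M"
 unfolding oscillation_def using X_measurable by (intro borel_measurable_Max) auto

lemma osc_X_tendsto: "i \<in> I \<Longrightarrow> w \<in> space M \<Longrightarrow> (\<lambda>n. oscillation s t (\<lambda>r. X i r w) n) \<longlonglongrightarrow> 0"
 using st by (intro oscillation_tendsto_0 continuous_on_subset[OF X_cont]) auto

lemma osc_A_tendsto: "i \<in> I \<Longrightarrow> w \<in> space M \<Longrightarrow> (\<lambda>n. oscillation s t (\<lambda>r. A i r w) n) \<longlonglongrightarrow> 0"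
 using st by (intro oscillation_tendsto_0 continuous_on_subset[OF A_cont]) auto

lemma osc_X_le_1: "i \<in> I \<Longrightarrow> w \<in> space M \<Longrightarrow> oscillation s t (\<lambda>r. X i r w) n \<le> 1"
 by (intro oscillation_le inc_X_bounded)

lemma sum_product_le:
 fixes a b :: "nat \<Rightarrow> real"
 assumes "\<And>k. k < n \<Longrightarrow> \<bar>a k\<bar> \<le> x" "(\<Sum>k<n. \<bar>b k\<bar>) \<le> y" "0 \<le> x"
 shows "(\<Sum>k<n. \<bar>a k * b k\<bar>) \<le> x * y"
proof -
 have "(\<Sum>k<n. \<bar>a k * b k\<bar>) \<le> (\<Sum>k<n. x * \<bar>b k\<bar>)"
  by (intro sum_mono) (use assms in \<open>auto simp: abs_mult intro!: mult_right_mono\<close>)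
 also have "\<dots> \<le> x * y" using assms by (simp add: sum_distrib_left[symmetric] mult_left_mono)
 finally show ?thesis .
qed

text \<open>For increments of \<open>J\<close> the expectations are exact: zero for different
  particles, the integrated bracket for the same one. All other products contain an increment of
  \<open>A\<close> and are at most an oscillation times a total variation.\<close>

lemma weighted_second_order:
 assumes G: "weight s t G C" and ij: "i \<in> I" "j \<in> I"
 shows "(\<lambda>n. \<E> (\<lambda>w. \<Sum>k<Suc n. G (grid s t n k) w * (inc X i s t n k w * inc X j s t n k w)))
  \<longlonglongrightarrow> (if i = j then \<E> (\<lambda>w. LINT r:{s<..t}|lborel. G r w * quadratic i r w) else 0)"
proof -
 let ?A = "\<lambda>n w. \<Sum>k<Suc n. G (grid s t n k) w * (inc J i s t n k w * inc J j s t n k w)"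
 let ?B = "\<lambda>n k w. G (grid s t n k) w * (inc J i s t n k w * inc J j s t n k w)"
 let ?C = "\<lambda>w. LINT r:{s<..t}|lborel. G r w * quadratic i r w"
 let ?D = "\<lambda>w. variation j t w + variation i t w + variation i t w * variation j t w"
 let ?F = "\<lambda>n w. \<Sum>k<Suc n. G (grid s t n k) w * (inc X i s t n k w * inc X j s t n k w)"
 note Gm = weightD(5)[OF G]
 have t: "0 \<le> t" using st by simp
 have Gb: "\<bar>G (grid s t n k) w\<bar> \<le> C" if "k \<le> n" "w \<in> space M" for n k w
  using weightD(4)[OF G that(2)] grid_range[of k n] that by auto
 have iJ: "integrable M (?B n k)" if "k \<le> n" for n k
  using sq_int_mult[OF sq_int_bounded_mult[OF inc_J_sq_int[OF ij(1) that] Gm Gb[OF that]] inc_J_sq_int[OF ij(2) that]]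
  by (simp add: mult.assoc)
 have iX: "integrable M (\<lambda>w. G (grid s t n k) w * (inc X i s t n k w * inc X j s t n k w))" if "k \<le> n" for n k
  using sq_int_mult[OF sq_int_bounded_mult[OF sq_int_bounded[OF inc_X_measurable[OF ij(1)] inc_X_bounded[OF ij(1)]] Gm Gb[OF that]]
   sq_int_bounded[OF inc_X_measurable[OF ij(2)] inc_X_bounded[OF ij(2)]]]
  by (simp add: mult.assoc)
 let ?L = "if i = j then \<E> ?C else 0"
 have main: "(\<lambda>n. \<E> (?A n)) \<longlonglongrightarrow> ?L"
 proof (cases "i = j")
  case False
  have "\<E> (?B n k) = 0" if k: "k \<le> n" for n k
   by (rule J_orthogonal[OF ij False _ grid_increasing weightD(1)[OF G] Gb[OF k]]) (use grid_range[of k n] k in auto)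
  then have "\<E> (?A n) = 0" for n
   using iJ by (subst lint_sum) (auto intro!: sum.neutral)
  then show ?thesis using False by simp
 next
  case True
  let ?Q = "\<lambda>n k w. LINT r:{grid s t n k<..grid s t n (Suc k)}|lborel. quadratic i r w"
  have qi: "set_integrable lborel {u<..v} (\<lambda>r. quadratic i r w)" if "w \<in> space M" for u v w
  proof (rule set_integrable_bounded_Ioc)
   show "(\<lambda>r. quadratic i r w) \<in> borel_measurable borel"
    by (rule process_section_measurable(1)[OF quadratic_joint[OF ij(1)] that])
   show "\<bar>quadratic i r w\<bar> \<le> 1" for r using quadratic_bounds[OF ij(1) that, of r] by simp
  qed
  have Qm: "?Q n k \<in> borel_measurable M" for n k
   by (rule set_integral_process_measurable[OF quadratic_joint[OF ij(1)]]) simp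
  have Q0: "0 \<le> ?Q n k w" if "w \<in> space M" for n k w
   unfolding set_lebesgue_integral_def using quadratic_bounds[OF ij(1) that]
   by (intro lint_nonneg) auto
  have Qs: "(\<Sum>k<Suc n. ?Q n k w) \<le> t - s" if w: "w \<in> space M" for n w
  proof -
   have "(\<Sum>k<Suc n. ?Q n k w) = (LINT r:{s<..t}|lborel. quadratic i r w)"
    by (rule sum_grid_integral[OF qi[OF w] st(2)])
   also have "\<dots> \<le> (LINT r:{s<..t}|lborel. 1)"
    by (rule set_integral_mono[OF qi[OF w] set_integrable_const_Ioc]) (use quadratic_bounds[OF ij(1) w] in auto)
   also have "\<dots> = t - s" using st by (simp add: set_integral_const_Ioc)
   finally show ?thesis .
  qed
  have Qle: "?Q n k w \<le> t - s" if "w \<in> space M" "k \<le> n" for n k w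
  proof -
   have "?Q n k w \<le> (\<Sum>k<Suc n. ?Q n k w)"
    by (rule member_le_sum) (use that Q0 in auto)
   then show ?thesis using Qs[OF that(1), of n] by linarith
  qed
  have iQ: "integrable M (\<lambda>w. G (grid s t n k) w * ?Q n k w)" if k: "k \<le> n" for n k
  proof (rule sq_int_imp_integrable[OF sq_int_bounded_mult[OF _ Gm Gb[OF k]]])
   show "sq_int M (?Q n k)" by (rule sq_int_bounded[OF Qm, where C="t - s"]) (use Q0 Qle k in auto)
  qed
  have "\<E> (?A n) =
    \<E> (\<lambda>w. \<Sum>k<Suc n. G (grid s t n k) w * ?Q n k w)" for n
  proof -
   have "\<E> (?B n k) =
     \<E> (\<lambda>w. G (grid s t n k) w * ?Q n k w)" if k: "k \<le> n" for k
    unfolding True[symmetric] power2_eq_square[symmetric] quadratic_def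
    by (rule J_isometry[OF ij(1) _ grid_increasing weightD(1)[OF G] Gb[OF k]]) (use grid_range[of k n] k in auto)
   then show ?thesis
    using iJ iQ by (subst (1 2) lint_sum) (auto intro!: sum.cong)
  qed
  moreover have "(\<lambda>n. \<E> (\<lambda>w. \<Sum>k<Suc n. G (grid s t n k) w * ?Q n k w))
   \<longlonglongrightarrow> \<E> ?C"
  proof (rule integral_dominated_convergence[where w="\<lambda>w. \<bar>C\<bar> * (t - s)"])
   show "?C \<in> borel_measurable M"
    using weightD(2)[OF G] quadratic_joint[OF ij(1)]
    by (intro set_integral_process_measurable) (auto simp: split_beta')
   show "(\<lambda>w. \<Sum>k<Suc n. G (grid s t n k) w * ?Q n k w) \<in> borel_measurable M" for n
    using Gm Qm by (intro borel_measurable_sum borel_measurable_times) auto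
   show "AE w in M. (\<lambda>n. \<Sum>k<Suc n. G (grid s t n k) w * ?Q n k w) \<longlonglongrightarrow> (LINT r:{s<..t}|lborel. G r w * quadratic i r w)"
    by (intro AE_I2 riemann_stieltjes_tendsto qi st weightD(3)[OF G] weightD(6)[OF G])
   show "AE w in M. norm (\<Sum>k<Suc n. G (grid s t n k) w * ?Q n k w) \<le> \<bar>C\<bar> * (t - s)" for n
   proof (rule AE_I2)
    fix w assume w: "w \<in> space M"
    have "(\<Sum>k<Suc n. \<bar>?Q n k w\<bar>) \<le> t - s" using Qs[OF w, of n] unfolding abs_of_nonneg[OF Q0[OF w]] .
    then show "norm (\<Sum>k<Suc n. G (grid s t n k) w * ?Q n k w) \<le> \<bar>C\<bar> * (t - s)"
     unfolding real_norm_def by (rule weighted_sum_abs_le[OF G w])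
   qed
  qed simp
  ultimately show ?thesis using True by simp
 qed
 let ?E = "\<lambda>n k w. inc X i s t n k w * inc A j s t n k w + inc X j s t n k w * inc A i s t n k w
   - inc A i s t n k w * inc A j s t n k w"
 \<comment> \<open>The error is written through \<open>X\<close> rather than \<open>J\<close>:
   oscillations of \<open>X\<close> are at most 1 on every path, which yields an integrable
   majorant.\<close>
 have split: "inc X i s t n k w * inc X j s t n k w = inc J i s t n k w * inc J j s t n k w + ?E n k w" for n k w
  by (simp add: A_def algebra_simps)
 have iE: "integrable M (\<lambda>w. G (grid s t n k) w * ?E n k w)" if "k \<le> n" for n k
  using lint_integrable_diff[OF iX[OF that] iJ[OF that]]
  unfolding right_diff_distrib[symmetric] by (simp add: split)
 have err: "(\<lambda>n. \<E> (\<lambda>w. \<Sum>k<Suc n. G (grid s t n k) w * ?E n k w)) \<longlonglongrightarrow> \<E> (\<lambda>w. 0)"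
 proof (rule integral_dominated_convergence[where w="\<lambda>w. \<bar>C\<bar> * (?D w)"])
  let ?b = "\<lambda>n w. \<bar>C\<bar> * (oscillation s t (\<lambda>r. X i r w) n * variation j t w +
    oscillation s t (\<lambda>r. X j r w) n * variation i t w + oscillation s t (\<lambda>r. A i r w) n * variation j t w)"
  show "(\<lambda>w. \<Sum>k<Suc n. G (grid s t n k) w * ?E n k w) \<in> borel_measurable M" for n
   using iE by (intro borel_measurable_sum) (auto dest: borel_measurable_integrable)
  show "integrable M (\<lambda>w. \<bar>C\<bar> * (?D w))"
   by (intro integrable_mult_right lint_integrable_add sq_int_imp_integrable sq_int_mult variation_sq_int ij t)
  have bd: "AE w in M. \<forall>n. \<bar>\<Sum>k<Suc n. G (grid s t n k) w * ?E n k w\<bar> \<le> ?b n w"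
   using sum_abs_inc_A[OF ij(1)] sum_abs_inc_A[OF ij(2)] AE_space
  proof eventually_elim
   case (elim w)
   show ?case
   proof
    fix n
    show "\<bar>\<Sum>k<Suc n. G (grid s t n k) w * ?E n k w\<bar> \<le> ?b n w"
    proof (rule weighted_sum_abs_le[OF G elim(3)])
     have "(\<Sum>k<Suc n. \<bar>?E n k w\<bar>) \<le> (\<Sum>k<Suc n. \<bar>inc X i s t n k w * inc A j s t n k w\<bar> + \<bar>inc X j s t n k w * inc A i s t n k w\<bar>
       + \<bar>inc A i s t n k w * inc A j s t n k w\<bar>)"
      by (intro sum_mono) linarith
     also have "\<dots> = (\<Sum>k<Suc n. \<bar>inc X i s t n k w * inc A j s t n k w\<bar>) + (\<Sum>k<Suc n. \<bar>inc X j s t n k w * inc A i s t n k w\<bar>)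
       + (\<Sum>k<Suc n. \<bar>inc A i s t n k w * inc A j s t n k w\<bar>)"
      by (simp only: sum.distrib)
     also have "\<dots> \<le> oscillation s t (\<lambda>r. X i r w) n * variation j t w +
      oscillation s t (\<lambda>r. X j r w) n * variation i t w + oscillation s t (\<lambda>r. A i r w) n * variation j t w"
      by (intro add_mono sum_product_le oscillation_nonneg
        oscillation_ge[of _ n "\<lambda>r. X i r w"] oscillation_ge[of _ n "\<lambda>r. X j r w"] oscillation_ge[of _ n "\<lambda>r. A i r w"]
        elim(1)[rule_format] elim(2)[rule_format])
     finally show "(\<Sum>k<Suc n. \<bar>?E n k w\<bar>) \<le> \<dots>" .
    qed
   qed
  qed
  show "AE w in M. (\<lambda>n. \<Sum>k<Suc n. G (grid s t n k) w * ?E n k w) \<longlonglongrightarrow> 0"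
   using bd AE_space
  proof eventually_elim
   case (elim w)
   have "(\<lambda>n. ?b n w) \<longlonglongrightarrow> \<bar>C\<bar> * (0 * variation j t w + 0 * variation i t w + 0 * variation j t w)"
    by (intro tendsto_intros osc_X_tendsto osc_A_tendsto ij elim(2))
   then have b0: "(\<lambda>n. ?b n w) \<longlonglongrightarrow> 0" by simp
   show ?case by (rule Lim_null_comparison[OF _ b0]) (use elim(1) in auto)
  qed
  \<comment> \<open>The oscillation of \<open>A\<close> is at most its total variation, so the
    majorant contains a product of two total variations. Its integrability is where their square
    integrability is needed.\<close>
  show "AE w in M. norm (\<Sum>k<Suc n. G (grid s t n k) w * ?E n k w) \<le> \<bar>C\<bar> * (?D w)" for n
   using bd sum_abs_inc_A[OF ij(1)] AE_space
  proof eventually_elim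
   case (elim w)
   have "oscillation s t (\<lambda>r. A i r w) n \<le> variation i t w"
   proof (rule oscillation_le)
    fix k assume "k < Suc n"
    then have "\<bar>inc A i s t n k w\<bar> \<le> (\<Sum>k<Suc n. \<bar>inc A i s t n k w\<bar>)"
     by (intro member_le_sum) auto
    also have "\<dots> \<le> variation i t w" using elim(2) by blast
    finally show "\<bar>A i (grid s t n (Suc k)) w - A i (grid s t n k) w\<bar> \<le> variation i t w" .
   qed
   then have "?b n w \<le> \<bar>C\<bar> * (1 * variation j t w + 1 * variation i t w + variation i t w * variation j t w)"
    using osc_X_le_1[OF ij(1) elim(3)] osc_X_le_1[OF ij(2) elim(3)] variation_nonneg
    by (intro mult_left_mono add_mono mult_right_mono) auto
   then show ?case using elim(1)[rule_format, of n] by simp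
  qed
 qed simp
 have "(\<lambda>n. \<E> (?A n) +
   \<E> (\<lambda>w. \<Sum>k<Suc n. G (grid s t n k) w * ?E n k w)) \<longlonglongrightarrow> ?L + \<E> (\<lambda>w. 0)"
  by (intro tendsto_add main err)
 moreover have "\<E> (?A n) +
   \<E> (\<lambda>w. \<Sum>k<Suc n. G (grid s t n k) w * ?E n k w) =
   \<E> (?F n)" for n
 proof -
  have "\<E> (?A n) +
   \<E> (\<lambda>w. \<Sum>k<Suc n. G (grid s t n k) w * ?E n k w) =
   \<E> (\<lambda>w. (\<Sum>k<Suc n. G (grid s t n k) w * (inc J i s t n k w * inc J j s t n k w)) +
    (\<Sum>k<Suc n. G (grid s t n k) w * ?E n k w))"
   by (intro lint_add[symmetric] lint_integrable_sum iJ iE; simp)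
  also have "\<dots> = \<E> (?F n)"
   by (simp only: split distrib_left sum.distrib)
  finally show ?thesis .
 qed
 ultimately show ?thesis by simp
qed

end

end

text \<open>By induction on the exponent: multiplying the expansion of \<open>y ^ n\<close> by
  \<open>y = x + h\<close> produces the next one and a single new cubic term with coefficient
  \<open>n (n - 1) / 2\<close>. The constant is thus uniform on the unit square.\<close>

lemma power_taylor:
 "\<exists>C\<ge>0. \<forall>x\<in>{0..1}. \<forall>y\<in>{0..1::real}.
   \<bar>y ^ n - x ^ n - real n * x ^ (n - 1) * (y - x) - real n * (real n - 1) / 2 * x ^ (n - 2) * (y - x)^2\<bar> \<le> C * \<bar>y - x\<bar> ^ 3"
proof (induction n)
 case 0
 then show ?case by (intro exI[of _ 0]) auto
next
 case (Suc n)
 then obtain C where C: "0 \<le> C" "\<And>x y. x \<in> {0..1} \<Longrightarrow> y \<in> {0..1::real} \<Longrightarrow>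
   \<bar>y ^ n - x ^ n - real n * x ^ (n - 1) * (y - x) - real n * (real n - 1) / 2 * x ^ (n - 2) * (y - x)^2\<bar> \<le> C * \<bar>y - x\<bar> ^ 3"
  by blast
 let ?c = "real n * (real n - 1) / 2"
 have c0: "0 \<le> ?c" by (cases n) auto
 show ?case
 proof (intro exI[of _ "C + ?c"] conjI ballI)
  fix x y :: real assume xy: "x \<in> {0..1}" "y \<in> {0..1}"
  define h where "h = y - x"
  define R where "R = y ^ n - x ^ n - real n * x ^ (n - 1) * h - ?c * x ^ (n - 2) * h^2"
  have y: "y = x + h" by (simp add: h_def)
  have yn: "y ^ n = x ^ n + real n * x ^ (n - 1) * h + ?c * x ^ (n - 2) * h^2 + R" by (simp add: R_def)
  \<comment> \<open>Where the truncated exponents \<open>n - 1\<close> and \<open>n - 2\<close> are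
    cut off at 0, the coefficient in front vanishes.\<close>
  have p1: "real n * (x ^ (n - 1) * x) = real n * x ^ n" by (cases n) auto
  have p2: "?c * (x ^ (n - 2) * x) = ?c * x ^ (n - 1)"
  proof (cases "n \<ge> 2")
   case True
   then obtain m where "n = 2 + m" using le_Suc_ex by blast
   then show ?thesis by simp
  next
   case False
   then have "n = 0 \<or> n = 1" by linarith
   then show ?thesis by auto
  qed
  have "y ^ Suc n = (x + h) * (x ^ n + real n * x ^ (n - 1) * h + ?c * x ^ (n - 2) * h^2 + R)"
   by (simp only: yn[symmetric] y[symmetric] power_Suc)
  also have "\<dots> = x ^ Suc n + (real n * (x ^ (n - 1) * x) + x ^ n) * h + (?c * (x ^ (n - 2) * x) + real n * x ^ (n - 1)) * h^2
    + ?c * x ^ (n - 2) * h ^ 3 + (x + h) * R"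
  proof -
   have "(x + h) * (p + real n * q * h + c * z * h^2 + R) = x * p + (real n * (q * x) + p) * h + (c * (z * x) + real n * q) * h^2
    + c * z * h ^ 3 + (x + h) * R" for p q z c
    by (simp add: algebra_simps power2_eq_square power3_eq_cube)
   then show ?thesis by (simp only: power_Suc)
  qed
  also have "x + h = y" by (simp add: h_def)
  also have "x ^ Suc n + (real n * (x ^ (n - 1) * x) + x ^ n) * h + (?c * (x ^ (n - 2) * x) + real n * x ^ (n - 1)) * h^2
    + ?c * x ^ (n - 2) * h ^ 3 + y * R = x ^ Suc n + real (Suc n) * x ^ n * h + (?c + real n) * x ^ (n - 1) * h^2
    + ?c * x ^ (n - 2) * h ^ 3 + y * R"
   unfolding p1 p2 by (simp add: algebra_simps)
  finally have e: "y ^ Suc n - x ^ Suc n - real (Suc n) * x ^ n * h - (?c + real n) * x ^ (n - 1) * h^2 =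
   ?c * x ^ (n - 2) * h ^ 3 + y * R" by simp
  have "\<bar>?c * x ^ (n - 2) * h ^ 3 + y * R\<bar> \<le> ?c * \<bar>h\<bar> ^ 3 + C * \<bar>h\<bar> ^ 3"
  proof (rule order_trans[OF abs_triangle_ineq], rule add_mono)
   have "x ^ (n - 2) \<le> 1" "0 \<le> x ^ (n - 2)" using xy by (auto intro: power_le_one)
   then have "?c * x ^ (n - 2) * \<bar>h\<bar> ^ 3 \<le> ?c * 1 * \<bar>h\<bar> ^ 3"
    using c0 by (intro mult_right_mono mult_left_mono) auto
   moreover have "\<bar>?c * x ^ (n - 2) * h ^ 3\<bar> = ?c * x ^ (n - 2) * \<bar>h\<bar> ^ 3"
    by (simp only: abs_mult[of "?c * x ^ (n - 2)"] power_abs abs_of_nonneg[OF mult_nonneg_nonneg[OF c0 \<open>0 \<le> x ^ (n - 2)\<close>]])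
   ultimately show "\<bar>?c * x ^ (n - 2) * h ^ 3\<bar> \<le> ?c * \<bar>h\<bar> ^ 3" by simp
   have "\<bar>y * R\<bar> \<le> 1 * \<bar>R\<bar>" unfolding abs_mult using xy by (intro mult_right_mono) auto
   also have "1 * \<bar>R\<bar> \<le> C * \<bar>h\<bar> ^ 3" using C(2)[OF xy] by (simp add: R_def h_def)
   finally show "\<bar>y * R\<bar> \<le> C * \<bar>h\<bar> ^ 3" .
  qed
  then have bound: "\<bar>?c * x ^ (n - 2) * h ^ 3 + y * R\<bar> \<le> (C + ?c) * \<bar>h\<bar> ^ 3"
   unfolding distrib_right[of C] by linarith
  have cc: "real (Suc n) * (real (Suc n) - 1) / 2 = ?c + real n" by (simp add: field_simps)
  have ex: "Suc n - 1 = n" "Suc n - 2 = n - 1" by simp_all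
  show "\<bar>y ^ Suc n - x ^ Suc n - real (Suc n) * x ^ (Suc n - 1) * (y - x)
    - real (Suc n) * (real (Suc n) - 1) / 2 * x ^ (Suc n - 2) * (y - x)^2\<bar> \<le> (C + ?c) * \<bar>y - x\<bar> ^ 3"
   unfolding cc ex h_def[symmetric] e by (rule bound)
 qed (use C c0 in auto)
qed

text \<open>On the unit interval the second-order and the cubic term are both at most a multiple of
  \<open>(y - x)^2\<close>. This coarser form serves for squared increments of power sums.\<close>

lemma power_taylor_first:
 "\<exists>C\<ge>0. \<forall>x\<in>{0..1}. \<forall>y\<in>{0..1::real}. \<bar>y ^ n - x ^ n - real n * x ^ (n - 1) * (y - x)\<bar> \<le> C * (y - x)^2"
proof -
 obtain C where C: "0 \<le> C" "\<And>x y. x \<in> {0..1} \<Longrightarrow> y \<in> {0..1::real} \<Longrightarrow>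
   \<bar>y ^ n - x ^ n - real n * x ^ (n - 1) * (y - x) - real n * (real n - 1) / 2 * x ^ (n - 2) * (y - x)^2\<bar> \<le> C * \<bar>y - x\<bar> ^ 3"
  using power_taylor[of n] by blast
 let ?c = "real n * (real n - 1) / 2"
 have c0: "0 \<le> ?c" by (cases n) auto
 have "\<bar>y ^ n - x ^ n - real n * x ^ (n - 1) * (y - x)\<bar> \<le> (C + ?c) * (y - x)^2" if xy: "x \<in> {0..1}" "y \<in> {0..1}" for x y :: real
 proof -
  have "x ^ (n - 2) \<le> 1" "0 \<le> x ^ (n - 2)" using xy by (auto intro: power_le_one)
  then have a: "?c * x ^ (n - 2) \<le> ?c * 1" and b: "0 \<le> ?c * x ^ (n - 2)"
   using c0 by (blast intro: mult_left_mono mult_nonneg_nonneg)+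
  then have "?c * x ^ (n - 2) * (y - x)^2 \<le> ?c * 1 * (y - x)^2" "0 \<le> ?c * x ^ (n - 2) * (y - x)^2"
   by (blast intro: mult_right_mono mult_nonneg_nonneg zero_le_power2)+
  then have "\<bar>?c * x ^ (n - 2) * (y - x)^2\<bar> \<le> ?c * 1 * (y - x)^2" by (simp only: abs_of_nonneg)
  moreover have "\<bar>y - x\<bar> ^ 3 \<le> \<bar>y - x\<bar> ^ 2" using xy by (intro power_decreasing) auto
  then have "C * \<bar>y - x\<bar> ^ 3 \<le> C * (y - x)^2" using C(1) by (intro mult_left_mono) auto
  moreover note C(2)[OF xy]
  ultimately show ?thesis unfolding distrib_right[of C] mult_1_right by linarith
 qed
 then show ?thesis using C c0 by (intro exI[of _ "C + ?c"]) auto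
qed

section \<open>Ito's formula for powers\<close>

context ito_system
begin

lemma quadratic_set_integrable:
 assumes "i \<in> I" "w \<in> space M"
 shows "set_integrable lborel {u<..v} (\<lambda>r. quadratic i r w)"
proof (rule set_integrable_bounded_Ioc)
 show "(\<lambda>r. quadratic i r w) \<in> borel_measurable borel"
  by (rule process_section_measurable(1)[OF quadratic_joint[OF assms(1)] assms(2)])
 show "\<bar>quadratic i r w\<bar> \<le> 1" for r using quadratic_bounds[OF assms, of r] by simp
qed

lemma quadratic_integral_bounds:
 assumes "i \<in> I" "w \<in> space M" "u \<le> v"
 shows "0 \<le> (LINT r:{u<..v}|lborel. quadratic i r w)" "(LINT r:{u<..v}|lborel. quadratic i r w) \<le> v - u"
proof -
 let ?A = "LINT r:{u<..v}|lborel. quadratic i r w"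
 show "0 \<le> ?A"
  unfolding set_lebesgue_integral_def using quadratic_bounds[OF assms(1,2)]
  by (intro lint_nonneg) auto
 have "?A \<le> (LINT r:{u<..v}|lborel. 1)"
  by (rule set_integral_mono[OF quadratic_set_integrable[OF assms(1,2)] set_integrable_const_Ioc])
   (use quadratic_bounds[OF assms(1,2)] in auto)
 then show "?A \<le> v - u" using assms(3) by (simp add: set_integral_const_Ioc)
qed

lemma isometry_bound:
 assumes i: "i \<in> I" and uv: "0 \<le> u" "u \<le> v" and Y: "Y \<in> borel_measurable (F u)" "\<And>w. w \<in> space M \<Longrightarrow> \<bar>Y w\<bar> \<le> 1"
 shows "\<E> (\<lambda>w. (Y w * (J i v w - J i u w))^2) \<le> v - u"
proof -
 have Y2: "\<bar>(Y w)^2\<bar> \<le> 1" if "w \<in> space M" for w using power_mono[OF Y(2)[OF that], of 2] by simp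
 have Ym: "Y \<in> borel_measurable M" by (rule F_measurable[OF Y(1)])
 let ?q = "\<lambda>w. LINT r:{u<..v}|lborel. quadratic i r w"
 have qm: "?q \<in> borel_measurable M" by (rule set_integral_process_measurable[OF quadratic_joint[OF i]]) simp
 have "\<E> (\<lambda>w. (Y w * (J i v w - J i u w))^2) = \<E> (\<lambda>w. (Y w)^2 * (J i v w - J i u w)^2)"
  by (simp add: power_mult_distrib)
 also have "\<dots> = \<E> (\<lambda>w. (Y w)^2 * ?q w)"
  unfolding quadratic_def by (rule J_isometry[OF i uv _ Y2]) (use Y(1) in auto)
 also have "\<dots> \<le> \<E> (\<lambda>w. v - u)"
 proof (rule integral_mono)
  have b: "\<bar>(Y w)^2 * ?q w\<bar> \<le> v - u" if w: "w \<in> space M" for w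
  proof -
   have "\<bar>(Y w)^2\<bar> * \<bar>?q w\<bar> \<le> 1 * (v - u)"
    using quadratic_integral_bounds[OF i w uv(2)] by (intro mult_mono Y2[OF w]) auto
   then show ?thesis by (simp add: abs_mult)
  qed
  then show "integrable M (\<lambda>w. (Y w)^2 * ?q w)"
   using Ym qm by (intro integrable_const_bound[where B="v - u"]) auto
  show "(Y w)^2 * ?q w \<le> v - u" if "w \<in> space M" for w using b[OF that] by linarith
 qed simp
 finally show ?thesis by (simp add: prob_space)
qed

text \<open>The drift of \<open>X ^ m\<close> in Ito's formula; half the bracket rate contributes a
  factor \<open>X * (1 - X)\<close>, whose \<open>X\<close> has been merged into the power.\<close>

definition power_drift :: "nat \<Rightarrow> 'i \<Rightarrow> real \<Rightarrow> 'w \<Rightarrow> real" where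
 "power_drift m i r w = real m * X i r w ^ (m - 1) * \<alpha> i r w + real m * (real m - 1) * (X i r w ^ (m - 1) * (1 - X i r w))"

context
 fixes s t :: real assumes st: "0 \<le> s" "s \<le> t"
begin

text \<open>A discrete stochastic integral: the cross term with the new increment has mean zero, so
  the second moments add, and each is at most the length of its cell because the weights lie in
  \<open>[0,1]\<close>.\<close>

lemma weighted_J_sum:
 assumes i: "i \<in> I"
 defines "R \<equiv> \<lambda>n K w. \<Sum>k<K. X i (grid s t n k) w * inc J i s t n k w"
 assumes K: "K \<le> Suc n"
 shows "sq_int M (R n K) \<and> R n K \<in> borel_measurable (F (grid s t n K)) \<and> \<E> (\<lambda>w. (R n K w)^2) \<le> grid s t n K - s"
 using K
proof (induction K)
 case 0
 then show ?case by (simp add: R_def)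
next
 case (Suc K)
 let ?g = "grid s t n K" and ?g' = "grid s t n (Suc K)"
 let ?Y = "X i ?g" and ?d = "\<lambda>w. J i ?g' w - J i ?g w"
 have K: "K \<le> Suc n" "K \<le> n" using Suc.prems by auto
 have g0: "0 \<le> ?g" "0 \<le> ?g'" using grid_range[OF st] Suc.prems by auto
 have gg: "?g \<le> ?g'" by (rule grid_increasing[OF st])
 have R: "R n (Suc K) = (\<lambda>w. R n K w + ?Y w * ?d w)" by (simp add: R_def)
 have IH: "sq_int M (R n K)" "R n K \<in> borel_measurable (F ?g)" "\<E> (\<lambda>w. (R n K w)^2) \<le> ?g - s"
  using Suc.IH[OF K(1)] by auto
 have Yb: "\<bar>?Y w\<bar> \<le> 1" if "w \<in> space M" for w using X_nonneg[OF i that] X_le_1[OF i that] by simp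
 have Ym: "?Y \<in> borel_measurable M" by (rule X_measurable[OF i])
 have d: "sq_int M ?d" by (rule inc_J_sq_int[OF st i K(2)])
 have Yd: "sq_int M (\<lambda>w. ?Y w * ?d w)" by (rule sq_int_bounded_mult[OF d Ym Yb])
 have RY: "sq_int M (\<lambda>w. ?Y w * R n K w)" by (rule sq_int_bounded_mult[OF IH(1) Ym Yb])
 have RYm: "(\<lambda>w. ?Y w * R n K w) \<in> borel_measurable (F ?g)"
  using X_adapted[OF i g0(1)] IH(2) by auto
 have z: "\<E> (\<lambda>w. (?Y w * R n K w) * ?d w) = 0"
  by (rule J_martingale_sq_int[OF i g0(1) gg RYm RY])
 have iz: "integrable M (\<lambda>w. (?Y w * R n K w) * ?d w)" by (rule sq_int_mult[OF RY d])
 have "\<E> (\<lambda>w. (R n (Suc K) w)^2) = \<E> (\<lambda>w. ((R n K w)^2 + (?Y w * ?d w)^2) + 2 * ((?Y w * R n K w) * ?d w))"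
  unfolding R by (intro lint_cong refl) (simp add: power2_sum mult_ac)
 also have "\<dots> = \<E> (\<lambda>w. (R n K w)^2) + \<E> (\<lambda>w. (?Y w * ?d w)^2)"
  using iz z sq_int_integrable_square[OF IH(1)] sq_int_integrable_square[OF Yd] by simp
 also have "\<dots> \<le> (?g - s) + (?g' - ?g)"
  by (intro add_mono IH(3) isometry_bound[OF i g0(1) gg X_adapted[OF i g0(1)] Yb])
 finally have e: "\<E> (\<lambda>w. (R n (Suc K) w)^2) \<le> ?g' - s" by simp
 have "R n (Suc K) \<in> borel_measurable (F ?g')"
  unfolding R
  by (intro borel_measurable_add borel_measurable_times borel_measurable_diff J_adapted[OF i g0(2)]
    F_measurable_mono[OF gg IH(2)] F_measurable_mono[OF gg X_adapted[OF i g0(1)]] F_measurable_mono[OF gg J_adapted[OF i g0(1)]])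
 then show ?case using e sq_int_add[OF IH(1) Yd] unfolding R by simp
qed

text \<open>A sum of squared increments is a telescoping difference minus twice a discrete
  stochastic integral of \<open>X\<close> against itself. This gives a second moment bound uniform
  in the partition from second moments of \<open>J\<close> alone, with no fourth moments of its
  increments.\<close>

lemma square_variation_moment:
 assumes i: "i \<in> I"
 shows "\<exists>B. \<forall>n. sq_int M (\<lambda>w. \<Sum>k<Suc n. (inc X i s t n k w)^2) \<and> \<E> (\<lambda>w. (\<Sum>k<Suc n. (inc X i s t n k w)^2)^2) \<le> B"
proof (intro exI allI conjI)
 let ?A = "\<lambda>w. (variation i t w)^2"
 let ?B = "\<lambda>n w. \<Sum>k<Suc n. (X i (grid s t n (Suc k)) w)^2 - (X i (grid s t n k) w)^2"
 fix n
 let ?Q = "\<lambda>w. \<Sum>k<Suc n. (inc X i s t n k w)^2"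
 let ?R = "\<lambda>w. \<Sum>k<Suc n. X i (grid s t n k) w * inc J i s t n k w"
 have t: "0 \<le> t" using st by simp
 have Qm: "?Q \<in> borel_measurable M" using X_measurable[OF i] by (intro borel_measurable_sum) auto
 have R: "sq_int M ?R" "\<E> (\<lambda>w. (?R w)^2) \<le> t - s"
  using weighted_J_sum[OF i, of "Suc n" n] by auto
 note V = variation_sq_int[OF i t]
 have Qb: "AE w in M. \<bar>?Q w\<bar> \<le> 1 + (2 * variation i t w + 2 * \<bar>?R w\<bar>)"
  using sum_abs_inc_A[OF st i] AE_space
 proof eventually_elim
  case (elim w)
  have Xb: "0 \<le> X i r w" "X i r w \<le> 1" for r using X_nonneg[OF i elim(2)] X_le_1[OF i elim(2)] by auto
  let ?S = "\<Sum>k<Suc n. X i (grid s t n k) w * inc A i s t n k w"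
  have S: "\<bar>?S\<bar> \<le> 1 * variation i t w"
  proof -
   have "\<bar>?S\<bar> \<le> (\<Sum>k<Suc n. \<bar>X i (grid s t n k) w * inc A i s t n k w\<bar>)" by (rule sum_abs)
   also have "\<dots> \<le> 1 * variation i t w"
    by (rule sum_product_le) (use Xb elim(1) in auto)
   finally show ?thesis .
  qed
  \<comment> \<open>This is \<open>(y - x)^2 = y^2 - x^2 - 2 x (y - x)\<close>, with the last
    increment split into its parts from \<open>A\<close> and \<open>J\<close>.\<close>
  have "(inc X i s t n k w)^2 = ((X i (grid s t n (Suc k)) w)^2 - (X i (grid s t n k) w)^2) -
    2 * (X i (grid s t n k) w * inc A i s t n k w) - 2 * (X i (grid s t n k) w * inc J i s t n k w)" for k
   by (simp add: A_def power2_eq_square algebra_simps)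
  then have "?Q w = (?B n w) - 2 * ?S - 2 * ?R w"
   by (simp only: sum_subtractf sum_distrib_left)
  also have "(?B n w) = (X i t w)^2 - (X i s w)^2"
   by (rule telescope_grid)
  finally have "?Q w = (X i t w)^2 - (X i s w)^2 - 2 * ?S - 2 * ?R w" .
  moreover have "\<bar>(X i t w)^2 - (X i s w)^2\<bar> \<le> 1"
   using Xb[of t] Xb[of s] power_le_one[of "X i t w" 2] power_le_one[of "X i s w" 2]
    zero_le_power2[of "X i t w"] zero_le_power2[of "X i s w"] by linarith
  ultimately show ?case using S by linarith
 qed
 have B: "sq_int M (\<lambda>w. 1 + (2 * variation i t w + 2 * \<bar>?R w\<bar>))"
  by (intro sq_int_add sq_int_cmult sq_int_abs V R) (auto simp: sq_int_def)
 show Q: "sq_int M ?Q"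
  by (rule sq_int_bound[OF B Qm]) (use Qb in \<open>auto elim!: eventually_mono\<close>)
 \<comment> \<open>The constants 2 and 16 arise from applying
   \<open>(x + y)^2 \<le> 2 x^2 + 2 y^2\<close> twice to \<open>1 + (2 V + 2 R)\<close>.\<close>
 have "\<E> (\<lambda>w. (?Q w)^2) \<le> \<E> (\<lambda>w. 2 + (16 * (variation i t w)^2 + 16 * (?R w)^2))"
 proof (rule integral_mono_AE)
  show "integrable M (\<lambda>w. (?Q w)^2)" by (rule sq_int_integrable_square[OF Q])
  show "integrable M (\<lambda>w. 2 + (16 * (variation i t w)^2 + 16 * (?R w)^2))"
   by (intro lint_integrable_add integrable_mult_right sq_int_integrable_square V R) auto
  show "AE w in M. (?Q w)^2 \<le> 2 + (16 * (variation i t w)^2 + 16 * (?R w)^2)"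
   using Qb
  proof eventually_elim
   case (elim w)
   have "(?Q w)^2 \<le> (1 + (2 * variation i t w + 2 * \<bar>?R w\<bar>))^2"
    using elim by (rule abs_le_square_iff[THEN iffD1, OF order_trans]) simp
   also have "\<dots> \<le> 2 * 1^2 + 2 * (2 * variation i t w + 2 * \<bar>?R w\<bar>)^2" by (rule power2_add_le)
   also have "(2 * variation i t w + 2 * \<bar>?R w\<bar>)^2 \<le> 2 * (2 * variation i t w)^2 + 2 * (2 * \<bar>?R w\<bar>)^2"
    by (rule power2_add_le)
   finally show ?case by (simp add: power_mult_distrib)
  qed
 qed
 also have "\<dots> = 2 + (16 * \<E> ?A + 16 * \<E> (\<lambda>w. (?R w)^2))"
  using sq_int_integrable_square[OF V] sq_int_integrable_square[OF R(1)]
  by (subst lint_add; (subst lint_add)?) (auto simp: prob_space simp del: sum.lessThan_Suc)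
 also have "\<dots> \<le> 2 + (16 * \<E> ?A + 16 * (t - s))"
  by (intro add_left_mono mult_left_mono R(2)) simp
 finally show "\<E> (\<lambda>w. (?Q w)^2) \<le> 2 + (16 * \<E> ?A + 16 * (t - s))" .
qed

text \<open>The cubic sum is at most the oscillation times the quadratic sum. By Cauchy-Schwarz it
  suffices that the oscillation, which is at most 1, tends to 0 in mean square while the quadratic
  sums stay bounded in \<open>L^2\<close>.\<close>

lemma cubic_variation_tendsto_0:
 assumes i: "i \<in> I"
 shows "(\<lambda>n. \<E> (\<lambda>w. \<Sum>k<Suc n. \<bar>inc X i s t n k w\<bar> ^ 3)) \<longlonglongrightarrow> 0"
proof -
 let ?A = "\<lambda>n w. \<Sum>k<Suc n. \<bar>inc X i s t n k w\<bar> ^ 3"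
 let ?Q = "\<lambda>n w. \<Sum>k<Suc n. (inc X i s t n k w)^2"
 let ?o = "\<lambda>n w. oscillation s t (\<lambda>r. X i r w) n"
 obtain B where B: "\<And>n. sq_int M (?Q n)" "\<And>n. \<E> (\<lambda>w. (?Q n w)^2) \<le> B"
  using square_variation_moment[OF i] by blast
 have om: "?o n \<in> borel_measurable M" for n by (rule osc_X_measurable[OF st i])
 have ob: "\<bar>?o n w\<bar> \<le> 1" if "w \<in> space M" for n w
  using osc_X_le_1[OF st i that] oscillation_nonneg by (simp add: abs_of_nonneg)
 have os: "sq_int M (?o n)" for n by (rule sq_int_bounded[OF om ob])
 have o0: "(\<lambda>n. \<E> (\<lambda>w. (?o n w)^2)) \<longlonglongrightarrow> \<E> (\<lambda>w. 0)"
 proof (rule integral_dominated_convergence[where w="\<lambda>_. 1"])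
  show "AE w in M. (\<lambda>n. (?o n w)^2) \<longlonglongrightarrow> 0"
  proof (rule AE_I2)
   fix w assume "w \<in> space M"
   from tendsto_power[OF osc_X_tendsto[OF st i this], of 2] show "(\<lambda>n. (?o n w)^2) \<longlonglongrightarrow> 0" by simp
  qed
  show "AE w in M. norm ((?o n w)^2) \<le> 1" for n
   using power_mono[OF ob, of _ n 2] by (intro AE_I2) auto
 qed (use om in auto)
 have bd: "\<E> (?A n) \<le> sqrt (\<E> (\<lambda>w. (?o n w)^2)) * sqrt B" for n
 proof -
  have "\<E> (?A n) \<le> \<E> (\<lambda>w. \<bar>?o n w * ?Q n w\<bar>)"
  proof (rule integral_mono)
   show "integrable M (?A n)"
   proof (rule lint_integrable_sum, rule integrable_const_bound[where B=1])
    fix k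
    show "AE w in M. norm (\<bar>inc X i s t n k w\<bar> ^ 3) \<le> 1"
     using inc_X_bounded[OF st i] by (intro AE_I2) (auto intro!: power_le_one)
   qed (use X_measurable[OF i] in auto)
   show "integrable M (\<lambda>w. \<bar>?o n w * ?Q n w\<bar>)" using sq_int_mult[OF os B(1)] by (rule integrable_abs)
   fix w assume w: "w \<in> space M"
   have "(\<Sum>k<Suc n. \<bar>inc X i s t n k w\<bar> ^ 3) \<le> (\<Sum>k<Suc n. ?o n w * (inc X i s t n k w)^2)"
   proof (rule sum_mono)
    fix k assume "k \<in> {..<Suc n}"
    then have "\<bar>inc X i s t n k w\<bar> \<le> ?o n w" using oscillation_ge[of k n "\<lambda>r. X i r w"] by simp
    then have "\<bar>inc X i s t n k w\<bar> * (inc X i s t n k w)^2 \<le> ?o n w * (inc X i s t n k w)^2" by (rule mult_right_mono) simp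
    then show "\<bar>inc X i s t n k w\<bar> ^ 3 \<le> ?o n w * (inc X i s t n k w)^2"
     by (simp add: power3_eq_cube power2_eq_square mult.assoc)
   qed
   also have "\<dots> = ?o n w * ?Q n w" by (simp only: sum_distrib_left)
   also have "\<dots> \<le> \<bar>?o n w * ?Q n w\<bar>" by simp
   finally show "(\<Sum>k<Suc n. \<bar>inc X i s t n k w\<bar> ^ 3) \<le> \<bar>?o n w * ?Q n w\<bar>" .
  qed
  also have "\<dots> \<le> sqrt (\<E> (\<lambda>w. (?o n w)^2)) * sqrt (\<E> (\<lambda>w. (?Q n w)^2))"
   by (rule integral_abs_mult_le[OF os B(1)])
  also have "\<dots> \<le> sqrt (\<E> (\<lambda>w. (?o n w)^2)) * sqrt B"
   by (intro mult_left_mono real_sqrt_le_mono B(2)) auto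
  finally show ?thesis .
 qed
 have "(\<lambda>n. sqrt (\<E> (\<lambda>w. (?o n w)^2)) * sqrt B) \<longlonglongrightarrow> sqrt (\<E> (\<lambda>w. 0)) * sqrt B"
  by (intro tendsto_intros o0)
 then have "(\<lambda>n. sqrt (\<E> (\<lambda>w. (?o n w)^2)) * sqrt B) \<longlonglongrightarrow> 0" by simp
 then show ?thesis
  by (intro tendsto_sandwich[OF _ always_eventually[OF allI[OF bd]] tendsto_const])
    (auto intro!: always_eventually lint_nonneg sum_nonneg simp del: sum.lessThan_Suc)
qed

lemma weight_power:
 assumes i: "i \<in> I" and Z: "Z \<in> borel_measurable (F s)" "\<And>w. w \<in> space M \<Longrightarrow> \<bar>Z w\<bar> \<le> D"
 shows "weight s t (\<lambda>r w. Z w * (c * X i r w ^ m)) (D * \<bar>c\<bar>)"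
 unfolding weight_def
proof (intro conjI ballI)
 show "(\<lambda>w. Z w * (c * X i r w ^ m)) \<in> borel_measurable (F r)" if "r \<in> {s..t}" for r
  using F_measurable_mono[OF _ Z(1), of r] X_adapted[OF i, of r] that st by auto
 have "(\<lambda>x. Z (snd x)) \<in> borel_measurable (borel \<Otimes>\<^sub>M M)"
  by (rule measurable_compose[OF measurable_snd F_measurable[OF Z(1)]])
 then show "(\<lambda>(r, w). Z w * (c * X i r w ^ m)) \<in> borel_measurable (borel \<Otimes>\<^sub>M M)"
  using X_joint[OF i] unfolding split_beta' by (intro borel_measurable_times borel_measurable_power) auto
 show "continuous_on {s..t} (\<lambda>r. Z w * (c * X i r w ^ m))" if "w \<in> space M" for w
  using st by (intro continuous_intros continuous_on_subset[OF X_cont[OF i that]]) auto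
 show "\<bar>Z w * (c * X i r w ^ m)\<bar> \<le> D * \<bar>c\<bar>" if w: "w \<in> space M" for w r
 proof -
  have "\<bar>X i r w ^ m\<bar> \<le> 1" using X_nonneg[OF i w] X_le_1[OF i w] by (simp add: power_le_one)
  then have "\<bar>c\<bar> * \<bar>X i r w ^ m\<bar> \<le> \<bar>c\<bar> * 1" by (rule mult_left_mono) simp
  then have "\<bar>Z w\<bar> * (\<bar>c\<bar> * \<bar>X i r w ^ m\<bar>) \<le> D * (\<bar>c\<bar> * 1)"
   by (rule mult_mono[OF Z(2)[OF w]]) (use Z(2)[OF w] in auto)
  then show ?thesis by (simp add: abs_mult)
 qed
qed

text \<open>The increment of \<open>X ^ m\<close> is telescoped over the grid and each step
  expanded. The expectation on the left does not depend on the grid, so it equals the sum of the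
  limits of the first-order, second-order and remainder sums. The test variable \<open>Z\<close>
  makes the result a martingale statement.\<close>

lemma ito_power:
 assumes i: "i \<in> I" and Z: "Z \<in> borel_measurable (F s)" "\<And>w. w \<in> space M \<Longrightarrow> \<bar>Z w\<bar> \<le> D"
 shows "integrable M (\<lambda>w. Z w * (LINT r:{s<..t}|lborel. power_drift m i r w))"
  and "\<E> (\<lambda>w. Z w * (X i t w ^ m - X i s w ^ m)) = \<E> (\<lambda>w. Z w * (LINT r:{s<..t}|lborel. power_drift m i r w))"
proof -
 let ?A = "\<lambda>n i w. \<Sum>k<Suc n. \<bar>inc X i s t n k w\<bar> ^ 3"
 let ?B = "\<lambda>i w. LINT r:{s<..t}|lborel. power_drift m i r w"
 let ?C = "\<lambda>i w. Z w * (X i t w ^ m - X i s w ^ m)"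
 let ?D = "\<lambda>n i w. \<Sum>k<Suc n. \<bar>inc X i s t n k w\<bar> ^ 3"
 let ?E = "\<lambda>n R w. \<Sum>k<Suc n. R n k w"
 have t: "0 \<le> t" using st by simp
 have Zm: "Z \<in> borel_measurable M" by (rule F_measurable[OF Z(1)])
 obtain w0 where "w0 \<in> space M" using not_empty by blast
 then have D: "0 \<le> D" using Z(2)[of w0] by linarith
 let ?c = "real m * (real m - 1) / 2"
 let ?G1 = "\<lambda>r w. Z w * (real m * X i r w ^ (m - 1))"
 let ?G2 = "\<lambda>r w. Z w * (?c * X i r w ^ (m - 2))"
 note G1 = weight_power[OF i Z, of "real m" "m - 1"] and G2 = weight_power[OF i Z, of ?c "m - 2"]
 obtain C where C: "0 \<le> C" "\<And>x y. x \<in> {0..1} \<Longrightarrow> y \<in> {0..1::real} \<Longrightarrow>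
   \<bar>y ^ m - x ^ m - real m * x ^ (m - 1) * (y - x) - ?c * x ^ (m - 2) * (y - x)^2\<bar> \<le> C * \<bar>y - x\<bar> ^ 3"
  using power_taylor[of m] by blast
 define R where "R n k w = Z w * (inc (\<lambda>i r w. X i r w ^ m) i s t n k w - real m * X i (grid s t n k) w ^ (m - 1) * inc X i s t n k w
   - ?c * X i (grid s t n k) w ^ (m - 2) * (inc X i s t n k w)^2)" for n k w
 have Rb: "\<bar>R n k w\<bar> \<le> D * C * \<bar>inc X i s t n k w\<bar> ^ 3" if w: "w \<in> space M" for n k w
 proof -
  have "X i r w \<in> {0..1}" for r using X_nonneg[OF i w] X_le_1[OF i w] by simp
  note C(2)[OF this this, of "grid s t n (Suc k)" "grid s t n k"]
  then have "\<bar>R n k w\<bar> \<le> D * (C * \<bar>inc X i s t n k w\<bar> ^ 3)"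
   unfolding R_def abs_mult[of "Z w"] by (intro mult_mono Z(2) w D) auto
  then show ?thesis by simp
 qed
 have bi: "integrable M f" if "f \<in> borel_measurable M" "\<And>w. w \<in> space M \<Longrightarrow> \<bar>f w\<bar> \<le> K" for f :: "'w \<Rightarrow> real" and K
  by (rule sq_int_imp_integrable[OF sq_int_bounded[OF that]])
 have c3: "\<bar>\<bar>inc X i s t n k w\<bar> ^ 3\<bar> \<le> 1" if "w \<in> space M" for n k w
  using inc_X_bounded[OF st i that] by (simp add: power_le_one)
 have i3: "integrable M (\<lambda>w. \<bar>inc X i s t n k w\<bar> ^ 3)" for n k
  by (rule bi[OF _ c3]) (use X_measurable[OF i] in auto)
 have Rm: "R n k \<in> borel_measurable M" for n k
  unfolding R_def[abs_def] using Zm X_measurable[OF i] by (intro borel_measurable_times borel_measurable_diff borel_measurable_power borel_measurable_const)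
 have iR: "integrable M (R n k)" for n k
 proof (rule bi[OF Rm, of _ _ "D * C"])
  fix w assume w: "w \<in> space M"
  have "D * C * \<bar>inc X i s t n k w\<bar> ^ 3 \<le> D * C * 1" using D C(1) c3[OF w, of n k] by (intro mult_left_mono) auto
  then show "\<bar>R n k w\<bar> \<le> D * C" using Rb[OF w, of n k] by linarith
 qed
 have iG: "integrable M (\<lambda>w. G (grid s t n k) w * (inc X i s t n k w) ^ l)" if "weight s t G K" "k \<le> n" for G K n k l
 proof (rule bi[of _ "\<bar>K\<bar> * 1"])
  show "(\<lambda>w. G (grid s t n k) w * (inc X i s t n k w) ^ l) \<in> borel_measurable M"
   using weightD(5)[OF that(1)] X_measurable[OF i] by auto
  fix w assume w: "w \<in> space M"
  have "\<bar>G (grid s t n k) w\<bar> \<le> \<bar>K\<bar>" using weightD(4)[OF that(1) w grid_range(1)[OF st, of k n]] that(2) by linarith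
  moreover have "\<bar>inc X i s t n k w ^ l\<bar> \<le> 1" using inc_X_bounded[OF st i w] by (simp add: power_abs power_le_one)
  ultimately show "\<bar>G (grid s t n k) w * (inc X i s t n k w) ^ l\<bar> \<le> \<bar>K\<bar> * 1" unfolding abs_mult by (intro mult_mono) auto
 qed
 let ?S1 = "\<lambda>n. \<E> (\<lambda>w. \<Sum>k<Suc n. ?G1 (grid s t n k) w * inc X i s t n k w)"
 let ?S2 = "\<lambda>n. \<E> (\<lambda>w. \<Sum>k<Suc n. ?G2 (grid s t n k) w * (inc X i s t n k w * inc X i s t n k w))"
 let ?S3 = "\<lambda>n. \<E> (?E n R)"
 have lhs: "\<E> (?C i) = ?S1 n + ?S2 n + ?S3 n" for n
 proof -
  have "Z w * (X i t w ^ m - X i s w ^ m) = (\<Sum>k<Suc n. ?G1 (grid s t n k) w * inc X i s t n k w) +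
    (\<Sum>k<Suc n. ?G2 (grid s t n k) w * (inc X i s t n k w * inc X i s t n k w)) + (\<Sum>k<Suc n. R n k w)" for w
  proof -
   have "X i t w ^ m - X i s w ^ m = (\<Sum>k<Suc n. inc (\<lambda>i r w. X i r w ^ m) i s t n k w)"
    by (rule telescope_grid[symmetric])
   then show ?thesis
    unfolding R_def sum.distrib[symmetric] by (simp only: sum_distrib_left) (intro sum.cong refl, simp add: power2_eq_square algebra_simps)
  qed
  moreover have "integrable M (\<lambda>w. \<Sum>k<Suc n. ?G1 (grid s t n k) w * inc X i s t n k w)"
   using iG[OF G1, of _ n 1] by (intro lint_integrable_sum) auto
  moreover have "integrable M (\<lambda>w. \<Sum>k<Suc n. ?G2 (grid s t n k) w * (inc X i s t n k w * inc X i s t n k w))"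
   using iG[OF G2, of _ n 2] by (intro lint_integrable_sum) (auto simp: power2_eq_square)
  moreover have "integrable M (?E n R)"
   using iR by (intro lint_integrable_sum)
  ultimately show ?thesis by (simp del: sum.lessThan_Suc)
 qed
 have S3: "?S3 \<longlonglongrightarrow> 0"
 proof (rule Lim_null_comparison)
  have "(\<lambda>n. D * C * \<E> (?A n i)) \<longlonglongrightarrow> D * C * 0"
   by (intro tendsto_mult tendsto_const cubic_variation_tendsto_0 i)
  then show "(\<lambda>n. D * C * \<E> (?A n i)) \<longlonglongrightarrow> 0" by (simp only: mult_zero_right)
  show "\<forall>\<^sub>F n in sequentially. norm (?S3 n) \<le> D * C * \<E> (?A n i)"
  proof (rule always_eventually, rule allI)
   fix n
   have "norm (?S3 n) \<le> \<E> (\<lambda>w. D * C * (?D n i w))"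
   proof (rule norm_integral_le)
    show "integrable M (?E n R)" using iR by (intro lint_integrable_sum)
    show "integrable M (\<lambda>w. D * C * (?D n i w))"
     using i3 by (intro integrable_mult_right lint_integrable_sum)
    show "norm (\<Sum>k<Suc n. R n k w) \<le> D * C * (?D n i w)" if w: "w \<in> space M" for w
     unfolding real_norm_def sum_distrib_left by (rule order_trans[OF sum_abs]) (intro sum_mono Rb w)
   qed
   then show "norm (?S3 n) \<le> D * C * \<E> (?A n i)"
    by (simp only: integral_mult_right_zero)
  qed
 qed
 let ?L1 = "\<lambda>w. LINT r:{s<..t}|lborel. ?G1 r w * \<alpha> i r w"
 let ?L2 = "\<lambda>w. LINT r:{s<..t}|lborel. ?G2 r w * quadratic i r w"
 have S1: "?S1 \<longlonglongrightarrow> \<E> ?L1" by (rule weighted_first_order[OF st G1 i])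
 have S2: "?S2 \<longlonglongrightarrow> \<E> ?L2" using weighted_second_order[OF st G2 i i] by simp
 have "(\<lambda>n. ?S1 n + ?S2 n + ?S3 n) \<longlonglongrightarrow> \<E> ?L1 + \<E> ?L2 + 0"
  by (intro tendsto_add S1 S2 S3)
 then have e: "\<E> (?C i) = \<E> ?L1 + \<E> ?L2"
  unfolding lhs[symmetric] by (simp add: LIMSEQ_const_iff)
 have pw: "AE w in M. set_integrable lborel {s<..t} (\<lambda>r. ?G1 r w * \<alpha> i r w) \<and> set_integrable lborel {s<..t} (\<lambda>r. ?G2 r w * quadratic i r w)
   \<and> \<bar>?L1 w\<bar> \<le> D * \<bar>real m\<bar> * variation i t w"
  using drift_increment[OF i] AE_space
 proof eventually_elim
  case (elim w)
  have f: "set_integrable lborel {s<..t} (\<lambda>r. \<alpha> i r w)" "(LINT r:{s<..t}|lborel. \<bar>\<alpha> i r w\<bar>) \<le> variation i t w" using elim st by blast+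
  have g1: "set_integrable lborel {s<..t} (\<lambda>r. ?G1 r w * \<alpha> i r w)"
   by (rule set_integrable_bounded_mult[OF f(1) weightD(6)[OF G1 elim(2)] weightD(4)[OF G1 elim(2)]]) auto
  moreover have "set_integrable lborel {s<..t} (\<lambda>r. ?G2 r w * quadratic i r w)"
   by (rule set_integrable_bounded_mult[OF quadratic_set_integrable[OF i elim(2)] weightD(6)[OF G2 elim(2)] weightD(4)[OF G2 elim(2)]]) auto
  moreover have "\<bar>?L1 w\<bar> \<le> D * \<bar>real m\<bar> * variation i t w"
  proof -
   have "\<bar>?L1 w\<bar> \<le> (LINT r:{s<..t}|lborel. \<bar>?G1 r w * \<alpha> i r w\<bar>)" by (rule set_integral_abs_le[OF g1])
   also have "\<dots> \<le> (LINT r:{s<..t}|lborel. D * \<bar>real m\<bar> * \<bar>\<alpha> i r w\<bar>)"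
   proof (rule set_integral_mono)
    show "set_integrable lborel {s<..t} (\<lambda>r. \<bar>?G1 r w * \<alpha> i r w\<bar>)" by (rule set_integrable_abs_real[OF g1])
    show "set_integrable lborel {s<..t} (\<lambda>r. D * \<bar>real m\<bar> * \<bar>\<alpha> i r w\<bar>)"
     by (intro set_integrable_mult_right set_integrable_abs_real f)
    show "\<bar>?G1 r w * \<alpha> i r w\<bar> \<le> D * \<bar>real m\<bar> * \<bar>\<alpha> i r w\<bar>" if "r \<in> {s<..t}" for r
     unfolding abs_mult[of "?G1 r w"] using weightD(4)[OF G1 elim(2), of r] that by (intro mult_right_mono) auto
   qed
   also have "\<dots> = D * \<bar>real m\<bar> * (LINT r:{s<..t}|lborel. \<bar>\<alpha> i r w\<bar>)" by (rule set_integral_mult_right)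
   also have "\<dots> \<le> D * \<bar>real m\<bar> * variation i t w" using f(2) D by (intro mult_left_mono) auto
   finally show ?thesis .
  qed
  ultimately show ?case by blast
 qed
 have L1m: "?L1 \<in> borel_measurable M"
 proof (rule set_integral_process_measurable)
  show "(\<lambda>(r, w). ?G1 r w * \<alpha> i r w) \<in> borel_measurable (borel \<Otimes>\<^sub>M M)"
   using weightD(2)[OF G1] drift_joint[OF i] unfolding split_beta' by (rule borel_measurable_times)
 qed simp
 have L2m: "?L2 \<in> borel_measurable M"
 proof (rule set_integral_process_measurable)
  show "(\<lambda>(r, w). ?G2 r w * quadratic i r w) \<in> borel_measurable (borel \<Otimes>\<^sub>M M)"
   using weightD(2)[OF G2] quadratic_joint[OF i] unfolding split_beta' by (rule borel_measurable_times)
 qed simp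
 have L1i: "integrable M ?L1"
 proof (rule integrable_dominated[OF _ L1m])
  show "integrable M (\<lambda>w. D * \<bar>real m\<bar> * variation i t w)"
   using sq_int_imp_integrable[OF variation_sq_int[OF i t]] by simp
  show "AE w in M. norm (?L1 w) \<le> norm (D * \<bar>real m\<bar> * variation i t w)"
   using pw by eventually_elim auto
 qed
 have L2i: "integrable M ?L2"
 proof (rule bi[OF L2m, of "D * \<bar>?c\<bar> * (t - s)"])
  fix w assume w: "w \<in> space M"
  have g2: "set_integrable lborel {s<..t} (\<lambda>r. ?G2 r w * quadratic i r w)"
   by (rule set_integrable_bounded_mult[OF quadratic_set_integrable[OF i w] weightD(6)[OF G2 w] weightD(4)[OF G2 w]]) auto
  have "\<bar>?L2 w\<bar> \<le> (LINT r:{s<..t}|lborel. \<bar>?G2 r w * quadratic i r w\<bar>)" by (rule set_integral_abs_le[OF g2])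
  also have "\<dots> \<le> (LINT r:{s<..t}|lborel. D * \<bar>?c\<bar>)"
  proof (rule set_integral_mono[OF set_integrable_abs_real[OF g2] set_integrable_const_Ioc])
   show "\<bar>?G2 r w * quadratic i r w\<bar> \<le> D * \<bar>?c\<bar>" if "r \<in> {s<..t}" for r
   proof -
    have "\<bar>?G2 r w\<bar> * \<bar>quadratic i r w\<bar> \<le> (D * \<bar>?c\<bar>) * 1"
     using weightD(4)[OF G2 w, of r] that quadratic_bounds[OF i w, of r] D by (intro mult_mono) auto
    then show ?thesis by (simp add: abs_mult)
   qed
  qed
  also have "\<dots> = D * \<bar>?c\<bar> * (t - s)" using st by (simp add: set_integral_const_Ioc)
  finally show "\<bar>?L2 w\<bar> \<le> D * \<bar>?c\<bar> * (t - s)" .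
 qed
 have ae: "AE w in M. ?L1 w + ?L2 w = Z w * (?B i w)"
  using pw
 proof eventually_elim
  case (elim w)
  have "?L1 w + ?L2 w = (LINT r:{s<..t}|lborel. ?G1 r w * \<alpha> i r w + ?G2 r w * quadratic i r w)"
   using elim by (intro set_integral_add(2)[symmetric]) auto
  also have "\<dots> = (LINT r:{s<..t}|lborel. Z w * power_drift m i r w)"
  proof -
   \<comment> \<open>For \<open>m < 2\<close> the exponent \<open>m - 2\<close> is truncated, but
     then the coefficient \<open>m (m - 1)\<close> is 0.\<close>
   have key: "?c * (X i r w ^ (m - 2) * (2 * X i r w)) = real m * (real m - 1) * X i r w ^ (m - 1)" for r
   proof (cases "m \<ge> 2")
    case True
    then obtain l where "m = 2 + l" using le_Suc_ex by blast
    then show ?thesis by simp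
   next
    case False
    then have "m = 0 \<or> m = 1" by linarith
    then show ?thesis by auto
   qed
   have "?G1 r w * \<alpha> i r w + ?G2 r w * quadratic i r w = Z w * power_drift m i r w" for r
   proof -
    have "?G1 r w * \<alpha> i r w + ?G2 r w * quadratic i r w =
     Z w * (real m * X i r w ^ (m - 1) * \<alpha> i r w) + Z w * ((?c * (X i r w ^ (m - 2) * (2 * X i r w))) * (1 - X i r w))"
     unfolding quadratic_def by (simp only: mult_ac)
    also have "\<dots> = Z w * power_drift m i r w"
     unfolding key power_drift_def by (simp only: distrib_left mult_ac)
    finally show ?thesis .
   qed
   then show ?thesis by simp
  qed
  also have "\<dots> = Z w * (?B i w)" by (rule set_integral_mult_right)
  finally show ?case .
 qed
 have pm: "(\<lambda>w. Z w * (?B i w)) \<in> borel_measurable M"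
  unfolding power_drift_def using X_joint[OF i] drift_joint[OF i]
  by (intro borel_measurable_times Zm set_integral_process_measurable)
    (auto simp: split_beta' intro!: borel_measurable_times borel_measurable_add borel_measurable_diff borel_measurable_power)
 show "integrable M (\<lambda>w. Z w * (?B i w))"
  by (rule integrable_cong_AE[THEN iffD1, OF _ pm ae]) (use L1i L2i in auto)
 show "\<E> (?C i) = \<E> (\<lambda>w. Z w * (?B i w))"
  unfolding e lint_add[symmetric, OF L1i L2i]
  by (rule integral_cong_AE[OF borel_measurable_add[OF L1m L2m] pm ae])
qed

end

end

section \<open>Power sums and their martingale part\<close>

text \<open>The sum is at most \<open>card I\<close> times its largest term, whose cube is one of
  the summands on the right.\<close>

lemma sum_cube_le:
 fixes x :: "'i \<Rightarrow> real"
 assumes "finite I" "\<And>i. i \<in> I \<Longrightarrow> 0 \<le> x i"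
 shows "(\<Sum>i\<in>I. x i) ^ 3 \<le> real (card I) ^ 3 * (\<Sum>i\<in>I. x i ^ 3)"
proof (cases "I = {}")
 case False
 define y where "y = Max (x ` I)"
 have y: "y \<in> x ` I" "\<And>i. i \<in> I \<Longrightarrow> x i \<le> y" unfolding y_def using assms False by auto
 then obtain j where j: "j \<in> I" "y = x j" by auto
 have y0: "0 \<le> y" using j assms by auto
 have "(\<Sum>i\<in>I. x i) \<le> real (card I) * y" using sum_bounded_above[of I x y] y by simp
 then have "(\<Sum>i\<in>I. x i) ^ 3 \<le> (real (card I) * y) ^ 3" using assms by (intro power_mono sum_nonneg) auto
 also have "\<dots> = real (card I) ^ 3 * x j ^ 3" using j by (simp add: power_mult_distrib)
 also have "\<dots> \<le> real (card I) ^ 3 * (\<Sum>i\<in>I. x i ^ 3)"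
  using assms j by (intro mult_left_mono member_le_sum) auto
 finally show ?thesis .
qed simp

lemma (in ito_system) weight_mult:
 assumes G: "weight s t G C" and H: "weight s t H C'"
 shows "weight s t (\<lambda>r w. G r w * H r w) (\<bar>C\<bar> * \<bar>C'\<bar>)"
 unfolding weight_def
proof (intro conjI ballI)
 show "(\<lambda>w. G r w * H r w) \<in> borel_measurable (F r)" if "r \<in> {s..t}" for r
  using weightD(1)[OF G that] weightD(1)[OF H that] by auto
 show "(\<lambda>(r, w). G r w * H r w) \<in> borel_measurable (borel \<Otimes>\<^sub>M M)"
  using weightD(2)[OF G] weightD(2)[OF H] unfolding split_beta' by (rule borel_measurable_times)
 show "continuous_on {s..t} (\<lambda>r. G r w * H r w)" if "w \<in> space M" for w
  by (intro continuous_on_mult weightD(3)[OF G that] weightD(3)[OF H that])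
 show "\<bar>G r w * H r w\<bar> \<le> \<bar>C\<bar> * \<bar>C'\<bar>" if "w \<in> space M" "r \<in> {s..t}" for r w
  unfolding abs_mult using weightD(4)[OF G that] weightD(4)[OF H that] by (intro mult_mono) auto
qed

text \<open>\<open>D\<close> is a bounded continuous version of the total drift of the
  \<open>m\<close>-th power sum. The individual drifts are singular at collisions, so agreement is
  required only at almost every time.\<close>

locale ito_power_sum = ito_system M F I X \<alpha> J
 for M :: "'w measure" and F and I :: "'i set" and X \<alpha> J +
 fixes m :: nat and D :: "real \<Rightarrow> 'w \<Rightarrow> real" and B :: real
 assumes D_joint: "(\<lambda>(r, w). D r w) \<in> borel_measurable (borel \<Otimes>\<^sub>M M)"
  and D_adapted: "\<And>r. 0 \<le> r \<Longrightarrow> D r \<in> borel_measurable (F r)"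
  and D_cont: "\<And>w. w \<in> space M \<Longrightarrow> continuous_on {0..} (\<lambda>r. D r w)"
  and D_bound: "\<And>r w. w \<in> space M \<Longrightarrow> \<bar>D r w\<bar> \<le> B"
  and D_eq: "AE w in M. AE r in lborel. 0 \<le> r \<longrightarrow> (\<Sum>i\<in>I. power_drift m i r w) = D r w"
begin

definition psum :: "real \<Rightarrow> 'w \<Rightarrow> real" where "psum t w = (\<Sum>i\<in>I. X i t w ^ m)"

definition Dint :: "real \<Rightarrow> real \<Rightarrow> 'w \<Rightarrow> real" where "Dint s t w = (LINT r:{s<..t}|lborel. D r w)"

definition Mart :: "real \<Rightarrow> 'w \<Rightarrow> real" where "Mart t w = psum t w - psum 0 w - Dint 0 t w"

lemma B_nonneg: "0 \<le> B"
 using D_bound not_empty by (metis abs_ge_zero all_not_in_conv order_trans)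

lemma psum_bounds:
 assumes "w \<in> space M"
 shows "0 \<le> psum t w" "psum t w \<le> real (card I)"
proof -
 have b: "0 \<le> X i t w ^ m" "X i t w ^ m \<le> 1" if "i \<in> I" for i
  using X_nonneg[OF that assms] X_le_1[OF that assms] by (auto intro: power_le_one)
 show "0 \<le> psum t w" unfolding psum_def using b by (intro sum_nonneg) auto
 show "psum t w \<le> real (card I)" unfolding psum_def using sum_bounded_above[of I "\<lambda>i. X i t w ^ m" 1] b by simp
qed

lemma psum_measurable: "psum t \<in> borel_measurable M"
 unfolding psum_def[abs_def] using X_measurable by (intro borel_measurable_sum borel_measurable_power)

lemma psum_adapted: "0 \<le> t \<Longrightarrow> psum t \<in> borel_measurable (F t)"
 unfolding psum_def[abs_def] using X_adapted by (intro borel_measurable_sum borel_measurable_power)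

lemma psum_cont: "w \<in> space M \<Longrightarrow> continuous_on {0..} (\<lambda>t. psum t w)"
 unfolding psum_def by (intro continuous_intros X_cont)

lemma D_section_measurable: "w \<in> space M \<Longrightarrow> (\<lambda>r. D r w) \<in> borel_measurable borel"
 using process_section_measurable(1)[OF D_joint] .

lemma D_set_integrable: "w \<in> space M \<Longrightarrow> set_integrable lborel {s<..t} (\<lambda>r. D r w)"
 by (rule set_integrable_bounded_Ioc[OF D_section_measurable D_bound])

lemma Dint_measurable: "Dint s t \<in> borel_measurable M"
 unfolding Dint_def[abs_def] by (rule set_integral_process_measurable[OF D_joint]) simp

lemma Dint_bound:
 assumes "w \<in> space M" "s \<le> t"
 shows "\<bar>Dint s t w\<bar> \<le> B * (t - s)"
proof -
 have "\<bar>Dint s t w\<bar> \<le> (LINT r:{s<..t}|lborel. \<bar>D r w\<bar>)"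
  unfolding Dint_def by (rule set_integral_abs_le[OF D_set_integrable[OF assms(1)]])
 also have "\<dots> \<le> (LINT r:{s<..t}|lborel. B)"
  by (rule set_integral_mono[OF set_integrable_abs_real[OF D_set_integrable[OF assms(1)]] set_integrable_const_Ioc])
   (rule D_bound[OF assms(1)])
 finally show ?thesis using assms(2) by (simp add: set_integral_const_Ioc mult.commute)
qed

lemma Dint_split:
 assumes "w \<in> space M" "0 \<le> s" "s \<le> t"
 shows "Dint 0 t w = Dint 0 s w + Dint s t w"
proof -
 have "{0<..t} = {0<..s} \<union> {s<..t}" using assms by auto
 then show ?thesis unfolding Dint_def
  by (simp only:) (intro set_integral_Un D_set_integrable assms; auto)
qed

text \<open>Joint measurability is available with respect to \<open>M\<close> only. Left-point
  Riemann sums of the continuous \<open>D\<close> involve just its values up to time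
  \<open>t\<close>, and limits preserve measurability.\<close>

lemma Dint_adapted:
 assumes t: "0 \<le> t"
 shows "Dint 0 t \<in> borel_measurable (F t)"
proof (rule borel_measurable_LIMSEQ_real)
 show "(\<lambda>w. \<Sum>k<Suc n. D (grid 0 t n k) w * (LINT r:{grid 0 t n k<..grid 0 t n (Suc k)}|lborel. 1)) \<in> borel_measurable (F t)" for n
 proof (intro borel_measurable_sum borel_measurable_times borel_measurable_const)
  fix k assume "k \<in> {..<Suc n}"
  then have "0 \<le> grid 0 t n k" "grid 0 t n k \<le> t" using grid_range[of 0 t k n] t by auto
  then show "D (grid 0 t n k) \<in> borel_measurable (F t)" using F_measurable_mono D_adapted by blast
 qed
 fix w assume "w \<in> space (F t)"
 then have w: "w \<in> space M" by (simp add: space_F)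
 have "continuous_on {0..t} (\<lambda>r. D r w)" by (rule continuous_on_subset[OF D_cont[OF w]]) auto
 from riemann_stieltjes_tendsto[OF set_integrable_const_Ioc[of 0 t 1] t this D_section_measurable[OF w]]
 show "(\<lambda>n. \<Sum>k<Suc n. D (grid 0 t n k) w * (LINT r:{grid 0 t n k<..grid 0 t n (Suc k)}|lborel. 1)) \<longlonglongrightarrow> Dint 0 t w"
  unfolding Dint_def by (simp only: mult_1_right)
qed

lemma Dint_cont:
 assumes w: "w \<in> space M"
 shows "continuous_on {0..} (\<lambda>t. Dint 0 t w)"
proof (rule lipschitz_on_continuous_on)
 show "B-lipschitz_on {0..} (\<lambda>t. Dint 0 t w)"
 proof (rule lipschitz_onI[OF _ B_nonneg])
  have *: "dist (Dint 0 x w) (Dint 0 y w) \<le> B * dist x y" if "x \<in> {0..}" "y \<in> {0..}" "x \<le> y" for x y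
   using Dint_split[OF w, of x y] Dint_bound[OF w, of x y] that by (simp add: dist_real_def)
  show "dist (Dint 0 x w) (Dint 0 y w) \<le> B * dist x y" if "x \<in> {0..}" "y \<in> {0..}" for x y
  proof (cases "x \<le> y")
   case False
   then show ?thesis using *[of y x] that by (simp add: dist_commute)
  qed (use * that in auto)
 qed
qed

lemma Mart_measurable: "Mart t \<in> borel_measurable M"
 unfolding Mart_def[abs_def] by (intro borel_measurable_diff psum_measurable Dint_measurable)

lemma Mart_adapted: "0 \<le> t \<Longrightarrow> Mart t \<in> borel_measurable (F t)"
 unfolding Mart_def[abs_def]
 by (intro borel_measurable_diff psum_adapted Dint_adapted F_measurable_mono[OF _ psum_adapted, of 0]) auto

lemma Mart_cont: "w \<in> space M \<Longrightarrow> continuous_on {0..} (\<lambda>t. Mart t w)"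
 unfolding Mart_def by (intro continuous_intros psum_cont Dint_cont)

lemma Mart_0: "Mart 0 w = 0"
 by (simp add: Mart_def Dint_def set_lebesgue_integral_def)

lemma Mart_increment: "w \<in> space M \<Longrightarrow> 0 \<le> s \<Longrightarrow> s \<le> t \<Longrightarrow> Mart t w - Mart s w = psum t w - psum s w - Dint s t w"
 using Dint_split[of w s t] by (simp add: Mart_def)

lemma Mart_bound:
 assumes w: "w \<in> space M" and t: "0 \<le> t"
 shows "\<bar>Mart t w\<bar> \<le> real (card I) + B * t"
 using psum_bounds[OF w, of t] psum_bounds[OF w, of 0] Dint_bound[OF w t] unfolding Mart_def by auto

lemma Mart_sq_int: "0 \<le> t \<Longrightarrow> sq_int M (Mart t)"
 by (rule sq_int_bounded[OF Mart_measurable Mart_bound])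

text \<open>Ito's formula is summed over the particles; only after the summation may the drift be
  replaced by \<open>D\<close>, inside the time integral.\<close>

lemma psum_expectation:
 assumes st: "0 \<le> s" "s \<le> t" and Z: "Z \<in> borel_measurable (F s)" "\<And>w. w \<in> space M \<Longrightarrow> \<bar>Z w\<bar> \<le> K"
 shows "\<E> (\<lambda>w. Z w * (psum t w - psum s w)) = \<E> (\<lambda>w. Z w * Dint s t w)"
proof -
 let ?A = "\<lambda>r w. \<Sum>i\<in>I. power_drift m i r w"
 let ?L = "\<lambda>i w. LINT r:{s<..t}|lborel. power_drift m i r w"
 have Zm: "Z \<in> borel_measurable M" by (rule F_measurable[OF Z(1)])
 have i1: "integrable M (\<lambda>w. Z w * (X i t w ^ m - X i s w ^ m))" if i: "i \<in> I" for i
 proof (rule sq_int_imp_integrable[OF sq_int_bounded_mult[OF sq_int_bounded[where C=1] Zm Z(2)]])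
  show "(\<lambda>w. X i t w ^ m - X i s w ^ m) \<in> borel_measurable M" using X_measurable[OF i] by auto
  fix w assume w: "w \<in> space M"
  have "0 \<le> X i r w ^ m \<and> X i r w ^ m \<le> 1" for r
   using X_nonneg[OF i w] X_le_1[OF i w] by (auto intro: power_le_one)
  from this[of s] this[of t] show "\<bar>X i t w ^ m - X i s w ^ m\<bar> \<le> 1" by linarith
 qed
 have ae: "AE w in M. (\<Sum>i\<in>I. ?L i w) = Dint s t w"
 proof -
  have "AE w in M. \<forall>i\<in>I. set_integrable lborel {s<..t} (\<lambda>r. power_drift m i r w)"
  proof (rule AE_finite_allI[OF finite_I])
   fix i assume i: "i \<in> I"
   show "AE w in M. set_integrable lborel {s<..t} (\<lambda>r. power_drift m i r w)"
    using drift_increment[OF i] AE_space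
   proof eventually_elim
    case (elim w)
    have f: "set_integrable lborel {s<..t} (\<lambda>r. \<alpha> i r w)" using elim st by blast
    have Xs: "(\<lambda>r. X i r w) \<in> borel_measurable borel"
     by (rule process_section_measurable(1)[OF X_joint[OF i] elim(2)])
    have pb: "\<bar>X i r w ^ l\<bar> \<le> 1" for r l
     using X_nonneg[OF i elim(2)] X_le_1[OF i elim(2)] by (simp add: power_le_one)
    have g1: "set_integrable lborel {s<..t} (\<lambda>r. (real m * X i r w ^ (m - 1)) * \<alpha> i r w)"
    proof (rule set_integrable_bounded_mult[OF f])
     show "\<bar>real m * X i r w ^ (m - 1)\<bar> \<le> real m" for r
      unfolding abs_mult using mult_left_mono[OF pb[of r "m - 1"], of "real m"] by simp
    qed (use Xs in auto)
    have g2: "set_integrable lborel {s<..t} (\<lambda>r. X i r w ^ (m - 1) * (1 - X i r w))"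
    proof (rule set_integrable_bounded_Ioc[where C=1])
     show "\<bar>X i r w ^ (m - 1) * (1 - X i r w)\<bar> \<le> 1" for r
      unfolding abs_mult using pb[of r "m - 1"] X_nonneg[OF i elim(2), of r] X_le_1[OF i elim(2), of r]
      by (intro mult_le_one) auto
    qed (use Xs in auto)
    have "set_integrable lborel {s<..t} (\<lambda>r. real m * (real m - 1) * (X i r w ^ (m - 1) * (1 - X i r w)))"
     using g2 by (rule set_integrable_mult_right)
    from set_integral_add(1)[OF g1 this] show ?case by (simp only: power_drift_def)
   qed
  qed
  then show ?thesis using D_eq AE_space
  proof eventually_elim
   case (elim w)
   have "(\<Sum>i\<in>I. ?L i w) = (LINT r:{s<..t}|lborel. (?A r w))"
    unfolding set_lebesgue_integral_def scaleR_sum_right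
    using elim(1) by (intro lint_sum[symmetric]) (auto simp: set_integrable_def)
   also have "\<dots> = Dint s t w"
    unfolding Dint_def set_lebesgue_integral_def
   proof (rule integral_cong_AE)
    have "(\<lambda>r. \<Sum>i\<in>I. indicator {s<..t} r *\<^sub>R power_drift m i r w) \<in> borel_measurable lborel"
     using elim(1) by (intro borel_measurable_sum) (auto simp: set_integrable_def)
    then show "(\<lambda>r. indicator {s<..t} r *\<^sub>R (?A r w)) \<in> borel_measurable lborel"
     by (simp only: scaleR_sum_right)
    show "(\<lambda>r. indicator {s<..t} r *\<^sub>R D r w) \<in> borel_measurable lborel"
     using D_set_integrable[OF elim(3), of s t] by (auto simp: set_integrable_def)
    show "AE r in lborel. indicator {s<..t} r *\<^sub>R (?A r w) = indicator {s<..t} r *\<^sub>R D r w"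
     using elim(2) by eventually_elim (use st in \<open>auto simp: indicator_def\<close>)
   qed
   finally show ?case .
  qed
 qed
 have "\<E> (\<lambda>w. Z w * (psum t w - psum s w)) = \<E> (\<lambda>w. \<Sum>i\<in>I. Z w * (X i t w ^ m - X i s w ^ m))"
  by (simp only: psum_def sum_subtractf[symmetric] sum_distrib_left)
 also have "\<dots> = (\<Sum>i\<in>I. \<E> (\<lambda>w. Z w * ?L i w))"
  using i1 ito_power(2)[OF st _ Z] by (subst lint_sum) auto
 also have "\<dots> = \<E> (\<lambda>w. \<Sum>i\<in>I. Z w * ?L i w)"
  using ito_power(1)[OF st _ Z] by (intro lint_sum[symmetric]) auto
 also have "\<dots> = \<E> (\<lambda>w. Z w * Dint s t w)"
 proof (rule integral_cong_AE)
  show "(\<lambda>w. \<Sum>i\<in>I. Z w * ?L i w) \<in> borel_measurable M"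
   using ito_power(1)[OF st _ Z] by (intro borel_measurable_sum) auto
  show "(\<lambda>w. Z w * Dint s t w) \<in> borel_measurable M" using Zm Dint_measurable by auto
  show "AE w in M. (\<Sum>i\<in>I. Z w * ?L i w) = Z w * Dint s t w"
   using ae by eventually_elim (simp add: sum_distrib_left[symmetric])
 qed
 finally show ?thesis .
qed

lemma Mart_martingale:
 assumes st: "0 \<le> s" "s \<le> t" and Z: "Z \<in> borel_measurable (F s)" "\<And>w. w \<in> space M \<Longrightarrow> \<bar>Z w\<bar> \<le> K"
 shows "\<E> (\<lambda>w. Z w * (Mart t w - Mart s w)) = 0"
proof -
 let ?A = "\<lambda>w. Z w * (psum t w - psum s w)"
 have Zm: "Z \<in> borel_measurable M" by (rule F_measurable[OF Z(1)])
 have "\<E> (\<lambda>w. Z w * (Mart t w - Mart s w)) = \<E> (\<lambda>w. Z w * (psum t w - psum s w) - Z w * Dint s t w)"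
  by (intro lint_cong refl) (simp add: Mart_increment st right_diff_distrib)
 also have "\<dots> = \<E> ?A - \<E> (\<lambda>w. Z w * Dint s t w)"
 proof (rule lint_diff)
  show "integrable M ?A"
  proof (rule sq_int_imp_integrable[OF sq_int_bounded_mult[OF sq_int_bounded[where C="real (card I)"] Zm Z(2)]])
   show "\<bar>psum t w - psum s w\<bar> \<le> real (card I)" if "w \<in> space M" for w
    using psum_bounds[OF that, of s] psum_bounds[OF that, of t] by linarith
  qed (use psum_measurable in auto)
  show "integrable M (\<lambda>w. Z w * Dint s t w)"
   by (rule sq_int_imp_integrable[OF sq_int_bounded_mult[OF sq_int_bounded[OF Dint_measurable Dint_bound[OF _ st(2)]] Zm Z(2)]])
 qed
 finally show ?thesis using psum_expectation[OF st Z] by simp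
qed

text \<open>Pythagoras for martingale increments: each new one is orthogonal to the current
  value.\<close>

lemma Mart_grid_orthogonal:
 assumes T: "0 \<le> T" and K: "K \<le> Suc n"
 shows "\<E> (\<lambda>w. (Mart (grid 0 T n K) w)^2) =
   (\<Sum>k<K. \<E> (\<lambda>w. (Mart (grid 0 T n (Suc k)) w - Mart (grid 0 T n k) w)^2))"
 using K
proof (induction K)
 case (Suc K)
 let ?g = "grid 0 T n K" and ?g' = "grid 0 T n (Suc K)"
 have g: "0 \<le> ?g" "?g \<le> ?g'" using grid_range[of 0 T K n] grid_increasing[of 0 T n K] T Suc.prems by auto
 have g': "0 \<le> ?g'" using g by simp
 have d: "sq_int M (\<lambda>w. Mart ?g' w - Mart ?g w)" by (intro sq_int_diff Mart_sq_int g g')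
 have z: "\<E> (\<lambda>w. Mart ?g w * (Mart ?g' w - Mart ?g w)) = 0"
  by (rule Mart_martingale[OF g Mart_adapted[OF g(1)] Mart_bound[OF _ g(1)]])
 have "\<E> (\<lambda>w. (Mart ?g' w)^2) = \<E> (\<lambda>w. ((Mart ?g w)^2 + (Mart ?g' w - Mart ?g w)^2) + 2 * (Mart ?g w * (Mart ?g' w - Mart ?g w)))"
  by (intro lint_cong refl) (simp add: power2_eq_square algebra_simps)
 also have "\<dots> = \<E> (\<lambda>w. (Mart ?g w)^2) + \<E> (\<lambda>w. (Mart ?g' w - Mart ?g w)^2)"
  using z sq_int_mult[OF Mart_sq_int[OF g(1)] d] sq_int_integrable_square[OF Mart_sq_int[OF g(1)]] sq_int_integrable_square[OF d]
  by simp
 finally show ?case using Suc by simp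
qed (simp add: Mart_0)

text \<open>With \<open>a\<close> the linear part of the increment, \<open>\<rho>\<close> the rest
  and \<open>S\<close> the sum of the absolute particle increments, \<open>a\<close> is of order
  \<open>S\<close> and \<open>\<rho>\<close> of order \<open>S^2\<close>, so the square differs from
  \<open>a^2\<close> by order \<open>S^3\<close>. The factors 1 are the test variable
  \<open>Z = 1\<close> of \<open>weight_power\<close>, which gives the double sum the shape of
  \<open>weighted_second_order\<close>.\<close>

lemma psum_square_expansion:
 assumes T: "0 \<le> T"
 shows "\<exists>K\<ge>0. \<forall>w\<in>space M. \<forall>n k. \<bar>(psum (grid 0 T n (Suc k)) w - psum (grid 0 T n k) w)^2
   - (\<Sum>i\<in>I. \<Sum>j\<in>I. ((1 * (real m * X i (grid 0 T n k) w ^ (m - 1))) * (1 * (real m * X j (grid 0 T n k) w ^ (m - 1)))) * (inc X i 0 T n k w * inc X j 0 T n k w))\<bar>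
   \<le> K * (\<Sum>i\<in>I. \<bar>inc X i 0 T n k w\<bar> ^ 3)"
proof -
 let ?A = "\<lambda>n k w. psum (grid 0 T n (Suc k)) w - psum (grid 0 T n k) w"
 obtain C where C: "0 \<le> C" "\<And>x y. x \<in> {0..1} \<Longrightarrow> y \<in> {0..1::real} \<Longrightarrow> \<bar>y ^ m - x ^ m - real m * x ^ (m - 1) * (y - x)\<bar> \<le> C * (y - x)^2"
  using power_taylor_first[of m] by blast
 let ?N = "real (card I)"
 \<comment> \<open>The cross term \<open>2 a \<rho>\<close> contributes \<open>2 m C\<close>, the
   square of \<open>\<rho>\<close> contributes \<open>C * C * ?N\<close> since
   \<open>S \<le> ?N\<close>, and the factor \<open>?N ^ 3\<close> passes from \<open>S ^ 3\<close>
   to the sum of cubes.\<close>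
 let ?K = "(2 * real m * C + C * C * ?N) * ?N ^ 3"
 have "\<bar>(?A n k w)^2
   - (\<Sum>i\<in>I. \<Sum>j\<in>I. ((1 * (real m * X i (grid 0 T n k) w ^ (m - 1))) * (1 * (real m * X j (grid 0 T n k) w ^ (m - 1)))) * (inc X i 0 T n k w * inc X j 0 T n k w))\<bar>
   \<le> ?K * (\<Sum>i\<in>I. \<bar>inc X i 0 T n k w\<bar> ^ 3)" if w: "w \<in> space M" for w n k
 proof -
  define x where "x i = X i (grid 0 T n k) w" for i
  define h where "h i = inc X i 0 T n k w" for i
  define a where "a = (\<Sum>i\<in>I. real m * x i ^ (m - 1) * h i)"
  define \<rho> where "\<rho> = (?A n k w) - a"
  define S where "S = (\<Sum>i\<in>I. \<bar>h i\<bar>)"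
  have x01: "X i r w \<in> {0..1}" if "i \<in> I" for i r using X_nonneg[OF that w] X_le_1[OF that w] by simp
  have S0: "0 \<le> S" unfolding S_def by (rule sum_nonneg) simp
  have h1: "\<bar>h i\<bar> \<le> 1" if "i \<in> I" for i unfolding h_def by (rule inc_X_bounded[OF order_refl T that w])
  have SN: "S \<le> ?N" unfolding S_def using sum_bounded_above[of I "\<lambda>i. \<bar>h i\<bar>" 1] h1 by simp
  have aS: "\<bar>a\<bar> \<le> real m * S"
  proof -
   have "\<bar>a\<bar> \<le> (\<Sum>i\<in>I. real m * \<bar>h i\<bar>)" unfolding a_def
   proof (rule order_trans[OF sum_abs], rule sum_mono)
    fix i assume i: "i \<in> I"
    have "\<bar>x i ^ (m - 1)\<bar> \<le> 1" using x01[OF i, of "grid 0 T n k"] by (simp add: x_def power_le_one)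
    then have "real m * \<bar>x i ^ (m - 1)\<bar> * \<bar>h i\<bar> \<le> real m * 1 * \<bar>h i\<bar>" by (intro mult_right_mono mult_left_mono) auto
    then show "\<bar>real m * x i ^ (m - 1) * h i\<bar> \<le> real m * \<bar>h i\<bar>" by (simp add: abs_mult)
   qed
   then show ?thesis by (simp add: S_def sum_distrib_left)
  qed
  have \<rho>S: "\<bar>\<rho>\<bar> \<le> C * S^2"
  proof -
   have "\<rho> = (\<Sum>i\<in>I. X i (grid 0 T n (Suc k)) w ^ m - x i ^ m - real m * x i ^ (m - 1) * h i)"
    by (simp add: \<rho>_def a_def psum_def x_def sum_subtractf)
   also have "\<bar>\<dots>\<bar> \<le> (\<Sum>i\<in>I. C * (\<bar>h i\<bar> * S))"
   proof (rule order_trans[OF sum_abs], rule sum_mono)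
    fix i assume i: "i \<in> I"
    have "\<bar>X i (grid 0 T n (Suc k)) w ^ m - x i ^ m - real m * x i ^ (m - 1) * h i\<bar> \<le> C * (h i)^2"
     unfolding x_def h_def by (rule C(2)[OF x01[OF i] x01[OF i]])
    also have "(h i)^2 = \<bar>h i\<bar> * \<bar>h i\<bar>" by (simp add: power2_eq_square)
    also have "C * (\<bar>h i\<bar> * \<bar>h i\<bar>) \<le> C * (\<bar>h i\<bar> * S)"
     unfolding S_def using C(1) i finite_I by (intro mult_left_mono member_le_sum) auto
    finally show "\<bar>X i (grid 0 T n (Suc k)) w ^ m - x i ^ m - real m * x i ^ (m - 1) * h i\<bar> \<le> C * (\<bar>h i\<bar> * S)" .
   qed
   also have "\<dots> = C * S^2" by (simp add: sum_distrib_left[symmetric] sum_distrib_right[symmetric] S_def power2_eq_square)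
   finally show ?thesis .
  qed
  have "(?A n k w)^2 - a^2 = 2 * a * \<rho> + \<rho> * \<rho>"
   by (simp add: \<rho>_def power2_eq_square algebra_simps)
  also have "\<bar>\<dots>\<bar> \<le> 2 * (\<bar>a\<bar> * \<bar>\<rho>\<bar>) + \<bar>\<rho>\<bar> * \<bar>\<rho>\<bar>"
   using abs_triangle_ineq[of "2 * a * \<rho>" "\<rho> * \<rho>"] by (simp add: abs_mult)
  also have "\<dots> \<le> 2 * ((real m * S) * (C * S^2)) + (C * (?N * S)) * (C * S^2)"
  proof -
   have "\<bar>\<rho>\<bar> \<le> C * (?N * S)"
    using \<rho>S mult_left_mono[OF mult_right_mono[OF SN S0] C(1)] by (simp add: power2_eq_square)
   then show ?thesis using aS \<rho>S C(1) S0 by (intro add_mono mult_left_mono mult_mono) auto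
  qed
  also have "\<dots> = (2 * real m * C + C * C * ?N) * S ^ 3" by (simp add: power2_eq_square power3_eq_cube algebra_simps)
  also have "\<dots> \<le> (2 * real m * C + C * C * ?N) * (?N ^ 3 * (\<Sum>i\<in>I. \<bar>h i\<bar> ^ 3))"
   unfolding S_def using C(1) by (intro mult_left_mono sum_cube_le finite_I) auto
  finally have "\<bar>(?A n k w)^2 - a^2\<bar> \<le> ?K * (\<Sum>i\<in>I. \<bar>h i\<bar> ^ 3)"
   by (simp add: mult.assoc)
  moreover have "a^2 = (\<Sum>i\<in>I. \<Sum>j\<in>I. ((1 * (real m * x i ^ (m - 1))) * (1 * (real m * x j ^ (m - 1)))) * (h i * h j))"
   unfolding a_def power2_eq_square sum_product by (intro sum.cong refl) simp
  ultimately show ?thesis unfolding x_def h_def by simp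
 qed
 moreover have "0 \<le> ?K" using C(1) by simp
 ultimately show ?thesis by blast
qed

text \<open>Different particles have orthogonal martingale parts, so only the diagonal of the double
  sum survives in the limit.\<close>

lemma psum_square_variation:
 assumes T: "0 \<le> T"
 shows "(\<lambda>n. \<E> (\<lambda>w. \<Sum>k<Suc n. (psum (grid 0 T n (Suc k)) w - psum (grid 0 T n k) w)^2))
   \<longlonglongrightarrow> (\<Sum>i\<in>I. \<E> (\<lambda>w. LINT r:{0<..T}|lborel. (real m * X i r w ^ (m - 1))^2 * quadratic i r w))"
proof -
 let ?A = "\<lambda>i w. LINT r:{0<..T}|lborel. (real m * X i r w ^ (m - 1))^2 * quadratic i r w"
 let ?B = "\<lambda>n k w. psum (grid 0 T n (Suc k)) w - psum (grid 0 T n k) w"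
 let ?G = "\<lambda>i j r w. (1 * (real m * X i r w ^ (m - 1))) * (1 * (real m * X j r w ^ (m - 1)))"
 let ?P = "\<lambda>n w. \<Sum>k<Suc n. (?B n k w)^2"
 let ?S = "\<lambda>n i j w. \<Sum>k<Suc n. ?G i j (grid 0 T n k) w * (inc X i 0 T n k w * inc X j 0 T n k w)"
 let ?c = "\<lambda>n i w. \<Sum>k<Suc n. \<bar>inc X i 0 T n k w\<bar> ^ 3"
 have one: "(\<lambda>_. 1 :: real) \<in> borel_measurable (F 0)" by simp
 have W: "weight 0 T (?G i j) (\<bar>1 * \<bar>real m\<bar>\<bar> * \<bar>1 * \<bar>real m\<bar>\<bar>)" if "i \<in> I" "j \<in> I" for i j
  by (rule weight_mult[OF weight_power[OF order_refl T that(1) one] weight_power[OF order_refl T that(2) one]]) auto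
 obtain K where K: "0 \<le> K" "\<And>w n k. w \<in> space M \<Longrightarrow> \<bar>(?B n k w)^2
   - (\<Sum>i\<in>I. \<Sum>j\<in>I. ?G i j (grid 0 T n k) w * (inc X i 0 T n k w * inc X j 0 T n k w))\<bar>
   \<le> K * (\<Sum>i\<in>I. \<bar>inc X i 0 T n k w\<bar> ^ 3)"
  using psum_square_expansion[OF T] by blast
 have bi: "integrable M f" if "f \<in> borel_measurable M" "\<And>w. w \<in> space M \<Longrightarrow> \<bar>f w\<bar> \<le> C" for f :: "'w \<Rightarrow> real" and C
  by (rule sq_int_imp_integrable[OF sq_int_bounded[OF that]])
 have iP: "integrable M (?P n)" for n
 proof (rule lint_integrable_sum)
  fix k
  show "integrable M (\<lambda>w. (?B n k w)^2)"
  proof (rule sq_int_integrable_square, rule sq_int_bounded[where C="real (card I)"])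
   show "\<bar>psum (grid 0 T n (Suc k)) w - psum (grid 0 T n k) w\<bar> \<le> real (card I)" if "w \<in> space M" for w
    using psum_bounds[OF that, of "grid 0 T n (Suc k)"] psum_bounds[OF that, of "grid 0 T n k"] by linarith
  qed (use psum_measurable in auto)
 qed
 have iS: "integrable M (?S n i j)" if ij: "i \<in> I" "j \<in> I" for n i j
 proof (rule lint_integrable_sum)
  fix k assume k: "k \<in> {..<Suc n}"
  let ?C = "\<bar>1 * \<bar>real m\<bar>\<bar> * \<bar>1 * \<bar>real m\<bar>\<bar>"
  show "integrable M (\<lambda>w. ?G i j (grid 0 T n k) w * (inc X i 0 T n k w * inc X j 0 T n k w))"
  proof (rule bi[of _ "?C * (1 * 1)"])
   show "(\<lambda>w. ?G i j (grid 0 T n k) w * (inc X i 0 T n k w * inc X j 0 T n k w)) \<in> borel_measurable M"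
    using X_measurable ij by auto
   fix w assume w: "w \<in> space M"
   show "\<bar>?G i j (grid 0 T n k) w * (inc X i 0 T n k w * inc X j 0 T n k w)\<bar> \<le> ?C * (1 * 1)"
    unfolding abs_mult[of "?G i j (grid 0 T n k) w"] abs_mult[of "inc X i 0 T n k w"]
    using weightD(4)[OF W[OF ij] w, of "grid 0 T n k"] grid_range(1)[OF order_refl T, of k n] k
     inc_X_bounded[OF order_refl T ij(1) w, of n k] inc_X_bounded[OF order_refl T ij(2) w, of n k]
    by (intro mult_mono) auto
  qed
 qed
 have ic: "integrable M (?c n i)" if i: "i \<in> I" for n i
 proof (rule lint_integrable_sum, rule bi[of _ 1])
  show "(\<lambda>w. \<bar>inc X i 0 T n k w\<bar> ^ 3) \<in> borel_measurable M" for k using X_measurable[OF i] by auto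
  show "\<bar>\<bar>inc X i 0 T n k w\<bar> ^ 3\<bar> \<le> 1" if "w \<in> space M" for k w
   using inc_X_bounded[OF order_refl T i that] by (simp add: power_le_one)
 qed
 have main: "(\<lambda>n. \<Sum>i\<in>I. \<Sum>j\<in>I. \<E> (?S n i j)) \<longlonglongrightarrow>
  (\<Sum>i\<in>I. \<Sum>j\<in>I. if i = j then \<E> (\<lambda>w. LINT r:{0<..T}|lborel. ?G i j r w * quadratic i r w) else 0)"
  by (intro tendsto_sum weighted_second_order[OF order_refl T W])
 have lim_eq: "(\<Sum>i\<in>I. \<Sum>j\<in>I. if i = j then \<E> (\<lambda>w. LINT r:{0<..T}|lborel. ?G i j r w * quadratic i r w) else 0)
  = (\<Sum>i\<in>I. \<E> (?A i))"
 proof (intro sum.cong refl)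
  fix i assume "i \<in> I"
  then show "(\<Sum>j\<in>I. if i = j then \<E> (\<lambda>w. LINT r:{0<..T}|lborel. ?G i j r w * quadratic i r w) else 0) =
   \<E> (?A i)"
   using finite_I by (simp add: sum.delta power2_eq_square)
 qed
 have err: "(\<lambda>n. \<E> (?P n) - (\<Sum>i\<in>I. \<Sum>j\<in>I. \<E> (?S n i j))) \<longlonglongrightarrow> 0"
 proof (rule Lim_null_comparison)
  have "(\<lambda>n. K * (\<Sum>i\<in>I. \<E> (?c n i))) \<longlonglongrightarrow> K * (\<Sum>i\<in>I. 0)"
   by (intro tendsto_mult tendsto_const tendsto_sum cubic_variation_tendsto_0 T order_refl)
  then show "(\<lambda>n. K * (\<Sum>i\<in>I. \<E> (?c n i))) \<longlonglongrightarrow> 0" by (simp only: sum.neutral_const mult_zero_right)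
  show "\<forall>\<^sub>F n in sequentially. norm (\<E> (?P n) - (\<Sum>i\<in>I. \<Sum>j\<in>I. \<E> (?S n i j))) \<le> K * (\<Sum>i\<in>I. \<E> (?c n i))"
  proof (rule always_eventually, rule allI)
   fix n
   have e1: "(\<Sum>i\<in>I. \<Sum>j\<in>I. \<E> (?S n i j)) = \<E> (\<lambda>w. \<Sum>i\<in>I. \<Sum>j\<in>I. ?S n i j w)"
    using iS by (intro integral_double_sum[symmetric])
   have e2: "(\<Sum>i\<in>I. \<E> (?c n i)) = \<E> (\<lambda>w. \<Sum>i\<in>I. ?c n i w)"
    using ic by (intro lint_sum[symmetric])
   have iSS: "integrable M (\<lambda>w. \<Sum>i\<in>I. \<Sum>j\<in>I. ?S n i j w)" by (rule lint_integrable_sum, rule lint_integrable_sum, rule iS)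
   have "norm (\<E> (\<lambda>w. ?P n w - (\<Sum>i\<in>I. \<Sum>j\<in>I. ?S n i j w))) \<le> \<E> (\<lambda>w. K * (\<Sum>i\<in>I. ?c n i w))"
   proof (rule norm_integral_le)
    show "integrable M (\<lambda>w. ?P n w - (\<Sum>i\<in>I. \<Sum>j\<in>I. ?S n i j w))" using iP iSS by (rule lint_integrable_diff)
    show "integrable M (\<lambda>w. K * (\<Sum>i\<in>I. ?c n i w))" by (rule integrable_mult_right, rule lint_integrable_sum, rule ic)
    fix w assume w: "w \<in> space M"
    have s1: "(\<Sum>i\<in>I. \<Sum>j\<in>I. ?S n i j w) = (\<Sum>k<Suc n. \<Sum>i\<in>I. \<Sum>j\<in>I. ?G i j (grid 0 T n k) w * (inc X i 0 T n k w * inc X j 0 T n k w))"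
    proof -
     have "(\<Sum>i\<in>I. \<Sum>j\<in>I. ?S n i j w) = (\<Sum>i\<in>I. \<Sum>k<Suc n. \<Sum>j\<in>I. ?G i j (grid 0 T n k) w * (inc X i 0 T n k w * inc X j 0 T n k w))"
      by (rule sum.cong[OF refl], rule sum.swap)
     also have "\<dots> = (\<Sum>k<Suc n. \<Sum>i\<in>I. \<Sum>j\<in>I. ?G i j (grid 0 T n k) w * (inc X i 0 T n k w * inc X j 0 T n k w))"
      by (rule sum.swap)
     finally show ?thesis .
    qed
    have s2: "(\<Sum>i\<in>I. ?c n i w) = (\<Sum>k<Suc n. \<Sum>i\<in>I. \<bar>inc X i 0 T n k w\<bar> ^ 3)" by (rule sum.swap)
    show "norm (?P n w - (\<Sum>i\<in>I. \<Sum>j\<in>I. ?S n i j w)) \<le> K * (\<Sum>i\<in>I. ?c n i w)"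
     unfolding s1 s2 sum_subtractf[symmetric] sum_distrib_left[of K "\<lambda>k. \<Sum>i\<in>I. \<bar>inc X i 0 T n k w\<bar> ^ 3"] real_norm_def
     by (rule order_trans[OF sum_abs]) (intro sum_mono K(2) w)
   qed
   then show "norm (\<E> (?P n) - (\<Sum>i\<in>I. \<Sum>j\<in>I. \<E> (?S n i j))) \<le> K * (\<Sum>i\<in>I. \<E> (?c n i))"
    unfolding e1 e2 lint_diff[OF iP iSS] integral_mult_right_zero .
  qed
 qed
 from tendsto_add[OF err main] show ?thesis unfolding lim_eq by simp
qed

text \<open>By orthogonality the second moment is the expected sum of squared increments on every
  grid. The compensator moves by at most a multiple of the mesh per cell, so in the limit the
  squares may be taken of the power sum instead.\<close>

lemma Mart_second_moment:
 assumes T: "0 \<le> T"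
 shows "\<E> (\<lambda>w. (Mart T w)^2) =
  (\<Sum>i\<in>I. \<E> (\<lambda>w. LINT r:{0<..T}|lborel. (real m * X i r w ^ (m - 1))^2 * quadratic i r w))"
proof -
 let ?A = "\<lambda>n k w. Mart (grid 0 T n (Suc k)) w - Mart (grid 0 T n k) w"
 let ?N = "real (card I)"
 let ?P = "\<lambda>n w. \<Sum>k<Suc n. (psum (grid 0 T n (Suc k)) w - psum (grid 0 T n k) w)^2"
 let ?Q = "\<lambda>n w. \<Sum>k<Suc n. (?A n k w)^2"
 let ?o = "\<lambda>n w. oscillation 0 T (\<lambda>r. psum r w) n"
 have g: "0 \<le> grid 0 T n k" "grid 0 T n k \<le> grid 0 T n (Suc k)" if "k < Suc n" for n k
  using grid_range[of 0 T k n] grid_increasing[of 0 T n k] T that by auto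
 have iP: "integrable M (?P n)" for n
 proof (rule lint_integrable_sum, rule sq_int_integrable_square, rule sq_int_bounded[where C="?N"])
  fix k
  show "\<bar>psum (grid 0 T n (Suc k)) w - psum (grid 0 T n k) w\<bar> \<le> ?N" if "w \<in> space M" for w
   using psum_bounds[OF that, of "grid 0 T n (Suc k)"] psum_bounds[OF that, of "grid 0 T n k"] by linarith
 qed (use psum_measurable in auto)
 have iQ1: "integrable M (\<lambda>w. (?A n k w)^2)" if "k < Suc n" for n k
  using g[OF that] by (intro sq_int_integrable_square sq_int_diff Mart_sq_int) auto
 have iQ: "integrable M (?Q n)" for n
  using iQ1 by (intro lint_integrable_sum) auto
 have MQ: "\<E> (\<lambda>w. (Mart T w)^2) = \<E> (?Q n)" for n
  using Mart_grid_orthogonal[OF T, of "Suc n" n] iQ1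
  by (subst lint_sum) (auto simp del: sum.lessThan_Suc)
 have om: "?o n \<in> borel_measurable M" for n
  unfolding oscillation_def using psum_measurable by (intro borel_measurable_Max) auto
 have ob: "?o n w \<le> ?N" if "w \<in> space M" for n w
 proof (rule oscillation_le)
  fix k
  show "\<bar>psum (grid 0 T n (Suc k)) w - psum (grid 0 T n k) w\<bar> \<le> ?N"
   using psum_bounds[OF that, of "grid 0 T n (Suc k)"] psum_bounds[OF that, of "grid 0 T n k"] by linarith
 qed
 have o0: "(\<lambda>n. \<E> (?o n)) \<longlonglongrightarrow> \<E> (\<lambda>w. 0)"
 proof (rule integral_dominated_convergence[where w="\<lambda>_. ?N"])
  show "AE w in M. (\<lambda>n. ?o n w) \<longlonglongrightarrow> 0"
   by (intro AE_I2 oscillation_tendsto_0[OF T] continuous_on_subset[OF psum_cont]) auto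
  show "AE w in M. norm (?o n w) \<le> ?N" for n
   using ob oscillation_nonneg by (intro AE_I2) (auto simp: abs_of_nonneg)
 qed (use om in auto)
 have io: "integrable M (?o n)" for n
  by (rule sq_int_imp_integrable[OF sq_int_bounded[OF om, where C="?N"]]) (use ob oscillation_nonneg in \<open>auto simp: abs_of_nonneg\<close>)
 let ?b = "\<lambda>n w. 2 * B * T * ?o n w + B * T * (B * (T / real (Suc n)))"
 have pw: "\<bar>?Q n w - ?P n w\<bar> \<le> ?b n w" if w: "w \<in> space M" for n w
 proof -
  \<comment> \<open>The mesh: each compensator increment is at most \<open>B * h\<close>, and there
    are \<open>Suc n\<close> of them with \<open>Suc n * h = T\<close>.\<close>
  define h where "h = T / real (Suc n)"
  have h0: "0 \<le> h" using T by (simp add: h_def)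
  have one: "\<bar>(?A n k w)^2 - (psum (grid 0 T n (Suc k)) w - psum (grid 0 T n k) w)^2\<bar>
    \<le> 2 * (B * h) * ?o n w + (B * h) * (B * h)" if k: "k < Suc n" for k
  proof -
   define p where "p = psum (grid 0 T n (Suc k)) w - psum (grid 0 T n k) w"
   define e where "e = Dint (grid 0 T n k) (grid 0 T n (Suc k)) w"
   have e: "\<bar>e\<bar> \<le> B * h" unfolding e_def h_def
    using Dint_bound[OF w g(2)[OF k]] grid_step[of 0 T n k] by simp
   have p: "\<bar>p\<bar> \<le> ?o n w" unfolding p_def by (rule oscillation_ge[OF k])
   have d: "Mart (grid 0 T n (Suc k)) w - Mart (grid 0 T n k) w = p - e"
    unfolding p_def e_def by (rule Mart_increment[OF w g[OF k]])
   have "(?A n k w)^2 - p^2 = e * e - 2 * (e * p)"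
    unfolding d by (simp add: power2_eq_square algebra_simps)
   also have "\<bar>\<dots>\<bar> \<le> \<bar>e\<bar> * \<bar>e\<bar> + 2 * (\<bar>e\<bar> * \<bar>p\<bar>)"
    using abs_triangle_ineq4[of "e * e" "2 * (e * p)"] by (simp add: abs_mult)
   also have "\<dots> \<le> (B * h) * (B * h) + 2 * ((B * h) * ?o n w)"
    using e p B_nonneg h0 by (intro add_mono mult_left_mono mult_mono) auto
   finally show ?thesis unfolding p_def by simp
  qed
  have "\<bar>?Q n w - ?P n w\<bar> \<le> (\<Sum>k<Suc n. 2 * (B * h) * ?o n w + (B * h) * (B * h))"
   unfolding sum_subtractf[symmetric] by (rule order_trans[OF sum_abs]) (intro sum_mono one, simp)
  also have "\<dots> = real (Suc n) * (2 * (B * h) * ?o n w + (B * h) * (B * h))" by (simp only: sum_constant card_lessThan)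
  also have "\<dots> = 2 * B * (real (Suc n) * h) * ?o n w + B * (real (Suc n) * h) * (B * h)" by (simp only: distrib_left mult_ac)
  also have "real (Suc n) * h = T" by (simp add: h_def)
  finally show ?thesis by (simp add: h_def)
 qed
 have bd: "norm (\<E> (?Q n) - \<E> (?P n)) \<le> 2 * B * T * \<E> (?o n) + B * T * (B * (T / real (Suc n)))" for n
 proof -
  have "norm (\<E> (\<lambda>w. ?Q n w - ?P n w)) \<le> \<E> (?b n)"
  proof (rule norm_integral_le)
   show "integrable M (\<lambda>w. ?Q n w - ?P n w)" using iQ iP by (rule lint_integrable_diff)
   show "integrable M (?b n)" using io by (intro lint_integrable_add integrable_mult_right) auto
  qed (use pw in \<open>simp only: real_norm_def\<close>)
  also have "\<E> (?b n) = 2 * B * T * \<E> (?o n) + B * T * (B * (T / real (Suc n)))"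
   using io by (subst lint_add) (auto simp: prob_space simp del: of_nat_Suc)
  finally show ?thesis unfolding lint_diff[OF iQ iP] .
 qed
 have "(\<lambda>n. 2 * B * T * \<E> (?o n) + B * T * (B * (T * (1 / real (Suc n))))) \<longlonglongrightarrow> 2 * B * T * \<E> (\<lambda>w. 0) + B * T * (B * (T * 0))"
  by (intro tendsto_intros o0 LIMSEQ_Suc[OF lim_1_over_n])
 then have b0: "(\<lambda>n. 2 * B * T * \<E> (?o n) + B * T * (B * (T / real (Suc n)))) \<longlonglongrightarrow> 0" by simp
 have "(\<lambda>n. \<E> (?Q n) - \<E> (?P n)) \<longlonglongrightarrow> 0"
  by (rule Lim_null_comparison[OF always_eventually[OF allI[OF bd]] b0])
 from tendsto_add[OF this psum_square_variation[OF T]]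
 have "(\<lambda>n. \<E> (?Q n)) \<longlonglongrightarrow> (\<Sum>i\<in>I. \<E> (\<lambda>w. LINT r:{0<..T}|lborel. (real m * X i r w ^ (m - 1))^2 * quadratic i r w))"
  by (simp del: sum.lessThan_Suc)
 then show ?thesis unfolding MQ[symmetric] by (simp add: LIMSEQ_const_iff)
qed

text \<open>The submartingale property of the square, on an event of the past: the cross term with
  the later increment has mean zero and its square is nonnegative.\<close>

lemma Mart_square_increment_nonneg:
 assumes st: "0 \<le> s" "s \<le> t" and E: "E \<in> sets (F s)"
 shows "\<E> (\<lambda>w. indicator E w * (Mart s w)^2) \<le> \<E> (\<lambda>w. indicator E w * (Mart t w)^2)"
proof -
 let ?A = "\<lambda>w. (indicator E w * Mart s w) * (Mart t w - Mart s w)"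
 have t: "0 \<le> t" using st by simp
 have E': "E \<in> sets M" using E sets_F by blast
 have iE: "(\<lambda>w. indicator E w :: real) \<in> borel_measurable (F s)" using E by simp
 have iE': "(\<lambda>w. indicator E w :: real) \<in> borel_measurable M" using E' by simp
 have sq: "integrable M (\<lambda>w. indicator E w * f w)" if "integrable M f" for f :: "'w \<Rightarrow> real"
  using integrable_mult_indicator[OF E' that] by simp
 have d: "sq_int M (\<lambda>w. Mart t w - Mart s w)" by (intro sq_int_diff Mart_sq_int st t)
 have z: "\<E> ?A = 0"
 proof (rule Mart_martingale[OF st])
  show "(\<lambda>w. indicator E w * Mart s w) \<in> borel_measurable (F s)"
   by (intro borel_measurable_times iE Mart_adapted st)
  fix w assume "w \<in> space M"
  from Mart_bound[OF this st(1)] show "\<bar>indicator E w * Mart s w\<bar> \<le> real (card I) + B * s"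
   using B_nonneg st by (auto simp: indicator_def)
 qed
 have iz: "integrable M ?A"
  using sq[OF sq_int_mult[OF Mart_sq_int[OF st(1)] d]] by (simp add: mult.assoc)
 note i1 = sq[OF sq_int_integrable_square[OF Mart_sq_int[OF st(1)]]]
  and i2 = sq[OF sq_int_integrable_square[OF d]]
 have "\<E> (\<lambda>w. indicator E w * (Mart t w)^2) = \<E> (\<lambda>w. (indicator E w * (Mart s w)^2 +
   indicator E w * (Mart t w - Mart s w)^2) + 2 * ((indicator E w * Mart s w) * (Mart t w - Mart s w)))"
  by (intro lint_cong refl) (auto simp: indicator_def power2_eq_square algebra_simps)
 also have "\<dots> = \<E> (\<lambda>w. indicator E w * (Mart s w)^2) + \<E> (\<lambda>w. indicator E w * (Mart t w - Mart s w)^2)"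
  unfolding lint_add[OF lint_integrable_add[OF i1 i2] integrable_mult_right[OF iz]]
   lint_add[OF i1 i2] integral_mult_right_zero z by simp
 finally show ?thesis
  using lint_nonneg[of M "\<lambda>w. indicator E w * (Mart t w - Mart s w)^2"] by simp
qed

text \<open>Doob's argument. The event is split according to the first grid time at which the level
  is exceeded; on each piece the squared level is below the square at that time, and the
  submartingale property moves it to time \<open>T\<close>.\<close>

lemma Mart_discrete_maximal:
 assumes T: "0 \<le> T" and \<epsilon>: "0 < \<epsilon>"
 shows "{w \<in> space M. \<exists>k\<le>Suc n. \<epsilon> < \<bar>Mart (grid 0 T n k) w\<bar>} \<in> sets M"
  and "\<epsilon>^2 * prob {w \<in> space M. \<exists>k\<le>Suc n. \<epsilon> < \<bar>Mart (grid 0 T n k) w\<bar>} \<le> \<E> (\<lambda>w. (Mart T w)^2)"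
proof -
 let ?A = "\<lambda>E k w. indicator (E k) w * (Mart T w)^2"
 let ?B = "\<lambda>E w. \<Sum>k\<le>Suc n. indicator (E k) w * (Mart T w)^2"
 let ?C = "\<lambda>w. (Mart T w)^2"
 let ?D = "\<lambda>E. \<Union>k\<in>{..Suc n}. E k"
 let ?M = "\<lambda>k. Mart (grid 0 T n k)"
 let ?U = "{w \<in> space M. \<exists>k\<le>Suc n. \<epsilon> < \<bar>?M k w\<bar>}"
 \<comment> \<open>First passage at index \<open>k\<close>: these events are disjoint, and each is
   known at its own grid time.\<close>
 define E where "E k = {w \<in> space M. \<epsilon> < \<bar>?M k w\<bar> \<and> (\<forall>j<k. \<bar>?M j w\<bar> \<le> \<epsilon>)}" for k
 have g: "0 \<le> grid 0 T n k" "grid 0 T n k \<le> T" if "k \<le> Suc n" for k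
  using grid_range[OF order_refl T that] by auto
 have EF: "E k \<in> sets (F (grid 0 T n k))" if k: "k \<le> Suc n" for k
 proof -
  have [measurable]: "?M j \<in> borel_measurable (F (grid 0 T n k))" if "j \<le> k" for j
  proof (rule F_measurable_mono)
   show "grid 0 T n j \<le> grid 0 T n k" by (rule grid_mono[OF T that])
   show "?M j \<in> borel_measurable (F (grid 0 T n j))" using that k by (intro Mart_adapted g) auto
  qed
  have "E k = {w \<in> space (F (grid 0 T n k)). \<epsilon> < \<bar>?M k w\<bar>} \<inter> {w \<in> space (F (grid 0 T n k)). \<forall>j\<in>{..<k}. \<bar>?M j w\<bar> \<le> \<epsilon>}"
   by (auto simp: E_def space_F)
  also have "\<dots> \<in> sets (F (grid 0 T n k))"
  proof (rule sets.Int)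
   show "{w \<in> space (F (grid 0 T n k)). \<epsilon> < \<bar>?M k w\<bar>} \<in> sets (F (grid 0 T n k))" by measurable
   show "{w \<in> space (F (grid 0 T n k)). \<forall>j\<in>{..<k}. \<bar>?M j w\<bar> \<le> \<epsilon>} \<in> sets (F (grid 0 T n k))"
    by (rule sets.sets_Collect_finite_All) (auto intro!: borel_measurable_le)
  qed
  finally show ?thesis .
 qed
 have EM: "E k \<in> sets M" if "k \<le> Suc n" for k using EF[OF that] sets_F by blast
 have U: "?U = (?D E)"
 proof (intro equalityI subsetI)
  fix w assume "w \<in> ?U"
  then obtain k where k: "w \<in> space M" "k \<le> Suc n" "\<epsilon> < \<bar>?M k w\<bar>" by auto
  define l where "l = (LEAST l. \<epsilon> < \<bar>?M l w\<bar>)"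
  have "\<epsilon> < \<bar>?M l w\<bar>" "l \<le> k" unfolding l_def using k(3) by (auto intro: LeastI Least_le)
  moreover have "\<bar>?M j w\<bar> \<le> \<epsilon>" if "j < l" for j using not_less_Least[of j] that unfolding l_def by force
  ultimately show "w \<in> (?D E)" using k by (auto simp: E_def intro!: bexI[of _ l])
 qed (auto simp: E_def)
 show UM: "?U \<in> sets M" unfolding U using EM by (intro sets.finite_UN) auto
 have disj: "disjoint_family_on E {..Suc n}"
 proof (unfold disjoint_family_on_def, intro ballI impI)
  fix j k :: nat assume "j \<noteq> k"
  then show "E j \<inter> E k = {}" by (cases j k rule: linorder_cases) (auto simp: E_def not_le[symmetric])
 qed
 have iM: "integrable M (\<lambda>w. indicator (E k) w * (Mart t w)^2)" if "k \<le> Suc n" "0 \<le> t" for k t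
  using integrable_mult_indicator[OF EM[OF that(1)] sq_int_integrable_square[OF Mart_sq_int[OF that(2)]]] by simp
 have one: "\<epsilon>^2 * prob (E k) \<le> \<E> (?A E k)" if k: "k \<le> Suc n" for k
 proof -
  have "\<epsilon>^2 * prob (E k) = \<E> (\<lambda>w. \<epsilon>^2 * indicator (E k) w)" using EM[OF k] by simp
  also have "\<dots> \<le> \<E> (\<lambda>w. indicator (E k) w * (?M k w)^2)"
  proof (rule integral_mono)
   show "integrable M (\<lambda>w. \<epsilon>^2 * indicator (E k) w)" using EM[OF k] by (intro integrable_mult_right integrable_real_indicator) (auto simp: emeasure_eq_measure)
   show "integrable M (\<lambda>w. indicator (E k) w * (?M k w)^2)" by (rule iM[OF k g(1)[OF k]])
   fix w
   have "\<epsilon>^2 \<le> (?M k w)^2" if "w \<in> E k"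
    using that \<epsilon> by (intro abs_le_square_iff[THEN iffD1]) (auto simp: E_def)
   then show "\<epsilon>^2 * indicator (E k) w \<le> indicator (E k) w * (?M k w)^2" by (auto simp: indicator_def)
  qed
  also have "\<dots> \<le> \<E> (?A E k)"
   by (rule Mart_square_increment_nonneg[OF g[OF k] EF[OF k]])
  finally show ?thesis .
 qed
 have "\<epsilon>^2 * prob ?U = (\<Sum>k\<le>Suc n. \<epsilon>^2 * prob (E k))"
  unfolding U using finite_measure_finite_Union[OF _ _ disj] EM by (subst finite_measure_finite_Union) (auto simp: disj sum_distrib_left simp del: sum.atMost_Suc)
 also have "\<dots> \<le> (\<Sum>k\<le>Suc n. \<E> (?A E k))"
  by (intro sum_mono one) simp
 also have "\<dots> = \<E> (?B E)"
  by (rule lint_sum[symmetric], rule iM) (use T in auto)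
 also have "\<dots> \<le> \<E> ?C"
 proof (rule integral_mono)
  show "integrable M (?B E)"
   by (rule lint_integrable_sum, rule iM) (use T in auto)
  show "integrable M ?C" by (rule sq_int_integrable_square[OF Mart_sq_int[OF T]])
  fix w
  have "(\<Sum>k\<le>Suc n. indicator (E k) w * (Mart T w)^2) = indicator (?D E) w * (Mart T w)^2"
   unfolding sum_distrib_right[symmetric] by (subst indicator_UN_disjoint[OF _ disj]) auto
  also have "\<dots> \<le> (Mart T w)^2" by (auto simp: indicator_def)
  finally show "(\<Sum>k\<le>Suc n. indicator (E k) w * (Mart T w)^2) \<le> (Mart T w)^2" .
 qed
 finally show "\<epsilon>^2 * prob ?U \<le> \<E> ?C" .
qed

text \<open>Dyadic grids are nested, so the discrete events increase and their union obeys the same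
  bound. Off the union the path is bounded at all dyadic fractions of \<open>T\<close>, hence
  everywhere on \<open>[0,T]\<close> by continuity.\<close>

lemma Mart_maximal_inequality:
 assumes T: "0 \<le> T" and \<epsilon>: "0 < \<epsilon>"
 shows "\<exists>E\<in>sets M. \<epsilon>^2 * prob E \<le> \<E> (\<lambda>w. (Mart T w)^2) \<and> (\<forall>w\<in>space M - E. \<forall>t\<in>{0..T}. \<bar>Mart t w\<bar> \<le> \<epsilon>)"
proof -
 define E where "E l = {w \<in> space M. \<exists>k\<le>Suc (2 ^ l - 1). \<epsilon> < \<bar>Mart (grid 0 T (2 ^ l - 1) k) w\<bar>}" for l :: nat
 \<comment> \<open>A grid with index \<open>n\<close> has \<open>n + 1\<close> cells, so the dyadic
   grid of level \<open>l\<close> has index \<open>2 ^ l - 1\<close>.\<close>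
 have S: "Suc (2 ^ l - 1) = 2 ^ l" for l :: nat by simp
 have g: "grid 0 T (2 ^ l - 1) k = T * real k / 2 ^ l" for l k :: nat unfolding grid_def S by simp
 have Em: "E l \<in> sets M" and Ep: "\<epsilon>^2 * prob (E l) \<le> \<E> (\<lambda>w. (Mart T w)^2)" for l
  unfolding E_def using Mart_discrete_maximal[OF T \<epsilon>] by blast+
 have "incseq E"
 proof (rule incseq_SucI, rule subsetI)
  fix l w assume "w \<in> E l"
  then obtain k where k: "w \<in> space M" "k \<le> 2 ^ l" "\<epsilon> < \<bar>Mart (grid 0 T (2 ^ l - 1) k) w\<bar>" by (auto simp: E_def)
  have "grid 0 T (2 ^ Suc l - 1) (2 * k) = grid 0 T (2 ^ l - 1) k" unfolding g by simp
  then show "w \<in> E (Suc l)" unfolding E_def S using k by (intro CollectI conjI exI[of _ "2 * k"]) auto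
 qed
 then have "(\<lambda>l. prob (E l)) \<longlonglongrightarrow> prob (\<Union>l. E l)" using Em by (intro finite_Lim_measure_incseq) auto
 then have lim: "(\<lambda>l. \<epsilon>^2 * prob (E l)) \<longlonglongrightarrow> \<epsilon>^2 * prob (\<Union>l. E l)" by (intro tendsto_intros)
 have "\<epsilon>^2 * prob (\<Union>l. E l) \<le> \<E> (\<lambda>w. (Mart T w)^2)"
  by (rule LIMSEQ_le_const2[OF lim]) (use Ep in auto)
 moreover have "\<bar>Mart t w\<bar> \<le> \<epsilon>" if w: "w \<in> space M - (\<Union>l. E l)" and t: "t \<in> {0..T}" for w t
 proof (cases "T = 0")
  case True
  then show ?thesis using t \<epsilon> Mart_0 by simp
 next
  case False
  then have T0: "0 < T" using T by simp
  \<comment> \<open>The point \<open>a l\<close> is the last dyadic grid point of level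
    \<open>l\<close> not after \<open>t\<close>.\<close>
  define k where "k l = nat \<lfloor>t / T * 2 ^ l\<rfloor>" for l :: nat
  define a where "a l = T * real (k l) / 2 ^ l" for l :: nat
  have kr: "real (k l) = of_int \<lfloor>t / T * 2 ^ l\<rfloor>" for l using t T0 by (simp add: k_def)
  have k1: "real (k l) \<le> t / T * 2 ^ l" "t / T * 2 ^ l - 1 \<le> real (k l)" for l unfolding kr by linarith+
  have "k l \<le> 2 ^ l" for l
  proof -
   have "t / T * 2 ^ l \<le> 1 * 2 ^ l" using t T0 by (intro mult_right_mono) auto
   from order_trans[OF k1(1) this] show ?thesis by simp
  qed
  then have Mb: "\<bar>Mart (a l) w\<bar> \<le> \<epsilon>" for l
   using w unfolding E_def S g a_def by (auto simp: not_less)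
  have "a \<longlonglongrightarrow> t"
  proof (rule tendsto_sandwich[of "\<lambda>l. t - T * (1 / 2) ^ l" _ _ "\<lambda>_. t"])
   show "\<forall>\<^sub>F l in sequentially. t - T * (1 / 2) ^ l \<le> a l"
   proof (rule always_eventually, rule allI)
    fix l
    have "T * (t / T * 2 ^ l - 1) / 2 ^ l \<le> a l" unfolding a_def using k1(2)[of l] T0
     by (intro divide_right_mono mult_left_mono) auto
    moreover have "T * (t / T * 2 ^ l - 1) / 2 ^ l = t - T * (1 / 2) ^ l"
     using T0 by (simp add: power_one_over right_diff_distrib diff_divide_distrib)
    ultimately show "t - T * (1 / 2) ^ l \<le> a l" by simp
   qed
   show "\<forall>\<^sub>F l in sequentially. a l \<le> t"
   proof (rule always_eventually, rule allI)
    fix l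
    have "a l \<le> T * (t / T * 2 ^ l) / 2 ^ l" unfolding a_def using k1(1)[of l] T0
     by (intro divide_right_mono mult_left_mono) auto
    then show "a l \<le> t" using T0 by simp
   qed
   have "(\<lambda>l. t - T * (1 / 2) ^ l) \<longlonglongrightarrow> t - T * 0" by (intro tendsto_intros LIMSEQ_power_zero) auto
   then show "(\<lambda>l. t - T * (1 / 2) ^ l) \<longlonglongrightarrow> t" by simp
  qed auto
  moreover have "0 \<le> a l" for l using T0 by (simp add: a_def)
  ultimately have "(\<lambda>l. Mart (a l) w) \<longlonglongrightarrow> Mart t w"
   using continuous_on_tendsto_compose[OF Mart_cont, of w a t sequentially] w t by auto
  then have "(\<lambda>l. \<bar>Mart (a l) w\<bar>) \<longlonglongrightarrow> \<bar>Mart t w\<bar>" by (rule tendsto_rabs)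
  then show ?thesis by (rule LIMSEQ_le_const2) (use Mb in auto)
 qed
 ultimately show ?thesis using Em by (intro bexI[of _ "\<Union>l. E l"]) auto
qed

end

section \<open>The Jacobi drift\<close>

definition interaction :: "(nat \<Rightarrow> real) \<Rightarrow> nat \<Rightarrow> nat \<Rightarrow> real" where
 "interaction x i j = 2 * x i * (1 - x i) / (x i - x j)"

lemma jacobi_drift_interaction:
 "jacobi_drift N a b \<beta> x i = a + 1 - (a + b + 2) * x i + \<beta> / 2 * (\<Sum>j\<in>{1..N} - {i}. interaction x i j)"
 by (simp add: jacobi_drift_def interaction_def)

text \<open>The two terms of a pair add up to the divided difference of the polynomial
  \<open>2 x (1 - x)\<close>, so the singularity cancels.\<close>

lemma interaction_add:
 assumes "x i \<noteq> x j"
 shows "interaction x i j + interaction x j i = 2 * (1 - x i - x j)"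
proof -
 have d: "x i - x j \<noteq> 0" using assms by simp
 have "interaction x j i = - (2 * x j * (1 - x j) / (x i - x j))"
  unfolding interaction_def by (metis minus_diff_eq minus_divide_right)
 then have "interaction x i j + interaction x j i = (2 * x i * (1 - x i) - 2 * x j * (1 - x j)) / (x i - x j)"
  by (simp add: interaction_def diff_divide_distrib)
 also have "2 * x i * (1 - x i) - 2 * x j * (1 - x j) = 2 * (1 - x i - x j) * (x i - x j)"
  by (simp add: algebra_simps)
 finally show ?thesis using d by simp
qed

text \<open>
 In the sum of the drifts weighted by the rank, the singular term of a pair \<open>j < k\<close> survives with the
 positive coefficient \<open>k - j\<close>; this controls every single drift from above.
\<close>

lemma jacobi_drift_abs_le:
 assumes \<beta>: "0 < \<beta>" and i: "i \<in> {1..N}"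
  and x: "\<And>j. j \<in> {1..N} \<Longrightarrow> 0 \<le> x j" "\<And>j. j \<in> {1..N} \<Longrightarrow> x j \<le> 1"
  and mono: "mono_on {1..N} x" and inj: "inj_on x {1..N}"
 shows "\<bar>jacobi_drift N a b \<beta> x i\<bar> \<le>
   (1 + 2 * (real N)^2) * (\<bar>a + 1\<bar> + \<bar>a + b + 2\<bar>) + \<beta> * (2 * real N ^ 3 + real N) + 2 * (\<Sum>k\<in>{1..N}. real k * jacobi_drift N a b \<beta> x k)"
proof -
 let ?I = "{1..N}"
 let ?T = "interaction x"
 \<comment> \<open>The interaction of the pair as seen from its upper particle: nonnegative for
   ordered particles, and symmetric in \<open>k\<close> and \<open>j\<close>.\<close>
 define u where "u k j = (if j < k then ?T k j else ?T j k)" for k j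
 define A where "A = \<bar>a + 1\<bar> + \<bar>a + b + 2\<bar>"
 have N: "1 \<le> real N" using i by simp
 have Tpos: "0 \<le> ?T k j" if "k \<in> ?I" "j \<in> ?I" "j < k" for k j
 proof -
  have "x j \<le> x k" using mono that by (auto simp: mono_on_def)
  then show ?thesis unfolding interaction_def using x[OF that(1)] by simp
 qed
 have ne: "x k \<noteq> x j" if "k \<in> ?I" "j \<in> ?I" "k \<noteq> j" for k j using inj_onD[OF inj _ that(1,2)] that(3) by blast
 have u0: "0 \<le> u k j" if "k \<in> ?I" "j \<in> ?I" "k \<noteq> j" for k j using Tpos[of k j] Tpos[of j k] that by (auto simp: u_def)
 have c1: "\<bar>1 - x k - x j\<bar> \<le> 1" if "k \<in> ?I" "j \<in> ?I" for k j using x[OF that(1)] x[OF that(2)] by (auto simp: abs_le_iff)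
 \<comment> \<open>The lower particle feels minus \<open>u\<close> plus the bounded term from
   \<open>interaction_add\<close>.\<close>
 have Tu: "\<bar>?T k j\<bar> \<le> u k j + 2" if kj: "k \<in> ?I" "j \<in> ?I" "k \<noteq> j" for k j
 proof (cases "j < k")
  case True
  then show ?thesis using Tpos[of k j] kj by (simp add: u_def)
 next
  case False
  then have "?T k j = 2 * (1 - x k - x j) - u k j" using interaction_add[of x k j] ne[OF kj] by (simp add: u_def)
  moreover have "\<bar>2 * v - w\<bar> \<le> w + 2" if "\<bar>v\<bar> \<le> 1" "0 \<le> w" for v w :: real using that by linarith
  ultimately show ?thesis using c1[OF kj(1,2)] u0[OF kj] by simp
 qed
 \<comment> \<open>With \<open>j < k\<close> the two weighted interactions combine to
   \<open>k - j\<close> copies of the singular term, at least one, plus a term of size at most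
   \<open>2 N\<close>.\<close>
 have pair: "u k j - 2 * real N \<le> real k * ?T k j + real j * ?T j k" if kj: "k \<in> ?I" "j \<in> ?I" "k \<noteq> j" for k j
 proof -
  have *: "?T k j - 2 * real N \<le> real k * ?T k j + real j * ?T j k" if kj: "k \<in> ?I" "j \<in> ?I" "j < k" for k j
  proof -
   have ji: "?T j k = 2 * (1 - x k - x j) - ?T k j" using interaction_add[of x k j] ne[of k j] kj by simp
   have e: "real k * ?T k j + real j * ?T j k = (real k - real j) * ?T k j + 2 * (real j * (1 - x k - x j))"
    unfolding ji by (simp add: algebra_simps)
   have "1 * ?T k j \<le> (real k - real j) * ?T k j" using kj Tpos[OF kj] by (intro mult_right_mono) auto
   moreover have "\<bar>real j * (1 - x k - x j)\<bar> \<le> real N * 1"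
    unfolding abs_mult using kj c1[OF kj(1,2)] by (intro mult_mono) auto
   ultimately show ?thesis unfolding e by linarith
  qed
  show ?thesis
  proof (cases "j < k")
   case True
   then show ?thesis using *[of k j] kj by (simp add: u_def)
  next
   case False
   then show ?thesis using *[of j k] kj by (simp add: u_def add.commute)
  qed
 qed
 define S where "S = (\<Sum>k\<in>?I. \<Sum>j\<in>?I - {k}. real k * ?T k j)"
 have swap: "(\<Sum>k\<in>?I. \<Sum>j\<in>?I - {k}. f k j) = (\<Sum>k\<in>?I. \<Sum>j\<in>?I - {k}. f j k)" for f :: "nat \<Rightarrow> nat \<Rightarrow> real"
 proof -
  have r: "(\<Sum>j\<in>?I - {k}. g j) = (\<Sum>j\<in>?I. if j = k then 0 else g j)" for k and g :: "nat \<Rightarrow> real"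
  proof -
   have "(\<Sum>j\<in>?I. if j = k then 0 else g j) = (\<Sum>j\<in>?I - {k}. if j = k then 0 else g j)"
    by (rule sum.mono_neutral_right) auto
   also have "\<dots> = (\<Sum>j\<in>?I - {k}. g j)" by (rule sum.cong) auto
   finally show ?thesis by simp
  qed
  show ?thesis unfolding r by (subst sum.swap) (intro sum.cong refl, auto)
 qed
 have "(\<Sum>k\<in>?I. \<Sum>j\<in>?I - {k}. u k j - 2 * real N) \<le> (\<Sum>k\<in>?I. \<Sum>j\<in>?I - {k}. real k * ?T k j + real j * ?T j k)"
  by (intro sum_mono pair) auto
 also have "\<dots> = 2 * S" unfolding sum.distrib S_def using swap[of "\<lambda>k j. real j * ?T j k"] by simp
 finally have S1: "(\<Sum>k\<in>?I. \<Sum>j\<in>?I - {k}. u k j) - (\<Sum>k\<in>?I. \<Sum>j\<in>?I - {k}. 2 * real N) \<le> 2 * S"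
  by (simp only: sum_subtractf)
 have S2: "(\<Sum>k\<in>?I. \<Sum>j\<in>?I - {k}. 2 * real N) \<le> 2 * real N ^ 3"
 proof -
  have "(\<Sum>j\<in>?I - {k}. 2 * real N) \<le> 2 * real N * real N" if "k \<in> ?I" for k
  proof -
   have "real (card (?I - {k})) \<le> real N" by (simp add: card_Diff_singleton_if)
   then have "real (card (?I - {k})) * (2 * real N) \<le> real N * (2 * real N)" by (rule mult_right_mono) simp
   then show ?thesis by (simp add: mult_ac)
  qed
  then have "(\<Sum>k\<in>?I. \<Sum>j\<in>?I - {k}. 2 * real N) \<le> (\<Sum>k\<in>?I. 2 * real N * real N)" by (rule sum_mono)
  then show ?thesis by (simp add: power3_eq_cube)
 qed
 have row: "(\<Sum>j\<in>?I - {i}. u i j) \<le> (\<Sum>k\<in>?I. \<Sum>j\<in>?I - {k}. u k j)"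
  by (rule member_le_sum[OF i, of "\<lambda>k. \<Sum>j\<in>?I - {k}. u k j"]) (auto intro!: sum_nonneg u0)
 have lin: "\<bar>a + 1 - (a + b + 2) * x k\<bar> \<le> A" if "k \<in> ?I" for k
 proof -
  have "\<bar>(a + b + 2) * x k\<bar> \<le> \<bar>a + b + 2\<bar> * 1" unfolding abs_mult using x[OF that] by (intro mult_left_mono) auto
  then show ?thesis unfolding A_def mult_1_right by (intro order_trans[OF abs_triangle_ineq4] add_left_mono)
 qed
 have "\<bar>jacobi_drift N a b \<beta> x i\<bar> \<le> A + \<beta> / 2 * (\<Sum>j\<in>?I - {i}. u i j + 2)"
 proof -
  have "\<bar>\<Sum>j\<in>?I - {i}. ?T i j\<bar> \<le> (\<Sum>j\<in>?I - {i}. u i j + 2)"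
   by (rule order_trans[OF sum_abs]) (intro sum_mono Tu, use i in auto)
  then have "\<bar>\<beta> / 2 * (\<Sum>j\<in>?I - {i}. ?T i j)\<bar> \<le> \<beta> / 2 * (\<Sum>j\<in>?I - {i}. u i j + 2)"
   unfolding abs_mult using \<beta> by simp
  then show ?thesis unfolding jacobi_drift_interaction using lin[OF i] by linarith
 qed
 also have "(\<Sum>j\<in>?I - {i}. u i j + 2) \<le> 2 * S + 2 * real N ^ 3 + 2 * real N"
 proof -
  have "real (card (?I - {i})) \<le> real N" by (simp add: card_Diff_singleton_if)
  then have "(\<Sum>j\<in>?I - {i}. u i j + 2) \<le> (\<Sum>j\<in>?I - {i}. u i j) + 2 * real N" by (simp add: sum.distrib)
  then show ?thesis using row S1 S2 by linarith
 qed
 finally have 1: "\<bar>jacobi_drift N a b \<beta> x i\<bar> \<le> A + \<beta> / 2 * (2 * S + 2 * real N ^ 3 + 2 * real N)"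
  using \<beta> by (simp add: mult_left_mono)
 \<comment> \<open>The rank-weighted sum of drifts is solved for its interaction part; the linear
   parts of the drifts cost at most \<open>N^2 * A\<close>.\<close>
 have 2: "\<beta> / 2 * S \<le> (\<Sum>k\<in>?I. real k * jacobi_drift N a b \<beta> x k) + (real N)^2 * A"
 proof -
  have "(\<Sum>k\<in>?I. real k * jacobi_drift N a b \<beta> x k) = (\<Sum>k\<in>?I. real k * (a + 1 - (a + b + 2) * x k)) + \<beta> / 2 * S"
   unfolding jacobi_drift_interaction S_def by (simp add: distrib_left sum.distrib sum_distrib_left mult_ac)
  moreover have "\<bar>\<Sum>k\<in>?I. real k * (a + 1 - (a + b + 2) * x k)\<bar> \<le> (\<Sum>k\<in>?I. real N * A)"
  proof (rule order_trans[OF sum_abs], rule sum_mono)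
   fix k assume k: "k \<in> ?I"
   show "\<bar>real k * (a + 1 - (a + b + 2) * x k)\<bar> \<le> real N * A"
    unfolding abs_mult using k lin[OF k] by (intro mult_mono) auto
  qed
  ultimately show ?thesis by (simp add: power2_eq_square abs_le_iff)
 qed
 have "A + \<beta> / 2 * (2 * S + 2 * real N ^ 3 + 2 * real N) = A + 2 * (\<beta> / 2 * S) + \<beta> * (real N ^ 3 + real N)"
  by (simp add: algebra_simps)
 also have "\<dots> \<le> A + 2 * ((\<Sum>k\<in>?I. real k * jacobi_drift N a b \<beta> x k) + (real N)^2 * A) + \<beta> * (2 * real N ^ 3 + real N)"
  using 2 \<beta> by (intro add_mono mult_left_mono) auto
 also have "\<dots> = (1 + 2 * (real N)^2) * A + \<beta> * (2 * real N ^ 3 + real N) + 2 * (\<Sum>k\<in>?I. real k * jacobi_drift N a b \<beta> x k)"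
  by (simp add: algebra_simps)
 finally show ?thesis using 1 unfolding A_def by linarith
qed

section \<open>The symmetrized drift of power sums\<close>

definition power_sum :: "nat \<Rightarrow> (nat \<Rightarrow> real) \<Rightarrow> nat \<Rightarrow> real" where
 "power_sum N x k = (\<Sum>i=1..N. x i ^ k)"

text \<open>The divided differences of the \<open>k\<close>-th power summed over all pairs, the
  diagonal included, where the value is the derivative; expanding them factorizes the sum into power
  sums.\<close>

definition pair_sum :: "nat \<Rightarrow> (nat \<Rightarrow> real) \<Rightarrow> nat \<Rightarrow> real" where
 "pair_sum N x k = (\<Sum>l<k. power_sum N x (k - Suc l) * power_sum N x l)"

text \<open>For \<open>m \<ge> 1\<close> and distinct particles this is the total drift of the power
  sum. Being polynomial, it extends continuously across collisions and is the \<open>D\<close> of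
  the abstract setting.\<close>

definition power_sum_drift :: "nat \<Rightarrow> real \<Rightarrow> real \<Rightarrow> real \<Rightarrow> nat \<Rightarrow> (nat \<Rightarrow> real) \<Rightarrow> real" where
 "power_sum_drift N a b \<beta> m x =
   real m * ((a + 1) * power_sum N x (m - 1) - (a + b + 2) * power_sum N x m) +
   real m * (real m - 1) * (power_sum N x (m - 1) - power_sum N x m) +
   real m * \<beta> / 2 * ((pair_sum N x m - real m * power_sum N x (m - 1)) - (pair_sum N x (Suc m) - real (Suc m) * power_sum N x m))"

lemma off_diagonal_pair_sum:
 "(\<Sum>i=1..N. \<Sum>j\<in>{1..N} - {i}. \<Sum>l<k. x j ^ (k - Suc l) * x i ^ l) = pair_sum N x k - real k * power_sum N x (k - 1)"
proof -
 let ?f = "\<lambda>i j. \<Sum>l<k. x j ^ (k - Suc l) * x i ^ l"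
 have d: "?f i i = real k * x i ^ (k - 1)" for i
 proof -
  have "?f i i = (\<Sum>l<k. x i ^ (k - 1))"
  proof (intro sum.cong refl)
   fix l assume "l \<in> {..<k}"
   then have "k - Suc l + l = k - 1" by auto
   then show "x i ^ (k - Suc l) * x i ^ l = x i ^ (k - 1)" by (metis power_add)
  qed
  then show ?thesis by simp
 qed
 have "(\<Sum>i=1..N. \<Sum>j\<in>{1..N} - {i}. ?f i j) = (\<Sum>i=1..N. (\<Sum>j=1..N. ?f i j) - ?f i i)"
  by (intro sum.cong refl) (simp add: sum_diff1)
 also have "\<dots> = (\<Sum>i=1..N. \<Sum>j=1..N. ?f i j) - real k * power_sum N x (k - 1)"
  unfolding d by (simp add: sum_subtractf power_sum_def sum_distrib_left)
 also have "(\<Sum>i=1..N. \<Sum>j=1..N. ?f i j) = pair_sum N x k"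
 proof -
  have "(\<Sum>i=1..N. \<Sum>j=1..N. ?f i j) = (\<Sum>i=1..N. \<Sum>l<k. \<Sum>j=1..N. x j ^ (k - Suc l) * x i ^ l)"
   by (rule sum.cong[OF refl], rule sum.swap)
  also have "\<dots> = (\<Sum>l<k. \<Sum>i=1..N. \<Sum>j=1..N. x j ^ (k - Suc l) * x i ^ l)" by (rule sum.swap)
  also have "\<dots> = pair_sum N x k"
   unfolding pair_sum_def power_sum_def sum_product by (rule sum.cong[OF refl], rule sum.swap)
  finally show ?thesis .
 qed
 finally show ?thesis .
qed

text \<open>Averaging over the two orders of a pair turns the singular quotients into divided
  differences of \<open>x ^ m\<close> and \<open>x ^ (m + 1)\<close>, because
  \<open>x ^ (m - 1) * 2 x (1 - x)\<close> is \<open>2 (x ^ m - x ^ (m + 1))\<close>. The subtracted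
  multiples of power sums are the missing diagonals.\<close>

lemma interaction_power_sum:
 assumes m: "1 \<le> m" and inj: "inj_on x {1..N}"
 shows "(\<Sum>i=1..N. x i ^ (m - 1) * (\<Sum>j\<in>{1..N} - {i}. interaction x i j)) =
   (pair_sum N x m - real m * power_sum N x (m - 1)) - (pair_sum N x (Suc m) - real (Suc m) * power_sum N x m)"
proof -
 let ?A = "\<lambda>m. pair_sum N x (Suc m) - real (Suc m) * power_sum N x (Suc m - 1)"
 let ?B = "\<lambda>m. pair_sum N x m - real m * power_sum N x (m - 1)"
 let ?C = "\<lambda>m j i. \<Sum>l<Suc m. x j ^ (Suc m - Suc l) * x i ^ l"
 let ?D = "\<lambda>m j i. \<Sum>l<m. x j ^ (m - Suc l) * x i ^ l"
 let ?I = "{1..N}"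
 have swap: "(\<Sum>k\<in>?I. \<Sum>j\<in>?I - {k}. f k j) = (\<Sum>k\<in>?I. \<Sum>j\<in>?I - {k}. f j k)" for f :: "nat \<Rightarrow> nat \<Rightarrow> real"
 proof -
  have r: "(\<Sum>j\<in>?I - {k}. g j) = (\<Sum>j\<in>?I. if j = k then 0 else g j)" for k and g :: "nat \<Rightarrow> real"
  proof -
   have "(\<Sum>j\<in>?I. if j = k then 0 else g j) = (\<Sum>j\<in>?I - {k}. if j = k then 0 else g j)"
    by (rule sum.mono_neutral_right) auto
   also have "\<dots> = (\<Sum>j\<in>?I - {k}. g j)" by (rule sum.cong) auto
   finally show ?thesis by simp
  qed
  show ?thesis unfolding r by (subst sum.swap) (intro sum.cong refl, auto)
 qed
 have pair: "x i ^ (m - 1) * interaction x i j + x j ^ (m - 1) * interaction x j i =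
  2 * (?D m j i) - 2 * (?C m j i)"
  if "i \<in> ?I" "j \<in> ?I" "i \<noteq> j" for i j
 proof -
  have d: "x i - x j \<noteq> 0" using inj_onD[OF inj _ that(1,2)] that(3) by auto
  obtain q where q: "m = Suc q" using m by (cases m) auto
  have "interaction x j i = - (2 * x j * (1 - x j) / (x i - x j))"
   unfolding interaction_def by (metis minus_diff_eq minus_divide_right)
  then have ji: "interaction x j i = - (2 * x j * (1 - x j) / (x i - x j))" .
  have ij: "interaction x i j = 2 * x i * (1 - x i) / (x i - x j)" by (simp add: interaction_def)
  have "v * (y / e) + w * (- (z / e)) = (v * y - w * z) / e" for v w y z e :: real by (simp add: diff_divide_distrib)
  then have "x i ^ (m - 1) * interaction x i j + x j ^ (m - 1) * interaction x j i =
   (x i ^ (m - 1) * (2 * x i * (1 - x i)) - x j ^ (m - 1) * (2 * x j * (1 - x j))) / (x i - x j)"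
   unfolding ij ji .
  also have "x i ^ (m - 1) * (2 * x i * (1 - x i)) - x j ^ (m - 1) * (2 * x j * (1 - x j)) =
   2 * (x i ^ m - x j ^ m) - 2 * (x i ^ Suc m - x j ^ Suc m)"
   unfolding q by (simp add: algebra_simps)
  also have "2 * (x i ^ m - x j ^ m) - 2 * (x i ^ Suc m - x j ^ Suc m) =
   (2 * (?D m j i) - 2 * (?C m j i)) * (x i - x j)"
  proof -
   have "2 * (e * v) - 2 * (e * w) = (2 * v - 2 * w) * e" for e v w :: real by (simp add: algebra_simps)
   then show ?thesis unfolding power_diff_sumr2 .
  qed
  finally show ?thesis unfolding nonzero_mult_div_cancel_right[OF d] .
 qed
 let ?L = "\<Sum>i\<in>?I. \<Sum>j\<in>?I - {i}. x i ^ (m - 1) * interaction x i j"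
 have "2 * ?L = (\<Sum>i\<in>?I. \<Sum>j\<in>?I - {i}. x i ^ (m - 1) * interaction x i j + x j ^ (m - 1) * interaction x j i)"
  unfolding sum.distrib using swap[of "\<lambda>i j. x i ^ (m - 1) * interaction x i j"] by simp
 also have "\<dots> = (\<Sum>i\<in>?I. \<Sum>j\<in>?I - {i}. 2 * (?D m j i) - 2 * (?C m j i))"
  by (intro sum.cong refl pair) auto
 also have "\<dots> = 2 * (?B m) - 2 * (?A m)"
  unfolding off_diagonal_pair_sum[symmetric] by (simp only: sum_subtractf sum_distrib_left)
 finally have e: "2 * ?L = 2 * (?B m) - 2 * (?A m)" .
 have "y = v - w" if "2 * y = 2 * v - 2 * w" for y v w :: real using that by linarith
 from this[OF e] have "?L = (?B m) - (?A m)" .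
 then show ?thesis unfolding sum_distrib_left diff_Suc_1 .
qed

lemma power_sum_drift_eq:
 assumes m: "1 \<le> m" and inj: "inj_on x {1..N}"
 shows "(\<Sum>i=1..N. real m * x i ^ (m - 1) * jacobi_drift N a b \<beta> x i + real m * (real m - 1) * (x i ^ (m - 1) * (1 - x i)))
   = power_sum_drift N a b \<beta> m x"
proof -
 have p: "x i ^ (m - 1) * x i = x i ^ m" for i using m by (cases m) auto
 have "(\<Sum>i=1..N. real m * x i ^ (m - 1) * jacobi_drift N a b \<beta> x i + real m * (real m - 1) * (x i ^ (m - 1) * (1 - x i))) =
  (\<Sum>i=1..N. real m * ((a + 1) * x i ^ (m - 1) - (a + b + 2) * (x i ^ (m - 1) * x i)) + real m * (real m - 1) * (x i ^ (m - 1) - x i ^ (m - 1) * x i)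
   + real m * \<beta> / 2 * (x i ^ (m - 1) * (\<Sum>j\<in>{1..N} - {i}. interaction x i j)))"
  unfolding jacobi_drift_interaction by (intro sum.cong refl) (simp add: algebra_simps)
 also have "\<dots> = real m * ((a + 1) * power_sum N x (m - 1) - (a + b + 2) * power_sum N x m) +
   real m * (real m - 1) * (power_sum N x (m - 1) - power_sum N x m) +
   real m * \<beta> / 2 * (\<Sum>i=1..N. x i ^ (m - 1) * (\<Sum>j\<in>{1..N} - {i}. interaction x i j))"
 proof -
  have "(\<Sum>i=1..N. c * (A * f i - B * g i) + d * (f i - g i) + e * h i) =
   c * (A * (\<Sum>i=1..N. f i) - B * (\<Sum>i=1..N. g i)) + d * ((\<Sum>i=1..N. f i) - (\<Sum>i=1..N. g i)) + e * (\<Sum>i=1..N. h i)"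
   for c d e A B :: real and f g h :: "nat \<Rightarrow> real"
   by (simp only: sum.distrib sum_subtractf sum_distrib_left[symmetric])
  then show ?thesis unfolding p power_sum_def .
 qed
 finally show ?thesis unfolding interaction_power_sum[OF m inj] power_sum_drift_def .
qed

lemma power_sum_bounds:
 assumes "\<And>i. i \<in> {1..N} \<Longrightarrow> 0 \<le> x i" "\<And>i. i \<in> {1..N} \<Longrightarrow> x i \<le> 1"
 shows "0 \<le> power_sum N x k" "power_sum N x k \<le> real N"
proof -
 show "0 \<le> power_sum N x k" unfolding power_sum_def using assms by (intro sum_nonneg) auto
 show "power_sum N x k \<le> real N" unfolding power_sum_def
  using sum_bounded_above[of "{1..N}" "\<lambda>i. x i ^ k" 1] assms by (auto intro: power_le_one)
qed

text \<open>Functions bounded on the cube form an algebra containing the power sums, so no explicit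
  constant has to be computed.\<close>

lemma power_sum_drift_bounded:
 "\<exists>B. \<forall>x. (\<forall>i\<in>{1..N}. 0 \<le> x i \<and> x i \<le> 1) \<longrightarrow> \<bar>power_sum_drift N a b \<beta> m x\<bar> \<le> B"
proof -
 let ?A = "\<lambda>x. \<forall>i\<in>{1..N}. 0 \<le> x i \<and> x i \<le> 1"
 define bdd where "bdd f \<longleftrightarrow> (\<exists>B. \<forall>x. (?A x) \<longrightarrow> \<bar>f x\<bar> \<le> B)" for f :: "(nat \<Rightarrow> real) \<Rightarrow> real"
 have P: "bdd (\<lambda>x. power_sum N x k)" for k unfolding bdd_def
  using power_sum_bounds by (intro exI[of _ "real N"]) fastforce
 have C: "bdd (\<lambda>x. c)" for c unfolding bdd_def by auto
 have A: "bdd (\<lambda>x. f x + g x)" if "bdd f" "bdd g" for f g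
  using that unfolding bdd_def by (meson abs_triangle_ineq add_mono order_trans)
 have Mu: "bdd (\<lambda>x. f x * g x)" if fg: "bdd f" "bdd g" for f g
 proof -
  obtain F G where "\<forall>x. (?A x) \<longrightarrow> \<bar>f x\<bar> \<le> F" "\<forall>x. (?A x) \<longrightarrow> \<bar>g x\<bar> \<le> G"
   using fg unfolding bdd_def by blast
  then have "\<forall>x. (?A x) \<longrightarrow> \<bar>f x * g x\<bar> \<le> \<bar>F\<bar> * \<bar>G\<bar>"
   unfolding abs_mult by (intro allI impI mult_mono) (auto intro: order_trans[OF _ abs_ge_self])
  then show ?thesis unfolding bdd_def by blast
 qed
 have D: "bdd (\<lambda>x. f x - g x)" if "bdd f" "bdd g" for f g
  using A[OF that(1) Mu[OF C[of "-1"] that(2)]] by simp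
 have S: "bdd (\<lambda>x. \<Sum>l<k. f l x)" if "\<And>l. bdd (f l)" for f and k :: nat
  by (induction k) (auto intro: A C that)
 have "bdd (\<lambda>x. pair_sum N x k)" for k unfolding pair_sum_def by (intro S Mu P)
 then have "bdd (power_sum_drift N a b \<beta> m)"
  unfolding power_sum_drift_def[abs_def] by (intro A Mu D C P)
 then show ?thesis unfolding bdd_def .
qed

section \<open>The Jacobi process as a semimartingale\<close>

lemma jacobi_drift_joint_measurable:
 fixes X :: "nat \<Rightarrow> real \<Rightarrow> 'w \<Rightarrow> real"
 assumes "\<And>i. i \<in> {1..N} \<Longrightarrow> (\<lambda>(r, w). X i r w) \<in> borel_measurable (borel \<Otimes>\<^sub>M M)" "i \<in> {1..N}"
 shows "(\<lambda>(r, w). jacobi_drift N a b \<beta> (\<lambda>j. X j r w) i) \<in> borel_measurable (borel \<Otimes>\<^sub>M M)"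
 using assms unfolding jacobi_drift_def split_beta'
 by (intro borel_measurable_add borel_measurable_diff borel_measurable_times borel_measurable_sum borel_measurable_divide borel_measurable_const) auto

lemma power_sum_measurable:
 assumes "\<And>i. i \<in> {1..N} \<Longrightarrow> (\<lambda>z. x z i) \<in> borel_measurable L"
 shows "(\<lambda>z. power_sum N (x z) k) \<in> borel_measurable L"
 unfolding power_sum_def using assms by (intro borel_measurable_sum borel_measurable_power) auto

lemma power_sum_drift_measurable:
 assumes "\<And>i. i \<in> {1..N} \<Longrightarrow> (\<lambda>z. x z i) \<in> borel_measurable L"
 shows "(\<lambda>z. power_sum_drift N a b \<beta> m (x z)) \<in> borel_measurable L"
 unfolding power_sum_drift_def pair_sum_def
 by (intro borel_measurable_add borel_measurable_diff borel_measurable_times borel_measurable_sum borel_measurable_const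
   borel_measurable_divide power_sum_measurable assms)

lemma power_sum_continuous_on:
 assumes "\<And>i. i \<in> {1..N} \<Longrightarrow> continuous_on S (\<lambda>z. x z i)"
 shows "continuous_on S (\<lambda>z. power_sum N (x z) k)"
 unfolding power_sum_def using assms by (intro continuous_intros) auto

lemma power_sum_drift_continuous_on:
 assumes "\<And>i. i \<in> {1..N} \<Longrightarrow> continuous_on S (\<lambda>z. x z i)"
 shows "continuous_on S (\<lambda>z. power_sum_drift N a b \<beta> m (x z))"
 unfolding power_sum_drift_def pair_sum_def
 by (intro continuous_on_add continuous_on_diff continuous_on_mult continuous_on_sum continuous_on_const
   continuous_on_divide power_sum_continuous_on assms) auto

text \<open>The particles are frozen at their initial values for negative times, so that joint
  measurability makes sense on the whole line. The point at issue is the square integrability of the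
  total variation: \<open>jacobi_drift_abs_le\<close> is integrated in time, and the integrated
  drifts on its right side are known from the equations.\<close>

lemma beta_jacobi_ito_system:
 fixes lam :: "nat \<Rightarrow> real \<Rightarrow> 'w \<Rightarrow> real"
 assumes P: "beta_jacobi_process M N a b \<beta> x0 W lam" and N: "1 \<le> N" and \<beta>: "0 < \<beta>"
 defines "X \<equiv> \<lambda>i r. lam i (max 0 r)"
 shows "\<exists>J. ito_system M (augmented_filtration M {1..N} W) {1..N} X
   (\<lambda>i r w. jacobi_drift N a b \<beta> (\<lambda>j. X j r w) i) J"
proof -
 let ?A = "\<lambda>t w i. LINT s:{0..t}|lborel. jacobi_drift N a b \<beta> (\<lambda>j. lam j s w) i"
 let ?B = "\<lambda>w i s. jacobi_drift N a b \<beta> (\<lambda>j. lam j s w) i"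
 let ?C = "\<lambda>i t w. sqrt (2 * lam i t w * (1 - lam i t w))"
 let ?D = "borel \<Otimes>\<^sub>M M"
 let ?I = "{1..N}" and ?F = "augmented_filtration M {1..N} W"
 let ?\<alpha> = "\<lambda>i r w. jacobi_drift N a b \<beta> (\<lambda>j. X j r w) i"
 have ps: "prob_space M" and ind: "independent_brownian_motions M ?I W"
  and adap: "\<And>i t. i \<in> ?I \<Longrightarrow> 0 \<le> t \<Longrightarrow> lam i t \<in> borel_measurable (?F t)"
  and init: "\<And>i w. w \<in> space M \<Longrightarrow> i \<in> ?I \<Longrightarrow> lam i 0 w = x0 i"
  and cont: "\<And>i w. w \<in> space M \<Longrightarrow> i \<in> ?I \<Longrightarrow> continuous_on {0..} (\<lambda>t. lam i t w)"
  and rng: "\<And>i t w. w \<in> space M \<Longrightarrow> 0 \<le> t \<Longrightarrow> i \<in> ?I \<Longrightarrow> 0 \<le> lam i t w \<and> lam i t w \<le> 1"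
  and mono: "\<And>t w. w \<in> space M \<Longrightarrow> 0 \<le> t \<Longrightarrow> mono_on ?I (\<lambda>i. lam i t w)"
  and inj: "AE w in M. AE t in lborel. 0 \<le> t \<longrightarrow> inj_on (\<lambda>i. lam i t w) ?I"
  using P unfolding beta_jacobi_process_def by blast+
 have "\<forall>i\<in>?I. \<exists>J. has_ito_integral M ?F (W i) (?C i) J \<and>
    (AE w in M. \<forall>t\<ge>0. set_integrable lborel {0..t} (?B w i) \<and>
      lam i t w = x0 i + J t w + (?A t w i))"
  using P unfolding beta_jacobi_process_def by blast
 from bchoice[OF this] obtain J where J2: "\<forall>i\<in>?I. has_ito_integral M ?F (W i) (?C i) (J i) \<and>
    (AE w in M. \<forall>t\<ge>0. set_integrable lborel {0..t} (?B w i) \<and>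
      lam i t w = x0 i + J i t w + (?A t w i))" ..
 have J: "\<And>i. i \<in> ?I \<Longrightarrow> has_ito_integral M ?F (W i) (?C i) (J i)"
  using J2 by blast
 have dec: "\<And>i. i \<in> ?I \<Longrightarrow> AE w in M. \<forall>t\<ge>0. set_integrable lborel {0..t} (?B w i) \<and>
      lam i t w = x0 i + J i t w + (?A t w i)"
  using J2 by blast
 interpret brownian_family M ?I W
  by (rule brownian_family.intro[OF ps]) (unfold_locales, use N ind in auto)
 have lamX: "lam i t = X i t" if "0 \<le> t" for i t using that by (simp add: X_def)
 have Xm: "X i t \<in> borel_measurable M" if "i \<in> ?I" for i t
  unfolding X_def by (rule filtration_measurable[OF adap]) (use that in auto)
 have Xjoint: "(\<lambda>(r, w). X i r w) \<in> borel_measurable ?D" if "i \<in> ?I" for i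
  unfolding X_def
  by (rule continuous_process_measurable) (use that cont filtration_measurable[OF adap] in auto)
 have Xr: "0 \<le> X i t w" "X i t w \<le> 1" if "w \<in> space M" "i \<in> ?I" for i t w
  unfolding X_def using rng[OF that(1) _ that(2)] by auto
 have \<alpha>joint: "(\<lambda>(r, w). ?\<alpha> i r w) \<in> borel_measurable ?D" if "i \<in> ?I" for i
  by (rule jacobi_drift_joint_measurable[OF Xjoint that])
 have Jsq: "sq_int M (J i t)" if "i \<in> ?I" "0 \<le> t" for i t
  by (rule ito_integral_sq_int[OF J[OF that(1)] that])
 have cg: "set_integrable lborel {0..t} (?B w i) \<longleftrightarrow> set_integrable lborel {0..t} (\<lambda>r. ?\<alpha> i r w)"
  "(?A t w i) = (LINT r:{0..t}|lborel. ?\<alpha> i r w)" for t w i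
 proof -
  have e: "(\<lambda>s. indicator {0..t} s *\<^sub>R jacobi_drift N a b \<beta> (\<lambda>j. lam j s w) i) = (\<lambda>r. indicator {0..t} r *\<^sub>R ?\<alpha> i r w)"
   by (rule ext) (auto simp: indicator_def X_def)
  show "set_integrable lborel {0..t} (?B w i) \<longleftrightarrow> set_integrable lborel {0..t} (\<lambda>r. ?\<alpha> i r w)"
   unfolding set_integrable_def e ..
  show "(?A t w i) = (LINT r:{0..t}|lborel. ?\<alpha> i r w)"
   unfolding set_lebesgue_integral_def e ..
 qed
 have dec': "AE w in M. \<forall>t\<ge>0. set_integrable lborel {0..t} (\<lambda>r. ?\<alpha> i r w) \<and>
    X i t w = X i 0 w + J i t w + (LINT r:{0..t}|lborel. ?\<alpha> i r w)" if i: "i \<in> ?I" for i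
  using dec[OF i] AE_space
 proof eventually_elim
  case (elim w)
  then show ?case using init[OF elim(2) i] by (simp add: cg lamX[symmetric])
 qed
 have drift: "sq_int M (\<lambda>w. LINT r:{0..t}|lborel. \<bar>?\<alpha> i r w\<bar>)" if i: "i \<in> ?I" and t: "0 \<le> t" for i t
 proof -
  define C where "C = (1 + 2 * (real N)^2) * (\<bar>a + 1\<bar> + \<bar>a + b + 2\<bar>) + \<beta> * (2 * real N ^ 3 + real N)"
  \<comment> \<open>The time integral of the bound in \<open>jacobi_drift_abs_le\<close>, with each
    integrated drift replaced by the increment of the particle minus its martingale part; bounded
    plus square integrable terms.\<close>
  let ?Y = "\<lambda>w. C * t + 2 * (\<Sum>k\<in>?I. real k * (X k t w - X k 0 w - J k t w))"
  have Y: "sq_int M ?Y"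
  proof (rule sq_int_add, simp add: sq_int_def, rule sq_int_cmult, rule sq_int_sum, rule sq_int_cmult)
   fix k assume k: "k \<in> ?I"
   have "sq_int M (X k s)" for s by (rule sq_int_bounded[OF Xm[OF k], of _ 1]) (use Xr[OF _ k] in auto)
   then show "sq_int M (\<lambda>w. X k t w - X k 0 w - J k t w)" by (intro sq_int_diff Jsq k t)
  qed
  show ?thesis
  proof (rule sq_int_bound[OF Y])
   show "(\<lambda>w. LINT r:{0..t}|lborel. \<bar>?\<alpha> i r w\<bar>) \<in> borel_measurable M"
    by (rule set_integral_process_measurable) (use \<alpha>joint[OF i] in \<open>auto simp: split_beta'\<close>)
   have "AE w in M. \<forall>k\<in>?I. \<forall>t\<ge>0. set_integrable lborel {0..t} (\<lambda>r. ?\<alpha> k r w) \<and>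
     X k t w = X k 0 w + J k t w + (LINT r:{0..t}|lborel. ?\<alpha> k r w)"
    using dec' by (intro AE_finite_allI) auto
   then show "AE w in M. \<bar>LINT r:{0..t}|lborel. \<bar>?\<alpha> i r w\<bar>\<bar> \<le> \<bar>?Y w\<bar>"
    using inj AE_space
   proof eventually_elim
    case (elim w)
    have si: "set_integrable lborel {0..t} (\<lambda>r. ?\<alpha> k r w)"
     and eq: "(LINT r:{0..t}|lborel. ?\<alpha> k r w) = X k t w - X k 0 w - J k t w" if "k \<in> ?I" for k
    proof -
     have z: "set_integrable lborel {0..t} (\<lambda>r. ?\<alpha> k r w) \<and>
       X k t w = X k 0 w + J k t w + (LINT r:{0..t}|lborel. ?\<alpha> k r w)" using elim(1) that t by blast
     show "set_integrable lborel {0..t} (\<lambda>r. ?\<alpha> k r w)" by (rule conjunct1[OF z])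
     show "(LINT r:{0..t}|lborel. ?\<alpha> k r w) = X k t w - X k 0 w - J k t w" using conjunct2[OF z] by linarith
    qed
    have sC: "set_integrable lborel {0..t} (\<lambda>r. C)"
     unfolding set_integrable_def by (rule integrableI_bounded_set_indicator[where B="\<bar>C\<bar>"]) (auto simp: emeasure_lborel_Icc_eq)
    have sk: "set_integrable lborel {0..t} (\<lambda>r. real k * ?\<alpha> k r w)" if "k \<in> ?I" for k
     using si[OF that] by (intro set_integrable_mult_right)
    have ss: "set_integrable lborel {0..t} (\<lambda>r. \<Sum>k\<in>?I. real k * ?\<alpha> k r w)"
     using sk unfolding set_integrable_def scaleR_sum_right by (intro lint_integrable_sum)
    have sb: "set_integrable lborel {0..t} (\<lambda>r. C + 2 * (\<Sum>k\<in>?I. real k * ?\<alpha> k r w))"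
     by (intro set_integral_add(1) sC set_integrable_mult_right ss)
    have "(LINT r:{0..t}|lborel. \<bar>?\<alpha> i r w\<bar>) \<le> (LINT r:{0..t}|lborel. C + 2 * (\<Sum>k\<in>?I. real k * ?\<alpha> k r w))"
     unfolding set_lebesgue_integral_def
    proof (rule integral_mono_AE)
     show "integrable lborel (\<lambda>r. indicator {0..t} r *\<^sub>R \<bar>?\<alpha> i r w\<bar>)"
      using set_integrable_abs_real[OF si[OF i]] by (simp add: set_integrable_def)
     show "integrable lborel (\<lambda>r. indicator {0..t} r *\<^sub>R (C + 2 * (\<Sum>k\<in>?I. real k * ?\<alpha> k r w)))"
      using sb by (simp add: set_integrable_def)
     show "AE r in lborel. indicator {0..t} r *\<^sub>R \<bar>?\<alpha> i r w\<bar> \<le> indicator {0..t} r *\<^sub>R (C + 2 * (\<Sum>k\<in>?I. real k * ?\<alpha> k r w))"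
      using elim(2)
     proof eventually_elim
      case (elim r)
      show ?case
      proof (cases "r \<in> {0..t}")
       case True
       then have r: "0 \<le> r" by simp
       have "\<bar>?\<alpha> i r w\<bar> \<le> C + 2 * (\<Sum>k\<in>?I. real k * ?\<alpha> k r w)"
        unfolding C_def
        by (rule jacobi_drift_abs_le[OF \<beta> i])
         (use Xr[OF \<open>w \<in> space M\<close>] mono[OF \<open>w \<in> space M\<close> r] elim r in \<open>auto simp: lamX\<close>)
       then show ?thesis using True by simp
      qed simp
     qed
    qed
    also have "\<dots> = (LINT r:{0..t}|lborel. C) + 2 * (LINT r:{0..t}|lborel. (\<Sum>k\<in>?I. real k * ?\<alpha> k r w))"
     by (subst set_integral_add(2)[OF sC set_integrable_mult_right[OF ss]]) simp
    also have "(LINT r:{0..t}|lborel. (\<Sum>k\<in>?I. real k * ?\<alpha> k r w)) = (\<Sum>k\<in>?I. LINT r:{0..t}|lborel. real k * ?\<alpha> k r w)"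
     unfolding set_lebesgue_integral_def scaleR_sum_right
     using sk by (intro lint_sum) (auto simp: set_integrable_def)
    also have "\<dots> = (\<Sum>k\<in>?I. real k * (X k t w - X k 0 w - J k t w))"
     using eq by (intro sum.cong refl) simp
    also have "(LINT r:{0..t}|lborel. C) = C * t"
     using t by (simp add: set_lebesgue_integral_def)
    finally have "(LINT r:{0..t}|lborel. \<bar>?\<alpha> i r w\<bar>) \<le> ?Y w" .
    moreover have "0 \<le> (LINT r:{0..t}|lborel. \<bar>?\<alpha> i r w\<bar>)"
     unfolding set_lebesgue_integral_def by (intro lint_nonneg) auto
    ultimately show ?case by linarith
   qed
  qed
 qed
 have "ito_system M ?F ?I X ?\<alpha> J"
 proof (rule ito_system.intro[OF ps ito_system_axioms.intro], goal_cases)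
  case (5 i t)
  then show ?case using adap[OF 5] by (simp add: lamX)
 next
  case (7 i w)
  have "continuous_on {0..} (\<lambda>t. X i t w) \<longleftrightarrow> continuous_on {0..} (\<lambda>t. lam i t w)"
   by (rule continuous_on_cong) (auto simp: X_def)
  then show ?case using cont[OF 7(2,1)] by simp
 next
  case (11 i t)
  then show ?case using J[OF 11(1)] unfolding has_ito_integral_def by blast
 next
  case (12 i w)
  then show ?case using J[OF 12(1)] unfolding has_ito_integral_def by blast
 next
  case (14 i s t Z D)
  show ?case by (rule ito_integral_martingale[OF J[OF 14(1)] 14(1-5)])
 next
  case (15 i j s t Z D)
  show ?case by (rule ito_integral_orthogonal[OF J[OF 15(1)] J[OF 15(2)] 15(1-7)])
 next
  case (16 i s t Z D)
  let ?G = "\<lambda>r w. sqrt (2 * X i r w * (1 - X i r w))"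
  have "\<E> (\<lambda>w. Z w * (J i t w - J i s w)^2) = \<E> (\<lambda>w. Z w * (LINT r:{s<..t}|lborel. (?G r w)^2))"
  proof (rule ito_isometry[OF J[OF 16(1)] 16(1-5)])
   show "(\<lambda>(r, w). ?G r w) \<in> borel_measurable ?D"
    using Xjoint[OF 16(1)] unfolding split_beta' by measurable
   show "?G r w = sqrt (2 * lam i r w * (1 - lam i r w))" if "0 \<le> r" for r w using that by (simp add: X_def)
   show "\<bar>?G r w\<bar> \<le> 1" if "w \<in> space M" for r w
   proof -
    have "0 \<le> (2 * X i r w - 1)^2" by simp
    then have "2 * X i r w * (1 - X i r w) \<le> 1" unfolding power2_eq_square by (simp add: algebra_simps)
    moreover have "0 \<le> 2 * X i r w * (1 - X i r w)" using Xr[OF that 16(1), of r] by simp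
    ultimately show ?thesis by simp
   qed
  qed
  also have "\<dots> = \<E> (\<lambda>w. Z w * (LINT r:{s<..t}|lborel. 2 * X i r w * (1 - X i r w)))"
   using Xr[OF _ 16(1)] by (intro lint_cong refl) simp
  finally show ?case .
 next
  case (4 s t)
  then show ?case by (rule sets_filtration_mono)
 next
  case (17 i)
  then show ?case by (rule dec')
 next
  case (18 i t)
  then show ?case by (rule drift)
 next
  case 1
  show ?case by simp
 next
  case (2 t)
  show ?case by (rule space_filtration)
 next
  case (3 t)
  show ?case by (rule sets_filtration_subset)
 next
  case (6 i)
  then show ?case by (rule Xjoint)
 next
  case (8 i t w)
  then show ?case by (intro Xr)
 next
  case (9 i t w)
  then show ?case by (intro Xr)
 next
  case (10 i)
  then show ?case by (rule \<alpha>joint)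
 next
  case (13 i t)
  then show ?case by (rule Jsq)
 qed
 then show ?thesis by blast
qed

text \<open>These two estimates are all that the scaling limit uses of the stochastic analysis: the
  mean of a power sum, and a uniform bound on its fluctuation. The bracket is estimated by the power
  sum of order \<open>2m - 1\<close>, which keeps the correct power of \<open>\<gamma>\<close> after
  rescaling; bounding it by a constant would not.\<close>

lemma jacobi_power_sum_estimates:
 fixes lam :: "nat \<Rightarrow> real \<Rightarrow> 'w \<Rightarrow> real"
 assumes P: "beta_jacobi_process M N a b \<beta> x0 W lam" and N: "1 \<le> N" and \<beta>: "0 < \<beta>" and m: "1 \<le> m"
 defines "p \<equiv> \<lambda>k t w. power_sum N (\<lambda>i. lam i t w) k"
  and "q \<equiv> \<lambda>t w. power_sum_drift N a b \<beta> m (\<lambda>i. lam i t w)"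
 shows "0 \<le> t \<Longrightarrow> (\<integral>w. p m t w \<partial>M) = power_sum N x0 m + (\<integral>w. (LINT r:{0<..t}|lborel. q r w) \<partial>M)"
  and "0 \<le> T \<Longrightarrow> 0 < \<epsilon> \<Longrightarrow> \<exists>E\<in>sets M. \<epsilon>^2 * measure M E \<le> 2 * (real m)^2 * (\<integral>w. (LINT r:{0<..T}|lborel. p (2 * m - 1) r w) \<partial>M) \<and>
    (\<forall>w\<in>space M - E. \<forall>t\<in>{0..T}. \<bar>p m t w - p m 0 w - (LINT r:{0<..t}|lborel. q r w)\<bar> \<le> \<epsilon>)"
proof -
 let ?A = "borel \<Otimes>\<^sub>M M"
 let ?B = "\<lambda>T w. LINT r:{0<..T}|lborel. p (2 * m - 1) r w"
 let ?C = "\<lambda>t w. LINT r:{0<..t}|lborel. q r w"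
 let ?I = "{1..N}" and ?F = "augmented_filtration M {1..N} W"
 define X where "X i r = lam i (max 0 r)" for i r
 let ?\<alpha> = "\<lambda>i r w. jacobi_drift N a b \<beta> (\<lambda>j. X j r w) i"
 define D where "D r w = power_sum_drift N a b \<beta> m (\<lambda>i. X i r w)" for r w
 have inj: "AE w in M. AE t in lborel. 0 \<le> t \<longrightarrow> inj_on (\<lambda>i. lam i t w) ?I"
  and init: "\<And>i w. w \<in> space M \<Longrightarrow> i \<in> ?I \<Longrightarrow> lam i 0 w = x0 i"
  using P unfolding beta_jacobi_process_def by blast+
 obtain J where J: "ito_system M ?F ?I X ?\<alpha> J"
  using beta_jacobi_ito_system[OF P N \<beta>] unfolding X_def[symmetric] by blast
 interpret ito_system M ?F ?I X ?\<alpha> J by (rule J)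
 obtain B where B: "\<And>x. (\<forall>i\<in>?I. 0 \<le> x i \<and> x i \<le> 1) \<Longrightarrow> \<bar>power_sum_drift N a b \<beta> m x\<bar> \<le> B"
  using power_sum_drift_bounded by blast
 interpret ito_power_sum M ?F ?I X ?\<alpha> J m D B
 proof (rule ito_power_sum.intro[OF J ito_power_sum_axioms.intro], goal_cases)
  case 1
  have "(\<lambda>z. power_sum_drift N a b \<beta> m (\<lambda>i. X i (fst z) (snd z))) \<in> borel_measurable ?A"
   by (rule power_sum_drift_measurable) (use X_joint in \<open>simp add: split_beta'\<close>)
  then show ?case by (simp add: D_def split_beta')
 next
  case (2 r)
  show ?case unfolding D_def[abs_def] by (rule power_sum_drift_measurable) (rule X_adapted[OF _ 2])
 next
  case (3 w)
  show ?case unfolding D_def by (rule power_sum_drift_continuous_on) (rule X_cont[OF _ 3])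
 next
  case (4 w r)
  show ?case unfolding D_def by (rule B) (use X_nonneg X_le_1 4 in auto)
 next
  case 5
  show ?case using inj
  proof eventually_elim
   case (elim w)
   then show ?case
   proof eventually_elim
    case (elim r)
    show ?case
    proof
     assume r: "0 \<le> r"
     then have "inj_on (\<lambda>i. X i r w) ?I" using elim by (simp add: X_def)
     from power_sum_drift_eq[OF m this] show "(\<Sum>i\<in>?I. power_drift m i r w) = D r w"
      unfolding power_drift_def D_def .
    qed
   qed
  qed
 qed
 have ps: "psum t w = p m t w" if "0 \<le> t" for t w
  unfolding psum_def p_def power_sum_def X_def using that by (simp add: max_def)
 have Di: "Dint 0 t w = (?C t w)" for t w
  unfolding Dint_def set_lebesgue_integral_def
  by (intro lint_cong refl) (auto simp: indicator_def D_def q_def X_def)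
 have M: "Mart t w = p m t w - p m 0 w - (?C t w)" if "0 \<le> t" for t w
  unfolding Mart_def ps[OF that] ps[OF order_refl] Di ..
 {
  assume t: "0 \<le> t"
  have "\<E> (\<lambda>w. 1 * (psum t w - psum 0 w)) = \<E> (\<lambda>w. 1 * Dint 0 t w)"
   by (rule psum_expectation[OF order_refl t]) auto
  then have e: "\<E> (\<lambda>w. psum t w - psum 0 w) = \<E> (Dint 0 t)" by simp
  have ip: "integrable M (psum s)" for s
   by (rule sq_int_imp_integrable[OF sq_int_bounded[OF psum_measurable, where C="real (card ?I)"]])
    (use psum_bounds in \<open>simp add: abs_of_nonneg\<close>)
  have "psum 0 w = power_sum N x0 m" if "w \<in> space M" for w
   unfolding ps[OF order_refl] p_def power_sum_def by (intro sum.cong refl arg_cong[where f="\<lambda>y. y ^ m"] init[OF that])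
  then have "\<E> (psum 0) = \<E> (\<lambda>w. power_sum N x0 m)"
   by (intro lint_cong refl)
  then have "\<E> (psum t) - power_sum N x0 m = \<E> (Dint 0 t)"
   using e lint_diff[OF ip ip, of t 0] by (simp add: prob_space)
  then show "(\<integral>w. p m t w \<partial>M) = power_sum N x0 m + (\<integral>w. (?C t w) \<partial>M)"
   unfolding Di ps[OF t] by linarith
 }
 {
  assume T: "0 \<le> T" and \<epsilon>: "0 < \<epsilon>"
  obtain E where E: "E \<in> sets M" "\<epsilon>^2 * prob E \<le> \<E> (\<lambda>w. (Mart T w)^2)"
   "\<And>w t. w \<in> space M - E \<Longrightarrow> t \<in> {0..T} \<Longrightarrow> \<bar>Mart t w\<bar> \<le> \<epsilon>"
   using Mart_maximal_inequality[OF T \<epsilon>] by blast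
  let ?f = "\<lambda>i r w. (real m * X i r w ^ (m - 1))^2 * quadratic i r w"
  let ?g = "\<lambda>i r w. 2 * (real m)^2 * X i r w ^ (2 * m - 1)"
  have joint: "(\<lambda>(r, w). ?f i r w) \<in> borel_measurable ?A" "(\<lambda>(r, w). ?g i r w) \<in> borel_measurable ?A"
   if "i \<in> ?I" for i
  proof -
   have v: "(\<lambda>z. X i (fst z) (snd z)) \<in> borel_measurable ?A" "(\<lambda>z. quadratic i (fst z) (snd z)) \<in> borel_measurable ?A"
    using X_joint[OF that] quadratic_joint[OF that] by (simp_all add: split_beta')
   show "(\<lambda>(r, w). ?f i r w) \<in> borel_measurable ?A"
    unfolding split_beta' by (intro borel_measurable_times borel_measurable_power borel_measurable_const v)
   show "(\<lambda>(r, w). ?g i r w) \<in> borel_measurable ?A"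
    unfolding split_beta' by (intro borel_measurable_times borel_measurable_power borel_measurable_const v)
  qed
  have fg: "0 \<le> ?f i r w" "?f i r w \<le> ?g i r w" "?g i r w \<le> 2 * (real m)^2" "0 \<le> ?g i r w" if i: "i \<in> ?I" and w: "w \<in> space M" for i r w
  proof -
   have x: "0 \<le> X i r w" "X i r w \<le> 1" using X_nonneg[OF i w] X_le_1[OF i w] by auto
   show "0 \<le> ?f i r w" using quadratic_bounds[OF i w] by simp
   obtain l where l: "m = Suc l" using m by (cases m) auto
   \<comment> \<open>The bracket rate is exactly \<open>2 m^2 x ^ (2 m - 1) (1 - x)\<close>; the
     factor \<open>1 - x\<close> is then estimated by 1.\<close>
   have "?f i r w = ?g i r w * (1 - X i r w)"
    unfolding quadratic_def l by (simp add: power_mult_distrib power2_eq_square power_add[symmetric] mult_2[symmetric] algebra_simps)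
   also have "\<dots> \<le> ?g i r w * 1" using x by (intro mult_left_mono) auto
   finally show "?f i r w \<le> ?g i r w" by simp
   have "2 * (real m)^2 * X i r w ^ (2 * m - 1) \<le> 2 * (real m)^2 * 1" using x by (intro mult_left_mono power_le_one) auto
   then show "?g i r w \<le> 2 * (real m)^2" by simp
   show "0 \<le> ?g i r w" using x by simp
  qed
  have si: "set_integrable lborel {0<..T} (\<lambda>r. ?f i r w)" "set_integrable lborel {0<..T} (\<lambda>r. ?g i r w)" if i: "i \<in> ?I" and w: "w \<in> space M" for i w
  proof -
   have f2: "\<bar>?f i r w\<bar> \<le> 2 * (real m)^2" "\<bar>?g i r w\<bar> \<le> 2 * (real m)^2" for r
    unfolding abs_of_nonneg[OF fg(1)[OF i w]] abs_of_nonneg[OF fg(4)[OF i w]]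
    using order_trans[OF fg(2)[OF i w] fg(3)[OF i w]] fg(3)[OF i w] by blast+
   show "set_integrable lborel {0<..T} (\<lambda>r. ?f i r w)"
    by (rule set_integrable_bounded_Ioc[OF process_section_measurable(1)[OF joint(1)[OF i] w] f2(1)])
   show "set_integrable lborel {0<..T} (\<lambda>r. ?g i r w)"
    by (rule set_integrable_bounded_Ioc[OF process_section_measurable(1)[OF joint(2)[OF i] w] f2(2)])
  qed
  have gb: "\<bar>LINT r:{0<..T}|lborel. ?g i r w\<bar> \<le> 2 * (real m)^2 * T" if i: "i \<in> ?I" and w: "w \<in> space M" for i w
  proof -
   have "\<bar>LINT r:{0<..T}|lborel. ?g i r w\<bar> \<le> (LINT r:{0<..T}|lborel. \<bar>?g i r w\<bar>)" by (rule set_integral_abs_le[OF si(2)[OF i w]])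
   also have "\<dots> \<le> (LINT r:{0<..T}|lborel. 2 * (real m)^2)"
    by (rule set_integral_mono[OF set_integrable_abs_real[OF si(2)[OF i w]] set_integrable_const_Ioc])
     (use fg(3,4)[OF i w] in \<open>simp only: abs_of_nonneg\<close>)
   finally show ?thesis using T by (simp add: set_integral_const_Ioc mult.commute)
  qed
  have ig: "integrable M (\<lambda>w. LINT r:{0<..T}|lborel. ?g i r w)" if i: "i \<in> ?I" for i
   by (rule sq_int_imp_integrable[OF sq_int_bounded[OF set_integral_process_measurable[OF joint(2)[OF i]] gb[OF i]]]) simp_all
  have "\<E> (\<lambda>w. (Mart T w)^2) = (\<Sum>i\<in>?I. \<E> (\<lambda>w. LINT r:{0<..T}|lborel. ?f i r w))"
   by (rule Mart_second_moment[OF T])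
  also have "\<dots> \<le> (\<Sum>i\<in>?I. \<E> (\<lambda>w. LINT r:{0<..T}|lborel. ?g i r w))"
  proof (intro sum_mono integral_mono_AE' AE_I2)
   fix i assume i: "i \<in> ?I"
   show "integrable M (\<lambda>w. LINT r:{0<..T}|lborel. ?g i r w)" by (rule ig[OF i])
   fix w assume w: "w \<in> space M"
   show "(LINT r:{0<..T}|lborel. ?f i r w) \<le> (LINT r:{0<..T}|lborel. ?g i r w)"
    by (rule set_integral_mono[OF si[OF i w] fg(2)[OF i w]])
   show "0 \<le> (LINT r:{0<..T}|lborel. ?g i r w)"
    unfolding set_lebesgue_integral_def using fg(4)[OF i w] by (intro lint_nonneg) auto
  qed
  also have "\<dots> = \<E> (\<lambda>w. \<Sum>i\<in>?I. LINT r:{0<..T}|lborel. ?g i r w)"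
   using ig by (intro lint_sum[symmetric])
  also have "\<dots> = \<E> (\<lambda>w. 2 * (real m)^2 * (?B T w))"
  proof (intro lint_cong refl)
   fix w assume w: "w \<in> space M"
   have "(\<Sum>i\<in>?I. LINT r:{0<..T}|lborel. ?g i r w) = (LINT r:{0<..T}|lborel. (\<Sum>i\<in>?I. ?g i r w))"
    unfolding set_lebesgue_integral_def scaleR_sum_right
    using si(2)[OF _ w] by (intro lint_sum[symmetric]) (simp add: set_integrable_def)
   also have "\<dots> = (LINT r:{0<..T}|lborel. 2 * (real m)^2 * p (2 * m - 1) r w)"
    unfolding set_lebesgue_integral_def
    by (intro lint_cong refl) (auto simp: indicator_def X_def p_def power_sum_def sum_distrib_left)
   finally show "(\<Sum>i\<in>?I. LINT r:{0<..T}|lborel. ?g i r w) = 2 * (real m)^2 * (?B T w)"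
    by simp
  qed
  also have "\<dots> = 2 * (real m)^2 * \<E> (\<lambda>w. LINT r:{0<..T}|lborel. p (2 * m - 1) r w)" by simp
  finally show "\<exists>E\<in>sets M. \<epsilon>^2 * measure M E \<le> 2 * (real m)^2 * (\<integral>w. (?B T w) \<partial>M) \<and>
    (\<forall>w\<in>space M - E. \<forall>t\<in>{0..T}. \<bar>p m t w - p m 0 w - (?C t w)\<bar> \<le> \<epsilon>)"
   using E M by (intro bexI[OF _ E(1)]) (auto intro: order_trans)
 }
qed

section \<open>Uniform convergence in probability\<close>

abbreviation off :: "(nat \<Rightarrow> 'w measure) \<Rightarrow> (nat \<Rightarrow> 'w set) \<Rightarrow> (nat \<Rightarrow> 'w \<Rightarrow> bool) \<Rightarrow> bool" where
 "off M E P \<equiv> \<forall>\<^sub>F N in sequentially. E N \<in> sets (M N) \<and> (\<forall>w\<in>space (M N) - E N. P N w)"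

text \<open>Uniform convergence to 0 in probability, stated through measurable exceptional events,
  so that it can be handled without measurability of suprema.\<close>

definition usmall :: "(nat \<Rightarrow> 'w measure) \<Rightarrow> real \<Rightarrow> (nat \<Rightarrow> real \<Rightarrow> 'w \<Rightarrow> real) \<Rightarrow> bool" where
 "usmall M T f \<longleftrightarrow> (\<forall>e>0. \<exists>E. (off M E (\<lambda>N w. \<forall>t\<in>{0..T}. \<bar>f N t w\<bar> < e)) \<and> (\<lambda>N. measure (M N) (E N)) \<longlonglongrightarrow> 0)"

definition ucp :: "(nat \<Rightarrow> 'w measure) \<Rightarrow> real \<Rightarrow> (nat \<Rightarrow> real \<Rightarrow> 'w \<Rightarrow> real) \<Rightarrow> (real \<Rightarrow> real) \<Rightarrow> bool" where
 "ucp M T X x \<longleftrightarrow> usmall M T (\<lambda>N t w. X N t w - x t)"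

lemma usmall_dominated:
 assumes f: "usmall M T f"
  and g: "\<And>e. 0 < e \<Longrightarrow> \<exists>\<delta>>0. \<forall>\<^sub>F N in sequentially. \<forall>w\<in>space (M N). (\<forall>t\<in>{0..T}. \<bar>f N t w\<bar> < \<delta>) \<longrightarrow> (\<forall>t\<in>{0..T}. \<bar>g N t w\<bar> < e)"
 shows "usmall M T g"
 unfolding usmall_def
proof (intro allI impI)
 let ?A = "\<lambda>e N w. \<forall>t\<in>{0..T}. \<bar>g N t w\<bar> < e"
 fix e :: real assume "0 < e"
 then obtain \<delta> where \<delta>: "0 < \<delta>" "\<forall>\<^sub>F N in sequentially. \<forall>w\<in>space (M N). (\<forall>t\<in>{0..T}. \<bar>f N t w\<bar> < \<delta>) \<longrightarrow> (\<forall>t\<in>{0..T}. \<bar>g N t w\<bar> < e)"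
  using g by blast
 obtain E where E: "off M E (\<lambda>N w. \<forall>t\<in>{0..T}. \<bar>f N t w\<bar> < \<delta>)"
  "(\<lambda>N. measure (M N) (E N)) \<longlonglongrightarrow> 0"
  using f \<delta>(1) unfolding usmall_def by blast
 have "off M E (?A e)"
  using E(1) \<delta>(2) by eventually_elim blast
 then show "\<exists>E. (off M E (?A e)) \<and> (\<lambda>N. measure (M N) (E N)) \<longlonglongrightarrow> 0"
  using E(2) by blast
qed

lemma usmall_union:
 fixes M :: "nat \<Rightarrow> 'w measure"
 assumes M: "\<forall>\<^sub>F N in sequentially. prob_space (M N)" and f: "usmall M T f" and g: "usmall M T g"
  and h: "\<And>e. 0 < e \<Longrightarrow> \<exists>\<delta>>0. \<forall>\<^sub>F N in sequentially. \<forall>w\<in>space (M N). (\<forall>t\<in>{0..T}. \<bar>f N t w\<bar> < \<delta>) \<longrightarrow> (\<forall>t\<in>{0..T}. \<bar>g N t w\<bar> < \<delta>) \<longrightarrow> (\<forall>t\<in>{0..T}. \<bar>h N t w\<bar> < e)"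
 shows "usmall M T h"
 unfolding usmall_def
proof (intro allI impI)
 fix e :: real assume "0 < e"
 then obtain \<delta> where \<delta>: "0 < \<delta>" "\<forall>\<^sub>F N in sequentially. \<forall>w\<in>space (M N). (\<forall>t\<in>{0..T}. \<bar>f N t w\<bar> < \<delta>) \<longrightarrow> (\<forall>t\<in>{0..T}. \<bar>g N t w\<bar> < \<delta>) \<longrightarrow> (\<forall>t\<in>{0..T}. \<bar>h N t w\<bar> < e)"
  using h by blast
 obtain E where E: "off M E (\<lambda>N w. \<forall>t\<in>{0..T}. \<bar>f N t w\<bar> < \<delta>)"
  "(\<lambda>N. measure (M N) (E N)) \<longlonglongrightarrow> 0"
  using f \<delta>(1) unfolding usmall_def by blast
 obtain E' where E': "\<forall>\<^sub>F N in sequentially. E' N \<in> sets (M N) \<and> (\<forall>w\<in>space (M N) - E' N. \<forall>t\<in>{0..T}. \<bar>g N t w\<bar> < \<delta>)"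
  "(\<lambda>N. measure (M N) (E' N)) \<longlonglongrightarrow> 0"
  using g \<delta>(1) unfolding usmall_def by blast
 have "\<forall>\<^sub>F N in sequentially. E N \<union> E' N \<in> sets (M N) \<and> (\<forall>w\<in>space (M N) - (E N \<union> E' N). \<forall>t\<in>{0..T}. \<bar>h N t w\<bar> < e)"
  using E(1) E'(1) \<delta>(2) by eventually_elim blast
 moreover have "(\<lambda>N. measure (M N) (E N \<union> E' N)) \<longlonglongrightarrow> 0"
 proof (rule tendsto_sandwich[of "\<lambda>_. 0"])
  show "\<forall>\<^sub>F N in sequentially. measure (M N) (E N \<union> E' N) \<le> measure (M N) (E N) + measure (M N) (E' N)"
   using E(1) E'(1) M
  proof eventually_elim
   case (elim N)
   interpret prob_space "M N" using elim by simp
   show ?case using elim by (intro measure_subadditive) auto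
  qed
  show "(\<lambda>N. measure (M N) (E N) + measure (M N) (E' N)) \<longlonglongrightarrow> 0"
   using tendsto_add[OF E(2) E'(2)] by simp
 qed auto
 ultimately show "\<exists>E. (off M E (\<lambda>N w. \<forall>t\<in>{0..T}. \<bar>h N t w\<bar> < e)) \<and> (\<lambda>N. measure (M N) (E N)) \<longlonglongrightarrow> 0"
  by (intro exI[of _ "\<lambda>N. E N \<union> E' N"] conjI)
qed

lemma usmall_deterministic:
 assumes "x \<longlonglongrightarrow> 0"
 shows "usmall M T (\<lambda>N t w. x N)"
 unfolding usmall_def
proof (intro allI impI exI[of _ "\<lambda>_. {}"] conjI)
 fix e :: real assume "0 < e"
 then have "\<forall>\<^sub>F N in sequentially. \<bar>x N\<bar> < e" using assms by (auto dest: tendsto_rabs_zero order_tendstoD)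
 then show "\<forall>\<^sub>F N in sequentially. {} \<in> sets (M N) \<and> (\<forall>w\<in>space (M N) - {}. \<forall>t\<in>{0..T}. \<bar>x N\<bar> < e)"
  by eventually_elim auto
qed simp

lemma usmall_add:
 assumes "\<forall>\<^sub>F N in sequentially. prob_space (M N)" "usmall M T f" "usmall M T g"
 shows "usmall M T (\<lambda>N t w. f N t w + g N t w)"
proof (rule usmall_union[OF assms])
 fix e :: real assume e: "0 < e"
 have "\<bar>f N t w + g N t w\<bar> < e" if "\<bar>f N t w\<bar> < e / 2" "\<bar>g N t w\<bar> < e / 2" for N t w using that by linarith
 then show "\<exists>\<delta>>0. \<forall>\<^sub>F N in sequentially. \<forall>w\<in>space (M N). (\<forall>t\<in>{0..T}. \<bar>f N t w\<bar> < \<delta>) \<longrightarrow> (\<forall>t\<in>{0..T}. \<bar>g N t w\<bar> < \<delta>) \<longrightarrow> (\<forall>t\<in>{0..T}. \<bar>f N t w + g N t w\<bar> < e)"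
  using e by (intro exI[of _ "e / 2"]) auto
qed

text \<open>One random variable dominates the process at all times, so Markov's inequality is
  applied to it alone.\<close>

lemma usmall_Markov:
 assumes M: "\<forall>\<^sub>F N in sequentially. prob_space (M N)"
  and Y: "\<forall>\<^sub>F N in sequentially. integrable (M N) (Y N) \<and> (\<forall>w\<in>space (M N). \<forall>t\<in>{0..T}. \<bar>f N t w\<bar> \<le> Y N w) \<and> (\<forall>w\<in>space (M N). 0 \<le> Y N w)"
  and lim: "(\<lambda>N. \<integral>w. Y N w \<partial>M N) \<longlonglongrightarrow> 0"
 shows "usmall M T f"
 unfolding usmall_def
proof (intro allI impI)
 let ?A = "\<lambda>e N w. \<forall>t\<in>{0..T}. \<bar>f N t w\<bar> < e"
 fix e :: real assume e: "0 < e"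
 define E where "E N = {w\<in>space (M N). e \<le> Y N w}" for N
 have "off M E (?A e)"
  using Y
 proof eventually_elim
  case (elim N)
  then have [measurable]: "Y N \<in> borel_measurable (M N)" by auto
  have "E N \<in> sets (M N)" unfolding E_def by measurable
  moreover have "\<bar>f N t w\<bar> < e" if "w \<in> space (M N) - E N" "t \<in> {0..T}" for w t
  proof -
   have "\<bar>f N t w\<bar> \<le> Y N w" using elim that by blast
   moreover have "Y N w < e" using that by (simp add: E_def not_le)
   ultimately show ?thesis by linarith
  qed
  ultimately show ?case by blast
 qed
 moreover have "(\<lambda>N. measure (M N) (E N)) \<longlonglongrightarrow> 0"
 proof (rule tendsto_sandwich[of "\<lambda>_. 0"])
  show "\<forall>\<^sub>F N in sequentially. measure (M N) (E N) \<le> (\<integral>w. Y N w \<partial>M N) / e"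
   using Y M unfolding E_def
  proof eventually_elim
   case (elim N)
   have "AE w in M N. 0 \<le> Y N w" using elim(1) by (intro AE_I2) blast
   then show ?case by (intro integral_Markov_inequality_measure[where A="{}"] e conjunct1[OF elim(1)] sets.empty_sets)
  qed
  show "(\<lambda>N. (\<integral>w. Y N w \<partial>M N) / e) \<longlonglongrightarrow> 0" using tendsto_divide[OF lim tendsto_const, of e] e by simp
 qed auto
 ultimately show "\<exists>E. (off M E (?A e)) \<and> (\<lambda>N. measure (M N) (E N)) \<longlonglongrightarrow> 0"
  by blast
qed

lemma ucp_add:
 assumes "\<forall>\<^sub>F N in sequentially. prob_space (M N)" "ucp M T X x" "ucp M T Y y"
 shows "ucp M T (\<lambda>N t w. X N t w + Y N t w) (\<lambda>t. x t + y t)"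
proof -
 have "(\<lambda>N t w. X N t w + Y N t w - (x t + y t)) = (\<lambda>N t w. (X N t w - x t) + (Y N t w - y t))" by (intro ext) simp
 then show ?thesis using usmall_add[OF assms(1)] assms(2,3) unfolding ucp_def by simp
qed

lemma ucp_deterministic: "z \<longlonglongrightarrow> z0 \<Longrightarrow> ucp M T (\<lambda>N t w. z N) (\<lambda>t. z0)"
 unfolding ucp_def by (rule usmall_deterministic) (simp add: LIM_zero)

lemma ucp_mult:
 assumes M: "\<forall>\<^sub>F N in sequentially. prob_space (M N)" and X: "ucp M T X x" and Y: "ucp M T Y y"
  and x: "continuous_on {0..T} x" and y: "continuous_on {0..T} y"
 shows "ucp M T (\<lambda>N t w. X N t w * Y N t w) (\<lambda>t. x t * y t)"
 unfolding ucp_def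
proof (rule usmall_union[OF M X[unfolded ucp_def] Y[unfolded ucp_def]])
 fix e :: real assume e: "0 < e"
 have bdd: "\<exists>B\<ge>0. \<forall>t\<in>{0..T}. \<bar>z t\<bar> \<le> B" if "continuous_on {0..T} z" for z :: "real \<Rightarrow> real"
 proof -
  have "bounded (z ` {0..T})" by (intro compact_imp_bounded compact_continuous_image that) simp
  then obtain B where "\<forall>v\<in>z ` {0..T}. norm v \<le> B" unfolding bounded_iff by blast
  then show ?thesis by (intro exI[of _ "\<bar>B\<bar>"]) force
 qed
 obtain A where A: "0 \<le> A" "\<And>t. t \<in> {0..T} \<Longrightarrow> \<bar>x t\<bar> \<le> A" using bdd[OF x] by blast
 obtain B where B: "0 \<le> B" "\<And>t. t \<in> {0..T} \<Longrightarrow> \<bar>y t\<bar> \<le> B" using bdd[OF y] by blast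
 \<comment> \<open>As \<open>\<delta> \<le> 1\<close>, the product of both deviations is at most
   \<open>\<delta>\<close>, so the total error is at most \<open>\<delta> * (1 + A + B)\<close>,
   which is below \<open>e\<close>.\<close>
 define \<delta> where "\<delta> = min 1 (e / (A + B + 2))"
 have \<delta>: "0 < \<delta>" "\<delta> \<le> 1" "\<delta> * (A + B + 1) < e"
 proof -
  show d: "0 < \<delta>" "\<delta> \<le> 1" using e A B by (auto simp: \<delta>_def)
  have "\<delta> * (A + B + 1) < \<delta> * (A + B + 2)" using d by simp
  also have "\<dots> \<le> e / (A + B + 2) * (A + B + 2)" unfolding \<delta>_def using A B by (intro mult_right_mono) auto
  also have "\<dots> = e" using A B by simp
  finally show "\<delta> * (A + B + 1) < e" .
 qed
 have "\<bar>X N t w * Y N t w - x t * y t\<bar> < e" if t: "t \<in> {0..T}" and d: "\<bar>X N t w - x t\<bar> < \<delta>" "\<bar>Y N t w - y t\<bar> < \<delta>" for N t w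
 proof -
  have e: "X N t w * Y N t w - x t * y t = (X N t w - x t) * (Y N t w - y t) + (X N t w - x t) * y t + x t * (Y N t w - y t)"
   by (simp add: algebra_simps)
  have "\<bar>X N t w * Y N t w - x t * y t\<bar> \<le> \<bar>X N t w - x t\<bar> * \<bar>Y N t w - y t\<bar> + \<bar>X N t w - x t\<bar> * \<bar>y t\<bar> + \<bar>x t\<bar> * \<bar>Y N t w - y t\<bar>"
   unfolding e abs_mult[symmetric] by (intro order_trans[OF abs_triangle_ineq] add_mono order_refl abs_triangle_ineq)
  also have "\<dots> \<le> \<delta> * 1 + \<delta> * B + A * \<delta>"
   using d A B t \<delta> by (intro add_mono mult_mono) (auto intro: less_imp_le order_trans)
  also have "\<dots> < e" using \<delta>(3) by (simp add: algebra_simps)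
  finally show ?thesis .
 qed
 then show "\<exists>\<delta>>0. \<forall>\<^sub>F N in sequentially. \<forall>w\<in>space (M N). (\<forall>t\<in>{0..T}. \<bar>X N t w - x t\<bar> < \<delta>) \<longrightarrow>
   (\<forall>t\<in>{0..T}. \<bar>Y N t w - y t\<bar> < \<delta>) \<longrightarrow> (\<forall>t\<in>{0..T}. \<bar>X N t w * Y N t w - x t * y t\<bar> < e)"
  using \<delta>(1) by (intro exI[of _ \<delta>]) auto
qed

lemma ucp_sum:
 assumes M: "\<forall>\<^sub>F N in sequentially. prob_space (M N)" and X: "\<And>l. l \<in> L \<Longrightarrow> ucp M T (X l) (x l)"
 shows "ucp M T (\<lambda>N t w. \<Sum>l\<in>L. X l N t w) (\<lambda>t. \<Sum>l\<in>L. x l t)"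
 using X
proof (induction L rule: infinite_finite_induct)
 case (insert l L)
 then show ?case using ucp_add[OF M, of T "X l" "x l"] by simp
qed (use ucp_deterministic[of "\<lambda>_. 0" 0] in auto)

lemma continuous_set_integrable_Ioc:
 fixes f :: "real \<Rightarrow> real"
 assumes "continuous_on {a..b} f"
 shows "set_integrable lborel {a<..b} f"
 by (rule set_integrable_subset_real[OF borel_integrable_atLeastAtMost'[OF assms]]) auto

lemma ucp_integral:
 fixes X :: "nat \<Rightarrow> real \<Rightarrow> 'w \<Rightarrow> real"
 assumes X: "ucp M T X x" and T: "0 < T"
  and Xc: "\<forall>\<^sub>F N in sequentially. \<forall>w\<in>space (M N). continuous_on {0..T} (\<lambda>t. X N t w)" and xc: "continuous_on {0..T} x"
 shows "ucp M T (\<lambda>N t w. LINT r:{0<..t}|lborel. X N r w) (\<lambda>t. LINT r:{0<..t}|lborel. x r)"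
 unfolding ucp_def
proof (rule usmall_dominated[OF X[unfolded ucp_def]])
 let ?A = "\<lambda>N w e. \<forall>t\<in>{0..T}. \<bar>(LINT r:{0<..t}|lborel. X N r w) - (LINT r:{0<..t}|lborel. x r)\<bar> < e"
 fix e :: real assume e: "0 < e"
 define \<delta> where "\<delta> = e / (2 * T)"
 have \<delta>: "0 < \<delta>" using e T by (simp add: \<delta>_def)
 have "\<forall>\<^sub>F N in sequentially. \<forall>w\<in>space (M N). (\<forall>t\<in>{0..T}. \<bar>X N t w - x t\<bar> < \<delta>) \<longrightarrow>
   (?A N w e)"
  using Xc
 proof (eventually_elim, intro ballI impI)
  fix N w t assume c: "\<forall>w\<in>space (M N). continuous_on {0..T} (\<lambda>t. X N t w)" and w: "w \<in> space (M N)"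
   and d: "\<forall>t\<in>{0..T}. \<bar>X N t w - x t\<bar> < \<delta>" and t: "t \<in> {0..T}"
  have cX: "continuous_on {0..t} (\<lambda>t. X N t w)" and cx: "continuous_on {0..t} x"
   using t by (auto intro: continuous_on_subset[OF bspec[OF c w]] continuous_on_subset[OF xc])
  have iX: "set_integrable lborel {0<..t} (\<lambda>t. X N t w)" and ix: "set_integrable lborel {0<..t} x"
   by (rule continuous_set_integrable_Ioc; fact)+
  have id: "set_integrable lborel {0<..t} (\<lambda>r. X N r w - x r)" by (rule set_integral_diff(1)[OF iX ix])
  have "\<bar>(LINT r:{0<..t}|lborel. X N r w) - (LINT r:{0<..t}|lborel. x r)\<bar> = \<bar>LINT r:{0<..t}|lborel. X N r w - x r\<bar>"
   by (subst set_integral_diff(2)[OF iX ix]) simp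
  also have "\<dots> \<le> (LINT r:{0<..t}|lborel. \<bar>X N r w - x r\<bar>)" by (rule set_integral_abs_le[OF id])
  also have "\<dots> \<le> (LINT r:{0<..t}|lborel. \<delta>)"
   by (rule set_integral_mono[OF set_integrable_abs_real[OF id] set_integrable_const_Ioc]) (use d t in \<open>auto intro: less_imp_le\<close>)
  also have "\<dots> = t * \<delta>" using t by (simp add: set_integral_const_Ioc)
  also have "\<dots> \<le> T * \<delta>" using t \<delta> by (intro mult_right_mono) auto
  also have "\<dots> < e" using T e by (simp add: \<delta>_def)
  finally show "\<bar>(LINT r:{0<..t}|lborel. X N r w) - (LINT r:{0<..t}|lborel. x r)\<bar> < e" .
 qed
 then show "\<exists>\<delta>>0. \<forall>\<^sub>F N in sequentially. \<forall>w\<in>space (M N). (\<forall>t\<in>{0..T}. \<bar>X N t w - x t\<bar> < \<delta>) \<longrightarrow>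
   (?A N w e)"
  using \<delta> by blast
qed

text \<open>By continuity, a bound on a countable dense set of times is a bound at all
  times.\<close>

lemma borel_measurable_SUP_continuous:
 fixes f :: "real \<Rightarrow> 'w \<Rightarrow> real"
 assumes T: "0 \<le> T" and m: "\<And>t. t \<in> {0..T} \<Longrightarrow> f t \<in> borel_measurable M"
  and c: "\<And>w. w \<in> space M \<Longrightarrow> continuous_on {0..T} (\<lambda>t. f t w)"
 shows "(\<lambda>w. SUP t\<in>{0..T}. f t w) \<in> borel_measurable M"
proof (rule borel_measurableI_le)
 fix y :: real
 obtain D where D: "countable D" "D \<subseteq> {0..T}" "{0..T} \<subseteq> closure D" using separable[of "{0..T}"] by blast
 have "{w\<in>space M. (SUP t\<in>{0..T}. f t w) \<le> y} = {w\<in>space M. \<forall>t\<in>D. f t w \<le> y}"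
 proof (intro Collect_cong conj_cong refl)
  fix w assume w: "w \<in> space M"
  have "bdd_above ((\<lambda>t. f t w) ` {0..T})"
   by (intro bounded_imp_bdd_above compact_imp_bounded compact_continuous_image c[OF w]) simp
  then have "(SUP t\<in>{0..T}. f t w) \<le> y \<longleftrightarrow> (\<forall>t\<in>{0..T}. f t w \<le> y)" using T by (intro cSUP_le_iff) auto
  also have "\<dots> \<longleftrightarrow> (\<forall>t\<in>D. f t w \<le> y)"
  proof (intro iffI ballI)
   fix t assume d: "\<forall>t\<in>D. f t w \<le> y" and t: "t \<in> {0..T}"
   then obtain s where s: "\<forall>n. s n \<in> D" "s \<longlonglongrightarrow> t" using D(3) closure_sequential[of t D] by blast
   have "\<forall>\<^sub>F n in sequentially. s n \<in> {0..T}" using s(1) D(2) by (intro always_eventually) auto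
   then have "(\<lambda>n. f (s n) w) \<longlonglongrightarrow> f t w" by (rule continuous_on_tendsto_compose[OF c[OF w] s(2) t])
   then show "f t w \<le> y" by (rule LIMSEQ_le_const2) (use s d in auto)
  qed (use D in auto)
  finally show "(SUP t\<in>{0..T}. f t w) \<le> y \<longleftrightarrow> (\<forall>t\<in>D. f t w \<le> y)" .
 qed
 also have "\<dots> \<in> sets M"
 proof -
  have "D \<noteq> {}" using D(3) T by auto
  then have "{w\<in>space M. \<forall>t\<in>D. f t w \<le> y} = (\<Inter>t\<in>D. {w\<in>space M. f t w \<le> y})" by auto
  also have "\<dots> \<in> sets M"
   using D(2) by (intro sets.countable_INT' D(1) \<open>D \<noteq> {}\<close> image_subsetI borel_measurable_le m borel_measurable_const) auto
  finally show ?thesis .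
 qed
 finally show "{w\<in>space M. (SUP t\<in>{0..T}. f t w) \<le> y} \<in> sets M" .
qed

lemma usmall_imp_tendsto_in_prob:
 fixes f :: "nat \<Rightarrow> real \<Rightarrow> 'w \<Rightarrow> real"
 assumes M: "\<forall>\<^sub>F N in sequentially. prob_space (M N)" and T: "0 \<le> T" and f: "usmall M T f"
  and reg: "\<forall>\<^sub>F N in sequentially. (\<forall>t\<in>{0..T}. f N t \<in> borel_measurable (M N)) \<and>
    (\<forall>w\<in>space (M N). continuous_on {0..T} (\<lambda>t. f N t w))"
 shows "tendsto_in_prob M (\<lambda>N w. SUP t\<in>{0..T}. \<bar>f N t w\<bar>) 0"
 unfolding tendsto_in_prob_def
proof (intro conjI allI impI)
 let ?A = "\<lambda>N w. SUP t\<in>{0..T}. \<bar>f N t w\<bar>"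
 let ?B = "\<lambda>N w. SUP t\<in>{0..T}. \<bar>f N t w\<bar>"
 have meas: "\<forall>\<^sub>F N in sequentially. (?B N) \<in> borel_measurable (M N)"
  using reg by eventually_elim (intro borel_measurable_SUP_continuous T borel_measurable_abs continuous_on_rabs, auto)
 then show "\<forall>\<^sub>F N in sequentially. (?B N) \<in> borel_measurable (M N)" .
 fix e :: real assume e: "0 < e"
 \<comment> \<open>Strict pointwise bounds give only a weak bound for the supremum, hence half of
   \<open>e\<close>.\<close>
 then have "0 < e / 2" by simp
 then obtain E where E: "off M E (\<lambda>N w. \<forall>t\<in>{0..T}. \<bar>f N t w\<bar> < e / 2)"
  "(\<lambda>N. measure (M N) (E N)) \<longlonglongrightarrow> 0"
  using f unfolding usmall_def by blast
 show "(\<lambda>N. measure (M N) {w \<in> space (M N). e \<le> \<bar>(?A N w) - 0\<bar>}) \<longlonglongrightarrow> 0"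
 proof (rule tendsto_sandwich[of "\<lambda>_. 0"])
  show "\<forall>\<^sub>F N in sequentially. measure (M N) {w \<in> space (M N). e \<le> \<bar>(?A N w) - 0\<bar>} \<le> measure (M N) (E N)"
   using E(1) M
  proof eventually_elim
   case (elim N)
   interpret prob_space "M N" using elim by simp
   show ?case
   proof (rule finite_measure_mono)
    show "{w \<in> space (M N). e \<le> \<bar>(?A N w) - 0\<bar>} \<subseteq> E N"
    proof
     fix w assume w: "w \<in> {w \<in> space (M N). e \<le> \<bar>(?A N w) - 0\<bar>}"
     show "w \<in> E N"
     proof (rule ccontr)
      assume "w \<notin> E N"
      then have b: "\<And>t. t \<in> {0..T} \<Longrightarrow> \<bar>f N t w\<bar> \<le> e / 2" using elim(1) w by (auto intro: less_imp_le)
      have "(?A N w) \<le> e / 2" using T by (intro cSUP_least b) auto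
      moreover have "\<bar>f N 0 w\<bar> \<le> (?A N w)"
       using b T by (intro cSUP_upper bdd_aboveI2[where M="e / 2"]) auto
      ultimately show False using w e by auto
     qed
    qed
   qed (use elim in auto)
  qed
 qed (use E(2) in auto)
qed

section \<open>The scaling limit of the empirical moments\<close>

lemma set_integral_rescale:
 fixes f :: "real \<Rightarrow> real"
 assumes k: "0 < k"
 shows "(LINT r:{0<..t / k}|lborel. f r) = 1 / k * (LINT v:{0<..t}|lborel. f (v / k))"
proof -
 have "(LINT r:{0<..t / k}|lborel. f r) = \<bar>1 / k\<bar> *\<^sub>R (\<integral>v. indicator {0<..t / k} (0 + 1 / k * v) *\<^sub>R f (0 + 1 / k * v) \<partial>lborel)"
  unfolding set_lebesgue_integral_def by (rule lborel_integral_real_affine) (use k in simp)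
 also have "(\<lambda>v. indicator {0<..t / k} (0 + 1 / k * v) *\<^sub>R f (0 + 1 / k * v)) = (\<lambda>v. indicator {0<..t} v *\<^sub>R f (v / k))"
  using k by (intro ext) (auto simp: indicator_def divide_le_cancel zero_less_divide_iff)
 finally show ?thesis using k by (simp add: set_lebesgue_integral_def)
qed

text \<open>Fubini for a bounded process on a bounded interval: a bound on the mean at each time
  gives one for the mean of the time integral.\<close>

lemma (in prob_space) expectation_time_integral_le:
 fixes Y :: "real \<Rightarrow> 'a \<Rightarrow> real"
 assumes Y: "(\<lambda>(r, w). Y r w) \<in> borel_measurable (borel \<Otimes>\<^sub>M M)"
  and b: "\<And>r w. w \<in> space M \<Longrightarrow> 0 \<le> Y r w \<and> Y r w \<le> B"
  and K: "\<And>r. r \<in> {0<..t} \<Longrightarrow> \<E> (Y r) \<le> K" and t: "0 \<le> t"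
 shows "integrable M (\<lambda>w. LINT r:{0<..t}|lborel. Y r w)" "\<E> (\<lambda>w. LINT r:{0<..t}|lborel. Y r w) \<le> K * t"
proof -
 let ?A = "\<lambda>w. LINT r:{0<..t}|lborel. Y r w"
 let ?B = "lborel \<Otimes>\<^sub>M M"
 let ?C = "\<lambda>r w. indicator {0<..t} r * Y r w"
 let ?D = "\<lambda>z. indicator {0<..t} (fst z) * Y (fst z) (snd z)"
 interpret L: pair_sigma_finite lborel M ..
 have lb: "sets (borel \<Otimes>\<^sub>M M) = sets ?B" by (intro sets_pair_measure_cong) auto
 have Ym: "(\<lambda>z. Y (fst z) (snd z)) \<in> borel_measurable ?B"
  using Y measurable_cong_sets[OF lb refl, of "borel :: real measure"] by (simp add: split_beta')
 have im: "?D \<in> borel_measurable ?B"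
  by (intro borel_measurable_times Ym measurable_compose[OF measurable_fst]) simp
 have s: "emeasure ?B ({0<..t} \<times> space M) < \<infinity>"
  using emeasure_lborel_Ioc_finite[of 0 t] by (simp add: emeasure_pair_measure_Times emeasure_space_1)
 have int: "integrable ?B ?D"
 proof (rule integrableI_bounded_set[where A="{0<..t} \<times> space M" and B=B])
  show "AE z in lborel \<Otimes>\<^sub>M M. z \<in> {0<..t} \<times> space M \<longrightarrow> norm (indicator {0<..t} (fst z) * Y (fst z) (snd z)) \<le> B"
   using b by (intro AE_I2) (auto simp: indicator_def)
  show "AE z in lborel \<Otimes>\<^sub>M M. z \<notin> {0<..t} \<times> space M \<longrightarrow> indicator {0<..t} (fst z) * Y (fst z) (snd z) = 0"
   by (intro AE_I2) (auto simp: indicator_def space_pair_measure)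
 qed (use s im in auto)
 have e: "?A = (\<lambda>w. \<integral>r. indicator {0<..t} r * Y r w \<partial>lborel)"
  by (simp add: set_lebesgue_integral_def)
 show "integrable M ?A"
  unfolding e using L.integrable_snd[of "\<lambda>r w. indicator {0<..t} r * Y r w"] int by (simp add: split_beta')
 have "\<E> ?A = (\<integral>r. \<E> (?C r) \<partial>lborel)"
  unfolding e using L.Fubini_integral[of "\<lambda>r w. indicator {0<..t} r * Y r w"] int by (simp add: split_beta')
 also have "\<dots> \<le> (\<integral>r. indicator {0<..t} r * K \<partial>lborel)"
 proof (rule integral_mono)
  show "integrable lborel (\<lambda>r. \<E> (?C r))"
   using L.integrable_fst[of "\<lambda>r w. indicator {0<..t} r * Y r w"] int by (simp add: split_beta')
  show "integrable lborel (\<lambda>r. indicator {0<..t} r * K)"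
   by (intro integrable_mult_left integrable_real_indicator emeasure_lborel_Ioc_finite) auto
  show "\<E> (?C r) \<le> indicator {0<..t} r * K" for r
   using K[of r] by (auto simp: indicator_def)
 qed
 also have "\<dots> = K * t" using t measure_lborel_Ioc_max[of 0 t] by simp
 finally show "\<E> ?A \<le> K * t" .
qed

lemma empirical_moment_power_sum:
 "empirical_moment n N (\<lambda>i. g * x i) = g ^ n / real N * power_sum N x n"
 by (simp add: empirical_moment_def power_sum_def power_mult_distrib sum_distrib_left)

text \<open>Chebyshev's sum inequality: on nonnegative numbers two powers are ordered in the same
  way, so the product of their differences is nonnegative for every pair.\<close>

lemma empirical_moment_mult_le:
 assumes N: "1 \<le> N" and x: "\<And>i. i \<in> {1..N} \<Longrightarrow> 0 \<le> x i"
 shows "empirical_moment j N x * empirical_moment l N x \<le> empirical_moment (j + l) N x"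
proof -
 let ?I = "{1..N}"
 have "0 \<le> (x i ^ j - x k ^ j) * (x i ^ l - x k ^ l)" if "i \<in> ?I" "k \<in> ?I" for i k
 proof (cases "x i \<le> x k")
  case True
  then show ?thesis using x that by (intro mult_nonpos_nonpos) (auto intro: power_mono)
 next
  case False
  then show ?thesis using x that by (intro mult_nonneg_nonneg) (auto intro: power_mono)
 qed
 then have "0 \<le> (\<Sum>i\<in>?I. \<Sum>k\<in>?I. (x i ^ j - x k ^ j) * (x i ^ l - x k ^ l))" by (intro sum_nonneg)
 also have "\<dots> = (\<Sum>i\<in>?I. \<Sum>k\<in>?I. x i ^ (j + l) + x k ^ (j + l) - x i ^ j * x k ^ l - x k ^ j * x i ^ l)"
  by (intro sum.cong refl) (simp add: algebra_simps power_add)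
 also have "\<dots> = 2 * (real N * (\<Sum>i\<in>?I. x i ^ (j + l))) - 2 * ((\<Sum>i\<in>?I. x i ^ j) * (\<Sum>i\<in>?I. x i ^ l))"
 proof -
  have "(\<Sum>i\<in>?I. \<Sum>k\<in>?I. x k ^ j * x i ^ l) = (\<Sum>i\<in>?I. x i ^ j) * (\<Sum>i\<in>?I. x i ^ l)"
   unfolding sum_product by (rule sum.swap)
  moreover have "(\<Sum>i\<in>?I. \<Sum>k\<in>?I. x i ^ j * x k ^ l) = (\<Sum>i\<in>?I. x i ^ j) * (\<Sum>i\<in>?I. x i ^ l)"
   unfolding sum_product ..
  ultimately show ?thesis by (simp add: sum.distrib sum_subtractf sum_distrib_left[symmetric])
 qed
 finally have le: "(\<Sum>i\<in>?I. x i ^ j) * (\<Sum>i\<in>?I. x i ^ l) \<le> real N * (\<Sum>i\<in>?I. x i ^ (j + l))" by linarith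
 have N0: "0 < real N" using N by simp
 have "(\<Sum>i\<in>?I. x i ^ j) * (\<Sum>i\<in>?I. x i ^ l) / (real N * real N) \<le> real N * (\<Sum>i\<in>?I. x i ^ (j + l)) / (real N * real N)"
  using le by (intro divide_right_mono) auto
 then show ?thesis unfolding empirical_moment_def using N0 by simp
qed

text \<open>The prefactor comes from scaling space by \<open>\<gamma>\<close>, averaging over
  \<open>N\<close> and slowing time by \<open>\<tau>\<close>. Degree \<open>m - 1\<close> then
  receives \<open>\<gamma> / \<tau>\<close> and degree \<open>m\<close> only
  \<open>1 / \<tau>\<close>. The factor \<open>1 / N\<close> in \<open>\<beta>\<close> turns the sum
  over pairs into products of empirical moments, its diagonal keeping \<open>1 / N\<close>. The
  coefficient \<open>m (m + a)\<close> is \<open>m (a + 1) + m (m - 1)\<close>.\<close>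

lemma power_sum_drift_rescaled:
 fixes \<gamma> \<tau> :: real and x :: "nat \<Rightarrow> real"
 assumes N: "1 \<le> N" and m: "1 \<le> m" and \<gamma>: "0 < \<gamma>" and \<tau>: "0 < \<tau>"
 defines "S \<equiv> \<lambda>k. empirical_moment k N (\<lambda>i. \<gamma> * x i)"
 shows "\<gamma> ^ m / (real N * \<tau>) * power_sum_drift N a b (2 * c / real N) m x =
   \<gamma> / \<tau> * (real m * (real m + a) * S (m - 1) + c * real m * (\<Sum>l<m. S (m - Suc l) * S l))
   - (\<gamma> / \<tau> * (c * real m * (real m / real N) * S (m - 1)) +
    1 / \<tau> * (real m * (a + b + 2) * S m + real m * (real m - 1) * S m + c * real m * ((\<Sum>l<Suc m. S (Suc m - Suc l) * S l) - real (Suc m) / real N * S m)))"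
proof -
 let ?A = "\<lambda>\<gamma> m q B. \<gamma> / \<tau> * (c * real m * (real m / real N) * S q) + 1 / \<tau> * (real m * (a + b + 2) * S m + real m * (real m - 1) * S m + c * real m * (B - real (Suc m) / real N * S m))"
 have N0: "real N \<noteq> 0" using N by simp
 have P: "power_sum N x k = real N / \<gamma> ^ k * S k" for k
  unfolding S_def empirical_moment_power_sum using N0 \<gamma> by simp
 obtain q where q: "m = Suc q" using m by (cases m) auto
 have pair: "pair_sum N x (Suc k) = (real N)^2 / \<gamma> ^ k * (\<Sum>l<Suc k. S (Suc k - Suc l) * S l)" for k
  unfolding pair_sum_def sum_distrib_left
 proof (intro sum.cong refl)
  fix l assume "l \<in> {..<Suc k}"
  then have "\<gamma> ^ k = \<gamma> ^ (Suc k - Suc l) * \<gamma> ^ l" by (simp add: power_add[symmetric])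
  then show "power_sum N x (Suc k - Suc l) * power_sum N x l = (real N)^2 / \<gamma> ^ k * (S (Suc k - Suc l) * S l)"
   unfolding P using \<gamma> by (simp add: power2_eq_square)
 qed
 define A where "A = (\<Sum>l<Suc q. S (Suc q - Suc l) * S l)"
 define B where "B = (\<Sum>l<Suc (Suc q). S (Suc (Suc q) - Suc l) * S l)"
 have g: "\<gamma> ^ m = \<gamma> ^ q * \<gamma>" "\<gamma> ^ q \<noteq> 0" "\<gamma> \<noteq> 0" using \<gamma> by (auto simp: q)
 have D: "power_sum_drift N a b (2 * c / real N) m x =
   real m * ((a + 1) * (real N / \<gamma> ^ q * S q) - (a + b + 2) * (real N / \<gamma> ^ m * S m)) +
   real m * (real m - 1) * (real N / \<gamma> ^ q * S q - real N / \<gamma> ^ m * S m) +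
   real m * (2 * c / real N) / 2 * (((real N)^2 / \<gamma> ^ q * A - real m * (real N / \<gamma> ^ q * S q)) -
    ((real N)^2 / \<gamma> ^ m * B - real (Suc m) * (real N / \<gamma> ^ m * S m)))"
  unfolding power_sum_drift_def P[symmetric] A_def B_def pair[symmetric] q by (simp only: diff_Suc_1 pair)
 have i: "\<gamma> ^ m / (real N * \<tau>) * (real N / \<gamma> ^ q) = \<gamma> / \<tau>" "\<gamma> ^ m / (real N * \<tau>) * (real N / \<gamma> ^ m) = 1 / \<tau>"
  using g N0 by simp_all
 have "\<gamma> ^ m / (real N * \<tau>) * power_sum_drift N a b (2 * c / real N) m x =
   real m * ((a + 1) * (\<gamma> ^ m / (real N * \<tau>) * (real N / \<gamma> ^ q) * S q) - (a + b + 2) * (\<gamma> ^ m / (real N * \<tau>) * (real N / \<gamma> ^ m) * S m)) +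
   real m * (real m - 1) * (\<gamma> ^ m / (real N * \<tau>) * (real N / \<gamma> ^ q) * S q - \<gamma> ^ m / (real N * \<tau>) * (real N / \<gamma> ^ m) * S m) +
   real m * c * ((\<gamma> ^ m / (real N * \<tau>) * (real N / \<gamma> ^ q) * A - real m / real N * (\<gamma> ^ m / (real N * \<tau>) * (real N / \<gamma> ^ q) * S q)) -
    (\<gamma> ^ m / (real N * \<tau>) * (real N / \<gamma> ^ m) * B - real (Suc m) / real N * (\<gamma> ^ m / (real N * \<tau>) * (real N / \<gamma> ^ m) * S m)))"
 proof -
  \<comment> \<open>Here \<open>n\<close> stands for the number of particles, \<open>u\<close> for
    the prefactor, and \<open>v\<close>, \<open>w\<close> for the powers of \<open>\<gamma>\<close>
    of degree \<open>m - 1\<close> and \<open>m\<close>.\<close>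
  have *: "u * (M * (A1 * (n / v * s) - A2 * (n / w * s')) + M * M1 * (n / v * s - n / w * s') +
    M * (2 * c / n) / 2 * ((n^2 / v * A - M * (n / v * s)) - (n^2 / w * B - M2 * (n / w * s')))) =
   M * (A1 * (u * (n / v) * s) - A2 * (u * (n / w) * s')) + M * M1 * (u * (n / v) * s - u * (n / w) * s') +
   M * c * ((u * (n / v) * A - M / n * (u * (n / v) * s)) - (u * (n / w) * B - M2 / n * (u * (n / w) * s')))"
   if "n \<noteq> 0" for u M A1 A2 M1 M2 n v w s s' :: real
  proof -
   have "c * (n^2 / v) / n = c * (n / v)" "c * (n^2 / w) / n = c * (n / w)" using that by (simp_all add: power2_eq_square)
   then have "M * (2 * c / n) / 2 * ((n^2 / v * A - M * (n / v * s)) - (n^2 / w * B - M2 * (n / w * s'))) =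
    M * c * ((n / v * A - M / n * (n / v * s)) - (n / w * B - M2 / n * (n / w * s')))"
    using that by (simp add: power2_eq_square algebra_simps)
   then show ?thesis by (simp only:) (simp add: algebra_simps)
  qed
  show ?thesis unfolding D by (rule *[OF N0])
 qed
 also have "\<dots> = \<gamma> / \<tau> * (real m * (real m + a) * S q + c * real m * A)
   - (?A \<gamma> m q B)"
  unfolding i
 proof -
  have "M * ((a + 1) * (g * s) - A2 * (k * s')) + M * (M - 1) * (g * s - k * s') +
   M * c * ((g * A - R * (g * s)) - (k * B - R' * (k * s'))) =
   g * (M * (M + a) * s + c * M * A) - (g * (c * M * R * s) + k * (M * A2 * s' + M * (M - 1) * s' + c * M * (B - R' * s')))"
   for M A2 g k s s' R R' :: real by (simp add: algebra_simps)
  then show "real m * ((a + 1) * (\<gamma> / \<tau> * S q) - (a + b + 2) * (1 / \<tau> * S m)) +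
   real m * (real m - 1) * (\<gamma> / \<tau> * S q - 1 / \<tau> * S m) +
   real m * c * ((\<gamma> / \<tau> * A - real m / real N * (\<gamma> / \<tau> * S q)) - (1 / \<tau> * B - real (Suc m) / real N * (1 / \<tau> * S m))) =
   \<gamma> / \<tau> * (real m * (real m + a) * S q + c * real m * A)
   - (?A \<gamma> m q B)" .
 qed
 finally show ?thesis unfolding A_def B_def q by (simp only: diff_Suc_1)
qed

text \<open>The off-diagonal part of the sum over pairs is nonnegative for nonnegative particles, so
  the diagonal is at most the whole.\<close>

lemma moment_diagonal_le:
 assumes N: "1 \<le> N" and x: "\<And>i. i \<in> {1..N} \<Longrightarrow> 0 \<le> x i"
 shows "real (Suc m) / real N * empirical_moment m N x \<le> (\<Sum>l<Suc m. empirical_moment (Suc m - Suc l) N x * empirical_moment l N x)"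
proof -
 have P: "empirical_moment k N x = 1 / real N * power_sum N x k" for k by (simp add: empirical_moment_def power_sum_def)
 have N0: "0 < real N" using N by simp
 have "0 \<le> (\<Sum>i=1..N. \<Sum>j\<in>{1..N} - {i}. \<Sum>l<Suc m. x j ^ (Suc m - Suc l) * x i ^ l)"
  using x by (intro sum_nonneg) auto
 then have "real (Suc m) * power_sum N x m \<le> pair_sum N x (Suc m)"
  unfolding off_diagonal_pair_sum by simp
 then have "real (Suc m) * power_sum N x m / (real N * real N) \<le> pair_sum N x (Suc m) / (real N * real N)"
  by (rule divide_right_mono) simp
 moreover have "(\<Sum>l<Suc m. empirical_moment (Suc m - Suc l) N x * empirical_moment l N x) = pair_sum N x (Suc m) / (real N * real N)"
  unfolding P pair_sum_def sum_divide_distrib by (intro sum.cong refl) simp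
 moreover have "real (Suc m) / real N * empirical_moment m N x = real (Suc m) * power_sum N x m / (real N * real N)"
  unfolding P by simp
 ultimately show ?thesis by linarith
qed

lemma limit_moment_continuous:
 "continuous_on {0..} (limit_moment \<sigma> c \<alpha> an n)"
proof (induction n rule: less_induct)
 case (less n)
 show ?case
 proof (cases "n = 0")
  case True
  have "limit_moment \<sigma> c \<alpha> an n = (\<lambda>t. 1)" by (rule ext, subst limit_moment.simps) (simp add: True)
  then show ?thesis by simp
 next
  case False
  have cI: "continuous_on {0..} (\<lambda>t. integral {0..t} f)" if f: "continuous_on {0..} f" for f :: "real \<Rightarrow> real"
  proof -
   have "continuous (at t within {0..}) (\<lambda>t. integral {0..t} f)" if t: "0 \<le> t" for t
   proof -
    have "continuous_on {0..t + 1} (\<lambda>t. integral {0..t} f)"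
     by (intro indefinite_integral_continuous_1 integrable_continuous_interval continuous_on_subset[OF f]) auto
    then have "continuous (at t within {0..t + 1}) (\<lambda>t. integral {0..t} f)" using t by (simp add: continuous_on_eq_continuous_within)
    moreover have "at t within {0..t + 1} = at t within {0..}"
     by (rule at_within_nhd[of _ "{..<t + 1}"]) auto
    ultimately show ?thesis by simp
   qed
   then show ?thesis by (simp add: continuous_on_eq_continuous_within)
  qed
  have e: "limit_moment \<sigma> c \<alpha> an n = (\<lambda>t. an n
    + \<sigma> * real n * (real n + \<alpha> - 1) * integral {0..t} (\<lambda>u. limit_moment \<sigma> c \<alpha> an (n - 1) u)
    + \<sigma> * c * real n * (\<Sum>j\<in>{0..<n}. integral {0..t} (\<lambda>u. limit_moment \<sigma> c \<alpha> an j u * limit_moment \<sigma> c \<alpha> an (n - 1 - j) u)))"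
   by (rule ext, subst limit_moment.simps) (simp add: False)
  show ?thesis unfolding e
   using False by (intro continuous_on_add continuous_on_mult continuous_on_const continuous_on_sum cI less.IH) auto
 qed
qed

text \<open>Links the Lebesgue integrals of the process side to the gauge integrals in the recursion
  of \<open>limit_moment\<close>.\<close>

lemma set_integral_Ioc_eq_integral:
 fixes f :: "real \<Rightarrow> real"
 assumes "continuous_on {0..t} f"
 shows "(LINT r:{0<..t}|lborel. f r) = integral {0..t} f"
proof -
 have i: "set_integrable lborel {0..t} f" by (rule borel_integrable_atLeastAtMost'[OF assms])
 have "(LINT r:{0<..t}|lborel. f r) = (LINT r:{0..t}|lborel. f r)"
  unfolding set_lebesgue_integral_def
 proof (rule integral_cong_AE)
  show "(\<lambda>r. indicator {0<..t} r *\<^sub>R f r) \<in> borel_measurable lborel"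
   using continuous_set_integrable_Ioc[OF assms] by (auto simp: set_integrable_def)
  show "(\<lambda>r. indicator {0..t} r *\<^sub>R f r) \<in> borel_measurable lborel" using i by (auto simp: set_integrable_def)
  show "AE r in lborel. indicator {0<..t} r *\<^sub>R f r = indicator {0..t} r *\<^sub>R f r"
   using AE_lborel_singleton[of 0] by eventually_elim (auto simp: indicator_def)
 qed
 then show ?thesis using set_borel_integral_eq_integral(2)[OF i] by simp
qed

locale jacobi_scaling =
 fixes a b c \<sigma> :: real and \<gamma> \<tau> :: "nat \<Rightarrow> real" and M :: "nat \<Rightarrow> 'w measure"
  and W lam :: "nat \<Rightarrow> nat \<Rightarrow> real \<Rightarrow> 'w \<Rightarrow> real" and x0 :: "nat \<Rightarrow> nat \<Rightarrow> real" and an :: "nat \<Rightarrow> real"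
 assumes c_pos: "c > 0" and a_gt: "a > - 1 / 2" and b_gt: "b > - 1 / 2" and \<sigma>_pos: "\<sigma> > 0"
  and \<gamma>_pos: "\<And>N. N \<ge> 1 \<Longrightarrow> \<gamma> N > 0" and \<tau>_pos: "\<And>N. N \<ge> 1 \<Longrightarrow> \<tau> N > 0"
  and process: "\<And>N. N \<ge> 1 \<Longrightarrow> beta_jacobi_process (M N) N a b (2 * c / real N) (x0 N) (W N) (lam N)"
  and \<tau>_lim: "filterlim \<tau> at_top sequentially"
  and \<gamma>\<tau>_lim: "(\<lambda>N. \<gamma> N / \<tau> N) \<longlonglongrightarrow> \<sigma>"
  and init_lim: "\<And>n. (\<lambda>N. empirical_moment n N (\<lambda>i. \<gamma> N * x0 N i)) \<longlonglongrightarrow> an n"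
begin

definition S :: "nat \<Rightarrow> nat \<Rightarrow> real \<Rightarrow> 'w \<Rightarrow> real" where
 "S n N t w = empirical_moment n N (\<lambda>i. \<gamma> N * lam N i (t / \<tau> N) w)"

definition main_drift :: "nat \<Rightarrow> nat \<Rightarrow> real \<Rightarrow> 'w \<Rightarrow> real" where
 "main_drift m N t w = real m * (real m + a) * S (m - 1) N t w + c * real m * (\<Sum>l<m. S (m - Suc l) N t w * S l N t w)"

text \<open>Everything that vanishes in the limit, collected with the sign that makes it
  nonnegative. Dropping it gives an upper bound for the drift, and its mean measures its
  size.\<close>

definition small_drift :: "nat \<Rightarrow> nat \<Rightarrow> real \<Rightarrow> 'w \<Rightarrow> real" where
 "small_drift m N t w = \<gamma> N / \<tau> N * (c * real m * (real m / real N) * S (m - 1) N t w) +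
   1 / \<tau> N * (real m * (a + b + 2) * S m N t w + real m * (real m - 1) * S m N t w
    + c * real m * ((\<Sum>l<Suc m. S (Suc m - Suc l) N t w * S l N t w) - real (Suc m) / real N * S m N t w))"

definition drift :: "nat \<Rightarrow> nat \<Rightarrow> real \<Rightarrow> 'w \<Rightarrow> real" where
 "drift m N t w = \<gamma> N / \<tau> N * main_drift m N t w - small_drift m N t w"

definition noise :: "nat \<Rightarrow> nat \<Rightarrow> real \<Rightarrow> 'w \<Rightarrow> real" where
 "noise m N t w = S m N t w - S m N 0 w - (LINT r:{0<..t}|lborel. drift m N r w)"

lemma eventually_ge_1: "\<forall>\<^sub>F N in sequentially. (1::nat) \<le> N"
 by (rule eventually_ge_at_top)

lemma prob: "1 \<le> N \<Longrightarrow> prob_space (M N)"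
 using process[of N] by (simp add: beta_jacobi_process_def)

lemma prob_eventually: "\<forall>\<^sub>F N in sequentially. prob_space (M N)"
 using eventually_ge_1 by eventually_elim (rule prob)

lemma \<beta>_pos: "1 \<le> N \<Longrightarrow> 0 < 2 * c / real N"
 using c_pos by simp

section \<open>Bounds for a fixed number of particles\<close>

context
 fixes N :: nat assumes N: "1 \<le> N"
begin

lemma scale_pos: "0 < \<gamma> N" "0 < \<tau> N" "0 < \<gamma> N / \<tau> N" "0 < real N"
 using \<gamma>_pos[OF N] \<tau>_pos[OF N] N by auto

lemma lam_range: "w \<in> space (M N) \<Longrightarrow> 0 \<le> t \<Longrightarrow> i \<in> {1..N} \<Longrightarrow> 0 \<le> lam N i t w \<and> lam N i t w \<le> 1"
 using process[OF N] unfolding beta_jacobi_process_def by blast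

lemma lam_cont: "w \<in> space (M N) \<Longrightarrow> i \<in> {1..N} \<Longrightarrow> continuous_on {0..} (\<lambda>t. lam N i t w)"
 using process[OF N] unfolding beta_jacobi_process_def by blast

lemma lam_init: "w \<in> space (M N) \<Longrightarrow> i \<in> {1..N} \<Longrightarrow> lam N i 0 w = x0 N i"
 using process[OF N] unfolding beta_jacobi_process_def by blast

lemma lam_measurable:
 assumes "i \<in> {1..N}" "0 \<le> t"
 shows "lam N i t \<in> borel_measurable (M N)"
proof -
 have ind: "independent_brownian_motions (M N) {1..N} (W N)"
  and ad: "lam N i t \<in> borel_measurable (augmented_filtration (M N) {1..N} (W N) t)"
  using process[OF N] assms unfolding beta_jacobi_process_def by blast+
 interpret brownian_family "M N" "{1..N}" "W N"
  by (rule brownian_family.intro[OF prob[OF N]], rule brownian_family_axioms.intro) (use N ind in auto)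
 show ?thesis by (rule filtration_measurable[OF ad])
qed

lemma x_nonneg: "w \<in> space (M N) \<Longrightarrow> 0 \<le> t \<Longrightarrow> i \<in> {1..N} \<Longrightarrow> 0 \<le> \<gamma> N * lam N i (t / \<tau> N) w"
 using lam_range[of w "t / \<tau> N" i] scale_pos by auto

lemma x_cont:
 assumes "w \<in> space (M N)" "i \<in> {1..N}"
 shows "continuous_on {0..} (\<lambda>t. \<gamma> N * lam N i (t / \<tau> N) w)"
proof (intro continuous_on_mult continuous_on_const)
 show "continuous_on {0..} (\<lambda>t. lam N i (t / \<tau> N) w)"
  by (rule continuous_on_compose2[OF lam_cont[OF assms]]) (use scale_pos in \<open>auto intro!: continuous_intros\<close>)
qed

lemma x_measurable: "i \<in> {1..N} \<Longrightarrow> 0 \<le> t \<Longrightarrow> (\<lambda>w. \<gamma> N * lam N i (t / \<tau> N) w) \<in> borel_measurable (M N)"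
 using lam_measurable[of i "t / \<tau> N"] scale_pos by auto

lemma S_nonneg: "w \<in> space (M N) \<Longrightarrow> 0 \<le> t \<Longrightarrow> 0 \<le> S n N t w"
 unfolding S_def empirical_moment_def by (rule mult_nonneg_nonneg[OF _ sum_nonneg[OF zero_le_power[OF x_nonneg]]]) auto

lemma S_le:
 assumes "w \<in> space (M N)" "0 \<le> t"
 shows "S n N t w \<le> \<gamma> N ^ n"
proof -
 let ?A = "\<lambda>i. lam N i (t / \<tau> N) w"
 have "0 \<le> t / \<tau> N" using assms scale_pos by simp
 then have "power_sum N ?A n \<le> real N"
  by (intro power_sum_bounds(2)) (use lam_range[OF assms(1)] in auto)
 then have "\<gamma> N ^ n / real N * power_sum N ?A n \<le> \<gamma> N ^ n / real N * real N"
  using scale_pos by (intro mult_left_mono) auto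
 then show ?thesis unfolding S_def empirical_moment_power_sum using scale_pos by simp
qed

lemma S_0: "S 0 N t w = 1"
 unfolding S_def empirical_moment_def using N by simp

lemma S_mult: "w \<in> space (M N) \<Longrightarrow> 0 \<le> t \<Longrightarrow> S j N t w * S l N t w \<le> S (j + l) N t w"
 unfolding S_def by (rule empirical_moment_mult_le[OF N]) (rule x_nonneg)

lemma S_measurable: "0 \<le> t \<Longrightarrow> S n N t \<in> borel_measurable (M N)"
 unfolding S_def[abs_def] empirical_moment_def
 by (intro borel_measurable_times borel_measurable_const borel_measurable_sum borel_measurable_power x_measurable[unfolded times_divide_eq_right]) auto

lemma S_cont: "w \<in> space (M N) \<Longrightarrow> continuous_on {0..} (\<lambda>t. S n N t w)"
 unfolding S_def empirical_moment_def
 by (intro continuous_on_mult continuous_on_const continuous_on_sum continuous_on_power x_cont)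

lemma main_drift_cont: "w \<in> space (M N) \<Longrightarrow> continuous_on {0..} (\<lambda>t. main_drift m N t w)"
 unfolding main_drift_def by (intro continuous_intros S_cont)

lemma small_drift_cont: "w \<in> space (M N) \<Longrightarrow> continuous_on {0..} (\<lambda>t. small_drift m N t w)"
 unfolding small_drift_def by (intro continuous_on_add continuous_on_diff continuous_on_mult continuous_on_const continuous_on_sum S_cont)

lemma Ioc_integrable: "continuous_on {0..} f \<Longrightarrow> set_integrable lborel {0<..t} f" for f :: "real \<Rightarrow> real"
 by (rule continuous_set_integrable_Ioc) (auto intro: continuous_on_subset)

lemma S_init: "w \<in> space (M N) \<Longrightarrow> S n N 0 w = empirical_moment n N (\<lambda>i. \<gamma> N * x0 N i)"
 unfolding S_def empirical_moment_def using lam_init by simp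

text \<open>By Chebyshev's inequality each product of moments is at most the moment of order
  \<open>m - 1\<close>. The bound is linear in a single lower moment, so that expectations can be
  taken.\<close>

lemma main_drift_le:
 assumes "w \<in> space (M N)" "0 \<le> t" "1 \<le> m"
 shows "main_drift m N t w \<le> (real m * (real m + a) + c * real m * real m) * S (m - 1) N t w"
proof -
 let ?A = "\<Sum>l<m. S (m - Suc l) N t w * S l N t w"
 have "?A \<le> (\<Sum>l<m. S (m - 1) N t w)"
 proof (rule sum_mono)
  fix l assume "l \<in> {..<m}"
  then have "m - Suc l + l = m - 1" by auto
  then show "S (m - Suc l) N t w * S l N t w \<le> S (m - 1) N t w" using S_mult[OF assms(1,2), of "m - Suc l" l] by simp
 qed
 then have "c * real m * ?A \<le> c * real m * (real m * S (m - 1) N t w)"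
  using c_pos by (intro mult_left_mono) auto
 then show ?thesis unfolding main_drift_def by (simp add: algebra_simps)
qed

text \<open>The sign rests on \<open>moment_diagonal_le\<close>: subtracting the diagonal leaves the
  sum over pairs nonnegative. For the upper bound products are again replaced by single moments,
  which displays the factors \<open>1 / N\<close> and \<open>1 / \<tau>\<close>.\<close>

lemma small_drift_bounds:
 assumes w: "w \<in> space (M N)" and t: "0 \<le> t" and m: "1 \<le> m"
 shows "0 \<le> small_drift m N t w"
  "small_drift m N t w \<le> \<gamma> N / \<tau> N * (c * real m * (real m / real N)) * S (m - 1) N t w +
    1 / \<tau> N * (real m * (a + b + 2) + real m * (real m - 1) + c * real m * real (Suc m)) * S m N t w"
proof -
 let ?P = "\<Sum>l<Suc m. S (Suc m - Suc l) N t w * S l N t w"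
 have P1: "real (Suc m) / real N * S m N t w \<le> ?P"
  unfolding S_def by (rule moment_diagonal_le[OF N]) (rule x_nonneg[OF w t])
 have P2: "?P \<le> (\<Sum>l<Suc m. S m N t w)"
 proof (rule sum_mono)
  fix l assume "l \<in> {..<Suc m}"
  then have "Suc m - Suc l + l = m" by auto
  then show "S (Suc m - Suc l) N t w * S l N t w \<le> S m N t w" using S_mult[OF w t, of "Suc m - Suc l" l] by simp
 qed
 have ab: "0 \<le> a + b + 2" using a_gt b_gt by simp
 have S0: "0 \<le> S k N t w" for k by (rule S_nonneg[OF w t])
 have nn: "0 \<le> \<gamma> N / \<tau> N * (c * real m * (real m / real N) * S (m - 1) N t w)"
  "0 \<le> real m * (a + b + 2) * S m N t w" "0 \<le> real m * (real m - 1) * S m N t w"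
  using scale_pos c_pos ab m S0 by auto
 have cP: "0 \<le> c * real m * (?P - real (Suc m) / real N * S m N t w)"
  using c_pos P1 by (intro mult_nonneg_nonneg) auto
 show "0 \<le> small_drift m N t w"
  unfolding small_drift_def using scale_pos by (intro add_nonneg_nonneg mult_nonneg_nonneg nn cP) auto
 have "?P - real (Suc m) / real N * S m N t w \<le> real (Suc m) * S m N t w"
 proof -
  have "0 \<le> real (Suc m) / real N * S m N t w" using S0 scale_pos by simp
  then show ?thesis using P2 by (simp only: sum_constant card_lessThan)
 qed
 then have "c * real m * (?P - real (Suc m) / real N * S m N t w) \<le> c * real m * (real (Suc m) * S m N t w)"
  using c_pos by (intro mult_left_mono) auto
 then have "1 / \<tau> N * (real m * (a + b + 2) * S m N t w + real m * (real m - 1) * S m N t w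
    + c * real m * (?P - real (Suc m) / real N * S m N t w)) \<le>
   1 / \<tau> N * (real m * (a + b + 2) * S m N t w + real m * (real m - 1) * S m N t w + c * real m * (real (Suc m) * S m N t w))"
  by (rule mult_left_mono[OF add_left_mono]) (use scale_pos in auto)
 then show "small_drift m N t w \<le> \<gamma> N / \<tau> N * (c * real m * (real m / real N)) * S (m - 1) N t w +
    1 / \<tau> N * (real m * (a + b + 2) + real m * (real m - 1) + c * real m * real (Suc m)) * S m N t w"
  unfolding small_drift_def by (simp only: distrib_left distrib_right mult.assoc)
qed

lemma S_time_integral:
 assumes t: "0 \<le> t" and K: "\<And>r. r \<in> {0..t} \<Longrightarrow> (\<integral>w. S k N r w \<partial>M N) \<le> K"
 shows "integrable (M N) (\<lambda>w. LINT r:{0<..t}|lborel. S k N r w)" "(\<integral>w. (LINT r:{0<..t}|lborel. S k N r w) \<partial>M N) \<le> K * t"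
proof -
 interpret prob_space "M N" by (rule prob[OF N])
 have j: "(\<lambda>(r, w). S k N (max 0 r) w) \<in> borel_measurable (borel \<Otimes>\<^sub>M M N)"
  by (rule continuous_process_measurable) (auto intro: S_measurable S_cont)
 have b: "0 \<le> S k N (max 0 r) w \<and> S k N (max 0 r) w \<le> \<gamma> N ^ k" if "w \<in> space (M N)" for r w
  using S_nonneg[OF that] S_le[OF that] by simp
 have e: "(LINT r:{0<..t}|lborel. S k N r w) = (LINT r:{0<..t}|lborel. S k N (max 0 r) w)" for w
  unfolding set_lebesgue_integral_def by (intro lint_cong refl) (auto simp: indicator_def)
 have K': "\<E> (S k N (max 0 r)) \<le> K" if "r \<in> {0<..t}" for r using K[of r] that by auto
 show "integrable (M N) (\<lambda>w. LINT r:{0<..t}|lborel. S k N r w)" "(\<integral>w. (LINT r:{0<..t}|lborel. S k N r w) \<partial>M N) \<le> K * t"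
  unfolding e by (rule expectation_time_integral_le[OF j b K' t]; assumption)+
qed

text \<open>The substitution \<open>r = v / \<tau>\<close> in time supplies the missing factor
  \<open>1 / \<tau>\<close> of \<open>power_sum_drift_rescaled\<close>.\<close>

lemma rescaled_drift_integral:
 assumes m: "1 \<le> m"
 shows "\<gamma> N ^ m / real N * (LINT r:{0<..t / \<tau> N}|lborel. power_sum_drift N a b (2 * c / real N) m (\<lambda>i. lam N i r w))
   = (LINT r:{0<..t}|lborel. drift m N r w)"
proof -
 have d: "drift m N v w = \<gamma> N ^ m / (real N * \<tau> N) * power_sum_drift N a b (2 * c / real N) m (\<lambda>i. lam N i (v / \<tau> N) w)" for v
  unfolding power_sum_drift_rescaled[OF N m scale_pos(1,2)] drift_def main_drift_def small_drift_def S_def ..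
 have "\<gamma> N ^ m / real N * (LINT r:{0<..t / \<tau> N}|lborel. power_sum_drift N a b (2 * c / real N) m (\<lambda>i. lam N i r w)) =
  \<gamma> N ^ m / (real N * \<tau> N) * (LINT v:{0<..t}|lborel. power_sum_drift N a b (2 * c / real N) m (\<lambda>i. lam N i (v / \<tau> N) w))"
  unfolding set_integral_rescale[OF scale_pos(2)] by simp
 then show ?thesis unfolding d set_integral_mult_right .
qed

lemma S_expectation:
 assumes m: "1 \<le> m" and t: "0 \<le> t"
 shows "(\<integral>w. S m N t w \<partial>M N) = empirical_moment m N (\<lambda>i. \<gamma> N * x0 N i) + (\<integral>w. (LINT r:{0<..t}|lborel. drift m N r w) \<partial>M N)"
proof -
 have t': "0 \<le> t / \<tau> N" using t scale_pos by simp
 note e = jacobi_power_sum_estimates(1)[OF process[OF N] N \<beta>_pos[OF N] m t']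
 have "(\<integral>w. S m N t w \<partial>M N) = \<gamma> N ^ m / real N * (\<integral>w. power_sum N (\<lambda>i. lam N i (t / \<tau> N) w) m \<partial>M N)"
  unfolding S_def empirical_moment_power_sum by simp
 also have "\<dots> = \<gamma> N ^ m / real N * power_sum N (x0 N) m +
  (\<integral>w. \<gamma> N ^ m / real N * (LINT r:{0<..t / \<tau> N}|lborel. power_sum_drift N a b (2 * c / real N) m (\<lambda>i. lam N i r w)) \<partial>M N)"
  unfolding e integral_mult_right_zero by (simp only: distrib_left)
 finally show ?thesis unfolding rescaled_drift_integral[OF m] empirical_moment_power_sum .
qed

text \<open>The noise is \<open>g\<close> times the martingale of the power sum, so its squared size
  is \<open>g^2\<close> times a bracket bounded by the power sum of order \<open>2m - 1\<close>. The
  powers of \<open>\<gamma>\<close> cancel except one, leaving \<open>\<gamma> / \<tau>\<close>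
  times \<open>1 / N\<close>.\<close>

lemma noise_small:
 assumes m: "1 \<le> m" and T: "0 \<le> T" and e: "0 < e"
  and K: "\<And>r. r \<in> {0..T} \<Longrightarrow> (\<integral>w. S (2 * m - 1) N r w \<partial>M N) \<le> K"
 shows "\<exists>E\<in>sets (M N). measure (M N) E \<le> 2 * (real m)^2 * (\<gamma> N / \<tau> N) * (K * T) / e^2 * (1 / real N) \<and>
   (\<forall>w\<in>space (M N) - E. \<forall>t\<in>{0..T}. \<bar>noise m N t w\<bar> \<le> e)"
proof -
 let ?A = "\<integral>w. (LINT r:{0<..T}|lborel. S (2 * m - 1) N r w) \<partial>M N"
 let ?B = "\<lambda>t w. LINT r:{0<..t / \<tau> N}|lborel. power_sum_drift N a b (2 * c / real N) m (\<lambda>i. lam N i r w)"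
 let ?C = "\<lambda>w. LINT r:{0<..T / \<tau> N}|lborel. power_sum N (\<lambda>i. lam N i r w) (2 * m - 1)"
 let ?D = "\<gamma> N / \<tau> N * (1 / real N) * (K * T)"
 define g where "g = \<gamma> N ^ m / real N"
 have g: "0 < g" using scale_pos by (simp add: g_def)
 have T': "0 \<le> T / \<tau> N" using T scale_pos by simp
 have e': "0 < e / g" using e g by simp
 obtain E where E: "E \<in> sets (M N)"
  "(e / g)^2 * measure (M N) E \<le> 2 * (real m)^2 * (\<integral>w. (?C w) \<partial>M N)"
  "\<And>w t. w \<in> space (M N) - E \<Longrightarrow> t \<in> {0..T / \<tau> N} \<Longrightarrow> \<bar>power_sum N (\<lambda>i. lam N i t w) m - power_sum N (\<lambda>i. lam N i 0 w) m -
    (LINT r:{0<..t}|lborel. power_sum_drift N a b (2 * c / real N) m (\<lambda>i. lam N i r w))\<bar> \<le> e / g"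
  using jacobi_power_sum_estimates(2)[OF process[OF N] N \<beta>_pos[OF N] m T' e'] by blast
 have nz: "\<bar>noise m N t w\<bar> \<le> e" if w: "w \<in> space (M N) - E" and t: "t \<in> {0..T}" for w t
 proof -
  have "t / \<tau> N \<in> {0..T / \<tau> N}" using t scale_pos by (auto intro: divide_right_mono)
  from E(3)[OF w this] have "g * \<bar>power_sum N (\<lambda>i. lam N i (t / \<tau> N) w) m - power_sum N (\<lambda>i. lam N i 0 w) m -
    (?B t w)\<bar> \<le> g * (e / g)"
   using g by (intro mult_left_mono) auto
  moreover have "noise m N t w = g * (power_sum N (\<lambda>i. lam N i (t / \<tau> N) w) m - power_sum N (\<lambda>i. lam N i 0 w) m -
    (?B t w))"
   unfolding noise_def rescaled_drift_integral[OF m, symmetric] S_def empirical_moment_power_sum g_def by (simp add: right_diff_distrib)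
  ultimately show ?thesis using g by (simp add: abs_mult)
 qed
 let ?I = "\<integral>w. (?C w) \<partial>M N"
 have I: "g * g * ?I = \<gamma> N / \<tau> N * (1 / real N) * ?A"
 proof -
  obtain q where q: "m = Suc q" using m by (cases m) auto
  \<comment> \<open>The count of powers: \<open>\<gamma> ^ (2 m)\<close> equals
    \<open>\<gamma>\<close> times \<open>\<gamma> ^ (2 m - 1)\<close>, the latter belonging to the
    normalization of the moment of order \<open>2m - 1\<close>.\<close>
  have k: "g * g * (1 / \<tau> N) = \<gamma> N / \<tau> N * (1 / real N) * (\<gamma> N ^ (2 * m - 1) / real N)"
   unfolding g_def q using scale_pos by (simp add: power_add[symmetric] mult_2[symmetric] field_simps)
  have "g * g * ?I = g * g * (1 / \<tau> N) * (\<integral>w. (LINT r:{0<..T}|lborel. power_sum N (\<lambda>i. lam N i (r / \<tau> N) w) (2 * m - 1)) \<partial>M N)"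
   unfolding set_integral_rescale[OF scale_pos(2)] by simp
  also have "\<dots> = \<gamma> N / \<tau> N * (1 / real N) * ?A"
   unfolding k S_def empirical_moment_power_sum set_integral_mult_right integral_mult_right_zero by (simp only: mult.assoc)
  finally show ?thesis .
 qed
 have "e^2 * measure (M N) E = g * g * ((e / g)^2 * measure (M N) E)" using g by (simp add: power2_eq_square)
 also have "\<dots> \<le> g * g * (2 * (real m)^2 * ?I)" using E(2) g by (intro mult_left_mono) auto
 also have "\<dots> = 2 * (real m)^2 * (g * g * ?I)" by (simp only: mult_ac)
 also have "\<dots> = 2 * (real m)^2 * (\<gamma> N / \<tau> N * (1 / real N) * ?A)"
  unfolding I ..
 also have "\<dots> \<le> 2 * (real m)^2 * ?D"
  using scale_pos by (intro mult_left_mono S_time_integral(2)[OF T K]) auto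
 finally have "measure (M N) E \<le> 2 * (real m)^2 * ?D / e^2"
  using e by (subst pos_le_divide_eq) (simp_all only: mult.commute zero_less_power)
 also have "\<dots> = 2 * (real m)^2 * (\<gamma> N / \<tau> N) * (K * T) / e^2 * (1 / real N)" by (simp add: mult_ac)
 finally show ?thesis using E(1) nz by blast
qed

end

text \<open>Induction on the order. In the mean the martingale is absent and the small drift only
  helps, so the growth of a moment is bounded by the time integral of the previous one; no Gronwall
  argument is needed.\<close>

lemma moment_bound:
 assumes T: "0 \<le> T"
 shows "\<exists>K\<ge>0. \<forall>\<^sub>F N in sequentially. \<forall>t\<in>{0..T}. (\<integral>w. S m N t w \<partial>M N) \<le> K"
proof (induction m)
 case 0
 have "\<forall>\<^sub>F N in sequentially. \<forall>t\<in>{0..T}. (\<integral>w. S 0 N t w \<partial>M N) \<le> 1"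
  using eventually_ge_1
 proof eventually_elim
  case (elim N)
  interpret prob_space "M N" by (rule prob[OF elim])
  show ?case using S_0[OF elim] by (simp add: prob_space)
 qed
 then show ?case by (intro exI[of _ 1]) auto
next
 case (Suc m)
 then obtain K where K: "0 \<le> K" "\<forall>\<^sub>F N in sequentially. \<forall>t\<in>{0..T}. (\<integral>w. S m N t w \<partial>M N) \<le> K" by blast
 define C where "C = real (Suc m) * (real (Suc m) + a) + c * real (Suc m) * real (Suc m)"
 have C: "0 \<le> C" using a_gt c_pos by (auto simp: C_def)
 have "\<forall>\<^sub>F N in sequentially. \<gamma> N / \<tau> N < \<sigma> + 1" by (rule order_tendstoD(2)[OF \<gamma>\<tau>_lim]) simp
 moreover have "\<forall>\<^sub>F N in sequentially. empirical_moment (Suc m) N (\<lambda>i. \<gamma> N * x0 N i) < an (Suc m) + 1"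
  by (rule order_tendstoD(2)[OF init_lim]) simp
 ultimately have "\<forall>\<^sub>F N in sequentially. \<forall>t\<in>{0..T}. (\<integral>w. S (Suc m) N t w \<partial>M N) \<le> \<bar>an (Suc m)\<bar> + 1 + (\<sigma> + 1) * C * (K * T)"
  using K(2) eventually_ge_1
 proof (eventually_elim, intro ballI)
  fix N t assume gt: "\<gamma> N / \<tau> N < \<sigma> + 1" and ini: "empirical_moment (Suc m) N (\<lambda>i. \<gamma> N * x0 N i) < an (Suc m) + 1"
   and KN: "\<forall>t\<in>{0..T}. (\<integral>w. S m N t w \<partial>M N) \<le> K" and N: "1 \<le> N" and t: "t \<in> {0..T}"
  have t0: "0 \<le> t" using t by simp
  interpret prob_space "M N" by (rule prob[OF N])
  note Sint = S_time_integral[OF N t0, of m K]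
  have Ki: "\<And>r. r \<in> {0..t} \<Longrightarrow> (\<integral>w. S m N r w \<partial>M N) \<le> K" using KN t by auto
  have "(\<integral>w. (LINT r:{0<..t}|lborel. drift (Suc m) N r w) \<partial>M N) \<le> (\<integral>w. (\<gamma> N / \<tau> N * C) * (LINT r:{0<..t}|lborel. S m N r w) \<partial>M N)"
  proof (rule integral_mono_AE')
   show "integrable (M N) (\<lambda>w. \<gamma> N / \<tau> N * C * (LINT r:{0<..t}|lborel. S m N r w))"
    by (intro integrable_mult_right Sint(1) Ki)
   show "AE w in M N. (LINT r:{0<..t}|lborel. drift (Suc m) N r w) \<le> \<gamma> N / \<tau> N * C * (LINT r:{0<..t}|lborel. S m N r w)"
   proof (rule AE_I2)
    fix w assume w: "w \<in> space (M N)"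
    have "(LINT r:{0<..t}|lborel. drift (Suc m) N r w) \<le> (LINT r:{0<..t}|lborel. \<gamma> N / \<tau> N * C * S m N r w)"
    proof (rule set_integral_mono)
     show "set_integrable lborel {0<..t} (\<lambda>r. drift (Suc m) N r w)"
      unfolding drift_def by (rule Ioc_integrable[OF N]) (intro continuous_intros main_drift_cont[OF N] small_drift_cont[OF N] w)
     show "set_integrable lborel {0<..t} (\<lambda>r. \<gamma> N / \<tau> N * C * S m N r w)"
      by (rule Ioc_integrable[OF N]) (intro continuous_on_mult continuous_on_const S_cont[OF N] w)
     fix r assume "r \<in> {0<..t}"
     then have r: "0 \<le> r" by simp
     have "drift (Suc m) N r w \<le> \<gamma> N / \<tau> N * main_drift (Suc m) N r w"
      unfolding drift_def using small_drift_bounds(1)[OF N w r, of "Suc m"] by simp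
     also have "\<dots> \<le> \<gamma> N / \<tau> N * (C * S m N r w)"
      using main_drift_le[OF N w r, of "Suc m"] scale_pos[OF N] by (intro mult_left_mono) (auto simp: C_def)
     finally show "drift (Suc m) N r w \<le> \<gamma> N / \<tau> N * C * S m N r w" by (simp only: mult.assoc)
    qed
    then show "(LINT r:{0<..t}|lborel. drift (Suc m) N r w) \<le> \<gamma> N / \<tau> N * C * (LINT r:{0<..t}|lborel. S m N r w)"
     unfolding set_integral_mult_right .
   qed
   show "AE w in M N. 0 \<le> \<gamma> N / \<tau> N * C * (LINT r:{0<..t}|lborel. S m N r w)"
   proof (rule AE_I2)
    fix w assume w: "w \<in> space (M N)"
    have "0 \<le> (LINT r:{0<..t}|lborel. S m N r w)"
     unfolding set_lebesgue_integral_def using S_nonneg[OF N w] by (intro lint_nonneg) (auto simp: indicator_def)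
    then show "0 \<le> \<gamma> N / \<tau> N * C * (LINT r:{0<..t}|lborel. S m N r w)" using scale_pos[OF N] C by simp
   qed
  qed
  also have "\<dots> = \<gamma> N / \<tau> N * C * (\<integral>w. (LINT r:{0<..t}|lborel. S m N r w) \<partial>M N)" by simp
  also have "\<dots> \<le> \<gamma> N / \<tau> N * C * (K * t)"
   using scale_pos[OF N] C Sint(2) Ki by (intro mult_left_mono) auto
  also have "\<dots> \<le> (\<sigma> + 1) * C * (K * T)"
   using gt scale_pos[OF N] C K(1) t \<sigma>_pos by (intro mult_mono) auto
  finally show "(\<integral>w. S (Suc m) N t w \<partial>M N) \<le> \<bar>an (Suc m)\<bar> + 1 + (\<sigma> + 1) * C * (K * T)"
   using S_expectation[OF N _ t0, of "Suc m"] ini by simp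
 qed
 then show ?case using C K(1) \<sigma>_pos T by (intro exI[of _ "\<bar>an (Suc m)\<bar> + 1 + (\<sigma> + 1) * C * (K * T)"]) auto
qed

lemma noise_usmall:
 assumes m: "1 \<le> m" and T: "0 \<le> T"
 shows "usmall M T (noise m)"
 unfolding usmall_def
proof (intro allI impI)
 let ?A = "\<lambda>K e N. 2 * (real m)^2 * (\<gamma> N / \<tau> N) * (K * T) / (e / 2)^2 * (1 / real N)"
 let ?B = "\<lambda>e N w. \<forall>t\<in>{0..T}. \<bar>noise m N t w\<bar> < e"
 fix e :: real assume "0 < e"
 then have e: "0 < e / 2" by simp
 obtain K where K: "0 \<le> K" "\<forall>\<^sub>F N in sequentially. \<forall>t\<in>{0..T}. (\<integral>w. S (2 * m - 1) N t w \<partial>M N) \<le> K"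
  using moment_bound[OF T] by blast
 define P where "P N E \<longleftrightarrow> E \<in> sets (M N) \<and> measure (M N) E \<le> 2 * (real m)^2 * (\<gamma> N / \<tau> N) * (K * T) / (e / 2)^2 * (1 / real N) \<and>
   (\<forall>w\<in>space (M N) - E. \<forall>t\<in>{0..T}. \<bar>noise m N t w\<bar> \<le> e / 2)" for N E
 \<comment> \<open>An exceptional event is chosen wherever the estimate provides one, which is the
   case for all large \<open>N\<close>; for the other \<open>N\<close> the choice is
   arbitrary.\<close>
 define E where "E N = (SOME E. P N E)" for N
 have ev: "\<forall>\<^sub>F N in sequentially. P N (E N)"
  using K(2) eventually_ge_1
 proof eventually_elim
  case (elim N)
  have "\<exists>E. P N E" unfolding P_def using noise_small[OF elim(2) m T e, of K] elim(1) by blast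
  then show ?case unfolding E_def by (rule someI_ex)
 qed
 have "off M E (?B e)"
  using ev
 proof eventually_elim
  case (elim N)
  have "e / 2 < e" using e by simp
  then show ?case using elim unfolding P_def by (blast intro: le_less_trans)
 qed
 moreover have "(\<lambda>N. measure (M N) (E N)) \<longlonglongrightarrow> 0"
 proof (rule tendsto_sandwich[of "\<lambda>_. 0"])
  show "\<forall>\<^sub>F N in sequentially. measure (M N) (E N) \<le> 2 * (real m)^2 * (\<gamma> N / \<tau> N) * (K * T) / (e / 2)^2 * (1 / real N)"
   using ev by eventually_elim (simp add: P_def)
  have "(?A K e) \<longlonglongrightarrow> 2 * (real m)^2 * \<sigma> * (K * T) / (e / 2)^2 * 0"
   by (intro tendsto_mult tendsto_divide tendsto_const \<gamma>\<tau>_lim lim_1_over_n) (use e in auto)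
  then show "(?A K e) \<longlonglongrightarrow> 0" by simp
 qed auto
 ultimately show "\<exists>E. (off M E (?B e)) \<and> (\<lambda>N. measure (M N) (E N)) \<longlonglongrightarrow> 0"
  by blast
qed

text \<open>As the small drift is nonnegative, its integral up to any time is at most that up to
  \<open>T\<close>, hence at most one variable \<open>Y\<close> whose mean is of order
  \<open>1 / N + 1 / \<tau>\<close>.\<close>

lemma small_drift_usmall:
 assumes m: "1 \<le> m" and T: "0 \<le> T"
 shows "usmall M T (\<lambda>N t w. LINT r:{0<..t}|lborel. small_drift m N r w)"
proof -
 let ?A = "\<lambda>m N. \<integral>w. (LINT r:{0<..T}|lborel. S (m - 1) N r w) \<partial>M N"
 let ?B = "\<lambda>m N. \<integral>w. (LINT r:{0<..T}|lborel. S m N r w) \<partial>M N"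
 let ?C = "\<lambda>Y N. \<integral>w. Y N w \<partial>M N"
 obtain K1 where K1: "0 \<le> K1" "\<forall>\<^sub>F N in sequentially. \<forall>t\<in>{0..T}. (\<integral>w. S (m - 1) N t w \<partial>M N) \<le> K1"
  using moment_bound[OF T] by blast
 obtain K2 where K2: "0 \<le> K2" "\<forall>\<^sub>F N in sequentially. \<forall>t\<in>{0..T}. (\<integral>w. S m N t w \<partial>M N) \<le> K2"
  using moment_bound[OF T] by blast
 define C where "C = real m * (a + b + 2) + real m * (real m - 1) + c * real m * real (Suc m)"
 have C: "0 \<le> C" using a_gt b_gt c_pos m by (auto simp: C_def)
 define u where "u N = \<gamma> N / \<tau> N * (c * real m * (real m / real N))" for N
 define Y where "Y N w = u N * (LINT r:{0<..T}|lborel. S (m - 1) N r w) + 1 / \<tau> N * C * (LINT r:{0<..T}|lborel. S m N r w)" for N w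
 have u: "0 \<le> u N" if "1 \<le> N" for N using scale_pos[OF that] c_pos by (simp add: u_def)
 have I0: "0 \<le> (LINT r:{0<..T}|lborel. S k N r w)" if "1 \<le> N" "w \<in> space (M N)" for k N w
  unfolding set_lebesgue_integral_def using S_nonneg[OF that] by (intro lint_nonneg) (auto simp: indicator_def)
 show ?thesis
 proof (rule usmall_Markov[OF prob_eventually])
  show "\<forall>\<^sub>F N in sequentially. integrable (M N) (Y N) \<and> (\<forall>w\<in>space (M N). \<forall>t\<in>{0..T}. \<bar>LINT r:{0<..t}|lborel. small_drift m N r w\<bar> \<le> Y N w) \<and> (\<forall>w\<in>space (M N). 0 \<le> Y N w)"
   using K1(2) K2(2) eventually_ge_1
  proof eventually_elim
   case (elim N)
   note N = elim(3)
   have "integrable (M N) (Y N)" unfolding Y_def[abs_def]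
    using elim by (intro lint_integrable_add integrable_mult_right S_time_integral(1)[OF N T, of _ K1] S_time_integral(1)[OF N T, of _ K2]) auto
   moreover have "0 \<le> Y N w" if "w \<in> space (M N)" for w
    unfolding Y_def using I0[OF N that] u[OF N] C scale_pos[OF N] by simp
   moreover have "\<bar>LINT r:{0<..t}|lborel. small_drift m N r w\<bar> \<le> Y N w" if w: "w \<in> space (M N)" and t: "t \<in> {0..T}" for w t
   proof -
    have si: "set_integrable lborel {0<..s} (\<lambda>r. small_drift m N r w)" for s by (rule Ioc_integrable[OF N small_drift_cont[OF N w]])
    have "\<bar>LINT r:{0<..t}|lborel. small_drift m N r w\<bar> \<le> (LINT r:{0<..t}|lborel. \<bar>small_drift m N r w\<bar>)" by (rule set_integral_abs_le[OF si])
    also have "\<dots> \<le> (LINT r:{0<..T}|lborel. \<bar>small_drift m N r w\<bar>)"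
     by (rule set_integral_mono_set[OF set_integrable_abs_real[OF si]]) (use t in auto)
    also have "\<dots> \<le> (LINT r:{0<..T}|lborel. u N * S (m - 1) N r w + 1 / \<tau> N * C * S m N r w)"
    proof (rule set_integral_mono[OF set_integrable_abs_real[OF si]])
     show "set_integrable lborel {0<..T} (\<lambda>r. u N * S (m - 1) N r w + 1 / \<tau> N * C * S m N r w)"
      by (rule Ioc_integrable[OF N]) (intro continuous_on_add continuous_on_mult continuous_on_const S_cont[OF N] w)
     show "\<bar>small_drift m N r w\<bar> \<le> u N * S (m - 1) N r w + 1 / \<tau> N * C * S m N r w" if "r \<in> {0<..T}" for r
      using small_drift_bounds[OF N w _ m, of r] that unfolding u_def C_def by simp
    qed
    also have "\<dots> = Y N w"
     unfolding Y_def set_integral_mult_right[symmetric]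
     by (intro set_integral_add(2) set_integrable_mult_right Ioc_integrable[OF N] S_cont[OF N] w)
    finally show ?thesis .
   qed
   ultimately show ?case by blast
  qed
  show "(\<lambda>N. \<integral>w. Y N w \<partial>M N) \<longlonglongrightarrow> 0"
  proof (rule tendsto_sandwich[of "\<lambda>_. 0" _ _ "\<lambda>N. u N * (K1 * T) + 1 / \<tau> N * C * (K2 * T)"])
   show "\<forall>\<^sub>F N in sequentially. (?C Y N) \<le> u N * (K1 * T) + 1 / \<tau> N * C * (K2 * T)"
    using K1(2) K2(2) eventually_ge_1
   proof eventually_elim
    case (elim N)
    note N = elim(3)
    have b1: "integrable (M N) (\<lambda>w. LINT r:{0<..T}|lborel. S (m - 1) N r w)" "(?A m N) \<le> K1 * T"
     using elim(1) by (auto intro: S_time_integral[OF N T])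
    have b2: "integrable (M N) (\<lambda>w. LINT r:{0<..T}|lborel. S m N r w)" "(?B m N) \<le> K2 * T"
     using elim(2) by (auto intro: S_time_integral[OF N T])
    have "(?C Y N) = u N * (?A m N) + 1 / \<tau> N * C * (?B m N)"
     unfolding Y_def lint_add[OF integrable_mult_right[OF b1(1)] integrable_mult_right[OF b2(1)]] integral_mult_right_zero ..
    also have "\<dots> \<le> u N * (K1 * T) + 1 / \<tau> N * C * (K2 * T)"
     using u[OF N] C scale_pos[OF N] by (intro add_mono mult_left_mono b1 b2) auto
    finally show ?case .
   qed
   show "\<forall>\<^sub>F N in sequentially. 0 \<le> (?C Y N)"
    using eventually_ge_1
   proof eventually_elim
    case (elim N)
    have "0 \<le> Y N w" if "w \<in> space (M N)" for w
     unfolding Y_def by (intro add_nonneg_nonneg mult_nonneg_nonneg I0 u elim that C) (use scale_pos[OF elim] in simp)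
    then show ?case by (rule lint_nonneg)
   qed
   have t0: "(\<lambda>N. 1 / \<tau> N) \<longlonglongrightarrow> 0" using tendsto_divide_0[OF tendsto_const filterlim_at_top_imp_at_infinity[OF \<tau>_lim], of 1] .
   have "(\<lambda>N. \<gamma> N / \<tau> N * (c * real m * (real m * (1 / real N))) * (K1 * T) + 1 / \<tau> N * C * (K2 * T)) \<longlonglongrightarrow> \<sigma> * (c * real m * (real m * 0)) * (K1 * T) + 0 * C * (K2 * T)"
    by (intro tendsto_intros \<gamma>\<tau>_lim t0 lim_1_over_n)
   then show "(\<lambda>N. u N * (K1 * T) + 1 / \<tau> N * C * (K2 * T)) \<longlonglongrightarrow> 0" by (simp add: u_def)
  qed auto
 qed
qed

abbreviation lm :: "nat \<Rightarrow> real \<Rightarrow> real" where "lm \<equiv> limit_moment \<sigma> c (a + 1) an"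

lemma lm_cont: "continuous_on {0..T} (lm n)"
 by (rule continuous_on_subset[OF limit_moment_continuous]) auto

text \<open>The main drift contains only moments of order below \<open>n\<close>. Uniform
  convergence in probability is preserved by sums, products with continuous limits and time
  integrals, so strong induction applies.\<close>

theorem S_ucp:
 assumes T: "0 < T"
 shows "ucp M T (S n) (lm n)"
proof (induction n rule: less_induct)
 case (less n)
 show ?case
 proof (cases "n = 0")
  case True
  have "lm 0 = (\<lambda>t. 1)" by (rule ext, subst limit_moment.simps) simp
  \<comment> \<open>The zeroth empirical moment is 1 only for \<open>N \<ge> 1\<close>; for
    \<open>N = 0\<close> it is 0 by the convention on division.\<close>
  moreover have "usmall M T (\<lambda>N t w. S 0 N t w - 1)"
  proof (rule usmall_dominated[OF usmall_deterministic[of "\<lambda>_. 0"]])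
   show "\<exists>\<delta>>0. \<forall>\<^sub>F N in sequentially. \<forall>w\<in>space (M N). (\<forall>t\<in>{0..T}. \<bar>0::real\<bar> < \<delta>) \<longrightarrow> (\<forall>t\<in>{0..T}. \<bar>S 0 N t w - 1\<bar> < e)" if "0 < e" for e :: real
   proof (intro exI[of _ 1] conjI zero_less_one)
    show "\<forall>\<^sub>F N in sequentially. \<forall>w\<in>space (M N). (\<forall>t\<in>{0..T}. \<bar>0::real\<bar> < 1) \<longrightarrow> (\<forall>t\<in>{0..T}. \<bar>S 0 N t w - 1\<bar> < e)"
     using eventually_ge_1 by eventually_elim (use that S_0 in simp)
   qed
  qed simp
  ultimately show ?thesis using True by (simp add: ucp_def)
 next
  case False
  then have n: "1 \<le> n" by simp
  let ?g = "\<lambda>t. real n * (real n + a) * lm (n - 1) t + c * real n * (\<Sum>l<n. lm (n - Suc l) t * lm l t)"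
  let ?R = "\<lambda>N t w. empirical_moment n N (\<lambda>i. \<gamma> N * x0 N i) + \<gamma> N / \<tau> N * (LINT r:{0<..t}|lborel. main_drift n N r w) - (an n + \<sigma> * (LINT r:{0<..t}|lborel. ?g r)) + (noise n N t w - (LINT r:{0<..t}|lborel. small_drift n N r w))"
  have P: "\<forall>\<^sub>F N in sequentially. prob_space (M N)" by (rule prob_eventually)
  have det: "ucp M T (\<lambda>N t w. k) (\<lambda>t. k)" for k :: real by (rule ucp_deterministic) simp
  have "ucp M T (main_drift n) ?g"
   unfolding main_drift_def[abs_def]
   by (intro ucp_add[OF P] ucp_mult[OF P] ucp_sum[OF P] det less.IH continuous_on_const continuous_on_sum continuous_on_mult lm_cont) (use n in auto)
  moreover have gc: "continuous_on {0..T} ?g" by (intro continuous_on_add continuous_on_mult continuous_on_sum continuous_on_const lm_cont)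
  moreover have "\<forall>\<^sub>F N in sequentially. \<forall>w\<in>space (M N). continuous_on {0..T} (\<lambda>t. main_drift n N t w)"
   using eventually_ge_1 by eventually_elim (auto intro: continuous_on_subset[OF main_drift_cont])
  ultimately have I: "ucp M T (\<lambda>N t w. LINT r:{0<..t}|lborel. main_drift n N r w) (\<lambda>t. LINT r:{0<..t}|lborel. ?g r)"
   using ucp_integral T by blast
  have Ic: "continuous_on {0..T} (\<lambda>t. LINT r:{0<..t}|lborel. ?g r)"
  proof -
   have "continuous_on {0..T} (\<lambda>t. integral {0..t} ?g)" by (intro indefinite_integral_continuous_1 integrable_continuous_interval gc)
   moreover have "(LINT r:{0<..t}|lborel. ?g r) = integral {0..t} ?g" if "t \<in> {0..T}" for t
    using that by (intro set_integral_Ioc_eq_integral continuous_on_subset[OF gc]) auto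
   ultimately show ?thesis by (rule continuous_on_eq[OF _ sym])
  qed
  have A: "ucp M T (\<lambda>N t w. empirical_moment n N (\<lambda>i. \<gamma> N * x0 N i) + \<gamma> N / \<tau> N * (LINT r:{0<..t}|lborel. main_drift n N r w))
   (\<lambda>t. an n + \<sigma> * (LINT r:{0<..t}|lborel. ?g r))"
   by (intro ucp_add[OF P] ucp_mult[OF P] I Ic ucp_deterministic init_lim \<gamma>\<tau>_lim continuous_on_const)
  \<comment> \<open>The recursion with its separate integrals collected into a single one, in the
    shape in which the drift converges; \<open>\<alpha> = a + 1\<close> makes its coefficient
    \<open>n + a\<close>.\<close>
  have lm_eq: "lm n t = an n + \<sigma> * (LINT r:{0<..t}|lborel. ?g r)" if t: "t \<in> {0..T}" for t
  proof -
   have c: "continuous_on {0..t} (lm k)" for k by (rule lm_cont)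
   have i: "lm k integrable_on {0..t}" "(\<lambda>u. lm k u * lm l u) integrable_on {0..t}" for k l
    by (intro integrable_continuous_interval continuous_on_mult c)+
   have "(LINT r:{0<..t}|lborel. ?g r) = integral {0..t} ?g"
    using t by (intro set_integral_Ioc_eq_integral continuous_on_subset[OF gc]) auto
   also have "\<dots> = real n * (real n + a) * integral {0..t} (lm (n - 1)) + c * real n * (\<Sum>l<n. integral {0..t} (\<lambda>u. lm (n - Suc l) u * lm l u))"
   proof -
    have "integral {0..t} (\<lambda>u. \<Sum>l<n. lm (n - Suc l) u * lm l u) = (\<Sum>l<n. integral {0..t} (\<lambda>u. lm (n - Suc l) u * lm l u))"
     by (rule Henstock_Kurzweil_Integration.integral_sum[OF finite_lessThan]) (rule i(2))
    moreover have "integral {0..t} ?g = integral {0..t} (\<lambda>u. real n * (real n + a) * lm (n - 1) u) + integral {0..t} (\<lambda>u. c * real n * (\<Sum>l<n. lm (n - Suc l) u * lm l u))"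
     by (rule Henstock_Kurzweil_Integration.integral_add; intro integrable_continuous_interval continuous_on_mult continuous_on_sum continuous_on_const c)
    ultimately show ?thesis by (simp only: Henstock_Kurzweil_Integration.integral_mult_right)
   qed
   also have "(\<Sum>l<n. integral {0..t} (\<lambda>u. lm (n - Suc l) u * lm l u)) = (\<Sum>j\<in>{0..<n}. integral {0..t} (\<lambda>u. lm j u * lm (n - 1 - j) u))"
    by (intro sum.cong) (auto simp: mult.commute)
   finally show ?thesis by (subst limit_moment.simps) (simp add: False algebra_simps sum_distrib_left)
  qed
  have "usmall M T (\<lambda>N t w. (LINT r:{0<..t}|lborel. small_drift n N r w))" "usmall M T (noise n)"
   using small_drift_usmall[OF n] noise_usmall[OF n] T by auto
  then have rest: "usmall M T (\<lambda>N t w. noise n N t w - (LINT r:{0<..t}|lborel. small_drift n N r w))"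
   using usmall_add[OF P, of T "noise n" "\<lambda>N t w. - (LINT r:{0<..t}|lborel. small_drift n N r w)"] by (simp add: usmall_def)
  show ?thesis unfolding ucp_def
  proof (rule usmall_dominated[OF usmall_add[OF P A[unfolded ucp_def] rest]])
   fix e :: real assume e: "0 < e"
   show "\<exists>\<delta>>0. \<forall>\<^sub>F N in sequentially. \<forall>w\<in>space (M N). (\<forall>t\<in>{0..T}. \<bar>?R N t w\<bar> < \<delta>) \<longrightarrow> (\<forall>t\<in>{0..T}. \<bar>S n N t w - lm n t\<bar> < e)"
   proof (intro exI[of _ e] conjI e)
    show "\<forall>\<^sub>F N in sequentially. \<forall>w\<in>space (M N). (\<forall>t\<in>{0..T}. \<bar>?R N t w\<bar> < e) \<longrightarrow> (\<forall>t\<in>{0..T}. \<bar>S n N t w - lm n t\<bar> < e)"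
     using eventually_ge_1
    proof (eventually_elim, intro ballI impI)
     fix N w t assume N: "1 \<le> N" and w: "w \<in> space (M N)" and t: "t \<in> {0..T}"
      and h: "\<forall>t\<in>{0..T}. \<bar>?R N t w\<bar> < e"
     have "(LINT r:{0<..t}|lborel. drift n N r w) = \<gamma> N / \<tau> N * (LINT r:{0<..t}|lborel. main_drift n N r w) - (LINT r:{0<..t}|lborel. small_drift n N r w)"
      unfolding drift_def set_integral_mult_right[symmetric]
      by (intro set_integral_diff(2) set_integrable_mult_right Ioc_integrable[OF N] main_drift_cont[OF N] small_drift_cont[OF N] w)
     then have e: "S n N t w - lm n t = ?R N t w"
      unfolding noise_def lm_eq[OF t] S_init[OF N w, symmetric] by linarith
     show "\<bar>S n N t w - lm n t\<bar> < e" unfolding e using h t by blast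
    qed
   qed
  qed
 qed
qed

theorem S_tendsto_in_prob_C:
 assumes T: "0 < T"
 shows "tendsto_in_prob_C M T (S n) (lm n)"
 unfolding tendsto_in_prob_C_def
proof (intro conjI)
 show reg: "\<forall>\<^sub>F N in sequentially. (\<forall>t\<in>{0..T}. S n N t \<in> borel_measurable (M N)) \<and> (\<forall>w\<in>space (M N). continuous_on {0..T} (\<lambda>t. S n N t w))"
  using eventually_ge_1 by eventually_elim (auto intro: S_measurable continuous_on_subset[OF S_cont])
 show "continuous_on {0..T} (lm n)" by (rule lm_cont)
 show "tendsto_in_prob M (\<lambda>N w. SUP t\<in>{0..T}. \<bar>S n N t w - lm n t\<bar>) 0"
 proof (rule usmall_imp_tendsto_in_prob[OF prob_eventually _ S_ucp[OF T, unfolded ucp_def]])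
  show "\<forall>\<^sub>F N in sequentially. (\<forall>t\<in>{0..T}. (\<lambda>w. S n N t w - lm n t) \<in> borel_measurable (M N)) \<and> (\<forall>w\<in>space (M N). continuous_on {0..T} (\<lambda>t. S n N t w - lm n t))"
   using reg by eventually_elim (auto intro!: continuous_on_diff lm_cont borel_measurable_diff)
 qed (use T in simp)
qed

end

section \<open>Determinacy of the moment problem\<close>

text \<open>Each differentiation of the cosine shifts its phase by a quarter period, so all
  derivatives are bounded by 1.\<close>

lemma cos_taylor_remainder:
 "\<bar>cos (\<phi> + v) - (\<Sum>k<K. cos (\<phi> + real k * (pi / 2)) / fact k * v ^ k)\<bar> \<le> \<bar>v\<bar> ^ K / fact K"
proof -
 have "((\<lambda>v. cos (\<phi> + v + real k * (pi / 2))) has_real_derivative cos (\<phi> + v + real (Suc k) * (pi / 2))) (at v)" for k v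
 proof -
  have "cos (\<phi> + v + real (Suc k) * (pi / 2)) = cos (\<phi> + v + real k * (pi / 2) + pi / 2)" by (simp add: algebra_simps add_divide_distrib)
  also have "\<dots> = - sin (\<phi> + v + real k * (pi / 2))" by (simp add: cos_add[of _ "pi / 2"])
  finally show ?thesis by (auto intro!: derivative_eq_intros)
 qed
 then obtain t where "cos (\<phi> + v) = (\<Sum>k<K. cos (\<phi> + 0 + real k * (pi / 2)) / fact k * v ^ k) + cos (\<phi> + t + real K * (pi / 2)) / fact K * v ^ K"
  using Maclaurin_all_le[of "\<lambda>k v. cos (\<phi> + v + real k * (pi / 2))" "\<lambda>v. cos (\<phi> + v)" v K] by auto
 then have "\<bar>cos (\<phi> + v) - (\<Sum>k<K. cos (\<phi> + real k * (pi / 2)) / fact k * v ^ k)\<bar> = \<bar>cos (\<phi> + t + real K * (pi / 2))\<bar> * (\<bar>v\<bar> ^ K / fact K)"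
  by (simp add: abs_mult power_abs)
 also have "\<dots> \<le> 1 * (\<bar>v\<bar> ^ K / fact K)" by (intro mult_right_mono) auto
 finally show ?thesis by simp
qed

text \<open>For \<open>x \<ge> 0\<close> the power of the root is at most 1 or at most
  \<open>x ^ n\<close>, according to whether \<open>x \<le> 1\<close>.\<close>

lemma sqrt_power_integrable:
 assumes "nonneg_distribution_with_moments \<mu> m"
 shows "f \<in> borel_measurable borel \<Longrightarrow> integrable \<mu> (\<lambda>x. sqrt x ^ n * cos (f x))"
  and "integrable \<mu> (\<lambda>x. sqrt x ^ n)"
proof -
 interpret real_distribution \<mu> using assms by (simp add: nonneg_distribution_with_moments_def)
 have p: "AE x in \<mu>. 0 \<le> x" and mi: "integrable \<mu> (\<lambda>x. x ^ n)" using assms by (auto simp: nonneg_distribution_with_moments_def)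
 have le: "sqrt x ^ n \<le> 1 + x ^ n" if "0 \<le> x" for x
 proof (cases "x \<le> 1")
  case True
  then have "sqrt x ^ n \<le> 1" using that by (intro power_le_one) auto
  then show ?thesis using that by (simp add: add_increasing2)
 next
  case False
  then have "sqrt x ^ n \<le> x ^ n" using that by (intro power_mono real_le_lsqrt) (auto simp: power2_eq_square)
  then show ?thesis by simp
 qed
 show i: "integrable \<mu> (\<lambda>x. sqrt x ^ n)"
 proof (rule integrable_dominated)
  show "integrable \<mu> (\<lambda>x. 1 + x ^ n)" using mi by simp
  show "AE x in \<mu>. norm (sqrt x ^ n) \<le> norm (1 + x ^ n)" using p by eventually_elim (simp add: le)
 qed measurable
 show "integrable \<mu> (\<lambda>x. sqrt x ^ n * cos (f x))" if [measurable]: "f \<in> borel_measurable borel"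
 proof (rule integrable_dominated[OF i])
  show "AE x in \<mu>. norm (sqrt x ^ n * cos (f x)) \<le> norm (sqrt x ^ n)"
   by (auto simp: abs_mult intro!: mult_left_le)
 qed measurable
qed

text \<open>The \<open>n\<close>-th derivative of the cosine transform of the law of
  \<open>sqrt x\<close>, each derivative again appearing as a phase shift by a quarter
  period.\<close>

definition cos_moment :: "real measure \<Rightarrow> nat \<Rightarrow> real \<Rightarrow> real" where
 "cos_moment \<mu> n \<theta> = (\<integral>x. sqrt x ^ n * cos (\<theta> * sqrt x + real n * (pi / 2)) \<partial>\<mu>)"

lemma cos_moment_taylor:
 assumes \<mu>: "nonneg_distribution_with_moments \<mu> m"
 shows "\<bar>cos_moment \<mu> n (\<theta> + h) - (\<Sum>k<K. h ^ k / fact k * cos_moment \<mu> (n + k) \<theta>)\<bar> \<le> \<bar>h\<bar> ^ K / fact K * (\<integral>x. sqrt x ^ (n + K) \<partial>\<mu>)"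
proof -
 interpret real_distribution \<mu> using \<mu> by (simp add: nonneg_distribution_with_moments_def)
 have p: "AE x in \<mu>. 0 \<le> x" using \<mu> by (auto simp: nonneg_distribution_with_moments_def)
 let ?g = "\<lambda>n \<theta> x. sqrt x ^ n * cos (\<theta> * sqrt x + real n * (pi / 2))"
 have i: "integrable \<mu> (?g n \<theta>)" for n \<theta> by (rule sqrt_power_integrable(1)[OF \<mu>]) measurable
 have si: "integrable \<mu> (\<lambda>x. \<Sum>k<K. h ^ k / fact k * ?g (n + k) \<theta> x)" by (intro lint_integrable_sum integrable_mult_right i)
 have e: "cos_moment \<mu> n (\<theta> + h) - (\<Sum>k<K. h ^ k / fact k * cos_moment \<mu> (n + k) \<theta>) =
   (\<integral>x. ?g n (\<theta> + h) x - (\<Sum>k<K. h ^ k / fact k * ?g (n + k) \<theta> x) \<partial>\<mu>)"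
  unfolding cos_moment_def by (subst lint_diff[OF i si], subst lint_sum, intro integrable_mult_right i, simp)
 have "\<bar>\<integral>x. ?g n (\<theta> + h) x - (\<Sum>k<K. h ^ k / fact k * ?g (n + k) \<theta> x) \<partial>\<mu>\<bar> \<le> (\<integral>x. \<bar>h\<bar> ^ K / fact K * sqrt x ^ (n + K) \<partial>\<mu>)"
 proof (rule order_trans[OF integral_abs_bound], rule integral_mono_AE)
  show "integrable \<mu> (\<lambda>x. \<bar>?g n (\<theta> + h) x - (\<Sum>k<K. h ^ k / fact k * ?g (n + k) \<theta> x)\<bar>)"
   by (intro integrable_abs lint_integrable_diff i si)
  show "integrable \<mu> (\<lambda>x. \<bar>h\<bar> ^ K / fact K * sqrt x ^ (n + K))" by (intro integrable_mult_right sqrt_power_integrable(2)[OF \<mu>])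
  show "AE x in \<mu>. \<bar>?g n (\<theta> + h) x - (\<Sum>k<K. h ^ k / fact k * ?g (n + k) \<theta> x)\<bar> \<le> \<bar>h\<bar> ^ K / fact K * sqrt x ^ (n + K)"
   using p
  proof eventually_elim
   case (elim x)
   define y where "y = sqrt x"
   have y: "0 \<le> y" using elim by (simp add: y_def)
   let ?\<phi> = "\<theta> * y + real n * (pi / 2)"
   have e: "?g n (\<theta> + h) x - (\<Sum>k<K. h ^ k / fact k * ?g (n + k) \<theta> x) =
    y ^ n * (cos (?\<phi> + h * y) - (\<Sum>k<K. cos (?\<phi> + real k * (pi / 2)) / fact k * (h * y) ^ k))"
    unfolding y_def[symmetric] right_diff_distrib sum_distrib_left
    by (intro arg_cong2[of _ _ _ _ "(-)"] sum.cong refl) (simp_all add: algebra_simps add_divide_distrib power_add power_mult_distrib)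
   have "\<bar>y ^ n * (cos (?\<phi> + h * y) - (\<Sum>k<K. cos (?\<phi> + real k * (pi / 2)) / fact k * (h * y) ^ k))\<bar> \<le> y ^ n * (\<bar>h * y\<bar> ^ K / fact K)"
    unfolding abs_mult[of "y ^ n"] using y by (intro mult_mono cos_taylor_remainder) auto
   also have "\<dots> = \<bar>h\<bar> ^ K / fact K * sqrt x ^ (n + K)"
    unfolding y_def[symmetric] using y by (simp add: abs_mult power_mult_distrib power_add)
   finally show ?case unfolding e .
  qed
 qed
 then show ?thesis unfolding e by simp
qed

lemma sqrt_power_even_moment:
 assumes \<mu>: "nonneg_distribution_with_moments \<mu> m"
 shows "(\<integral>x. sqrt x ^ (2 * n) \<partial>\<mu>) = m n"
proof -
 let ?A = "\<integral>x. x ^ n \<partial>\<mu>"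
 have p: "AE x in \<mu>. 0 \<le> x" and e: "?A = m n" and "real_distribution \<mu>" using \<mu> by (auto simp: nonneg_distribution_with_moments_def)
 interpret real_distribution \<mu> by fact
 have "(\<integral>x. sqrt x ^ (2 * n) \<partial>\<mu>) = ?A"
  by (rule integral_cong_AE; (measurable)?) (use p in eventually_elim, simp add: power_mult)
 then show ?thesis using e by simp
qed

text \<open>One step of analytic continuation: two transforms whose derivatives all agree at
  \<open>\<theta>\<close> have the same Taylor polynomials, and by the growth bound the remainders
  tend to 0 geometrically for small \<open>h\<close>. The admissible \<open>h\<close> depends only
  on \<open>L\<close>, neither on \<open>\<theta>\<close> nor on \<open>n\<close>, so the step can
  be iterated.\<close>

lemma cos_moment_eq_step:
 assumes \<mu>: "nonneg_distribution_with_moments \<mu> m" and \<nu>: "nonneg_distribution_with_moments \<nu> m"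
  and bound: "\<And>n. m n \<le> L ^ n * fact (2 * n)" and h: "4 * h^2 * L < 1" and L: "0 < L"
  and eq: "\<And>n. cos_moment \<mu> n \<theta> = cos_moment \<nu> n \<theta>"
 shows "cos_moment \<mu> n (\<theta> + h) = cos_moment \<nu> n (\<theta> + h)"
proof -
 let ?A = "\<lambda>K n. \<Sum>k<K. h ^ k / fact k * cos_moment \<mu> (n + k) \<theta>"
 let ?D = "\<bar>cos_moment \<mu> n (\<theta> + h) - cos_moment \<nu> n (\<theta> + h)\<bar>"
 define q where "q = 4 * h^2 * L"
 define C where "C = 2 * (\<bar>h\<bar> ^ n * (L ^ n * (fact n * 4 ^ n)))"
 have "?D \<le> C * q ^ i" for i
 proof -
  \<comment> \<open>This order makes \<open>n + K\<close> even, so that the remainder involves an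
    ordinary moment of the measure, of order \<open>n + i\<close>.\<close>
  define K where "K = n + 2 * i"
  have nK: "n + K = 2 * (n + i)" by (simp add: K_def)
  have T: "\<bar>cos_moment \<mu> n (\<theta> + h) - (?A K n)\<bar> \<le> \<bar>h\<bar> ^ K / fact K * m (n + i)"
   "\<bar>cos_moment \<nu> n (\<theta> + h) - (?A K n)\<bar> \<le> \<bar>h\<bar> ^ K / fact K * m (n + i)"
   using cos_moment_taylor[OF \<mu>, of n \<theta> h K] cos_moment_taylor[OF \<nu>, of n \<theta> h K]
   unfolding nK sqrt_power_even_moment[OF \<mu>] sqrt_power_even_moment[OF \<nu>] eq by auto
  have "\<bar>h\<bar> ^ K / fact K * m (n + i) \<le> \<bar>h\<bar> ^ K / fact K * (L ^ (n + i) * fact (2 * (n + i)))"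
   by (intro mult_left_mono bound) auto
  also have "\<dots> = \<bar>h\<bar> ^ K * L ^ (n + i) * (fact (2 * (n + i)) / fact K)" by simp
  also have "\<dots> \<le> \<bar>h\<bar> ^ K * L ^ (n + i) * (fact n * 4 ^ (n + i))"
  proof (rule mult_left_mono)
   \<comment> \<open>The quotient of factorials is \<open>fact n\<close> times a binomial
     coefficient of \<open>2 (n + i)\<close>, at most \<open>4 ^ (n + i)\<close>. This is the origin
     of the 4 in \<open>q\<close>.\<close>
   have "real (2 * (n + i) choose n) = fact (2 * (n + i)) / (fact n * fact K)"
    by (subst binomial_fact) (auto simp: K_def intro!: arg_cong[of _ _ fact])
   then have "fact (2 * (n + i)) / fact K = fact n * real (2 * (n + i) choose n)" by simp
   also have "real (2 * (n + i) choose n) \<le> 4 ^ (n + i)"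
    using of_nat_mono[OF binomial_le_pow2[of "2 * (n + i)" n], where 'a=real] unfolding power_mult by simp
   finally show "fact (2 * (n + i)) / fact K \<le> (fact n * 4 ^ (n + i) :: real)" by simp
   show "0 \<le> \<bar>h\<bar> ^ K * L ^ (n + i)" using L by simp
  qed
  also have "\<dots> = C * q ^ i / 2"
  proof -
   have "\<bar>h\<bar> ^ K = \<bar>h\<bar> ^ n * (h^2) ^ i" by (simp add: K_def power_add power_mult)
   then show ?thesis by (simp add: C_def q_def power_add power_mult_distrib mult_ac)
  qed
  finally have "\<bar>h\<bar> ^ K / fact K * m (n + i) \<le> C * q ^ i / 2" .
  then show ?thesis using T by linarith
 qed
 moreover have "(\<lambda>i. C * q ^ i) \<longlonglongrightarrow> C * 0"
  using h L by (intro tendsto_mult tendsto_const LIMSEQ_realpow_zero) (auto simp: q_def)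
 ultimately have "?D \<le> C * 0" by (intro LIMSEQ_le_const[of _ "C * 0"]) auto
 then show ?thesis by simp
qed

text \<open>At 0 the odd derivatives vanish and the even ones are moments up to sign, so both
  transforms have the same germ. Finitely many steps of equal size lead from 0 to
  \<open>\<theta>\<close>.\<close>

lemma cos_transform_eq:
 assumes \<mu>: "nonneg_distribution_with_moments \<mu> m" and \<nu>: "nonneg_distribution_with_moments \<nu> m"
  and bound: "\<And>n. m n \<le> L ^ n * fact (2 * n)" and L: "0 < L"
 shows "(\<integral>x. cos (\<theta> * sqrt x) \<partial>\<mu>) = (\<integral>x. cos (\<theta> * sqrt x) \<partial>\<nu>)"
proof -
 have base: "cos_moment \<mu> n 0 = cos_moment \<nu> n 0" for n
 proof (cases "even n")
  case True
  then obtain j where "n = 2 * j" by (rule evenE)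
  then show ?thesis unfolding cos_moment_def using sqrt_power_even_moment[OF \<mu>, of j] sqrt_power_even_moment[OF \<nu>, of j] by simp
 next
  case False
  then obtain j where j: "n = 2 * j + 1" by (rule oddE)
  have "cos (real n * (pi / 2)) = 0" by (simp add: cos_zero_iff) (metis False mult.commute)
  then show ?thesis unfolding cos_moment_def by simp
 qed
 \<comment> \<open>The number \<open>j\<close> of steps is taken so large that the step size is
   admissible.\<close>
 have "(\<lambda>j. 4 * (\<theta> * (1 / real j))^2 * L) \<longlonglongrightarrow> 4 * (\<theta> * 0)^2 * L" by (intro tendsto_intros lim_1_over_n)
 then have "\<forall>\<^sub>F j in sequentially. 4 * (\<theta> * (1 / real j))^2 * L < 1" by (rule order_tendstoD) simp
 then have "\<forall>\<^sub>F j in sequentially. 4 * (\<theta> * (1 / real j))^2 * L < 1 \<and> 1 \<le> j" using eventually_ge_at_top[of 1] by eventually_elim simp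
 then obtain j where j: "4 * (\<theta> * (1 / real j))^2 * L < 1" "1 \<le> j" by (auto simp: eventually_sequentially)
 have "\<forall>n. cos_moment \<mu> n (real i * (\<theta> * (1 / real j))) = cos_moment \<nu> n (real i * (\<theta> * (1 / real j)))" for i
 proof (induction i)
  case 0 then show ?case using base by simp
 next
  case (Suc i)
  have "real (Suc i) * (\<theta> * (1 / real j)) = real i * (\<theta> * (1 / real j)) + \<theta> * (1 / real j)" by (simp add: algebra_simps add_divide_distrib)
  then show ?case using cos_moment_eq_step[OF \<mu> \<nu> bound j(1) L] Suc by presburger
 qed
 from spec[OF this[of j], of 0] show ?thesis using j(2) by (simp add: cos_moment_def)
qed

text \<open>The law of \<open>\<plusminus>\<surd>x\<close> with an independent fair sign, whose characteristic function is the cosine transform.\<close>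

definition symmetrized_sqrt :: "real measure \<Rightarrow> real measure" where
 "symmetrized_sqrt \<mu> = distr (\<mu> \<Otimes>\<^sub>M measure_pmf (pmf_of_set {- 1, 1 :: real})) borel (\<lambda>z. snd z * sqrt (fst z))"

section \<open>From the cosine transform back to the measure\<close>

context
 fixes \<mu> :: "real measure" assumes rd: "real_distribution \<mu>"
begin

interpretation real_distribution \<mu> by (rule rd)
interpretation pr: pair_prob_space \<mu> "measure_pmf (pmf_of_set {- 1, 1 :: real})" ..

lemma signed_sqrt_measurable: "(\<lambda>z. snd z * sqrt (fst z)) \<in> borel_measurable (\<mu> \<Otimes>\<^sub>M measure_pmf (pmf_of_set {- 1, 1 :: real}))"
proof -
 have [measurable]: "(\<lambda>s. s) \<in> borel_measurable (measure_pmf (pmf_of_set {- 1, 1 :: real}))" by simp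
 have [measurable]: "sqrt \<in> borel_measurable \<mu>" by simp
 have "(\<lambda>z. snd z) \<in> borel_measurable (\<mu> \<Otimes>\<^sub>M measure_pmf (pmf_of_set {- 1, 1 :: real}))"
  by (rule measurable_compose[OF measurable_snd]) simp
 moreover have "(\<lambda>z. sqrt (fst z)) \<in> borel_measurable (\<mu> \<Otimes>\<^sub>M measure_pmf (pmf_of_set {- 1, 1 :: real}))"
  by (rule measurable_compose[OF measurable_fst]) simp
 ultimately show ?thesis by (rule borel_measurable_times)
qed

lemma real_distribution_symmetrized_sqrt: "real_distribution (symmetrized_sqrt \<mu>)"
 unfolding symmetrized_sqrt_def by (rule pr.real_distribution_distr[OF signed_sqrt_measurable])

lemma char_symmetrized_sqrt: "char (symmetrized_sqrt \<mu>) \<theta> = complex_of_real (\<integral>x. cos (\<theta> * sqrt x) \<partial>\<mu>)"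
proof -
 let ?A = "\<lambda>z. iexp (\<theta> * (snd z * sqrt (fst z)))"
 have "char (symmetrized_sqrt \<mu>) \<theta> = (\<integral>z. iexp (\<theta> * (snd z * sqrt (fst z))) \<partial>(\<mu> \<Otimes>\<^sub>M measure_pmf (pmf_of_set {- 1, 1 :: real})))"
  unfolding char_def symmetrized_sqrt_def by (rule integral_distr[OF signed_sqrt_measurable]) simp
 also have "\<dots> = (\<integral>x. \<integral>s. iexp (\<theta> * (snd (x, s) * sqrt (fst (x, s)))) \<partial>measure_pmf (pmf_of_set {- 1, 1 :: real}) \<partial>\<mu>)"
 proof (rule pr.integral_fst'[symmetric])
  have "?A \<in> borel_measurable (\<mu> \<Otimes>\<^sub>M measure_pmf (pmf_of_set {- 1, 1 :: real}))"
   by (rule measurable_compose[OF signed_sqrt_measurable, of "\<lambda>y. iexp (\<theta> * y)"]) simp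
  then show "integrable (\<mu> \<Otimes>\<^sub>M measure_pmf (pmf_of_set {- 1, 1 :: real})) ?A"
   by (intro pr.integrable_const_bound[of _ 1]) auto
 qed
 also have "\<dots> = (\<integral>x. complex_of_real (cos (\<theta> * sqrt x)) \<partial>\<mu>)"
 proof (rule lint_cong[OF refl])
  fix x
  have "(\<integral>s. iexp (\<theta> * (s * sqrt x)) \<partial>measure_pmf (pmf_of_set {- 1, 1 :: real})) = (\<Sum>s\<in>{- 1, 1}. pmf (pmf_of_set {- 1, 1}) s *\<^sub>R iexp (\<theta> * (s * sqrt x)))"
   by (rule integral_measure_pmf) auto
  also have "\<dots> = (iexp (- (\<theta> * sqrt x)) + iexp (\<theta> * sqrt x)) / 2" by (simp add: scaleR_conv_of_real add_divide_distrib)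
  also have "\<dots> = complex_of_real (cos (\<theta> * sqrt x))" by (simp add: cos_exp_eq cos_of_real[symmetric])
  finally show "(\<integral>s. iexp (\<theta> * (snd (x, s) * sqrt (fst (x, s)))) \<partial>measure_pmf (pmf_of_set {- 1, 1 :: real})) = complex_of_real (cos (\<theta> * sqrt x))" by simp
 qed
 finally show ?thesis by simp
qed

lemma distr_square_symmetrized_sqrt:
 assumes p: "AE x in \<mu>. 0 \<le> x"
 shows "distr (symmetrized_sqrt \<mu>) borel (\<lambda>y. y^2) = \<mu>"
proof -
 let ?A = "\<lambda>z. (snd z * sqrt (fst z))^2"
 let ?P = "\<mu> \<Otimes>\<^sub>M measure_pmf (pmf_of_set {- 1, 1 :: real})"
 have m1: "fst \<in> borel_measurable ?P" by (rule measurable_compose[OF measurable_fst]) simp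
 have m2: "?A \<in> borel_measurable ?P" using signed_sqrt_measurable by simp
 have "distr (symmetrized_sqrt \<mu>) borel (\<lambda>y. y^2) = distr ?P borel ?A"
  unfolding symmetrized_sqrt_def by (subst distr_distr[OF _ signed_sqrt_measurable]) (auto simp: comp_def)
 also have "\<dots> = distr ?P borel fst"
 proof (rule distr_cong_AE[OF refl refl _ m2 m1])
  have "AE z in ?P. 0 \<le> fst z \<and> snd z \<in> {- 1, 1}"
  proof (rule pr.AE_pair_measure)
   have "{z \<in> space ?P. 0 \<le> fst z \<and> snd z \<in> {- 1, 1}} = {x \<in> space \<mu>. 0 \<le> x} \<times> {- 1, 1}" by (auto simp: space_pair_measure)
   then show "{z \<in> space ?P. 0 \<le> fst z \<and> snd z \<in> {- 1, 1}} \<in> sets ?P" by simp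
   show "AE x in \<mu>. AE s in measure_pmf (pmf_of_set {- 1, 1 :: real}). 0 \<le> fst (x, s) \<and> snd (x, s) \<in> {- 1, 1}"
    using p by eventually_elim (simp add: AE_measure_pmf_iff)
  qed
  then show "AE z in ?P. (snd z * sqrt (fst z))^2 = fst z" by eventually_elim (auto simp: power_mult_distrib)
 qed
 also have "\<dots> = distr ?P \<mu> fst" by (rule distr_cong) auto
 also have "\<dots> = \<mu>"
 proof (rule measure_eqI)
  fix A assume "A \<in> sets (distr ?P \<mu> fst)"
  then have A: "A \<in> sets \<mu>" by simp
  have "fst -` A \<inter> space ?P = A \<times> UNIV" using sets.sets_into_space[OF A] by (auto simp: space_pair_measure)
  then show "emeasure (distr ?P \<mu> fst) A = emeasure \<mu> A"
   using A measure_pmf.emeasure_pair_measure_Times[OF A, of UNIV] measure_pmf.emeasure_space_1 by (simp add: emeasure_distr)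
 qed simp
 finally show ?thesis .
qed

end

text \<open>The cosine transform determines the symmetrized law of the root by the uniqueness
  theorem for characteristic functions, and squaring recovers the measure.\<close>

theorem nonneg_distribution_with_moments_unique:
 assumes \<mu>: "nonneg_distribution_with_moments \<mu> m" and \<nu>: "nonneg_distribution_with_moments \<nu> m"
  and bound: "\<And>n. m n \<le> L ^ n * fact (2 * n)" and L: "0 < L"
 shows "\<mu> = \<nu>"
proof -
 have rd: "real_distribution \<mu>" "real_distribution \<nu>" and p: "AE x in \<mu>. 0 \<le> x" "AE x in \<nu>. 0 \<le> x"
  using \<mu> \<nu> by (auto simp: nonneg_distribution_with_moments_def)
 have "char (symmetrized_sqrt \<mu>) = char (symmetrized_sqrt \<nu>)"
  unfolding fun_eq_iff char_symmetrized_sqrt[OF rd(1)] char_symmetrized_sqrt[OF rd(2)] by (simp only: cos_transform_eq[OF \<mu> \<nu> bound L] simp_thms)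
 then have "symmetrized_sqrt \<mu> = symmetrized_sqrt \<nu>"
  by (intro Levy_uniqueness real_distribution_symmetrized_sqrt rd)
 then show ?thesis
  using distr_square_symmetrized_sqrt[OF rd(1) p(1)] distr_square_symmetrized_sqrt[OF rd(2) p(2)] by metis
qed

section \<open>The method of moments\<close>

lemma moment_distributionD:
 assumes "nonneg_distribution_with_moments \<mu> m"
 shows "real_distribution \<mu>" "AE x in \<mu>. 0 \<le> x" "integrable \<mu> (\<lambda>x. x ^ n)" "(\<integral>x. x ^ n \<partial>\<mu>) = m n"
 using assms by (auto simp: nonneg_distribution_with_moments_def)

text \<open>Markov's inequality with the first moment, which is bounded along the sequence.\<close>

lemma tight_if_moments_converge:
 assumes \<nu>: "\<And>k. nonneg_distribution_with_moments (\<nu> k) (q k)" and lim: "(\<lambda>k. q k 1) \<longlonglongrightarrow> m"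
 shows "tight \<nu>"
 unfolding tight_def
proof (intro conjI allI impI)
 show rd: "real_distribution (\<nu> k)" for k by (rule moment_distributionD[OF \<nu>])
 fix e :: real assume e: "0 < e"
 obtain B where B: "0 < B" "\<And>k. norm (q k 1) \<le> B" using convergent_imp_Bseq[OF convergentI[OF lim]] by (auto simp: Bseq_def)
 \<comment> \<open>With this \<open>b\<close> the mass above \<open>b\<close> is at most
   \<open>e / 2\<close>.\<close>
 define b where "b = 2 * B / e"
 have b: "0 < b" using B e by (simp add: b_def)
 \<comment> \<open>The interval starts at -1 because it is open on the left and has to contain
   0.\<close>
 have "1 - e < measure (\<nu> k) {-1<..b}" for k
 proof -
  interpret real_distribution "\<nu> k" by (rule rd)
  note D = moment_distributionD[OF \<nu>[of k]]
  have i: "integrable (\<nu> k) (\<lambda>x. x)" using D(3)[of 1] by simp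
  have "q k 1 / b \<le> B / b" using B(2)[of k] b by (intro divide_right_mono) auto
  also have "\<dots> = e / 2" using B(1) e by (simp add: b_def)
  finally have "1 - e < 1 - q k 1 / b" using e by linarith
  also have "\<dots> = (\<integral>x. 1 - x / b \<partial>\<nu> k)"
   using D(4)[of 1] i prob_space by (subst lint_diff) (auto simp: prob_space)
  also have "\<dots> \<le> (\<integral>x. indicator {-1<..b} x \<partial>\<nu> k)"
  proof (rule integral_mono_AE)
   show "integrable (\<nu> k) (\<lambda>x. 1 - x / b)" using i by simp
   show "integrable (\<nu> k) (indicat_real {- 1<..b})" by (rule integrable_const_bound[of _ 1]) auto
   show "AE x in \<nu> k. 1 - x / b \<le> indicat_real {- 1<..b} x"
    using D(2) by eventually_elim (use b in \<open>auto simp: indicator_def\<close>)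
  qed
  finally show ?thesis by simp
 qed
 then show "\<exists>a b. a < b \<and> (\<forall>k. 1 - e < measure (\<nu> k) {a<..b})" using b by (intro exI[of _ "-1"] exI[of _ b]) auto
qed

lemma truncated_power_bounds:
 fixes x R :: real assumes "0 \<le> x" "0 < R"
 shows "min x R ^ n \<le> x ^ n" "x ^ n - min x R ^ n \<le> x ^ Suc n / R"
proof -
 show "min x R ^ n \<le> x ^ n" using assms by (intro power_mono) auto
 show "x ^ n - min x R ^ n \<le> x ^ Suc n / R"
 proof (cases "x \<le> R")
  case True then show ?thesis using assms by (simp add: min_def)
 next
  case False
  then have "x ^ n * 1 \<le> x ^ n * (x / R)" using assms by (intro mult_left_mono) auto
  moreover have "0 \<le> min x R ^ n" using assms by simp
  ultimately show ?thesis by (simp add: mult.commute)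
 qed
qed

text \<open>Powers are not bounded, so weak convergence is applied to truncated ones. The next
  higher moment bounds the truncation error uniformly along the sequence; afterwards the level is
  sent to infinity by monotone convergence.\<close>

lemma moments_of_weak_limit:
 assumes \<nu>: "\<And>k. nonneg_distribution_with_moments (\<nu> k) (q k)" and lim: "\<And>n. (\<lambda>k. q k n) \<longlonglongrightarrow> m n"
  and w: "weak_conv_m \<nu> \<mu>" and rd: "real_distribution \<mu>"
 shows "nonneg_distribution_with_moments \<mu> m"
proof -
 interpret real_distribution \<mu> by (rule rd)
 note D = moment_distributionD[OF \<nu>]
 have conv: "(\<lambda>k. \<integral>x. f x \<partial>\<nu> k) \<longlonglongrightarrow> (\<integral>x. f x \<partial>\<mu>)" if "\<And>x. isCont f x" "\<And>x. \<bar>f x\<bar> \<le> B" for f :: "real \<Rightarrow> real" and B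
  using weak_conv_imp_integral_bdd_continuous_conv[OF D(1) rd w, of f B] that by simp
 have p: "AE x in \<mu>. 0 \<le> x"
 proof -
  \<comment> \<open>A bounded continuous function whose zeros are exactly the nonnegative
    reals.\<close>
  let ?f = "\<lambda>x::real. min 1 (max 0 (- x))"
  have "(\<lambda>k. \<integral>x. ?f x \<partial>\<nu> k) \<longlonglongrightarrow> (\<integral>x. ?f x \<partial>\<mu>)" by (rule conv[of _ 1]) (auto intro!: continuous_intros)
  moreover have "(\<integral>x. ?f x \<partial>\<nu> k) = 0" for k
  proof -
   interpret \<nu>: real_distribution "\<nu> k" by (rule D)
   have "(\<integral>x. ?f x \<partial>\<nu> k) = (\<integral>x. 0 \<partial>\<nu> k)" by (rule integral_cong_AE; (measurable)?) (use D(2)[of k] in eventually_elim, simp)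
   then show ?thesis by simp
  qed
  ultimately have "(\<integral>x. ?f x \<partial>\<mu>) = 0" by (simp add: LIMSEQ_const_iff)
  moreover have "integrable \<mu> ?f" by (rule integrable_const_bound[of _ 1]) auto
  ultimately have "AE x in \<mu>. ?f x = 0" by (subst integral_nonneg_eq_0_iff_AE[symmetric]) auto
  then show ?thesis by eventually_elim (auto simp: min_def max_def split: if_splits)
 qed
 have main: "integrable \<mu> (\<lambda>x. x ^ n) \<and> (\<integral>x. x ^ n \<partial>\<mu>) = m n" for n
 proof -
  let ?f = "\<lambda>R x::real. min (max 0 x) R ^ n"
  \<comment> \<open>The convergent moments of order \<open>n + 1\<close> are bounded; the error of
    truncation at level \<open>R\<close> is then at most \<open>C / R\<close>.\<close>
  obtain C where C: "0 < C" "\<And>k. norm (q k (Suc n)) \<le> C" using convergent_imp_Bseq[OF convergentI[OF lim]] by (auto simp: Bseq_def)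
  have b: "\<bar>?f R x\<bar> \<le> R ^ n" if "0 < R" for R x using that by (auto simp: power_abs[symmetric] intro!: power_mono)
  have fi: "integrable \<mu> (?f R)" if "0 < R" for R
   by (rule integrable_const_bound[of _ "R ^ n"]) (use b[OF that] in auto)
  have fR: "m n - C / R \<le> (\<integral>x. ?f R x \<partial>\<mu>) \<and> (\<integral>x. ?f R x \<partial>\<mu>) \<le> m n" if R: "0 < R" for R
  proof -
   have lf: "(\<lambda>k. \<integral>x. ?f R x \<partial>\<nu> k) \<longlonglongrightarrow> (\<integral>x. ?f R x \<partial>\<mu>)" by (rule conv[OF _ b[OF R]]) (auto intro!: continuous_intros)
   have bd: "q k n - C / R \<le> (\<integral>x. ?f R x \<partial>\<nu> k) \<and> (\<integral>x. ?f R x \<partial>\<nu> k) \<le> q k n" for k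
   proof -
    interpret \<nu>: real_distribution "\<nu> k" by (rule D)
    have fk: "integrable (\<nu> k) (?f R)" by (rule \<nu>.integrable_const_bound[of _ "R ^ n"]) (use b[OF R] in auto)
    have i: "integrable (\<nu> k) (\<lambda>x. x ^ Suc n / R)" by (intro integrable_divide_zero D(3))
    have "(\<integral>x. x ^ n - ?f R x \<partial>\<nu> k) \<le> (\<integral>x. x ^ Suc n / R \<partial>\<nu> k)"
    proof (rule integral_mono_AE[OF _ i])
     show "AE x in \<nu> k. x ^ n - ?f R x \<le> x ^ Suc n / R"
      using D(2)[of k] by eventually_elim (use truncated_power_bounds(2)[OF _ R] in simp)
    qed (intro lint_integrable_diff D(3) fk)
    moreover have "(\<integral>x. x ^ n - ?f R x \<partial>\<nu> k) = q k n - (\<integral>x. ?f R x \<partial>\<nu> k)"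
     by (subst lint_diff[OF D(3) fk]) (simp only: D(4))
    moreover have "(\<integral>x. x ^ Suc n / R \<partial>\<nu> k) = q k (Suc n) / R" by (simp only: integral_divide_zero D(4))
    moreover have "q k (Suc n) / R \<le> C / R" using C(2)[of k] R by (intro divide_right_mono) auto
    moreover have "(\<integral>x. ?f R x \<partial>\<nu> k) \<le> (\<integral>x. x ^ n \<partial>\<nu> k)"
    proof (rule integral_mono_AE[OF fk D(3)])
     show "AE x in \<nu> k. ?f R x \<le> x ^ n"
      using D(2)[of k] by eventually_elim (use truncated_power_bounds(1)[OF _ R] in simp)
    qed
    ultimately show ?thesis unfolding D(4) by linarith
   qed
   show ?thesis
   proof
    show "m n - C / R \<le> (\<integral>x. ?f R x \<partial>\<mu>)"
     by (rule LIMSEQ_le[OF tendsto_diff[OF lim[of n] tendsto_const] lf]) (use bd in blast)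
    show "(\<integral>x. ?f R x \<partial>\<mu>) \<le> m n" by (rule LIMSEQ_le[OF lf lim[of n]]) (use bd in blast)
   qed
  qed
  have lim_f: "(\<lambda>j. \<integral>x. ?f (real (Suc j)) x \<partial>\<mu>) \<longlonglongrightarrow> m n"
  proof (rule tendsto_sandwich[OF always_eventually always_eventually _ tendsto_const])
   show "\<forall>j. m n - C / real (Suc j) \<le> (\<integral>x. ?f (real (Suc j)) x \<partial>\<mu>)" "\<forall>j. (\<integral>x. ?f (real (Suc j)) x \<partial>\<mu>) \<le> m n" using fR by auto
   have "(\<lambda>j. m n - C * inverse (real (Suc j))) \<longlonglongrightarrow> m n - C * 0" by (intro tendsto_intros LIMSEQ_inverse_real_of_nat)
   then show "(\<lambda>j. m n - C / real (Suc j)) \<longlonglongrightarrow> m n" by (simp add: divide_inverse)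
  qed
  have mono: "AE x in \<mu>. mono (\<lambda>j. ?f (real (Suc j)) x)"
   by (intro AE_I2 monoI power_mono) auto
  have pt: "AE x in \<mu>. (\<lambda>j. ?f (real (Suc j)) x) \<longlonglongrightarrow> x ^ n"
   using p
  proof eventually_elim
   case (elim x)
   obtain j0 :: nat where "x \<le> real j0" using real_arch_simple by blast
   then have "?f (real (Suc j)) x = x ^ n" if "j0 \<le> j" for j using elim that by (simp add: min_def)
   then show ?case by (intro tendsto_eventually eventually_sequentiallyI) auto
  qed
  show ?thesis
   using integrable_monotone_convergence[OF fi mono pt lim_f] integral_monotone_convergence[OF fi mono pt lim_f] by auto
 qed
 show ?thesis unfolding nonneg_distribution_with_moments_def using rd p main by blast
qed

text \<open>Tightness gives a weakly convergent subsequence, along which the moments still tend to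
  \<open>m\<close>; its limit is the required measure.\<close>

lemma distribution_with_limit_moments:
 assumes \<nu>: "\<And>k. nonneg_distribution_with_moments (\<nu> k) (q k)" and lim: "\<And>n. (\<lambda>k. q k n) \<longlonglongrightarrow> m n"
 shows "\<exists>\<mu>. nonneg_distribution_with_moments \<mu> m"
proof -
 obtain r \<mu> where r: "strict_mono (r :: nat \<Rightarrow> nat)" "real_distribution \<mu>" "weak_conv_m (\<nu> \<circ> id \<circ> r) \<mu>"
  using tight_imp_convergent_subsubsequence[OF tight_if_moments_converge[OF \<nu> lim] strict_mono_id] by auto
 have "nonneg_distribution_with_moments \<mu> m"
 proof (rule moments_of_weak_limit[OF _ _ r(3,2)])
  show "nonneg_distribution_with_moments ((\<nu> \<circ> id \<circ> r) k) (q (r k))" for k using \<nu> by simp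
  show "(\<lambda>k. q (r k) n) \<longlonglongrightarrow> m n" for n using LIMSEQ_subseq_LIMSEQ[OF lim r(1)] by (simp add: comp_def)
 qed
 then show ?thesis by blast
qed

text \<open>Every subsequential limit has moments \<open>m\<close>, so by uniqueness it is
  \<open>\<mu>\<close>; together with tightness this gives convergence of the whole
  sequence.\<close>

lemma method_of_moments:
 assumes \<nu>: "\<And>k. nonneg_distribution_with_moments (\<nu> k) (q k)" and lim: "\<And>n. (\<lambda>k. q k n) \<longlonglongrightarrow> m n"
  and \<mu>: "nonneg_distribution_with_moments \<mu> m" and uniq: "\<And>\<rho>. nonneg_distribution_with_moments \<rho> m \<Longrightarrow> \<rho> = \<mu>"
 shows "weak_conv_m \<nu> \<mu>"
proof (rule tight_subseq_weak_converge)
 show "real_distribution (\<nu> k)" for k by (rule moment_distributionD[OF \<nu>])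
 show "real_distribution \<mu>" by (rule moment_distributionD[OF \<mu>])
 show "tight \<nu>" by (rule tight_if_moments_converge[OF \<nu> lim])
 fix s :: "nat \<Rightarrow> nat" and \<rho> assume s: "strict_mono s" "real_distribution \<rho>" "weak_conv_m (\<nu> \<circ> s) \<rho>"
 have "nonneg_distribution_with_moments \<rho> m"
 proof (rule moments_of_weak_limit[OF _ _ s(3,2)])
  show "nonneg_distribution_with_moments ((\<nu> \<circ> s) k) (q (s k))" for k using \<nu> by simp
  show "(\<lambda>k. q (s k) n) \<longlonglongrightarrow> m n" for n using LIMSEQ_subseq_LIMSEQ[OF lim s(1)] by (simp add: comp_def)
 qed
 then show "weak_conv_m (\<nu> \<circ> s) \<mu>" using s(3) uniq by blast
qed

section \<open>The weak topology\<close>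

lemma weak_conv_m_integral:
 fixes f :: "real \<Rightarrow> real"
 assumes "\<And>k. real_distribution (\<nu> k)" "real_distribution \<mu>" "weak_conv_m \<nu> \<mu>"
  and f: "continuous_on UNIV f" "bounded (range f)"
 shows "(\<lambda>k. \<integral>x. f x \<partial>\<nu> k) \<longlonglongrightarrow> (\<integral>x. f x \<partial>\<mu>)"
proof -
 obtain B where "\<And>x. norm (f x) \<le> B" using f(2) by (auto simp: bounded_iff)
 then show ?thesis using weak_conv_imp_integral_bdd_continuous_conv[OF assms(1-3), of f B] f(1)
  by (simp add: continuous_on_eq_continuous_at)
qed

text \<open>On subbasic sets this is convergence of one integral; being eventually inside passes to
  finite intersections and to unions, hence to all open sets.\<close>

lemma limitin_weak_topology:
 assumes rd: "\<And>k. real_distribution (\<nu> k)" "real_distribution \<mu>" and w: "weak_conv_m \<nu> \<mu>"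
 shows "limitin weak_topology \<nu> \<mu> sequentially"
proof -
 let ?S = "{{\<mu>. real_distribution \<mu> \<and> (\<integral>x. f x \<partial>\<mu>) \<in> U} | f U. continuous_on UNIV f \<and> bounded (range f) \<and> open (U :: real set)}"
 have "generate_topology_on ?S V \<Longrightarrow> \<mu> \<in> V \<Longrightarrow> \<forall>\<^sub>F k in sequentially. \<nu> k \<in> V" for V
 proof (induction rule: generate_topology_on.induct)
  case Empty then show ?case by simp
 next
  case (Int a b)
  then have "\<forall>\<^sub>F k in sequentially. \<nu> k \<in> a" "\<forall>\<^sub>F k in sequentially. \<nu> k \<in> b" by auto
  then show ?case by eventually_elim simp
 next
  case (UN K)
  then obtain k where "k \<in> K" "\<mu> \<in> k" by blast
  then have "\<forall>\<^sub>F i in sequentially. \<nu> i \<in> k" using UN by blast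
  then show ?case by eventually_elim (use \<open>k \<in> K\<close> in blast)
 next
  case (Basis s)
  then obtain f U where s: "s = {\<mu>. real_distribution \<mu> \<and> (\<integral>x. f x \<partial>\<mu>) \<in> U}" and f: "continuous_on UNIV f" "bounded (range f)" and U: "open (U :: real set)"
   by blast
  have "\<forall>\<^sub>F k in sequentially. (\<integral>x. f x \<partial>\<nu> k) \<in> U"
   using weak_conv_m_integral[OF rd w f] U Basis(2) unfolding s by (intro topological_tendstoD[where l="\<integral>x. f x \<partial>\<mu>"]) auto
  then show ?case unfolding s by eventually_elim (simp add: rd)
 qed
 then show ?thesis
  unfolding limitin_def topspace_weak_topology using rd(2)
  by (auto simp: weak_topology_def openin_topology_generated_by_iff)
qed

lemma continuous_map_weak_topology:
 assumes "\<And>t. t \<in> topspace X \<Longrightarrow> real_distribution (\<mu> t)"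
  and "\<And>f :: real \<Rightarrow> real. continuous_on UNIV f \<Longrightarrow> bounded (range f) \<Longrightarrow> continuous_map X euclidean (\<lambda>t. \<integral>x. f x \<partial>\<mu> t)"
 shows "continuous_map X weak_topology \<mu>"
 unfolding weak_topology_def
proof (rule continuous_on_generated_topo)
 fix V assume "V \<in> {{\<mu>. real_distribution \<mu> \<and> (\<integral>x. f x \<partial>\<mu>) \<in> U} | f U. continuous_on UNIV f \<and> bounded (range f) \<and> open (U :: real set)}"
 then obtain f U where V: "V = {\<mu>. real_distribution \<mu> \<and> (\<integral>x. f x \<partial>\<mu>) \<in> U}" and f: "continuous_on UNIV f" "bounded (range f)" and U: "open (U :: real set)"
  by blast
 have "\<mu> -` V \<inter> topspace X = {t \<in> topspace X. (\<integral>x. f x \<partial>\<mu> t) \<in> U}" using assms(1) by (auto simp: V)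
 then show "openin X (\<mu> -` V \<inter> topspace X)"
  using assms(2)[OF f] U by (auto simp: continuous_map_def)
next
 have "Collect real_distribution = \<Union>{{\<mu>. real_distribution \<mu> \<and> (\<integral>x. f x \<partial>\<mu>) \<in> U} | f U. continuous_on UNIV f \<and> bounded (range f) \<and> open (U :: real set)}"
  using topspace_weak_topology unfolding weak_topology_def topology_generated_by_topspace by simp
 then show "\<mu> ` topspace X \<subseteq> \<Union>{{\<mu>. real_distribution \<mu> \<and> (\<integral>x. f x \<partial>\<mu>) \<in> U} | f U. continuous_on UNIV f \<and> bounded (range f) \<and> open (U :: real set)}"
  using assms(1) by blast
qed

lemma metrizes_weak_topology_continuous:
 assumes d: "metrizes_weak_topology d" and "continuous_map X weak_topology \<mu>" "continuous_map X weak_topology \<nu>"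
 shows "continuous_map X euclidean (\<lambda>t. d (\<mu> t) (\<nu> t))"
proof -
 interpret Metric_space "Collect real_distribution" d using d by (simp add: metrizes_weak_topology_def)
 have "mtopology_of Self = weak_topology" using d by (simp add: metrizes_weak_topology_def mtopology_of_def)
 then show ?thesis using continuous_map_mdist[of X Self \<mu> \<nu>] assms(2,3) by simp
qed

lemma metrizes_weak_topology_tendsto:
 assumes d: "metrizes_weak_topology d" and "limitin weak_topology \<nu> \<mu> sequentially"
 shows "(\<lambda>k. d (\<nu> k) \<mu>) \<longlonglongrightarrow> 0"
proof -
 interpret Metric_space "Collect real_distribution" d using d by (simp add: metrizes_weak_topology_def)
 have "limitin mtopology \<nu> \<mu> sequentially" using assms by (simp add: metrizes_weak_topology_def)
 show ?thesis
 proof (rule tendstoI)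
  fix e :: real assume "0 < e"
  then have "\<forall>\<^sub>F k in sequentially. \<nu> k \<in> Collect real_distribution \<and> d (\<nu> k) \<mu> < e"
   using \<open>limitin mtopology \<nu> \<mu> sequentially\<close> by (simp add: limitin_metric)
  then show "\<forall>\<^sub>F k in sequentially. dist (d (\<nu> k) \<mu>) 0 < e" by eventually_elim (simp add: nonneg)
 qed
qed

section \<open>Empirical measures\<close>

context
 fixes N :: nat assumes N: "1 \<le> N"
begin

lemma measurable_uniform_count_measure: "x \<in> borel_measurable (uniform_count_measure {1..N})"
 by (auto simp: measurable_def sets_uniform_count_measure space_uniform_count_measure)

lemma real_distribution_empirical_measure: "real_distribution (empirical_measure N x)"
proof -
 interpret prob_space "uniform_count_measure {1..N}" using N by (intro prob_space_uniform_count_measure) auto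
 show ?thesis unfolding empirical_measure_def by (rule real_distribution_distr[OF measurable_uniform_count_measure])
qed

lemma integral_empirical_measure:
 fixes f :: "real \<Rightarrow> real"
 assumes [measurable]: "f \<in> borel_measurable borel"
 shows "(\<integral>y. f y \<partial>empirical_measure N x) = 1 / real N * (\<Sum>i=1..N. f (x i))"
proof -
 have "(\<integral>y. f y \<partial>empirical_measure N x) = (\<integral>i. f (x i) \<partial>uniform_count_measure {1..N})"
  unfolding empirical_measure_def by (rule integral_distr[OF measurable_uniform_count_measure assms])
 also have "\<dots> = (\<Sum>i=1..N. f (x i)) / real N" by (subst integral_uniform_count_measure) auto
 finally show ?thesis by simp
qed

lemma empirical_measure_moments:
 assumes "\<And>i. i \<in> {1..N} \<Longrightarrow> 0 \<le> x i"
 shows "nonneg_distribution_with_moments (empirical_measure N x) (\<lambda>n. empirical_moment n N x)"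
 unfolding nonneg_distribution_with_moments_def
proof (intro conjI allI)
 note x = measurable_uniform_count_measure
 show "real_distribution (empirical_measure N x)" by (rule real_distribution_empirical_measure)
 have "AE i in uniform_count_measure {1..N}. 0 \<le> x i" using assms by (intro AE_I2) (simp add: space_uniform_count_measure)
 then show "AE y in empirical_measure N x. 0 \<le> y" unfolding empirical_measure_def by (subst AE_distr_iff[OF x]) simp_all
 fix n
 have "integrable (uniform_count_measure {1..N}) (\<lambda>i. x i ^ n)"
  unfolding uniform_count_measure_def by (rule integrable_point_measure_finite) simp
 then show "integrable (empirical_measure N x) (\<lambda>y. y ^ n)"
  unfolding empirical_measure_def by (subst integrable_distr_eq[OF x]) auto
 show "(\<integral>y. y ^ n \<partial>empirical_measure N x) = empirical_moment n N x"
  unfolding empirical_moment_def by (rule integral_empirical_measure) simp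
qed

lemma continuous_map_empirical_measure:
 assumes "\<And>i. i \<in> {1..N} \<Longrightarrow> continuous_map X euclideanreal (\<lambda>t. x t i)"
 shows "continuous_map X weak_topology (\<lambda>t. empirical_measure N (x t))"
proof (rule continuous_map_weak_topology[OF real_distribution_empirical_measure])
 fix f :: "real \<Rightarrow> real" assume f: "continuous_on UNIV f"
 have "continuous_map X euclideanreal (\<lambda>t. 1 / real N * (\<Sum>i=1..N. f (x t i)))"
 proof (intro continuous_map_real_mult continuous_map_sum continuous_map_const[THEN iffD2])
  show "continuous_map X euclideanreal (\<lambda>t. f (x t i))" if "i \<in> {1..N}" for i
   using continuous_map_compose[OF assms[OF that], of euclideanreal f] f by (simp add: comp_def)
 qed auto
 then show "continuous_map X euclideanreal (\<lambda>t. \<integral>y. f y \<partial>empirical_measure N (x t))"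
  using integral_empirical_measure[OF borel_measurable_continuous_onI[OF f]] by simp
qed

text \<open>The distance is a continuous function of the configuration, viewed as a point of a
  countable product of lines, and the configuration is a measurable map.\<close>

lemma borel_measurable_dist_empirical_measure:
 assumes d: "metrizes_weak_topology d" and \<rho>: "real_distribution \<rho>"
  and x: "\<And>i. i \<in> {1..N} \<Longrightarrow> (\<lambda>w. x w i) \<in> borel_measurable M"
 shows "(\<lambda>w. d (empirical_measure N (x w)) \<rho>) \<in> borel_measurable M"
proof -
 let ?A = "\<lambda>x. d (empirical_measure N x) \<rho>"
 \<comment> \<open>Coordinates outside \<open>{1..N}\<close> are arbitrary and possibly not
   measurable; they do not affect the empirical measure and are set to 0.\<close>
 let ?x = "\<lambda>w i. if i \<in> {1..N} then x w i else 0"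
 have "empirical_measure N (x w) = empirical_measure N (?x w)" for w
  unfolding empirical_measure_def by (rule distr_cong) (auto simp: space_uniform_count_measure)
 moreover have mx: "?x \<in> borel_measurable M"
 proof (rule measurable_coordinatewise_then_product)
  show "(\<lambda>w. ?x w i) \<in> borel_measurable M" for i
   by (cases "i \<in> {1..N}") (simp_all only: if_True if_False x borel_measurable_const)
 qed
 moreover have "continuous_map euclidean euclideanreal ?A"
  by (intro metrizes_weak_topology_continuous[OF d] continuous_map_empirical_measure continuous_map_const[THEN iffD2])
   (use \<rho> in \<open>auto simp: topspace_weak_topology\<close>)
 then have "?A \<in> borel_measurable borel" by (intro borel_measurable_continuous_onI) simp
 from measurable_compose[OF mx this] have "(\<lambda>w. d (empirical_measure N (?x w)) \<rho>) \<in> borel_measurable M" .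
 ultimately show ?thesis by presburger
qed

end

text \<open>A single term of the exponential series at \<open>n\<close>.\<close>

lemma self_power_le_exp_fact: "real n ^ n \<le> exp (real n) * fact n"
proof -
 have "real n ^ n / fact n \<le> exp (real n)"
  using sums_unique[OF exp_converges[of "real n"]] sum_le_suminf[OF summable_exp_generic[of "real n"], of "{n}"]
  by (simp add: exp_def divide_inverse mult.commute)
 then show ?thesis by (simp add: field_simps)
qed

context jacobi_scaling
begin

section \<open>The limiting moments\<close>

lemma S_uniformly_close:
 assumes T: "0 < T" and e: "0 < e"
 shows "\<exists>E. (off M E (\<lambda>N w. \<forall>t\<in>{0..T}. \<forall>n\<le>k. \<bar>S n N t w - lm n t\<bar> < e)) \<and>
  (\<lambda>N. measure (M N) (E N)) \<longlonglongrightarrow> 0"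
proof -
 have a: "usmall M T (\<lambda>N t w. \<bar>S n N t w - lm n t\<bar>)" for n using S_ucp[OF T, of n] by (simp add: ucp_def usmall_def)
 have "usmall M T (\<lambda>N t w. \<Sum>n\<le>k. \<bar>S n N t w - lm n t\<bar>)"
 proof (induction k)
  case 0 show ?case using a[of 0] by simp
 next
  case (Suc k) show ?case using usmall_add[OF prob_eventually Suc a[of "Suc k"]] by simp
 qed
 then obtain E where E: "off M E (\<lambda>N w. \<forall>t\<in>{0..T}. \<bar>\<Sum>n\<le>k. \<bar>S n N t w - lm n t\<bar>\<bar> < e)"
  "(\<lambda>N. measure (M N) (E N)) \<longlonglongrightarrow> 0" using e unfolding usmall_def by blast
 have "\<bar>S n N t w - lm n t\<bar> < e" if "\<bar>\<Sum>n\<le>k. \<bar>S n N t w - lm n t\<bar>\<bar> < e" "n \<le> k" for n N t w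
  using member_le_sum[of n "{..k}" "\<lambda>n. \<bar>S n N t w - lm n t\<bar>"] that by auto
 then show ?thesis using E by (intro exI[of _ E] conjI) (auto elim!: eventually_mono)
qed

text \<open>For each \<open>k\<close> the event that the first \<open>k\<close> moments are close to
  their limits has positive probability for some \<open>N\<close>, hence contains an outcome. These
  outcomes live on different spaces, but their empirical measures form one deterministic sequence
  with the limiting moments.\<close>

lemma good_sample:
 assumes t: "0 \<le> t"
 shows "\<exists>N w. (\<forall>k. 1 \<le> N k \<and> w k \<in> space (M (N k))) \<and> (\<forall>n. (\<lambda>k. S n (N k) t (w k)) \<longlonglongrightarrow> lm n t)"
proof -
 have "\<exists>N w. 1 \<le> N \<and> w \<in> space (M N) \<and> (\<forall>n\<le>k. \<bar>S n N t w - lm n t\<bar> < 1 / real (Suc k))" for k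
 proof -
  \<comment> \<open>The horizon \<open>t + 1\<close> is positive also when
    \<open>t = 0\<close>.\<close>
  obtain E where E: "off M E (\<lambda>N w. \<forall>s\<in>{0..t + 1}. \<forall>n\<le>k. \<bar>S n N s w - lm n s\<bar> < 1 / real (Suc k))"
   "(\<lambda>N. measure (M N) (E N)) \<longlonglongrightarrow> 0"
   using S_uniformly_close[of "t + 1" "1 / real (Suc k)" k] t by auto
  have "\<forall>\<^sub>F N in sequentially. measure (M N) (E N) < 1" by (rule order_tendstoD(2)[OF E(2)]) simp
  then have "\<forall>\<^sub>F N in sequentially. 1 \<le> N \<and> measure (M N) (E N) < 1 \<and> (\<forall>w\<in>space (M N) - E N. \<forall>s\<in>{0..t + 1}. \<forall>n\<le>k. \<bar>S n N s w - lm n s\<bar> < 1 / real (Suc k)) \<and> E N \<in> sets (M N)"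
   using eventually_ge_1 E(1) by eventually_elim simp
  then obtain N where N: "1 \<le> N" "measure (M N) (E N) < 1" "\<forall>w\<in>space (M N) - E N. \<forall>s\<in>{0..t + 1}. \<forall>n\<le>k. \<bar>S n N s w - lm n s\<bar> < 1 / real (Suc k)" "E N \<in> sets (M N)"
   using eventually_happens'[OF sequentially_bot] by blast
  interpret prob_space "M N" by (rule prob[OF N(1)])
  have "E N \<noteq> space (M N)" using N(2) prob_space by auto
  then obtain w where "w \<in> space (M N) - E N" using sets.sets_into_space[OF N(4)] by blast
  then show ?thesis using N(1,3) t by (intro exI[of _ N] exI[of _ w]) auto
 qed
 then obtain N w where c: "\<And>k. 1 \<le> N k \<and> w k \<in> space (M (N k)) \<and> (\<forall>n\<le>k. \<bar>S n (N k) t (w k) - lm n t\<bar> < 1 / real (Suc k))"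
  by metis
 have "(\<lambda>k. S n (N k) t (w k)) \<longlonglongrightarrow> lm n t" for n
 proof (rule LIM_zero_cancel, rule Lim_null_comparison[OF _ LIMSEQ_inverse_real_of_nat])
  show "\<forall>\<^sub>F k in sequentially. norm (S n (N k) t (w k) - lm n t) \<le> inverse (real (Suc k))"
   using eventually_ge_at_top[of n] by eventually_elim (use c in \<open>simp add: inverse_eq_divide less_imp_le\<close>)
 qed
 then show ?thesis using c by blast
qed

text \<open>All three properties hold for empirical measures and survive the limit along a good
  sample; for the third, the limiting measure is extracted from the empirical measures of the
  sample.\<close>

lemma lm_nonneg: "0 \<le> t \<Longrightarrow> 0 \<le> lm n t"
 and lm_mult_le: "0 \<le> t \<Longrightarrow> lm j t * lm l t \<le> lm (j + l) t"
 and lm_distribution: "0 \<le> t \<Longrightarrow> \<exists>\<mu>. nonneg_distribution_with_moments \<mu> (\<lambda>n. lm n t)"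
proof -
 assume t: "0 \<le> t"
 obtain N w where c: "\<And>k. 1 \<le> N k" "\<And>k. w k \<in> space (M (N k))" "\<And>n. (\<lambda>k. S n (N k) t (w k)) \<longlonglongrightarrow> lm n t"
  using good_sample[OF t] by blast
 show "0 \<le> lm n t" using S_nonneg[OF c(1,2) t] by (intro LIMSEQ_le_const[OF c(3)]) auto
 show "lm j t * lm l t \<le> lm (j + l) t"
  using S_mult[OF c(1,2) t] by (intro LIMSEQ_le[OF tendsto_mult[OF c(3) c(3)] c(3)]) auto
 show "\<exists>\<mu>. nonneg_distribution_with_moments \<mu> (\<lambda>n. lm n t)"
  by (rule distribution_with_limit_moments[OF empirical_measure_moments[OF c(1) x_nonneg[OF c(1,2) t]] c(3)[unfolded S_def]])
qed

text \<open>Since products of moments are at most the moment of the total order, the recursion gives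
  \<open>m_(n+1) \<le> a_(n+1) + K (n + 1)^2\<close> times the integral of \<open>m_n\<close>. The
  factor \<open>(n + 1)^2\<close> is the one by which \<open>(fact n)^2\<close> grows, and
  \<open>L\<close> is the sum of the growth rate of the initial moments and \<open>K T\<close>,
  which closes the induction.\<close>

lemma lm_growth:
 assumes \<Lambda>: "0 < \<Lambda>" "\<And>n. an n \<le> (\<Lambda> * real n) ^ (2 * n)" and T: "0 \<le> T"
 shows "\<exists>L>0. \<forall>n. \<forall>t\<in>{0..T}. lm n t \<le> L ^ n * fact (2 * n)"
proof -
 let ?A = "\<lambda>n t. \<Sum>j\<in>{0..<Suc n}. integral {0..t} (\<lambda>u. lm j u * lm (Suc n - 1 - j) u)"
 define K where "K = \<sigma> * (1 + \<bar>a\<bar> + c)"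
 define L where "L = (exp 1 * \<Lambda>)^2 + K * T"
 have K: "0 < K" using \<sigma>_pos c_pos by (auto simp: K_def intro!: mult_pos_pos)
 have L: "0 < L" using K T \<Lambda> by (auto simp: L_def intro!: add_pos_nonneg)
 have an: "an n \<le> ((exp 1 * \<Lambda>)^2) ^ n * (fact n)^2" for n
 proof -
  have "an n \<le> (\<Lambda> ^ n)^2 * (real n ^ n)^2" using \<Lambda>(2)[of n] by (simp add: power_mult_distrib power_mult[symmetric] mult.commute)
  also have "\<dots> \<le> (\<Lambda> ^ n)^2 * (exp (real n) * fact n)^2" by (intro mult_left_mono power_mono self_power_le_exp_fact) auto
  also have "exp (real n) = exp 1 ^ n" by (simp add: exp_of_nat_mult[symmetric])
  also have "(\<Lambda> ^ n)^2 * (exp 1 ^ n * fact n)^2 = ((exp 1 * \<Lambda>)^2) ^ n * (fact n)^2"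
   by (simp add: power_mult_distrib power_mult[symmetric] mult_ac)
  finally show ?thesis .
 qed
 have "\<forall>t\<in>{0..T}. lm n t \<le> L ^ n * (fact n)^2" for n
 proof (induction n)
  case 0 show ?case by (subst limit_moment.simps) simp
 next
  case (Suc n)
  show ?case
  proof
   fix t assume t: "t \<in> {0..T}"
   have c: "continuous_on {0..t} (lm k)" for k by (rule lm_cont)
   let ?I = "integral {0..t} (lm n)"
   have I0: "0 \<le> ?I" by (rule Henstock_Kurzweil_Integration.integral_nonneg[OF integrable_continuous_interval[OF c]]) (auto intro: lm_nonneg)
   have "?I \<le> integral {0..t} (\<lambda>_. L ^ n * (fact n)^2)"
    by (rule integral_le[OF integrable_continuous_interval[OF c]]) (use Suc t in auto)
   also have "\<dots> = L ^ n * (fact n)^2 * t" using t by simp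
   also have "\<dots> \<le> L ^ n * (fact n)^2 * T" using t L by (intro mult_left_mono) auto
   finally have I: "?I \<le> L ^ n * (fact n)^2 * T" .
   have "(?A n t) \<le> (\<Sum>j\<in>{0..<Suc n}. ?I)"
   proof (intro sum_mono integral_le integrable_continuous_interval continuous_on_mult c)
    fix j u assume "j \<in> {0..<Suc n}" and u: "u \<in> {0..t}"
    then have "j + (Suc n - 1 - j) = n" by auto
    then show "lm j u * lm (Suc n - 1 - j) u \<le> lm n u" using lm_mult_le[of u j "Suc n - 1 - j"] u by simp
   qed
   also have "\<dots> = real (Suc n) * ?I" by simp
   finally have P: "\<sigma> * c * real (Suc n) * (?A n t) \<le> \<sigma> * c * real (Suc n) * (real (Suc n) * ?I)"
    using \<sigma>_pos c_pos by (intro mult_left_mono) auto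
   have "real (Suc n) + (a + 1) - 1 \<le> (1 + \<bar>a\<bar>) * real (Suc n)"
   proof -
    have "a \<le> \<bar>a\<bar> * real (Suc n)" using mult_mono[of "\<bar>a\<bar>" "\<bar>a\<bar>" 1 "real (Suc n)"] by simp
    then show ?thesis by (simp add: algebra_simps)
   qed
   then have Q: "\<sigma> * real (Suc n) * (real (Suc n) + (a + 1) - 1) * ?I \<le> \<sigma> * real (Suc n) * ((1 + \<bar>a\<bar>) * real (Suc n)) * ?I"
    using \<sigma>_pos I0 by (intro mult_right_mono mult_left_mono) auto
   have "lm (Suc n) t \<le> an (Suc n) + \<sigma> * real (Suc n) * ((1 + \<bar>a\<bar>) * real (Suc n)) * ?I + \<sigma> * c * real (Suc n) * (real (Suc n) * ?I)"
    using add_mono[OF add_left_mono[OF Q] P] by (subst limit_moment.simps) simp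
   also have "\<dots> = an (Suc n) + K * (real (Suc n))^2 * ?I" by (simp add: K_def power2_eq_square algebra_simps)
   also have "\<dots> \<le> ((exp 1 * \<Lambda>)^2) ^ Suc n * (fact (Suc n))^2 + K * (real (Suc n))^2 * (L ^ n * (fact n)^2 * T)"
    using K by (intro add_mono an mult_left_mono I) auto
   also have "\<dots> \<le> (exp 1 * \<Lambda>)^2 * L ^ n * (fact (Suc n))^2 + K * (real (Suc n))^2 * (L ^ n * (fact n)^2 * T)"
   proof -
    have "((exp 1 * \<Lambda>)^2) ^ n \<le> L ^ n" using K T by (intro power_mono) (auto simp: L_def)
    then have "(exp 1 * \<Lambda>)^2 * ((exp 1 * \<Lambda>)^2) ^ n * (fact (Suc n))^2 \<le> (exp 1 * \<Lambda>)^2 * L ^ n * (fact (Suc n))^2"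
     by (intro mult_right_mono mult_left_mono) auto
    then show ?thesis by (simp only: power_Suc add_le_cancel_right)
   qed
   also have "\<dots> = L ^ Suc n * (fact (Suc n))^2"
   proof -
    have "(fact (Suc n))^2 = (real (Suc n))^2 * (fact n)^2" by (simp only: fact_Suc power_mult_distrib of_nat_id)
    then show ?thesis by (simp add: L_def algebra_simps)
   qed
   finally show "lm (Suc n) t \<le> L ^ Suc n * (fact (Suc n))^2" .
  qed
 qed
 moreover have "L ^ n * (fact n)^2 \<le> L ^ n * fact (2 * n)" for n
 proof (rule mult_left_mono)
  have "(fact n * fact n :: nat) \<le> fact (n + n)" by (rule dvd_imp_le[OF fact_fact_dvd_fact]) simp
  then have "real (fact n * fact n) \<le> real (fact (n + n))" by (rule of_nat_mono)
  then show "(fact n)^2 \<le> (fact (2 * n) :: real)" by (simp add: power2_eq_square mult_2)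
 qed (use L in simp)
 ultimately show ?thesis using L by (meson order_trans)
qed

section \<open>Convergence of the empirical measures\<close>

context
 fixes \<mu> :: "real \<Rightarrow> real measure"
 assumes \<mu>: "\<And>t. 0 \<le> t \<Longrightarrow> nonneg_distribution_with_moments (\<mu> t) (\<lambda>n. lm n t)"
  and uniq: "\<And>t \<rho>. 0 \<le> t \<Longrightarrow> nonneg_distribution_with_moments \<rho> (\<lambda>n. lm n t) \<Longrightarrow> \<rho> = \<mu> t"
begin

lemma lm_seq:
 assumes "\<And>k. 0 \<le> s k" "0 \<le> t" "s \<longlonglongrightarrow> t"
 shows "(\<lambda>k. lm n (s k)) \<longlonglongrightarrow> lm n t"
 using limit_moment_continuous assms unfolding continuous_on_sequentially by (fastforce simp: comp_def)

lemma \<mu>_seq: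
 assumes "\<And>k. 0 \<le> s k" "0 \<le> t" "s \<longlonglongrightarrow> t"
 shows "weak_conv_m (\<lambda>k. \<mu> (s k)) (\<mu> t)"
 by (rule method_of_moments[OF \<mu>[OF assms(1)] lm_seq[OF assms] \<mu>[OF assms(2)] uniq[OF assms(2)]])

lemma continuous_map_\<mu>: "continuous_map (top_of_set {0..}) weak_topology \<mu>"
proof (rule continuous_map_weak_topology)
 let ?A = "\<lambda>f t. \<integral>x. f x \<partial>\<mu> t"
 show "real_distribution (\<mu> t)" if "t \<in> topspace (top_of_set {0..})" for t using that moment_distributionD(1)[OF \<mu>] by simp
 fix f :: "real \<Rightarrow> real" assume f: "continuous_on UNIV f" "bounded (range f)"
 have "continuous_on {0..} (?A f)"
  unfolding continuous_on_sequentially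
 proof (intro allI ballI impI, elim conjE)
  fix s t assume s: "\<forall>k. s k \<in> {0..}" "s \<longlonglongrightarrow> t" and t: "t \<in> {0::real..}"
  then have "\<And>k. 0 \<le> s k" "0 \<le> t" by auto
  then show "((?A f) \<circ> s) \<longlonglongrightarrow> (\<integral>x. f x \<partial>\<mu> t)"
   using weak_conv_m_integral[OF moment_distributionD(1)[OF \<mu>] moment_distributionD(1)[OF \<mu>] \<mu>_seq f] s(2) by (simp add: comp_def)
 qed
 then show "continuous_map (top_of_set {0..}) euclidean (?A f)" by simp
qed

text \<open>A deterministic statement, uniform in time, proved by compactness. A sequence of
  counterexamples has times converging to some \<open>t0\<close>; then both the measures and the
  \<open>\<mu> (t k)\<close> converge weakly to \<open>\<mu> t0\<close>, so their distance cannot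
  stay above \<open>e\<close>.\<close>

lemma moments_close_imp_weakly_close:
 assumes d: "metrizes_weak_topology d" and e: "0 < e"
 shows "\<exists>k. \<forall>t\<in>{0..T}. \<forall>\<nu> q. nonneg_distribution_with_moments \<nu> q \<longrightarrow> (\<forall>n\<le>k. \<bar>q n - lm n t\<bar> < 1 / real (Suc k)) \<longrightarrow> d \<nu> (\<mu> t) < e"
proof (rule ccontr)
 assume "\<not> ?thesis"
 then have "\<forall>k. \<exists>t \<nu> q. t \<in> {0..T} \<and> nonneg_distribution_with_moments \<nu> q \<and> (\<forall>n\<le>k. \<bar>q n - lm n t\<bar> < 1 / real (Suc k)) \<and> \<not> d \<nu> (\<mu> t) < e" by blast
 then obtain t \<nu> q where t: "\<And>k. t k \<in> {0..T}" and \<nu>: "\<And>k. nonneg_distribution_with_moments (\<nu> k) (q k)"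
  and q: "\<And>k n. n \<le> k \<Longrightarrow> \<bar>q k n - lm n (t k)\<bar> < 1 / real (Suc k)" and far: "\<And>k. \<not> d (\<nu> k) (\<mu> (t k)) < e"
  by metis
 obtain t0 and r :: "nat \<Rightarrow> nat" where r: "t0 \<in> {0..T}" "strict_mono r" "(t \<circ> r) \<longlonglongrightarrow> t0"
  using compact_Icc[of 0 T] t unfolding compact_def by metis
 have tr: "\<And>k. 0 \<le> t (r k)" "0 \<le> t0" "(\<lambda>k. t (r k)) \<longlonglongrightarrow> t0" using t r by (auto simp: comp_def)
 have qr: "(\<lambda>k. q (r k) n) \<longlonglongrightarrow> lm n t0" for n
 proof -
  have "(\<lambda>k. q k n - lm n (t k)) \<longlonglongrightarrow> 0"
  proof (rule Lim_null_comparison[OF _ LIMSEQ_inverse_real_of_nat])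
   show "\<forall>\<^sub>F k in sequentially. norm (q k n - lm n (t k)) \<le> inverse (real (Suc k))"
    using eventually_ge_at_top[of n] by eventually_elim (use q in \<open>simp add: inverse_eq_divide less_imp_le\<close>)
  qed
  then have "(\<lambda>k. q (r k) n - lm n (t (r k))) \<longlonglongrightarrow> 0" using LIMSEQ_subseq_LIMSEQ[OF _ r(2)] by (fastforce simp: comp_def)
  from tendsto_add[OF this lm_seq[OF tr, of n]] show ?thesis by simp
 qed
 have rd0: "real_distribution (\<mu> t0)" by (rule moment_distributionD(1)[OF \<mu>[OF tr(2)]])
 have "weak_conv_m (\<lambda>k. \<nu> (r k)) (\<mu> t0)" by (rule method_of_moments[OF \<nu> qr \<mu>[OF tr(2)] uniq[OF tr(2)]])
 then have l1: "(\<lambda>k. d (\<nu> (r k)) (\<mu> t0)) \<longlonglongrightarrow> 0"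
  by (intro metrizes_weak_topology_tendsto[OF d] limitin_weak_topology moment_distributionD(1)[OF \<nu>] rd0)
 have l2: "(\<lambda>k. d (\<mu> (t (r k))) (\<mu> t0)) \<longlonglongrightarrow> 0"
  by (intro metrizes_weak_topology_tendsto[OF d] limitin_weak_topology moment_distributionD(1)[OF \<mu>[OF tr(1)]] rd0 \<mu>_seq tr)
 interpret Metric_space "Collect real_distribution" d using d by (simp add: metrizes_weak_topology_def)
 have "d (\<nu> (r k)) (\<mu> (t (r k))) \<le> d (\<nu> (r k)) (\<mu> t0) + d (\<mu> (t (r k))) (\<mu> t0)" for k
  using triangle[of "\<nu> (r k)" "\<mu> t0" "\<mu> (t (r k))"] moment_distributionD(1)[OF \<nu>[of "r k"]] moment_distributionD(1)[OF \<mu>[OF tr(1)]] rd0 commute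
  by simp
 moreover have "\<forall>\<^sub>F k in sequentially. d (\<nu> (r k)) (\<mu> t0) + d (\<mu> (t (r k))) (\<mu> t0) < e"
  by (rule order_tendstoD(2)[OF tendsto_add[OF l1 l2]]) (use e in simp)
 ultimately have "\<forall>\<^sub>F k in sequentially. d (\<nu> (r k)) (\<mu> (t (r k))) < e" by (auto elim!: eventually_mono intro: le_less_trans)
 then have "\<forall>\<^sub>F k :: nat in sequentially. False" by (rule eventually_mono) (use far in blast)
 then show False by simp
qed

abbreviation E :: "nat \<Rightarrow> real \<Rightarrow> 'w \<Rightarrow> real measure" where
 "E N t w \<equiv> empirical_measure N (\<lambda>i. \<gamma> N * lam N i (t / \<tau> N) w)"

text \<open>Off an event of small probability finitely many moments are close to their limits at all
  times simultaneously, and \<open>moments_close_imp_weakly_close\<close> turns this into closeness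
  of the measures.\<close>

theorem empirical_measure_tendsto:
 assumes d: "metrizes_weak_topology d" and T: "0 < T"
 shows "tendsto_in_prob_C_weak d M T E \<mu>"
proof -
 let ?A = "\<lambda>e N w. \<forall>t\<in>{0..T}. \<bar>d (E N t w) (\<mu> t)\<bar> < e"
 interpret Metric_space "Collect real_distribution" d using d by (simp add: metrizes_weak_topology_def)
 have \<mu>c: "continuous_map (top_of_set {0..T}) weak_topology \<mu>"
  using continuous_map_from_subtopology_mono[OF continuous_map_\<mu>, of "{0..T}"] by auto
 have Ec: "continuous_map (top_of_set {0..T}) weak_topology (\<lambda>t. E N t w)" if N: "1 \<le> N" and w: "w \<in> space (M N)" for N w
 proof (rule continuous_map_empirical_measure[OF N])
  fix i assume "i \<in> {1..N}"
  then have "continuous_on {0..T} (\<lambda>t. \<gamma> N * lam N i (t / \<tau> N) w)" by (rule continuous_on_subset[OF x_cont[OF N w]]) auto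
  then show "continuous_map (top_of_set {0..T}) euclideanreal (\<lambda>t. \<gamma> N * lam N i (t / \<tau> N) w)" by simp
 qed
 have small: "usmall M T (\<lambda>N t w. d (E N t w) (\<mu> t))"
  unfolding usmall_def
 proof (intro allI impI)
  fix e :: real assume "0 < e"
  from moments_close_imp_weakly_close[OF d this, of T] obtain k where
   k: "\<And>t \<nu> q. t \<in> {0..T} \<Longrightarrow> nonneg_distribution_with_moments \<nu> q \<Longrightarrow> (\<forall>n\<le>k. \<bar>q n - lm n t\<bar> < 1 / real (Suc k)) \<Longrightarrow> d \<nu> (\<mu> t) < e"
   by blast
  obtain A where A: "off M A (\<lambda>N w. \<forall>t\<in>{0..T}. \<forall>n\<le>k. \<bar>S n N t w - lm n t\<bar> < 1 / real (Suc k))"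
   "(\<lambda>N. measure (M N) (A N)) \<longlonglongrightarrow> 0"
   using S_uniformly_close[OF T, of "1 / real (Suc k)" k] by auto
  have "off M A (?A e)"
   using A(1) eventually_ge_1
  proof (eventually_elim, intro conjI ballI)
   fix N w t assume A': "A N \<in> sets (M N) \<and> (\<forall>w\<in>space (M N) - A N. \<forall>t\<in>{0..T}. \<forall>n\<le>k. \<bar>S n N t w - lm n t\<bar> < 1 / real (Suc k))"
    and N: "1 \<le> N"
   show "A N \<in> sets (M N)" using A' by blast
   assume w: "w \<in> space (M N) - A N" and t: "t \<in> {0..T}"
   then have "nonneg_distribution_with_moments (E N t w) (\<lambda>n. S n N t w)"
    unfolding S_def by (intro empirical_measure_moments[OF N] x_nonneg[OF N]) auto
   from k[OF t this] have "d (E N t w) (\<mu> t) < e" using A' w t by blast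
   then show "\<bar>d (E N t w) (\<mu> t)\<bar> < e" by (simp add: nonneg)
  qed
  then show "\<exists>A. (off M A (?A e)) \<and>
   (\<lambda>N. measure (M N) (A N)) \<longlonglongrightarrow> 0" using A(2) by blast
 qed
 have "tendsto_in_prob M (\<lambda>N w. SUP t\<in>{0..T}. \<bar>d (E N t w) (\<mu> t)\<bar>) 0"
 proof (rule usmall_imp_tendsto_in_prob[OF prob_eventually _ small])
  show "\<forall>\<^sub>F N in sequentially. (\<forall>t\<in>{0..T}. (\<lambda>w. d (E N t w) (\<mu> t)) \<in> borel_measurable (M N)) \<and> (\<forall>w\<in>space (M N). continuous_on {0..T} (\<lambda>t. d (E N t w) (\<mu> t)))"
   using eventually_ge_1
  proof (eventually_elim, intro conjI ballI)
   fix N :: nat assume N: "1 \<le> N"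
   show "(\<lambda>w. d (E N t w) (\<mu> t)) \<in> borel_measurable (M N)" if "t \<in> {0..T}" for t
    using that by (intro borel_measurable_dist_empirical_measure[OF N d] moment_distributionD(1)[OF \<mu>] x_measurable[OF N]) auto
   show "continuous_on {0..T} (\<lambda>t. d (E N t w) (\<mu> t))" if "w \<in> space (M N)" for w
    using metrizes_weak_topology_continuous[OF d Ec[OF N that] \<mu>c] by simp
  qed
 qed (use T in simp)
 moreover have "\<forall>\<^sub>F N in sequentially. \<forall>w\<in>space (M N). continuous_map (top_of_set {0..T}) weak_topology (\<lambda>t. E N t w)"
  using eventually_ge_1 by eventually_elim (use Ec in blast)
 ultimately show ?thesis unfolding tendsto_in_prob_C_weak_def using \<mu>c by (simp add: nonneg)
qed

end

end

theorem mainTheorem7: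
  fixes a b c \<sigma> :: real
    and \<gamma> \<tau> :: "nat \<Rightarrow> real"
    and M :: "nat \<Rightarrow> 'w measure"
    and W lam :: "nat \<Rightarrow> nat \<Rightarrow> real \<Rightarrow> 'w \<Rightarrow> real"
    and x0 :: "nat \<Rightarrow> nat \<Rightarrow> real"
    and an :: "nat \<Rightarrow> real"
    and d :: "real measure \<Rightarrow> real measure \<Rightarrow> real"
  assumes "c > 0" and "a > - 1 / 2" and "b > - 1 / 2" and "\<sigma> > 0"
    and "\<And>N. N \<ge> 1 \<Longrightarrow> \<gamma> N > 0" and "\<And>N. N \<ge> 1 \<Longrightarrow> \<tau> N > 0"
    and "\<And>N. N \<ge> 1 \<Longrightarrow>
           beta_jacobi_process (M N) N a b (2 * c / real N) (x0 N) (W N) (lam N)"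
    and "filterlim \<tau> at_top sequentially"
    and "(\<lambda>N. \<gamma> N / \<tau> N) \<longlonglongrightarrow> \<sigma>"
    and "\<And>n. (\<lambda>N. empirical_moment n N (\<lambda>i. \<gamma> N * x0 N i)) \<longlonglongrightarrow> an n"
    and "metrizes_weak_topology d"
  shows "(\<forall>n. \<forall>T>0. tendsto_in_prob_C M T
            (\<lambda>N t \<omega>. empirical_moment n N (\<lambda>i. \<gamma> N * lam N i (t / \<tau> N) \<omega>))
            (limit_moment \<sigma> c (a + 1) an n)) \<and>
         ((\<exists>\<Lambda>>0. \<forall>n. an n \<le> (\<Lambda> * real n) ^ (2 * n)) \<longrightarrow>
          (\<exists>\<mu>.
             (\<forall>t\<ge>0.
                nonneg_distribution_with_moments (\<mu> t) (\<lambda>n. limit_moment \<sigma> c (a + 1) an n t) \<and>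
                (\<forall>\<nu>. nonneg_distribution_with_moments \<nu> (\<lambda>n. limit_moment \<sigma> c (a + 1) an n t)
                   \<longrightarrow> \<nu> = \<mu> t)) \<and>
             continuous_map (top_of_set {0..}) weak_topology \<mu> \<and>
             (\<forall>T>0. tendsto_in_prob_C_weak d M T
                (\<lambda>N t \<omega>. empirical_measure N (\<lambda>i. \<gamma> N * lam N i (t / \<tau> N) \<omega>)) \<mu>)))"
proof -
 interpret jacobi_scaling a b c \<sigma> \<gamma> \<tau> M W lam x0 an
  by (rule jacobi_scaling.intro) (fact assms)+
 show ?thesis
 proof (intro conjI allI impI)
  show "tendsto_in_prob_C M T (\<lambda>N t w. empirical_moment n N (\<lambda>i. \<gamma> N * lam N i (t / \<tau> N) w)) (limit_moment \<sigma> c (a + 1) an n)"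
   if "0 < T" for n T
   using S_tendsto_in_prob_C[OF that, of n] unfolding S_def[abs_def] .
  assume "\<exists>\<Lambda>>0. \<forall>n. an n \<le> (\<Lambda> * real n) ^ (2 * n)"
  then obtain \<Lambda> where \<Lambda>: "0 < \<Lambda>" "\<And>n. an n \<le> (\<Lambda> * real n) ^ (2 * n)" by blast
  have "\<forall>t. \<exists>\<mu>. 0 \<le> t \<longrightarrow> nonneg_distribution_with_moments \<mu> (\<lambda>n. lm n t)" using lm_distribution by blast
  then obtain \<mu> where \<mu>: "\<And>t. 0 \<le> t \<Longrightarrow> nonneg_distribution_with_moments (\<mu> t) (\<lambda>n. lm n t)" by metis
  \<comment> \<open>The growth bound is taken on \<open>[0,t]\<close>, so the constant
    \<open>L\<close> may depend on \<open>t\<close>.\<close>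
  have uniq: "\<rho> = \<mu> t" if t: "0 \<le> t" and \<rho>: "nonneg_distribution_with_moments \<rho> (\<lambda>n. lm n t)" for t \<rho>
  proof -
   obtain L where L: "0 < L" "\<And>n. lm n t \<le> L ^ n * fact (2 * n)" using lm_growth[OF \<Lambda> t] t by fastforce
   show ?thesis by (rule nonneg_distribution_with_moments_unique[OF \<rho> \<mu>[OF t] L(2,1)])
  qed
  show "\<exists>\<mu>. (\<forall>t\<ge>0. nonneg_distribution_with_moments (\<mu> t) (\<lambda>n. lm n t) \<and> (\<forall>\<nu>. nonneg_distribution_with_moments \<nu> (\<lambda>n. lm n t) \<longrightarrow> \<nu> = \<mu> t)) \<and>
       continuous_map (top_of_set {0..}) weak_topology \<mu> \<and>
       (\<forall>T>0. tendsto_in_prob_C_weak d M T (\<lambda>N t w. empirical_measure N (\<lambda>i. \<gamma> N * lam N i (t / \<tau> N) w)) \<mu>)"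
   using \<mu> uniq continuous_map_\<mu>[OF \<mu> uniq] empirical_measure_tendsto[OF \<mu> uniq assms(11)] by blast
 qed
qed

end
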